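(* For any link $L$ with at least $2$ components, any $L$-generating subset of the directed oriented Reidemeister moves contains at least one forward move of type $\Omega3$ and at least one backward move of type $\Omega3$.
   Context: Links are oriented; link diagrams are oriented generic planar diagrams in $\mathbb{R}^2$, up to planar isotopy. Directed oriented Reidemeister moves are the 32 types of moves obtained from the 16 types of oriented Reidemeister moves (four of type $\Omega1$, four of type $\Omega2$, eight of type $\Omega3$, distinguished by orientations and over/under information of the strands) by distinguishing the two directions (forward $\uparrow$, backward $\downarrow$) in which each may be performed. A move of type $\Omega1$ (creating/removing a curl with one crossing) or $\Omega2$ (pushing one arc over a neighbouring arc, creating two crossings bounding a bigon, or the inverse) is forward if it increases the number of crossings and backward if it decreases it. An $\Omega3$ move passes a strand across the crossing of two other strands, where the three strands (top, middle, bottom) pairwise cross once. For an $\Omega3$ move, call the triangle formed by the three crossings the vanishing triangle, and orient it by the cyclic order bottom$\to$middle$\to$top of its sides; let $n$ be the number of sides on which this orientation agrees with that of the diagram, and $q=(-1)^n$. Every $\Omega3$ move changes $q$; it is forward if it changes $q=-1$ to $q=+1$ and backward otherwise. A set $A$ of directed moves is $L$-generating if for any two diagrams $L_1,L_2$ of $L$, $L_2$ can be obtained from $L_1$ by a finite sequence of moves from $A$ (each used only in its specified direction). *)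

theory Defs
  imports "HOL-Analysis.Analysis"
begin

section \<open>Links\<close>

text \<open>
  Links and diagrams are given by \<open>1\<close>-periodic parametrisations of their components,
  numbered \<open>0, \<dots>, n - 1\<close>; both are only ever used up to orientation preserving
  reparametrisation and renumbering of the components, i.e. as oriented, unlabelled objects.
  A pair \<open>(i, t)\<close> is the point with parameter \<open>t\<close> on component \<open>i\<close>.  The plane is
  \<^typ>\<open>complex\<close> and space is \<^typ>\<open>complex \<times> real\<close>, a point of the plane together with a height.
\<close>

datatype link =
  Link (link_components: nat) (link_curve: "nat \<Rightarrow> real \<Rightarrow> complex \<times> real")

datatype diagram =
  Diagram (components: nat) (curve: "nat \<Rightarrow> real \<Rightarrow> complex")
    (upper: "nat \<Rightarrow> real \<Rightarrow> bool")

definition same_point :: "nat \<times> real \<Rightarrow> nat \<times> real \<Rightarrow> bool" where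
  "same_point p q \<longleftrightarrow> fst p = fst q \<and> snd p - snd q \<in> \<int>"

text \<open>
  A closed polygon, parametrised with nonzero speed.  One-sided linearity at every parameter
  amounts, by compactness of a period, to finitely many linear pieces.
\<close>

definition polygonal_loop :: "(real \<Rightarrow> 'a::real_normed_vector) \<Rightarrow> bool" where
  "polygonal_loop c \<longleftrightarrow>
     (\<forall>t. c (t + 1) = c t) \<and>
     (\<forall>t. \<exists>v. v \<noteq> 0 \<and> (\<forall>\<^sub>F h in at_right 0. c (t + h) = c t + h *\<^sub>R v)) \<and>
     (\<forall>t. \<exists>v. v \<noteq> 0 \<and> (\<forall>\<^sub>F h in at_left 0. c (t + h) = c t + h *\<^sub>R v))"

definition embedded_link :: "link \<Rightarrow> bool" where
  "embedded_link L \<longleftrightarrow>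
     (\<forall>i<link_components L. continuous_on UNIV (link_curve L i) \<and>
        (\<forall>t. link_curve L i (t + 1) = link_curve L i t)) \<and>
     (\<forall>i<link_components L. \<forall>j<link_components L. \<forall>s t.
        link_curve L i s = link_curve L j t \<longrightarrow> same_point (i, s) (j, t))"

definition polygonal_link :: "link \<Rightarrow> bool" where
  "polygonal_link L \<longleftrightarrow>
     embedded_link L \<and> (\<forall>i<link_components L. polygonal_loop (link_curve L i))"

definition ambient_isotopy :: "(real \<Rightarrow> 'a \<Rightarrow> 'a::topological_space) \<Rightarrow> bool" where
  "ambient_isotopy H \<longleftrightarrow>
     continuous_on ({0..1} \<times> UNIV) (\<lambda>(\<tau>, x). H \<tau> x) \<and> H 0 = id \<and>
     (\<forall>\<tau>\<in>{0..1}. \<exists>g. homeomorphism UNIV UNIV (H \<tau>) g)"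

text \<open>Lifts to the line of orientation preserving homeomorphisms of the circle.\<close>

definition reparametrisation :: "(real \<Rightarrow> real) \<Rightarrow> bool" where
  "reparametrisation f \<longleftrightarrow>
     continuous_on UNIV f \<and> strict_mono f \<and> (\<forall>t. f (t + 1) = f t + 1)"

definition link_isotopic :: "link \<Rightarrow> link \<Rightarrow> bool" where
  "link_isotopic K L \<longleftrightarrow>
     (\<exists>H \<pi> f. ambient_isotopy H \<and>
        bij_betw \<pi> {..<link_components K} {..<link_components L} \<and>
        (\<forall>i<link_components K. reparametrisation (f i) \<and>
           (\<forall>t. H 1 (link_curve K i t) = link_curve L (\<pi> i) (f i t))))"

text \<open>Links are tame, as usual.\<close>

definition is_link :: "link \<Rightarrow> bool" where
  "is_link L \<longleftrightarrow> embedded_link L \<and> (\<exists>K. polygonal_link K \<and> link_isotopic K L)"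


section \<open>Diagrams\<close>

definition double_point :: "diagram \<Rightarrow> nat \<times> real \<Rightarrow> nat \<times> real \<Rightarrow> bool" where
  "double_point D p q \<longleftrightarrow>
     fst p < components D \<and> fst q < components D \<and>
     curve D (fst p) (snd p) = curve D (fst q) (snd q) \<and> \<not> same_point p q"

definition velocity :: "diagram \<Rightarrow> nat \<times> real \<Rightarrow> complex" where
  "velocity D p = vector_derivative (curve D (fst p)) (at (snd p))"

definition velocity_det :: "diagram \<Rightarrow> nat \<times> real \<Rightarrow> nat \<times> real \<Rightarrow> real" where
  "velocity_det D p q = Re (velocity D p) * Im (velocity D q) - Im (velocity D p) * Re (velocity D q)"

text \<open>
  Generic polygonal plane curves: no triple points, and every double point is a transverse
  crossing of interior points of edges.  At a crossing, \<open>upper\<close> selects the overpassing one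
  of the two points; its value is irrelevant elsewhere.
\<close>

definition is_diagram :: "diagram \<Rightarrow> bool" where
  "is_diagram D \<longleftrightarrow>
     (\<forall>i<components D. polygonal_loop (curve D i)) \<and>
     (\<forall>p q. double_point D p q \<longrightarrow>
        curve D (fst p) differentiable at (snd p) \<and>
        curve D (fst q) differentiable at (snd q) \<and>
        velocity_det D p q \<noteq> 0 \<and>
        upper D (fst p) (snd p) \<noteq> upper D (fst q) (snd q)) \<and>
     (\<forall>p q r. double_point D p q \<and> double_point D p r \<longrightarrow> same_point q r)"

definition planar_isotopic :: "diagram \<Rightarrow> diagram \<Rightarrow> bool" where
  "planar_isotopic D E \<longleftrightarrow>
     (\<exists>H \<pi> f. ambient_isotopy H \<and>
        bij_betw \<pi> {..<components D} {..<components E} \<and>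
        (\<forall>i<components D. reparametrisation (f i) \<and>
           (\<forall>t. H 1 (curve D i t) = curve E (\<pi> i) (f i t))) \<and>
        (\<forall>i t q. double_point D (i, t) q \<longrightarrow> upper D i t = upper E (\<pi> i) (f i t)))"

definition projects_to :: "link \<Rightarrow> diagram \<Rightarrow> bool" where
  "projects_to K D \<longleftrightarrow>
     link_components K = components D \<and>
     (\<forall>i<components D. \<forall>t. fst (link_curve K i t) = curve D i t) \<and>
     (\<forall>i s j t. double_point D (i, s) (j, t) \<longrightarrow>
        (upper D i s \<longleftrightarrow> snd (link_curve K j t) < snd (link_curve K i s)))"

definition diagram_of :: "link \<Rightarrow> diagram \<Rightarrow> bool" where
  "diagram_of L D \<longleftrightarrow>
     is_diagram D \<and> (\<exists>K. embedded_link K \<and> projects_to K D \<and> link_isotopic K L)"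


section \<open>Oriented Reidemeister moves\<close>

text \<open>
  A strand \<open>(i, a, b)\<close> is the part of component \<open>i\<close> with parameters in \<open>[a, b]\<close>.  A
  tangle is a disc that meets the diagram exactly in the strands of \<open>S\<close>, each properly
  embedded or immersed in the disc.
\<close>

type_synonym strand = "nat \<times> real \<times> real"

fun strand_points :: "strand \<Rightarrow> (nat \<times> real) set" where
  "strand_points (i, a, b) = {i} \<times> {a..b}"

definition tangle :: "diagram \<Rightarrow> complex set \<Rightarrow> strand set \<Rightarrow> bool" where
  "tangle D B S \<longleftrightarrow>
     B homeomorphic cball (0::complex) 1 \<and>
     (\<forall>(i, a, b)\<in>S. i < components D \<and> a < b \<and> b < a + 1 \<and>
        curve D i a \<in> frontier B \<and> curve D i b \<in> frontier B \<and>
        (\<forall>t\<in>{a<..<b}. curve D i t \<in> interior B)) \<and>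
     (\<forall>x\<in>S. \<forall>y\<in>S. x \<noteq> y \<longrightarrow>
        (\<forall>p\<in>strand_points x. \<forall>q\<in>strand_points y. \<not> same_point p q)) \<and>
     (\<forall>i<components D. \<forall>t. curve D i t \<in> B \<longrightarrow>
        (\<exists>x\<in>S. \<exists>p\<in>strand_points x. same_point p (i, t)))"

text \<open>\<open>D\<close> and \<open>E\<close> agree except inside a disc, which both meet in the strands of \<open>S\<close>.\<close>

definition local_change :: "diagram \<Rightarrow> diagram \<Rightarrow> strand set \<Rightarrow> bool" where
  "local_change D E S \<longleftrightarrow>
     is_diagram D \<and> is_diagram E \<and> components D = components E \<and>
     (\<exists>B. tangle D B S \<and> tangle E B S) \<and>
     (\<forall>i<components D. \<forall>t.
        \<not> (\<exists>(j, a, b)\<in>S. \<exists>s\<in>{a<..<b}. same_point (j, s) (i, t)) \<longrightarrow>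
        curve E i t = curve D i t \<and> upper E i t = upper D i t)"

fun intersections :: "diagram \<Rightarrow> strand \<Rightarrow> strand \<Rightarrow> (real \<times> real) set" where
  "intersections D (i, a, b) (j, c, d) =
     {(s, t). s \<in> {a..b} \<and> t \<in> {c..d} \<and> curve D i s = curve D j t}"

fun self_intersections :: "diagram \<Rightarrow> strand \<Rightarrow> (real \<times> real) set" where
  "self_intersections D (i, a, b) =
     {(s, t). a \<le> s \<and> s < t \<and> t \<le> b \<and> curve D i s = curve D i t}"

definition positive_crossing :: "diagram \<Rightarrow> nat \<times> real \<Rightarrow> nat \<times> real \<Rightarrow> bool" where
  "positive_crossing D p q \<longleftrightarrow>
     (if upper D (fst p) (snd p) then 0 < velocity_det D p q else 0 < velocity_det D q p)"

text \<open>
  The Boolean arguments distinguish the oriented types: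

  \<^item> \<open>Omega1 pos over_first\<close>: the sign of the crossing of the curl, and whether the curl is
    entered through the overpass or the underpass.  (Together they determine whether the curl
    turns clockwise or counterclockwise.)
  \<^item> \<open>Omega2 par pos\<close>: whether the two strands are parallel or antiparallel, and the sign of
    the crossing that the over-strand reaches first.  (Together they determine on which side
    of the over-strand the under-strand lies before the crossings are created.)
  \<^item> \<open>Omega3 tm tb mb\<close>: the signs of the top-middle, top-bottom and middle-bottom crossings.
    They determine the cyclic order in which the oriented strands meet the boundary of the disc.
\<close>

datatype reidemeister_type =
    is_Omega1: Omega1 bool bool
  | is_Omega2: Omega2 bool bool
  | is_Omega3: Omega3 bool bool bool

definition creates_curl :: "bool \<Rightarrow> bool \<Rightarrow> diagram \<Rightarrow> diagram \<Rightarrow> bool" where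
  "creates_curl pos over_first D E \<longleftrightarrow>
     (\<exists>i a b s t. local_change D E {(i, a, b)} \<and>
        self_intersections D (i, a, b) = {} \<and>
        self_intersections E (i, a, b) = {(s, t)} \<and>
        pos = positive_crossing E (i, s) (i, t) \<and>
        over_first = upper E i s)"

definition creates_bigon :: "bool \<Rightarrow> bool \<Rightarrow> diagram \<Rightarrow> diagram \<Rightarrow> bool" where
  "creates_bigon par pos D E \<longleftrightarrow>
     (\<exists>i a b j c d s1 t1 s2 t2. local_change D E {(i, a, b), (j, c, d)} \<and>
        (\<forall>F\<in>{D, E}. self_intersections F (i, a, b) = {} \<and> self_intersections F (j, c, d) = {}) \<and>
        intersections D (i, a, b) (j, c, d) = {} \<and>
        intersections E (i, a, b) (j, c, d) = {(s1, t1), (s2, t2)} \<and>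
        s1 < s2 \<and> upper E i s1 \<and> upper E i s2 \<and>
        par = (t1 < t2) \<and>
        pos = positive_crossing E (i, s1) (j, t1))"

definition passes_over_once :: "diagram \<Rightarrow> strand \<Rightarrow> strand \<Rightarrow> bool" where
  "passes_over_once D x y \<longleftrightarrow>
     (\<exists>s t. intersections D x y = {(s, t)} \<and> upper D (fst x) s)"

definition triangle :: "diagram \<Rightarrow> strand \<Rightarrow> strand \<Rightarrow> strand \<Rightarrow> bool" where
  "triangle D hi mid lo \<longleftrightarrow>
     (\<forall>x\<in>{hi, mid, lo}. self_intersections D x = {}) \<and>
     passes_over_once D hi mid \<and> passes_over_once D hi lo \<and> passes_over_once D mid lo"

text \<open>For strands that meet once: the parameter on the strand \<open>x\<close> of its crossing with \<open>y\<close>.\<close>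

definition param_at :: "diagram \<Rightarrow> strand \<Rightarrow> strand \<Rightarrow> real" where
  "param_at D x y = (THE s. \<exists>t. (s, t) \<in> intersections D x y)"

definition meets_before :: "diagram \<Rightarrow> strand \<Rightarrow> strand \<Rightarrow> strand \<Rightarrow> bool" where
  "meets_before D x y z \<longleftrightarrow> param_at D x y < param_at D x z"

definition positive_at :: "diagram \<Rightarrow> strand \<Rightarrow> strand \<Rightarrow> bool" where
  "positive_at D x y \<longleftrightarrow>
     positive_crossing D (fst x, param_at D x y) (fst y, param_at D y x)"

text \<open>
  Going round the vanishing triangle along its sides in the cyclic order bottom, middle, top,
  the bottom side runs from the top-bottom to the bottom-middle crossing, the middle side from
  the bottom-middle to the middle-top crossing, and the top side from the middle-top to the
  top-bottom crossing.
\<close>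

definition agreeing_sides :: "diagram \<Rightarrow> strand \<Rightarrow> strand \<Rightarrow> strand \<Rightarrow> nat" where
  "agreeing_sides D hi mid lo =
     of_bool (meets_before D lo hi mid) +
     of_bool (meets_before D mid lo hi) +
     of_bool (meets_before D hi mid lo)"

definition triangle_sign :: "diagram \<Rightarrow> strand \<Rightarrow> strand \<Rightarrow> strand \<Rightarrow> int" where
  "triangle_sign D hi mid lo = (-1) ^ agreeing_sides D hi mid lo"

text \<open>
  Passing a strand across the crossing of the other two reverses, on each of the three
  strands, the order of its two crossings.  This is the move without its direction: the
  relation is symmetric, since the strands have the same end points and hence the same
  crossing signs before and after the move.
\<close>

definition triangle_move ::
  "bool \<Rightarrow> bool \<Rightarrow> bool \<Rightarrow> strand \<Rightarrow> strand \<Rightarrow> strand \<Rightarrow> diagram \<Rightarrow> diagram \<Rightarrow> bool" where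
  "triangle_move tm tb mb hi mid lo D E \<longleftrightarrow>
     local_change D E {hi, mid, lo} \<and>
     triangle D hi mid lo \<and> triangle E hi mid lo \<and>
     meets_before D hi mid lo \<noteq> meets_before E hi mid lo \<and>
     meets_before D mid lo hi \<noteq> meets_before E mid lo hi \<and>
     meets_before D lo hi mid \<noteq> meets_before E lo hi mid \<and>
     (\<forall>F\<in>{D, E}. tm = positive_at F hi mid \<and> tb = positive_at F hi lo \<and>
        mb = positive_at F mid lo)"

fun forward_move :: "reidemeister_type \<Rightarrow> diagram \<Rightarrow> diagram \<Rightarrow> bool" where
  "forward_move (Omega1 pos over_first) D E = creates_curl pos over_first D E"
| "forward_move (Omega2 par pos) D E = creates_bigon par pos D E"
| "forward_move (Omega3 tm tb mb) D E =
     (\<exists>hi mid lo. triangle_move tm tb mb hi mid lo D E \<and>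
        triangle_sign D hi mid lo = -1 \<and> triangle_sign E hi mid lo = 1)"

datatype direction = Forward | Backward

type_synonym directed_move = "reidemeister_type \<times> direction"

fun performs :: "directed_move \<Rightarrow> diagram \<Rightarrow> diagram \<Rightarrow> bool" where
  "performs (m, Forward) D E = forward_move m D E"
| "performs (m, Backward) D E = forward_move m E D"

text \<open>Diagrams are considered up to planar isotopy, so isotopies may be interspersed freely.\<close>

definition step :: "directed_move set \<Rightarrow> diagram \<Rightarrow> diagram \<Rightarrow> bool" where
  "step A D E \<longleftrightarrow>
     is_diagram D \<and> is_diagram E \<and> (planar_isotopic D E \<or> (\<exists>m\<in>A. performs m D E))"

definition generating :: "link \<Rightarrow> directed_move set \<Rightarrow> bool" where
  "generating L A \<longleftrightarrow>
     (\<forall>D E. diagram_of L D \<and> diagram_of L E \<longrightarrow> (step A)\<^sup>*\<^sup>* D E)"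

end

theory Submission
  imports Defs "HOL-Complex_Analysis.Winding_Numbers"
begin

text \<open>
  Winding numbers tell forward triangle moves from backward ones. Follow the lower strand
  through a crossing \<open>z\<close> of two different components. It passes from one side of
  the upper component to the other, and the winding number of the upper component about the
  moving point changes by \<open>\<plusminus>1\<close>. The weight of \<open>z\<close> is the
  square of this winding number after \<open>z\<close> minus its square before \<open>z\<close>,
  and the winding sum of a diagram is the sum of the weights of all crossings of different
  components.

  Weights telescope: if a strand meets a component only from below, the weights of these
  crossings add up to a difference that depends on the end points of the strand alone. A local
  move does not alter the winding numbers about points outside of its disc, so only the
  crossings in the disc matter. A curl has no crossing of different components. The two
  crossings of a bigon have weights that telescope to zero. In a triangle move all weights are
  determined by end points, hence unchanged, with one exception: the top and the bottom strand
  belong to one component and the middle strand to another one. The middle strand then meets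
  that component once from below, which counts, and once from above, which does not. The move
  exchanges the order of the two meetings, and this changes the counted weight by
  \<open>\<plusminus>2\<close>. The relation between the winding numbers of the middle component
  that are seen along the other two strands determines the sign: the winding sum grows in a
  forward move. So it never decreases in a forward \<open>\<Omega>3\<close> move, never
  increases in a backward one, and is invariant under the other moves
  (\<open>winding_sum_step\<close>).

  It remains to find two diagrams of the link with different winding sums
  (\<open>diagrams_with_different_winding_sum\<close>), because both the passage from one to the
  other and the way back are possible with the given moves. A polygonal representative can be
  folded and tilted so that its projection is a diagram in which the first two components cross
  (\<open>noncoplanar_edges\<close>, \<open>generic_tilt\<close>,
  \<open>tilt_with_crossing\<close>). Near such a crossing, pull a finger out of the upper
  strand, lower it below both strands, and lead it around the crossing point. This is an ambient
  isotopy with support over a small parallelogram. The weights of the two crossings of the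
  finger with the other component telescope to zero, but the finger shifts the winding numbers
  about the points next to the old crossing by one, and the winding sum drops by
  \<open>2\<close> (\<open>winding_sum_changes\<close>).
\<close>

section \<open>Winding numbers of closed curves\<close>

definition closed_curve :: "(real \<Rightarrow> 'a::real_normed_vector) \<Rightarrow> bool" where
  "closed_curve c \<longleftrightarrow> continuous_on UNIV c \<and> (\<forall>t. c (t + 1) = c t)"

lemma periodic_add_int:
  fixes c :: "real \<Rightarrow> 'a"
  assumes "\<And>t. c (t + 1) = c t"
  shows "c (t + of_int k) = c t"
proof -
  have nat: "c (t + of_nat n) = c t" for n t
  proof (induction n)
    case (Suc n)
    then show ?case using assms[of "t + of_nat n"] by (simp add: add.commute add.left_commute)
  qed simp
  show ?thesis
  proof (cases "k \<ge> 0")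
    case True
    then show ?thesis using nat[of t "nat k"] by simp
  next
    case False
    then show ?thesis using nat[of "t + of_int k" "nat (-k)"] by simp
  qed
qed

lemma closed_curve_add_int: "closed_curve c \<Longrightarrow> c (t + of_int k) = c t"
  using periodic_add_int[of c] by (auto simp: closed_curve_def)

lemma closed_curve_cong_Ints:
  assumes "closed_curve c" "s - t \<in> \<int>" shows "c s = c t"
proof -
  obtain k where "s - t = of_int k" using assms(2) by (auto elim: Ints_cases)
  then have "s = t + of_int k" by simp
  then show ?thesis using closed_curve_add_int[OF assms(1)] by simp
qed

lemma closed_curve_range:
  assumes "closed_curve c" shows "range c = path_image c"
proof -
  have "c t \<in> c ` {0..1}" for t
  proof -
    have "c (frac t) = c t"
      by (rule closed_curve_cong_Ints[OF assms]) (simp add: frac_def)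
    moreover have "frac t \<in> {0..1}" using frac_lt_1[of t] by (simp add: less_imp_le)
    ultimately show ?thesis by (metis image_eqI)
  qed
  then show ?thesis by (auto simp: path_image_def)
qed

lemma closed_curve_path:
  assumes "closed_curve c" shows "path c" "pathfinish c = pathstart c"
proof -
  show "path c" using assms unfolding closed_curve_def path_def
    by (meson continuous_on_subset subset_UNIV)
  have "c (0 + 1) = c 0" using assms unfolding closed_curve_def by blast
  then show "pathfinish c = pathstart c" by (simp add: pathfinish_def pathstart_def)
qed

lemma closed_curve_closed_range:
  assumes "closed_curve (c :: real \<Rightarrow> 'a::real_normed_vector)" shows "closed (range c)" "compact (range c)"
  using assms closed_curve_path(1)[OF assms] by (simp_all add: closed_curve_range closed_path_image compact_path_image)

lemma polygonal_loop_closed_curve: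
  assumes "polygonal_loop c" shows "closed_curve c"
proof -
  have "isCont c t" for t
  proof -
    obtain v where v: "\<forall>\<^sub>F h in at_right 0. c (t + h) = c t + h *\<^sub>R v"
      using assms unfolding polygonal_loop_def by blast
    obtain w where w: "\<forall>\<^sub>F h in at_left 0. c (t + h) = c t + h *\<^sub>R w"
      using assms unfolding polygonal_loop_def by blast
    have "((\<lambda>h. c t + h *\<^sub>R v) \<longlongrightarrow> c t + 0 *\<^sub>R v) (at_right 0)"
      by (intro tendsto_intros)
    then have r: "((\<lambda>h. c (t + h)) \<longlongrightarrow> c t) (at_right 0)"
      using v by (simp add: tendsto_cong)
    have "((\<lambda>h. c t + h *\<^sub>R w) \<longlongrightarrow> c t + 0 *\<^sub>R w) (at_left 0)"
      by (intro tendsto_intros)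
    then have l: "((\<lambda>h. c (t + h)) \<longlongrightarrow> c t) (at_left 0)"
      using w by (simp add: tendsto_cong)
    have "((\<lambda>h. c (t + h)) \<longlongrightarrow> c t) (at 0)"
      using l r filterlim_split_at by blast
    then show ?thesis by (simp add: isCont_iff)
  qed
  then show ?thesis using assms by (auto simp: closed_curve_def polygonal_loop_def continuous_at_imp_continuous_on)
qed

text \<open>
  The homotopy interpolates linearly between \<open>f\<close> and the identity; it consists of
  loops because the interpolated functions still commute with translation by one.
\<close>

lemma winding_number_reparametrisation:
  assumes c: "closed_curve c" and f: "continuous_on UNIV f" "\<And>t. f (t + 1) = f t + 1"
    and z: "z \<notin> range c"
  shows "winding_number (c \<circ> f) z = winding_number c z"
proof -
  let ?h = "\<lambda>(\<tau>, t). c ((1 - \<tau>) * f t + \<tau> * t)"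
  have cc: "continuous_on UNIV c" using c by (simp add: closed_curve_def)
  have "homotopic_loops (- {z}) (c \<circ> f) c"
    unfolding homotopic_loops
  proof (intro exI[of _ ?h] conjI)
    show "continuous_on ({0..1} \<times> {0..1}) ?h"
      unfolding case_prod_beta
      by (intro continuous_on_compose2[OF cc] continuous_intros continuous_on_compose2[OF f(1)]) auto
    show "?h \<in> {0..1} \<times> {0..1} \<rightarrow> - {z}" using z by auto
    have "c ((1 - \<tau>) * f 1 + \<tau>) = c ((1 - \<tau>) * f 0)" for \<tau>
    proof (rule closed_curve_cong_Ints[OF c])
      have "f 1 = f 0 + 1" using f(2)[of 0] by simp
      then show "(1 - \<tau>) * f 1 + \<tau> - (1 - \<tau>) * f 0 \<in> \<int>" by (simp add: algebra_simps)
    qed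
    then show "\<forall>t\<in>{0..1}. pathfinish (?h \<circ> Pair t) = pathstart (?h \<circ> Pair t)"
      by (simp add: pathfinish_def pathstart_def)
  qed auto
  then show ?thesis by (rule winding_number_homotopic_loops)
qed

text \<open>
  The loops \<open>H \<tau> \<circ> c - H \<tau> z\<close> avoid the origin, because each
  \<open>H \<tau>\<close> is injective. Letting \<open>z\<close> move along with the curve thus
  turns the isotopy into a homotopy of loops around a fixed point.
\<close>

lemma winding_number_isotopy:
  assumes c: "closed_curve c" and H: "ambient_isotopy H" and z: "z \<notin> range c"
  shows "winding_number (H 1 \<circ> c) (H 1 z) = winding_number c z"
proof -
  let ?h = "\<lambda>(\<tau>, t). H \<tau> (c t) - H \<tau> z"
  have cc: "continuous_on UNIV c" and c1: "c 1 = c 0"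
    using c closed_curve_path(2)[OF c] by (auto simp: closed_curve_def pathfinish_def pathstart_def)
  have Hc: "continuous_on ({0..1} \<times> UNIV) (\<lambda>(\<tau>, x). H \<tau> x)" and H0: "H 0 = id"
    using H by (auto simp: ambient_isotopy_def)
  have inj: "H \<tau> x = H \<tau> y \<Longrightarrow> x = y" if "\<tau> \<in> {0..1}" for \<tau> x y
    using H that unfolding ambient_isotopy_def homeomorphism_def by (metis UNIV_I)
  have "homotopic_loops (- {0}) (\<lambda>t. c t - z) (\<lambda>t. H 1 (c t) - H 1 z)"
    unfolding homotopic_loops
  proof (intro exI[of _ ?h] conjI)
    have "continuous_on ({0..1} \<times> {0..1}) (\<lambda>p. (\<lambda>(\<tau>, x). H \<tau> x) (fst p, c (snd p)))"
      by (intro continuous_on_compose2[OF Hc] continuous_intros continuous_on_compose2[OF cc]) auto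
    moreover have "continuous_on ({0..1} \<times> {0..1}) (\<lambda>p :: real \<times> real. (\<lambda>(\<tau>, x). H \<tau> x) (fst p, z))"
      by (intro continuous_on_compose2[OF Hc] continuous_intros) auto
    ultimately show "continuous_on ({0..1} \<times> {0..1}) ?h"
      unfolding case_prod_beta by (intro continuous_on_diff) auto
    show "?h \<in> {0..1} \<times> {0..1} \<rightarrow> - {0}"
    proof
      fix p :: "real \<times> real" assume "p \<in> {0..1} \<times> {0..1}"
      moreover have "c (snd p) \<noteq> z" using z by (metis rangeI)
      ultimately show "?h p \<in> - {0}" using inj[of "fst p" "c (snd p)" z] by (auto simp: case_prod_beta)
    qed
  qed (auto simp: H0 pathfinish_def pathstart_def c1)
  then have "winding_number (\<lambda>t. c t - z) 0 = winding_number (\<lambda>t. H 1 (c t) - H 1 z) 0"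
    by (rule winding_number_homotopic_loops)
  then show ?thesis
    using winding_number_offset[of c z] winding_number_offset[of "H 1 \<circ> c" "H 1 z"] by (simp add: o_def)
qed

text \<open>
  A topological disc is convex in suitable coordinates. The straight homotopy in these
  coordinates deforms the part of \<open>c\<close> in \<open>B\<close> into that of
  \<open>e\<close> without leaving \<open>B\<close>, so it does not meet \<open>z\<close>.
\<close>

lemma winding_number_eq_off_disc:
  fixes c e :: "real \<Rightarrow> complex"
  assumes c: "closed_curve c" and e: "closed_curve e"
    and B: "B homeomorphic cball (0::complex) 1"
    and same: "\<And>t. c t = e t \<or> c t \<in> B \<and> e t \<in> B"
    and z: "z \<notin> B" "z \<notin> range c"
  shows "winding_number c z = winding_number e z"
proof -
  obtain g g' where g: "homeomorphism B (cball (0::complex) 1) g g'"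
    using B unfolding homeomorphic_def by blast
  have gB: "g ` B = cball 0 1" and g'B: "g' ` cball 0 1 = B" and g'g: "\<And>x. x \<in> B \<Longrightarrow> g' (g x) = x"
    and gc: "continuous_on B g" and g'c: "continuous_on (cball 0 1) g'"
    using g by (auto simp: homeomorphism_def)
  have "compact B" using g by (meson B compact_cball homeomorphic_compactness)
  then have "closed B" by (rule compact_imp_closed)
  have cc: "continuous_on UNIV c" and ec: "continuous_on UNIV e" and c1: "c 1 = c 0" and e1: "e 1 = e 0"
    using c e closed_curve_path(2) by (auto simp: closed_curve_def pathfinish_def pathstart_def)
  let ?P = "{0..1} \<times> {t \<in> {0..1}. c t = e t} :: (real \<times> real) set"
  let ?Q = "{0..1} \<times> {t \<in> {0..1}. c t \<in> B \<and> e t \<in> B} :: (real \<times> real) set"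
  let ?m = "\<lambda>p. g' ((1 - fst p) *\<^sub>R g (c (snd p)) + fst p *\<^sub>R g (e (snd p)))"
  let ?h = "\<lambda>p. if c (snd p) = e (snd p) then c (snd p) else ?m p"
  have conv: "(1 - \<tau>) *\<^sub>R g x + \<tau> *\<^sub>R g y \<in> cball 0 1" if "x \<in> B" "y \<in> B" "\<tau> \<in> {0..1}" for \<tau> x y
  proof -
    have "g x \<in> cball 0 1" "g y \<in> cball 0 1" using that(1,2) gB by blast+
    then show ?thesis using that(3) convexD_alt[OF convex_cball, of "g x" 0 1 "g y" \<tau>] by simp
  qed
  have "closed ({0..1} \<inter> {t. c t = e t})"
    by (intro closed_Int closed_Collect_eq cc ec closed_real_atLeastAtMost)
  then have P: "closed ?P" by (intro closed_Times closed_real_atLeastAtMost) (simp add: Int_def)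
  have "closed ({0..1} \<inter> (c -` B \<inter> e -` B))"
    by (intro closed_Int closed_vimage \<open>closed B\<close> cc ec closed_real_atLeastAtMost)
  moreover have "{0..1} \<inter> (c -` B \<inter> e -` B) = {t \<in> {0..1}. c t \<in> B \<and> e t \<in> B}" by blast
  ultimately have Q: "closed ?Q" by (intro closed_Times closed_real_atLeastAtMost) simp
  have PQ: "{0..1} \<times> {0..1} = ?P \<union> ?Q" using same by blast
  have cont: "continuous_on (?P \<union> ?Q) ?h"
  proof (rule continuous_on_cases[OF P Q])
    show "continuous_on ?P (\<lambda>p. c (snd p))"
      by (intro continuous_on_compose2[OF cc] continuous_intros) auto
    have 1: "continuous_on ?Q (\<lambda>p. g (c (snd p)))"
      by (intro continuous_on_compose2[OF gc] continuous_on_compose2[OF cc] continuous_intros) auto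
    have 2: "continuous_on ?Q (\<lambda>p. g (e (snd p)))"
      by (intro continuous_on_compose2[OF gc] continuous_on_compose2[OF ec] continuous_intros) auto
    show "continuous_on ?Q ?m"
    proof (intro continuous_on_compose2[OF g'c] continuous_intros 1 2)
      show "(\<lambda>p. (1 - fst p) *\<^sub>R g (c (snd p)) + fst p *\<^sub>R g (e (snd p))) ` ?Q \<subseteq> cball 0 1"
      proof (rule image_subsetI)
        fix p assume "p \<in> ?Q"
        then show "(1 - fst p) *\<^sub>R g (c (snd p)) + fst p *\<^sub>R g (e (snd p)) \<in> cball 0 1"
          by (intro conv) (auto simp: mem_Times_iff)
      qed
    qed
    show "\<forall>p. p \<in> ?P \<and> \<not> c (snd p) = e (snd p) \<or> p \<in> ?Q \<and> c (snd p) = e (snd p) \<longrightarrow> c (snd p) = ?m p"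
    proof (intro allI impI)
      fix p :: "real \<times> real"
      assume "p \<in> ?P \<and> \<not> c (snd p) = e (snd p) \<or> p \<in> ?Q \<and> c (snd p) = e (snd p)"
      then have p: "e (snd p) = c (snd p)" "c (snd p) \<in> B" by (auto simp: mem_Times_iff)
      have "(1 - fst p) *\<^sub>R g (c (snd p)) + fst p *\<^sub>R g (c (snd p)) = g (c (snd p))"
        by (simp add: algebra_simps)
      then show "c (snd p) = ?m p" using p g'g by simp
    qed
  qed
  have "homotopic_loops (- {z}) c e"
    unfolding homotopic_loops
  proof (intro exI[of _ ?h] conjI)
    show "continuous_on ({0..1} \<times> {0..1}) ?h" using cont PQ by simp
    show "?h \<in> {0..1} \<times> {0..1} \<rightarrow> - {z}"
    proof
      fix p :: "real \<times> real" assume p: "p \<in> {0..1} \<times> {0..1}"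
      show "?h p \<in> - {z}"
      proof (cases "c (snd p) = e (snd p)")
        case True
        then have "?h p = c (snd p)" by simp
        then have "?h p \<in> range c" by (metis rangeI)
        then show ?thesis using z(2) by blast
      next
        case False
        then have "c (snd p) \<in> B" "e (snd p) \<in> B" using same by blast+
        then have "?m p \<in> B" using conv[of "c (snd p)" "e (snd p)" "fst p"] p g'B
          by (metis (no_types, lifting) image_eqI mem_Sigma_iff prod.collapse)
        then show ?thesis using False z by auto
      qed
    qed
    show "\<forall>t\<in>{0..1}. ?h (0, t) = c t"
    proof
      fix t :: real
      show "?h (0, t) = c t" using same[of t] g'g[of "c t"] by auto
    qed
    show "\<forall>t\<in>{0..1}. ?h (1, t) = e t"
    proof
      fix t :: real
      show "?h (1, t) = e t" using same[of t] g'g[of "e t"] by auto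
    qed
  qed (auto simp: pathfinish_def pathstart_def c1 e1)
  then show ?thesis by (rule winding_number_homotopic_loops)
qed

abbreviation det2 :: "complex \<Rightarrow> complex \<Rightarrow> real" where
  "det2 u v \<equiv> Re u * Im v - Im u * Re v"

text \<open>
  By compactness, the part of the curve away from the parameter \<open>s\<close> keeps a
  positive distance from \<open>z\<close>.
\<close>

lemma near_point_near_parameter:
  fixes c :: "real \<Rightarrow> 'a::real_normed_vector"
  assumes c: "closed_curve c" and z: "c s = z" and inj: "\<And>r. c r = z \<Longrightarrow> r - s \<in> \<int>"
    and eps: "\<epsilon> > 0"
  obtains \<rho> where "\<rho> > 0" "\<And>r. dist (c r) z < \<rho> \<Longrightarrow> \<exists>k::int. \<bar>r + of_int k - s\<bar> < \<epsilon>"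
proof -
  define \<eta> where "\<eta> = min \<epsilon> (1/2)"
  have eta: "0 < \<eta>" "\<eta> \<le> \<epsilon>" "\<eta> \<le> 1/2" using eps by (auto simp: \<eta>_def)
  let ?K = "c ` {s + \<eta>..s + 1 - \<eta>}"
  have "compact ?K" using c unfolding closed_curve_def
    by (metis compact_Icc compact_continuous_image continuous_on_subset subset_UNIV)
  then have "open (- ?K)" by (simp add: compact_imp_closed open_Compl)
  moreover have "z \<notin> ?K"
  proof
    assume "z \<in> ?K"
    then obtain r where r: "c r = z" "s + \<eta> \<le> r" "r \<le> s + 1 - \<eta>" by auto
    obtain k where k: "r - s = of_int k" using inj[OF r(1)] by (auto elim: Ints_cases)
    have "of_int k > (0::real)" "of_int k < (1::real)" using r k eta by linarith+
    then show False by simp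
  qed
  ultimately obtain \<rho> where \<rho>: "\<rho> > 0" "ball z \<rho> \<subseteq> - ?K" by (meson open_contains_ball_eq ComplI)
  show ?thesis
  proof (rule that[OF \<rho>(1)])
    fix r assume r: "dist (c r) z < \<rho>"
    define k where "k = - \<lfloor>r - s + \<eta>\<rfloor>"
    have k: "s - \<eta> \<le> r + of_int k" "r + of_int k < s - \<eta> + 1"
      unfolding k_def by (simp_all; linarith)+
    have "c (r + of_int k) = c r" using closed_curve_add_int[OF c] .
    then have "c (r + of_int k) \<notin> ?K" using r \<rho>(2) by (auto simp: dist_commute subset_iff)
    then have "r + of_int k \<notin> {s + \<eta>..s + 1 - \<eta>}" by blast
    then have "r + of_int k < s + \<eta>" using k by auto
    moreover have "r + of_int k > s - \<eta>"
    proof (rule ccontr)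
      assume "\<not> ?thesis"
      then have e: "r + of_int k = s - \<eta>" using k by simp
      have "c (r + of_int (k + 1)) = c r" using closed_curve_add_int[OF c] .
      then have "c (r + of_int (k + 1)) \<notin> ?K" using r \<rho>(2) by (auto simp: dist_commute subset_iff)
      then have "r + of_int (k + 1) \<notin> {s + \<eta>..s + 1 - \<eta>}" by blast
      then show False using e eta by auto
    qed
    ultimately have "\<bar>r + of_int k - s\<bar> < \<epsilon>" using eta by auto
    then show "\<exists>k::int. \<bar>r + of_int k - s\<bar> < \<epsilon>" by blast
  qed
qed

lemma det2_independent:
  assumes "det2 u v \<noteq> 0" "of_real a * u = of_real b * v" shows "a = 0" "b = 0"
proof -
  have "a * Re u = b * Re v" "a * Im u = b * Im v" using assms(2) by (auto simp: complex_eq_iff)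
  then have "a * det2 u v = 0" "b * det2 u v = 0" by algebra+
  then show "a = 0" "b = 0" using assms(1) by auto
qed

text \<open>
  A closed curve that passes once through \<open>z\<close>, in the direction \<open>u\<close>,
  has a winding number larger by one on the left than on the right. Replace the short chord of
  \<open>c\<close> at \<open>z\<close> by a detour around \<open>z\<close> on the right. The new
  loop does not separate the points on the two sides, and the difference of the two loops is the
  boundary of a triangle, which surrounds the points on the right only. The parameter
  \<open>1/2\<close> keeps the passage away from the ends of the unit interval.
\<close>

lemma winding_number_jump_half:
  assumes c: "closed_curve c" and z: "c (1/2) = z" and inj: "\<And>r. c r = z \<Longrightarrow> r - 1/2 \<in> \<int>"
    and eps: "\<epsilon> > 0" and lin: "\<And>\<sigma>. \<bar>\<sigma>\<bar> \<le> \<epsilon> \<Longrightarrow> c (1/2 + \<sigma>) = z + of_real \<sigma> * u"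
    and det: "det2 u v > 0"
  obtains \<kappa> where "\<kappa> > 0"
    "\<And>h. 0 < h \<Longrightarrow> h < \<kappa> \<Longrightarrow>
       winding_number c (z + of_real h * v) = winding_number c (z - of_real h * v) + 1"
proof -
  define \<epsilon>' where "\<epsilon>' = min \<epsilon> (1/4)"
  have e': "0 < \<epsilon>'" "\<epsilon>' \<le> \<epsilon>" "\<epsilon>' \<le> 1/4" using eps by (auto simp: \<epsilon>'_def)
  obtain \<rho> where \<rho>: "\<rho> > 0" "\<And>r. dist (c r) z < \<rho> \<Longrightarrow> \<exists>k::int. \<bar>r + of_int k - 1/2\<bar> < \<epsilon>'"
    using near_point_near_parameter[OF c z inj e'(1)] by blast
  have uv: "u \<noteq> 0" "v \<noteq> 0" using det by auto
  have det0: "det2 u v \<noteq> 0" using det by simp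
  define \<delta> where "\<delta> = \<epsilon>' / 2"
  define \<kappa> where "\<kappa> = \<rho> / (2 * norm v)"
  have dk: "0 < \<delta>" "\<delta> < \<epsilon>'" "0 < \<kappa>" "\<kappa> * norm v < \<rho>"
    using e' \<rho> uv by (auto simp: \<delta>_def \<kappa>_def)
  define x y a b m where "x = 1/2 - \<delta>" and "y = 1/2 + \<delta>" and "a = z - of_real \<delta> * u"
    and "b = z + of_real \<delta> * u" and "m = z - of_real \<kappa> * v"
  have xy: "0 \<le> x" "x \<le> y" "y \<le> 1" using dk e' by (auto simp: x_def y_def)
  have cx: "c x = a" and cy: "c y = b"
    using lin[of "-\<delta>"] lin[of \<delta>] dk e' by (auto simp: x_def y_def a_def b_def)
  have pc: "path c" and loop: "pathfinish c = pathstart c" using closed_curve_path[OF c] by auto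
  let ?p1 = "subpath 0 x c" and ?p2 = "subpath y 1 c"
  have paths: "path ?p1" "path ?p2" "path (subpath x y c)" using pc xy by (auto intro!: path_subpath)
  have sub: "winding_number (subpath x y c) w = winding_number (linepath a b) w" for w
  proof (rule winding_number_cong)
    fix t :: real assume t: "0 \<le> t" "t \<le> 1"
    have 1: "(y - x) * t + x = 1/2 + (2 * t - 1) * \<delta>" by (simp add: x_def y_def algebra_simps)
    have "\<bar>2 * t - 1\<bar> * \<delta> \<le> 1 * \<delta>" using dk t by (intro mult_right_mono) auto
    then have "\<bar>2 * t - 1\<bar> * \<delta> \<le> \<epsilon>" using dk e' by linarith
    then have "\<bar>(2 * t - 1) * \<delta>\<bar> \<le> \<epsilon>" using dk by (simp add: abs_mult)
    from lin[OF this] show "subpath x y c t = linepath a b t" unfolding subpath_def 1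
      by (simp add: linepath_def a_def b_def scaleR_conv_of_real algebra_simps)
  qed
  \<comment> \<open>Near \<open>z\<close> the curve is the line with direction \<open>u\<close>, and this line meets the line with direction \<open>v\<close> only in \<open>z\<close>.\<close>
  have near: "\<exists>\<sigma>. \<bar>\<sigma>\<bar> < \<epsilon>' \<and> r = 1/2 + \<sigma> \<and> c r = z + of_real \<sigma> * u" if r: "0 \<le> r" "r \<le> 1" "dist (c r) z < \<rho>" for r
  proof -
    obtain k :: int where k: "\<bar>r + of_int k - 1/2\<bar> < \<epsilon>'" using \<rho>(2)[OF r(3)] by blast
    then have "of_int k < (1::real)" "of_int k > (-1::real)" using r e' by linarith+
    then have "k = 0" by simp
    then show ?thesis using k lin[of "r - 1/2"] e' by (intro exI[of _ "r - 1/2"]) auto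
  qed
  have det_line: "\<theta> = 0 \<and> \<sigma> = 0" if "z + of_real \<theta> * v = z + of_real \<sigma> * u" for \<theta> \<sigma>
    using det2_independent[OF det0, of \<sigma> \<theta>] that by auto
  have vline: "z + of_real \<theta> * v \<noteq> c r" if "\<bar>\<theta>\<bar> < \<kappa>" "0 \<le> r" "r \<le> 1" "r \<noteq> 1/2" for \<theta> r
  proof
    assume e: "z + of_real \<theta> * v = c r"
    have "dist (c r) z = \<bar>\<theta>\<bar> * norm v" using e by (simp add: dist_norm norm_mult flip: e)
    also have "\<dots> \<le> \<kappa> * norm v" using that by (intro mult_right_mono) auto
    finally have "dist (c r) z < \<rho>" using dk by simp
    from near[OF that(2,3) this] obtain \<sigma> where \<sigma>: "r = 1/2 + \<sigma>" "c r = z + of_real \<sigma> * u" by blast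
    then have "\<sigma> = 0" using det_line[of \<theta> \<sigma>] e by auto
    then show False using \<sigma> that by simp
  qed
  have vline0: "z + of_real \<theta> * v \<notin> path_image c" if "\<bar>\<theta>\<bar> < \<kappa>" "\<theta> \<noteq> 0" for \<theta>
  proof
    assume "z + of_real \<theta> * v \<in> path_image c"
    then obtain r where r: "0 \<le> r" "r \<le> 1" "z + of_real \<theta> * v = c r" by (auto simp: path_image_def)
    then have "r = 1/2" using vline[OF that(1)] by blast
    then have "c r = z" using z by (simp only:)
    then show False using r that uv by simp
  qed
  have seg: "z + of_real \<theta> * v \<notin> closed_segment w m" if w: "\<bar>\<theta>\<bar> < \<kappa>" "w = a \<or> w = b" for \<theta> w
  proof
    have "a = z + of_real (- \<delta>) * u" "b = z + of_real \<delta> * u" by (simp_all add: a_def b_def)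
    then obtain d where d: "w = z + of_real d * u" "d \<noteq> 0"
      using w dk by (metis less_irrefl neg_0_equal_iff_equal)
    assume "z + of_real \<theta> * v \<in> closed_segment w m"
    then obtain t where t: "0 \<le> t" "t \<le> 1" "z + of_real \<theta> * v = (1 - t) *\<^sub>R w + t *\<^sub>R m"
      by (auto simp: closed_segment_def)
    then have "z + of_real (\<theta> + t * \<kappa>) * v = z + of_real ((1 - t) * d) * u"
      by (simp add: d m_def scaleR_conv_of_real algebra_simps)
    from det_line[OF this] have "t = 1" "\<theta> = - \<kappa>" using d by auto
    then show False using w by simp
  qed
  have ab: "z + of_real \<theta> * v \<notin> closed_segment a b" if "\<theta> \<noteq> 0" for \<theta>
  proof
    assume "z + of_real \<theta> * v \<in> closed_segment a b"
    then obtain t where t: "z + of_real \<theta> * v = (1 - t) *\<^sub>R a + t *\<^sub>R b" by (auto simp: closed_segment_def)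
    then have "z + of_real \<theta> * v = z + of_real ((2 * t - 1) * \<delta>) * u"
      by (simp add: a_def b_def scaleR_conv_of_real algebra_simps)
    from det_line[OF this] show False using that by simp
  qed
  \<comment> \<open>The curve with its chord from \<open>a\<close> to \<open>b\<close> replaced by a
    detour over \<open>m\<close>, and the triangle by which the two differ.\<close>
  define g where "g = ?p1 +++ linepath a m +++ linepath m b +++ ?p2"
  define T where "T = linepath a b +++ linepath b m +++ linepath m a"
  have ends [simp]: "pathstart ?p1 = c 0" "pathfinish ?p1 = a" "pathstart ?p2 = b" "pathfinish ?p2 = c 1"
    using cx cy by (simp_all add: subpath_def pathstart_def pathfinish_def)
  have gpath: "path g" and gloop: "pathfinish g = pathstart g"
    using paths loop cx cy by (auto simp: g_def pathfinish_def[of c] pathstart_def[of c])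
  have gim: "path_image g = c ` {0..x} \<union> closed_segment a m \<union> closed_segment m b \<union> c ` {y..1}"
    using xy paths cx cy by (simp add: g_def path_image_join path_image_subpath Un_assoc)
  have Tloop: "path T" "pathfinish T = pathstart T" by (auto simp: T_def)
  have Tim: "path_image T = closed_segment a b \<union> closed_segment b m \<union> closed_segment m a"
    by (auto simp: T_def path_image_join)
  have goff: "z + of_real \<theta> * v \<notin> path_image g" if "\<bar>\<theta>\<bar> < \<kappa>" for \<theta>
  proof -
    have "r \<noteq> 1/2" if "r \<in> {0..x} \<union> {y..1}" for r using that dk by (auto simp: x_def y_def)
    then have "z + of_real \<theta> * v \<notin> c ` ({0..x} \<union> {y..1})"
      using vline[OF that] xy
      by (smt (verit) UnE atLeastAtMost_iff imageE)
    then show ?thesis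
      unfolding gim using seg[OF that, of a] seg[OF that, of b] by (auto simp: closed_segment_commute)
  qed
  have split: "winding_number c w = winding_number g w + winding_number T w"
    if w: "w = z + of_real \<theta> * v" "\<bar>\<theta>\<bar> < \<kappa>" "\<theta> \<noteq> 0" for w \<theta>
  proof -
    have off: "w \<notin> path_image c" "w \<notin> path_image g" "w \<notin> closed_segment a b"
       "w \<notin> closed_segment a m" "w \<notin> closed_segment b m"
      using w vline0 goff ab seg by auto
    have off': "w \<notin> path_image ?p1" "w \<notin> path_image ?p2"
      using off xy by (auto simp: path_image_subpath path_image_def[of c])
    have "winding_number (subpath 0 x c) w + winding_number (subpath x y c) w = winding_number (subpath 0 y c) w"
      "winding_number (subpath 0 y c) w + winding_number (subpath y 1 c) w = winding_number (subpath 0 1 c) w"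
      using xy by (intro winding_number_subpath_combine pc off; auto)+
    then have 1: "winding_number c w = winding_number ?p1 w + winding_number (linepath a b) w + winding_number ?p2 w"
      by (simp add: sub)
    have 2: "winding_number g w = winding_number ?p1 w + winding_number (linepath a m) w
        + winding_number (linepath m b) w + winding_number ?p2 w"
      unfolding g_def using off off' paths cx cy
      by (simp add: winding_number_join path_image_join closed_segment_commute)
    have 3: "winding_number T w = winding_number (linepath a b) w + winding_number (linepath b m) w
        + winding_number (linepath m a) w"
      unfolding T_def using off
      by (simp add: winding_number_join path_image_join closed_segment_commute)
    have "winding_number (linepath b m) w = - winding_number (linepath m b) w"
      "winding_number (linepath m a) w = - winding_number (linepath a m) w"
      using off winding_number_reversepath[of "linepath m b" w] winding_number_reversepath[of "linepath a m" w]
      by (simp_all add: closed_segment_commute)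
    then show ?thesis using 1 2 3 by simp
  qed
  have line_const: "winding_number g (z + of_real h * v) = winding_number g (z - of_real h * v)"
    if "0 < h" "h < \<kappa>" for h
  proof (rule winding_number_eq[OF gpath gloop])
    let ?S = "(\<lambda>\<theta>. z + of_real \<theta> * v) ` {-h..h}"
    show "connected ?S" by (intro connected_continuous_image continuous_intros) auto
    show "z + of_real h * v \<in> ?S" "z - of_real h * v \<in> ?S" using that by (force simp: image_iff)+
    show "?S \<inter> path_image g = {}" using goff that by fastforce
  qed
  \<comment> \<open>The triangle lies in the closed half-plane to the right of the curve.\<close>
  have Tplus: "winding_number T (z + of_real h * v) = 0" if "0 < h" for h
  proof (rule winding_number_zero_outside[OF Tloop(1) _ Tloop(2)])
    let ?S = "{w. det2 u w \<le> det2 u z}"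
    have "?S = {w. inner (u * \<i>) w \<le> inner (u * \<i>) z}" by (simp add: inner_complex_def)
    then show "convex ?S" using convex_halfspace_le by metis
    have step: "det2 u (z + of_real \<sigma> * u + of_real \<theta> * v) = det2 u z + \<theta> * det2 u v" for \<sigma> \<theta>
      by (simp add: algebra_simps)
    have pos: "h * det2 u v > 0" "\<kappa> * det2 u v > 0" using that det dk by simp_all
    show "z + of_real h * v \<notin> ?S" using step[of 0 h] pos by simp
    have "a \<in> ?S" "b \<in> ?S" "m \<in> ?S"
      using step[of "-\<delta>" 0] step[of \<delta> 0] step[of 0 "-\<kappa>"] pos by (simp_all add: a_def b_def m_def)
    then show "path_image T \<subseteq> ?S" unfolding Tim
      by (intro Un_least closed_segment_subset \<open>convex ?S\<close>)
  qed
  have Tminus: "winding_number T (z - of_real h * v) = -1" if h: "0 < h" "h < \<kappa>" for h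
  proof -
    let ?q = "z - of_real h * v"
    have ncol: "\<not> collinear {a, b, m}"
    proof
      assume "collinear {a, b, m}"
      then obtain t where "b = t *\<^sub>R a + (1 - t) *\<^sub>R m \<or> a = m" unfolding collinear_3_expand by blast
      moreover have "a \<noteq> m" using seg[of 0 a] dk det_line[of "-\<kappa>" "-\<delta>"] by (auto simp: a_def m_def)
      ultimately have "z + of_real ((1 - t) * \<kappa>) * v = z + of_real (- \<delta> - t * \<delta>) * u"
        by (auto simp: a_def b_def m_def scaleR_conv_of_real algebra_simps)
      from det_line[OF this] show False using dk by auto
    qed
    have "?q \<in> interior (convex hull {a, b, m})"
      unfolding interior_convex_hull_3_minimal[OF ncol DIM_complex]
    proof (intro CollectI exI conjI)
      show "0 < (1 - h / \<kappa>) / 2" "0 < (1 - h / \<kappa>) / 2" "0 < h / \<kappa>" using h dk by auto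
      show "(1 - h / \<kappa>) / 2 + (1 - h / \<kappa>) / 2 + h / \<kappa> = 1" by (simp add: field_simps)
      show "((1 - h / \<kappa>) / 2) *\<^sub>R a + ((1 - h / \<kappa>) / 2) *\<^sub>R b + (h / \<kappa>) *\<^sub>R m = ?q"
        using dk by (simp add: a_def b_def m_def complex_eq_iff field_simps)
    qed
    from winding_number_triangle[OF this]
    have "winding_number T ?q = (if 0 < Im ((b - a) * cnj (b - ?q)) then 1 else -1)" by (simp add: T_def)
    moreover have "Im ((b - a) * cnj (b - ?q)) = - (2 * \<delta> * h * det2 u v)"
      by (simp add: a_def b_def algebra_simps)
    moreover have "2 * \<delta> * h * det2 u v > 0" using dk h det by simp
    ultimately show ?thesis by simp
  qed
  show ?thesis
  proof (rule that[OF dk(3)])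
    fix h :: real assume h: "0 < h" "h < \<kappa>"
    have "winding_number c (z + of_real h * v) = winding_number g (z + of_real h * v) + 0"
      using split[of _ h] Tplus h by simp
    moreover have "winding_number c (z - of_real h * v) = winding_number g (z - of_real h * v) + (-1)"
      using split[of "z - of_real h * v" "-h"] Tminus h by simp
    ultimately show "winding_number c (z + of_real h * v) = winding_number c (z - of_real h * v) + 1"
      using line_const[OF h] by simp
  qed
qed

lemma winding_number_shift:
  assumes c: "closed_curve c" and z: "z \<notin> range c"
  shows "winding_number (\<lambda>t. c (t + a)) z = winding_number c z"
  using winding_number_reparametrisation[OF c _ _ z, of "\<lambda>t. t + a"]
  by (simp add: o_def continuous_intros)

lemma winding_number_jump:
  assumes c: "closed_curve c" and z: "c s = z" and inj: "\<And>r. c r = z \<Longrightarrow> r - s \<in> \<int>"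
    and eps: "\<epsilon> > 0" and lin: "\<And>\<sigma>. \<bar>\<sigma>\<bar> \<le> \<epsilon> \<Longrightarrow> c (s + \<sigma>) = z + of_real \<sigma> * u"
    and det: "det2 u v > 0"
    and off: "\<And>h. 0 < \<bar>h\<bar> \<Longrightarrow> \<bar>h\<bar> < \<delta> \<Longrightarrow> z + of_real h * v \<notin> range c" and "\<delta> > 0"
  obtains \<kappa> where "\<kappa> > 0"
    "\<And>h. 0 < h \<Longrightarrow> h < \<kappa> \<Longrightarrow>
       winding_number c (z + of_real h * v) = winding_number c (z - of_real h * v) + 1"
proof -
  let ?c = "\<lambda>t. c (t + (s - 1/2))"
  have cc: "closed_curve ?c"
  proof -
    have "continuous_on UNIV c" using c by (simp add: closed_curve_def)
    then have "continuous_on UNIV ?c" by (rule continuous_on_compose2) (auto intro!: continuous_intros)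
    moreover have "?c (t + 1) = ?c t" for t
    proof -
      have "c ((t + (s - 1/2)) + 1) = c (t + (s - 1/2))" using c unfolding closed_curve_def by blast
      then show ?thesis by (simp add: algebra_simps)
    qed
    ultimately show ?thesis unfolding closed_curve_def by blast
  qed
  obtain \<kappa> where k: "\<kappa> > 0"
    "\<And>h. 0 < h \<Longrightarrow> h < \<kappa> \<Longrightarrow>
       winding_number ?c (z + of_real h * v) = winding_number ?c (z - of_real h * v) + 1"
  proof (rule winding_number_jump_half[OF cc _ _ eps _ det, of z])
    show "\<And>r. c (r + (s - 1 / 2)) = z \<Longrightarrow> r - 1 / 2 \<in> \<int>" using inj[of "_ + (s - 1/2)"] by (simp add: algebra_simps)
    show "\<And>\<sigma>. \<bar>\<sigma>\<bar> \<le> \<epsilon> \<Longrightarrow> c (1 / 2 + \<sigma> + (s - 1 / 2)) = z + of_real \<sigma> * u"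
      using lin by (simp add: add.commute)
  qed (use z in auto)
  show ?thesis
  proof (rule that[of "min \<kappa> \<delta>"])
    fix h assume h: "0 < h" "h < min \<kappa> \<delta>"
    have "z + of_real h * v \<notin> range c" "z - of_real h * v \<notin> range c"
      using off[of h] off[of "-h"] h by auto
    then show "winding_number c (z + of_real h * v) = winding_number c (z - of_real h * v) + 1"
      using k(2)[of h] h by (simp add: winding_number_shift[OF c])
  qed (use k \<open>\<delta> > 0\<close> in auto)
qed

section \<open>Crossings of different components and the winding sum\<close>

text \<open>Winding numbers of closed curves are integers; the real part spares conversions.\<close>

definition windno :: "(real \<Rightarrow> complex) \<Rightarrow> complex \<Rightarrow> real" where
  "windno c z = Re (winding_number c z)"

lemma windno_constant:
  assumes c: "closed_curve c" and S: "connected S" "S \<inter> range c = {}" "x \<in> S" "y \<in> S"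
  shows "windno c x = windno c y"
proof -
  have "winding_number c x = winding_number c y"
    using winding_number_eq[OF closed_curve_path[OF c] S(3,4,1)] S(2) by (simp add: closed_curve_range[OF c])
  then show ?thesis by (simp add: windno_def)
qed

lemma windno_constant_along:
  fixes d :: "real \<Rightarrow> complex"
  assumes c: "closed_curve c" and d: "continuous_on UNIV d"
    and off: "\<And>r. x \<le> r \<Longrightarrow> r \<le> y \<Longrightarrow> d r \<notin> range c" and "x \<le> y"
  shows "windno c (d x) = windno c (d y)"
proof (rule windno_constant[OF c])
  show "connected (d ` {x..y})"
    by (intro connected_continuous_image continuous_on_subset[OF d] connected_Icc) auto
  show "d ` {x..y} \<inter> range c = {}" using off by fastforce
qed (use \<open>x \<le> y\<close> in \<open>auto intro!: imageI\<close>)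

text \<open>A derivative forces the two one-sided directions to agree.\<close>

lemma polygonal_loop_linear_at:
  fixes c :: "real \<Rightarrow> 'a::real_normed_vector"
  assumes c: "polygonal_loop c" and d: "c differentiable at t"
  obtains \<epsilon> where "\<epsilon> > 0" "\<And>\<sigma>. \<bar>\<sigma>\<bar> \<le> \<epsilon> \<Longrightarrow> c (t + \<sigma>) = c t + \<sigma> *\<^sub>R vector_derivative c (at t)"
proof -
  let ?d = "vector_derivative c (at t)"
  have "(c has_vector_derivative ?d) (at t)" using d vector_derivative_works by blast
  then have lim: "((\<lambda>h. norm (c (t + h) - c t - h *\<^sub>R ?d) / norm h) \<longlongrightarrow> 0) (at 0)"
    unfolding has_vector_derivative_def has_derivative_at by simp
  have eq: "v = ?d" if F: "F \<le> at 0" "F \<noteq> bot" and v: "\<forall>\<^sub>F h in F. c (t + h) = c t + h *\<^sub>R v" for v and F :: "real filter"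
  proof -
    have l: "((\<lambda>h. norm (c (t + h) - c t - h *\<^sub>R ?d) / norm h) \<longlongrightarrow> 0) F"
      using lim F(1) by (rule tendsto_mono[rotated])
    have "\<forall>\<^sub>F h in at (0::real). h \<noteq> 0" by (simp add: eventually_at_filter)
    then have "\<forall>\<^sub>F h in F. h \<noteq> 0" using F(1) filter_leD by blast
    with v have "\<forall>\<^sub>F h in F. norm (c (t + h) - c t - h *\<^sub>R ?d) / norm h = norm (v - ?d)"
    proof eventually_elim
      case (elim h)
      have "c (t + h) - c t - h *\<^sub>R ?d = h *\<^sub>R (v - ?d)" using elim by (simp add: algebra_simps)
      then show ?case using elim by simp
    qed
    then have "((\<lambda>h. norm (v - ?d)) \<longlongrightarrow> 0) F" using l by (simp add: tendsto_cong)
    then show ?thesis using F(2) by (simp add: tendsto_const_iff)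
  qed
  obtain v where v: "\<forall>\<^sub>F h in at_right 0. c (t + h) = c t + h *\<^sub>R v"
    using c unfolding polygonal_loop_def by blast
  obtain w where w: "\<forall>\<^sub>F h in at_left 0. c (t + h) = c t + h *\<^sub>R w"
    using c unfolding polygonal_loop_def by blast
  have "v = ?d" "w = ?d"
    using eq[OF _ _ v] eq[OF _ _ w] by (simp_all add: at_le)
  then obtain a b where "a > 0" "\<And>h. 0 < h \<Longrightarrow> h < a \<Longrightarrow> c (t + h) = c t + h *\<^sub>R ?d"
    "b < 0" "\<And>h. b < h \<Longrightarrow> h < 0 \<Longrightarrow> c (t + h) = c t + h *\<^sub>R ?d"
    using v w unfolding eventually_at_right_field eventually_at_left_field by blast
  then show ?thesis
    by (intro that[of "min a (-b) / 2"]) (auto simp: abs_if le_less not_less split: if_splits)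
qed

definition crossing :: "diagram \<Rightarrow> nat \<Rightarrow> real \<Rightarrow> nat \<Rightarrow> real \<Rightarrow> bool" where
  "crossing D i s j t \<longleftrightarrow>
     i < components D \<and> j < components D \<and> i \<noteq> j \<and> curve D i s = curve D j t"

text \<open>
  Crossings are counted as points of the plane, since parameters are only determined up to
  integers.
\<close>

definition mixed_crossings :: "diagram \<Rightarrow> complex set" where
  "mixed_crossings D = {curve D i s | i s j t. crossing D i s j t}"

lemma crossing_sym: "crossing D i s j t \<Longrightarrow> crossing D j t i s"
  by (auto simp: crossing_def)

lemma is_diagram_closed_curve:
  "is_diagram D \<Longrightarrow> i < components D \<Longrightarrow> closed_curve (curve D i)"
  by (simp add: is_diagram_def polygonal_loop_closed_curve)

lemma same_point_sym: "same_point p q \<Longrightarrow> same_point q p"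
  unfolding same_point_def by (metis Ints_minus minus_diff_eq)

lemma double_point_params:
  assumes D: "is_diagram D" and dp: "double_point D p q"
    and k: "k < components D" "curve D k r = curve D (fst p) (snd p)"
  shows "same_point (k, r) p \<or> same_point (k, r) q"
proof (cases "same_point (k, r) p")
  case False
  then have "double_point D p (k, r)" using dp k unfolding double_point_def
    by (auto dest: same_point_sym)
  then have "same_point q (k, r)" using D dp unfolding is_diagram_def by blast
  then show ?thesis by (auto dest: same_point_sym)
qed simp

lemma crossing_double_point: "crossing D i s j t \<Longrightarrow> double_point D (i, s) (j, t)"
  by (auto simp: crossing_def double_point_def same_point_def)

lemma crossing_params:
  assumes D: "is_diagram D" and cr: "crossing D i s j t"
    and k: "k < components D" "curve D k r = curve D i s"
  shows "k = i \<and> r - s \<in> \<int> \<or> k = j \<and> r - t \<in> \<int>"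
  using double_point_params[OF D crossing_double_point[OF cr], of k r] k by (auto simp: same_point_def)

lemma double_point_upper:
  "is_diagram D \<Longrightarrow> double_point D p q \<Longrightarrow> upper D (fst p) (snd p) \<noteq> upper D (fst q) (snd q)"
  unfolding is_diagram_def by blast

lemma double_point_linear:
  assumes D: "is_diagram D" and dp: "double_point D p q"
  obtains \<epsilon> where "\<epsilon> > 0" "\<And>\<sigma>. \<bar>\<sigma>\<bar> \<le> \<epsilon> \<Longrightarrow> curve D (fst p) (snd p + \<sigma>) = curve D (fst p) (snd p) + of_real \<sigma> * velocity D p"
proof -
  have "fst p < components D" using dp by (simp add: double_point_def)
  then have "polygonal_loop (curve D (fst p))" using D by (simp add: is_diagram_def)
  moreover have "curve D (fst p) differentiable at (snd p)"
    using D dp unfolding is_diagram_def by blast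
  ultimately have *: "polygonal_loop (curve D (fst p))" "curve D (fst p) differentiable at (snd p)" .
  from polygonal_loop_linear_at[OF *] show ?thesis
    using that by (metis velocity_def scaleR_conv_of_real)
qed

lemma crossing_linear:
  assumes D: "is_diagram D" and cr: "crossing D i s j t"
  obtains \<epsilon> where "\<epsilon> > 0"
    "\<And>\<sigma>. \<bar>\<sigma>\<bar> \<le> \<epsilon> \<Longrightarrow> curve D i (s + \<sigma>) = curve D i s + of_real \<sigma> * velocity D (i, s)"
    "\<And>\<sigma>. \<bar>\<sigma>\<bar> \<le> \<epsilon> \<Longrightarrow> curve D j (t + \<sigma>) = curve D i s + of_real \<sigma> * velocity D (j, t)"
proof -
  obtain a where a: "a > 0" "\<And>\<sigma>. \<bar>\<sigma>\<bar> \<le> a \<Longrightarrow> curve D i (s + \<sigma>) = curve D i s + of_real \<sigma> * velocity D (i, s)"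
    using double_point_linear[OF D crossing_double_point[OF cr]] by auto
  obtain b where b: "b > 0" "\<And>\<sigma>. \<bar>\<sigma>\<bar> \<le> b \<Longrightarrow> curve D j (t + \<sigma>) = curve D j t + of_real \<sigma> * velocity D (j, t)"
    using double_point_linear[OF D crossing_double_point[OF crossing_sym[OF cr]]] by auto
  show ?thesis using a b cr by (intro that[of "min a b"]) (auto simp: crossing_def)
qed

lemma crossing_velocity_det: "is_diagram D \<Longrightarrow> crossing D i s j t \<Longrightarrow> velocity_det D (i, s) (j, t) \<noteq> 0"
  using crossing_double_point unfolding is_diagram_def by blast

lemma velocity_det_swap: "velocity_det D q p = - velocity_det D p q"
  by (simp add: velocity_det_def)

lemma crossing_near_point:
  assumes D: "is_diagram D" and cr: "crossing D i s j t" and eps: "\<epsilon> > 0"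
  obtains \<rho> where "\<rho> > 0"
    "\<And>r. dist (curve D i r) (curve D i s) < \<rho> \<Longrightarrow> \<exists>k::int. \<bar>r + of_int k - s\<bar> < \<epsilon>"
proof (rule near_point_near_parameter[OF _ refl _ eps])
  show "closed_curve (curve D i)" using D cr by (auto simp: crossing_def intro: is_diagram_closed_curve)
  show "r - s \<in> \<int>" if "curve D i r = curve D i s" for r
    using crossing_params[OF D cr _ that] cr by (auto simp: crossing_def)
qed (use that in blast)

text \<open>Near the crossing both components are straight lines with different directions.\<close>

lemma crossing_isolated:
  assumes D: "is_diagram D" and cr: "crossing D i s j t"
  obtains \<rho> where "\<rho> > 0" "range (curve D i) \<inter> range (curve D j) \<inter> ball (curve D i s) \<rho> = {curve D i s}"
proof -
  let ?z = "curve D i s"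
  have z: "curve D j t = ?z" using cr by (simp add: crossing_def)
  obtain \<epsilon> where e: "\<epsilon> > 0"
    "\<And>\<sigma>. \<bar>\<sigma>\<bar> \<le> \<epsilon> \<Longrightarrow> curve D i (s + \<sigma>) = ?z + of_real \<sigma> * velocity D (i, s)"
    "\<And>\<sigma>. \<bar>\<sigma>\<bar> \<le> \<epsilon> \<Longrightarrow> curve D j (t + \<sigma>) = ?z + of_real \<sigma> * velocity D (j, t)"
    using crossing_linear[OF D cr] by blast
  obtain a where a: "a > 0" "\<And>r. dist (curve D i r) ?z < a \<Longrightarrow> \<exists>k::int. \<bar>r + of_int k - s\<bar> < \<epsilon>"
    using crossing_near_point[OF D cr e(1)] by blast
  obtain b where b: "b > 0" "\<And>r. dist (curve D j r) ?z < b \<Longrightarrow> \<exists>k::int. \<bar>r + of_int k - t\<bar> < \<epsilon>"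
    using crossing_near_point[OF D crossing_sym[OF cr] e(1)] unfolding z by blast
  have cl: "closed_curve (curve D i)" "closed_curve (curve D j)"
    using D cr by (auto simp: crossing_def intro: is_diagram_closed_curve)
  have "w = ?z" if w: "w \<in> range (curve D i)" "w \<in> range (curve D j)" "dist w ?z < min a b" for w
  proof -
    obtain r where "w = curve D i r" using w(1) by blast
    moreover obtain r' where "w = curve D j r'" using w(2) by blast
    ultimately have r: "w = curve D i r" "w = curve D j r'" .
    obtain k k' :: int where k: "\<bar>r + of_int k - s\<bar> < \<epsilon>" "\<bar>r' + of_int k' - t\<bar> < \<epsilon>"
      using a(2)[of r] b(2)[of r'] r w by auto
    have "w = ?z + of_real (r + of_int k - s) * velocity D (i, s)"
      using e(2)[of "r + of_int k - s"] k r closed_curve_add_int[OF cl(1)] by simp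
    moreover have "w = ?z + of_real (r' + of_int k' - t) * velocity D (j, t)"
      using e(3)[of "r' + of_int k' - t"] k r closed_curve_add_int[OF cl(2)] by simp
    ultimately have "of_real (r + of_int k - s) * velocity D (i, s) = of_real (r' + of_int k' - t) * velocity D (j, t)"
      by (metis add_left_imp_eq)
    from det2_independent(1)[OF _ this] have "r + of_int k - s = 0"
      using crossing_velocity_det[OF D cr] by (simp add: velocity_det_def)
    then have "curve D i (r + of_int k) = curve D i s" by simp
    then show ?thesis using r closed_curve_add_int[OF cl(1)] by simp
  qed
  then have "range (curve D i) \<inter> range (curve D j) \<inter> ball ?z (min a b) \<subseteq> {?z}"
    by (metis IntE dist_commute mem_ball singletonI subsetI)
  moreover have "?z \<in> range (curve D i)" "?z \<in> range (curve D j)" using z rangeI by metis+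
  moreover have "?z \<in> ball ?z (min a b)" using a b by simp
  ultimately have "range (curve D i) \<inter> range (curve D j) \<inter> ball ?z (min a b) = {?z}" by blast
  then show ?thesis using a(1) b(1) that[of "min a b"] by simp
qed

lemma crossing_isolated_param:
  assumes D: "is_diagram D" and cr: "crossing D i s j t"
  obtains \<delta> where "\<delta> > 0"
    "\<And>h. 0 < \<bar>h\<bar> \<Longrightarrow> \<bar>h\<bar> < \<delta> \<Longrightarrow> curve D j (t + h) = curve D i s + of_real h * velocity D (j, t)"
    "\<And>h. 0 < \<bar>h\<bar> \<Longrightarrow> \<bar>h\<bar> < \<delta> \<Longrightarrow> curve D j (t + h) \<notin> range (curve D i)"
proof -
  let ?z = "curve D i s" and ?v = "velocity D (j, t)"
  obtain \<epsilon> where e: "\<epsilon> > 0"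
    "\<And>\<sigma>. \<bar>\<sigma>\<bar> \<le> \<epsilon> \<Longrightarrow> curve D j (t + \<sigma>) = ?z + of_real \<sigma> * ?v"
    by (rule crossing_linear[OF D cr]) (rule that)
  obtain \<rho> where \<rho>: "\<rho> > 0" "range (curve D i) \<inter> range (curve D j) \<inter> ball ?z \<rho> = {?z}"
    using crossing_isolated[OF D cr] by blast
  have v: "?v \<noteq> 0" using crossing_velocity_det[OF D cr] by (auto simp: velocity_det_def)
  define \<delta> where "\<delta> = min \<epsilon> (\<rho> / norm ?v)"
  show ?thesis
  proof (rule that[of \<delta>])
    show "\<delta> > 0" using e \<rho> v by (auto simp: \<delta>_def)
    fix h :: real assume h: "0 < \<bar>h\<bar>" "\<bar>h\<bar> < \<delta>"
    show eq: "curve D j (t + h) = ?z + of_real h * ?v" using e(2)[of h] h by (simp add: \<delta>_def)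
    have "\<bar>h\<bar> < \<rho> / norm ?v" using h by (simp add: \<delta>_def)
    then have "\<bar>h\<bar> * norm ?v < \<rho>" using v by (simp add: field_simps)
    then have "curve D j (t + h) \<in> ball ?z \<rho>" by (simp add: eq dist_norm norm_mult)
    moreover have "curve D j (t + h) \<noteq> ?z" using eq v h by simp
    ultimately show "curve D j (t + h) \<notin> range (curve D i)" using \<rho>(2) by blast
  qed
qed

text \<open>
  An accumulation point of the common points of two components would be a common point that is
  not isolated.
\<close>

lemma finite_mixed_crossings:
  assumes D: "is_diagram D" shows "finite (mixed_crossings D)"
proof -
  have fin: "finite (range (curve D i) \<inter> range (curve D j))"
    if ij: "i < components D" "j < components D" "i \<noteq> j" for i j
  proof (rule ccontr)
    let ?C = "range (curve D i) \<inter> range (curve D j)"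
    assume inf: "infinite ?C"
    have comp: "compact ?C" using ij D
      by (intro compact_Int closed_curve_closed_range is_diagram_closed_curve)
    obtain z where z: "z \<in> ?C" "z islimpt ?C"
      using Heine_Borel_imp_Bolzano_Weierstrass[OF comp inf] by blast
    then obtain s t where "curve D i s = z" "curve D j t = z" by auto
    then have cr: "crossing D i s j t" using ij by (simp add: crossing_def)
    then obtain \<rho> where "\<rho> > 0" "?C \<inter> ball z \<rho> = {z}"
      using crossing_isolated[OF D cr] \<open>curve D i s = z\<close> by metis
    then show False using z(2) unfolding islimpt_approachable
      by (metis IntI dist_commute mem_ball singletonD)
  qed
  have sub: "mixed_crossings D \<subseteq>
      (\<Union>(i, j)\<in>{(i, j). i < components D \<and> j < components D \<and> i \<noteq> j}. range (curve D i) \<inter> range (curve D j))"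
    unfolding mixed_crossings_def crossing_def by fastforce
  have pairs: "finite {(i, j). i < components D \<and> j < components D \<and> i \<noteq> j}"
    by (rule finite_subset[of _ "{..<components D} \<times> {..<components D}"]) auto
  have "finite
      (\<Union>(i, j)\<in>{(i, j). i < components D \<and> j < components D \<and> i \<noteq> j}. range (curve D i) \<inter> range (curve D j))"
    by (rule finite_UN_I[OF pairs]) (simp add: case_prod_beta fin)
  with sub show ?thesis by (rule finite_subset)
qed

text \<open>
  The parameter \<open>t\<close> belongs to the lower strand at a crossing with component
  \<open>i\<close>; the number \<open>k\<close> compares the two sides of component
  \<open>i\<close> next to the crossing.
\<close>

definition square_jump :: "diagram \<Rightarrow> nat \<Rightarrow> nat \<Rightarrow> real \<Rightarrow> real \<Rightarrow> bool" where
  "square_jump D i j t k \<longleftrightarrow>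
     (\<forall>\<^sub>F h in at_right 0. (windno (curve D i) (curve D j (t + h)))\<^sup>2 - (windno (curve D i) (curve D j (t - h)))\<^sup>2 = k)"

text \<open>
  Well defined by \<open>weight_eqI\<close>: at a crossing of a diagram only the two strands of
  the crossing meet, and \<open>upper\<close> singles out one of them.
\<close>

definition weight :: "diagram \<Rightarrow> complex \<Rightarrow> real" where
  "weight D z = (THE k. \<exists>i s j t. crossing D i s j t \<and> curve D i s = z \<and> upper D i s \<and> square_jump D i j t k)"

definition winding_sum :: "diagram \<Rightarrow> real" where
  "winding_sum D = (\<Sum>z\<in>mixed_crossings D. weight D z)"

lemma square_jump_unique: "square_jump D i j t k \<Longrightarrow> square_jump D i j t l \<Longrightarrow> k = l"
proof -
  assume "square_jump D i j t k" "square_jump D i j t l"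
  then have "\<forall>\<^sub>F h in at_right (0::real). k = l" unfolding square_jump_def by eventually_elim simp
  then show "k = l" by simp
qed

lemma square_jump_shift:
  assumes "closed_curve (curve D j)" "r - t \<in> \<int>" "square_jump D i j t k" shows "square_jump D i j r k"
proof -
  have "curve D j (r + h) = curve D j (t + h)" "curve D j (r - h) = curve D j (t - h)" for h
    using assms(2) by (auto intro!: closed_curve_cong_Ints[OF assms(1)])
  then show ?thesis using assms(3) by (simp add: square_jump_def)
qed

lemma weight_eqI:
  assumes D: "is_diagram D" and cr: "crossing D i s j t" and up: "upper D i s" and k: "square_jump D i j t k"
  shows "weight D (curve D i s) = k"
  unfolding weight_def
proof (rule the_equality)
  show "\<exists>i' s' j' t'. crossing D i' s' j' t' \<and> curve D i' s' = curve D i s \<and> upper D i' s' \<and> square_jump D i' j' t' k"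
    using cr up k by blast
  fix l assume "\<exists>i' s' j' t'. crossing D i' s' j' t' \<and> curve D i' s' = curve D i s \<and> upper D i' s' \<and> square_jump D i' j' t' l"
  then obtain i' s' j' t' where l: "crossing D i' s' j' t'" "curve D i' s' = curve D i s" "upper D i' s'"
    "square_jump D i' j' t' l" by blast
  have i': "i' = i"
  proof (rule ccontr)
    assume "i' \<noteq> i"
    then have "crossing D i s i' s'" using l cr by (auto simp: crossing_def)
    from double_point_upper[OF D crossing_double_point[OF this]] show False using up l by simp
  qed
  have "j' \<noteq> i" using l i' by (auto simp: crossing_def)
  then have j': "j' = j \<and> t' - t \<in> \<int>"
    using crossing_params[OF D cr, of j' t'] l by (auto simp: crossing_def)
  have "closed_curve (curve D j)" using D cr by (auto simp: crossing_def intro: is_diagram_closed_curve)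
  then have "square_jump D i j t' k" using square_jump_shift j' k by blast
  then show "l = k" using square_jump_unique l i' j' by blast
qed

lemma square_jumpI:
  assumes D: "is_diagram D" and ij: "i < components D" "j < components D"
    and t: "t1 < t" "t < t2" and off: "\<And>r. t1 \<le> r \<Longrightarrow> r \<le> t2 \<Longrightarrow> r \<noteq> t \<Longrightarrow> curve D j r \<notin> range (curve D i)"
  shows "square_jump D i j t ((windno (curve D i) (curve D j t2))\<^sup>2 - (windno (curve D i) (curve D j t1))\<^sup>2)"
proof -
  have cl: "closed_curve (curve D i)" "continuous_on UNIV (curve D j)"
    using D ij is_diagram_closed_curve by (auto simp: closed_curve_def)
  have "\<forall>\<^sub>F h in at_right 0. h < min (t2 - t) (t - t1)"
    unfolding eventually_at_right_field using t by (intro exI[of _ "min (t2 - t) (t - t1)"]) auto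
  moreover have "\<forall>\<^sub>F h in at_right (0::real). h > 0" by (rule eventually_at_right_less)
  ultimately show ?thesis unfolding square_jump_def
  proof eventually_elim
    case (elim h)
    have "windno (curve D i) (curve D j (t + h)) = windno (curve D i) (curve D j t2)"
      by (rule windno_constant_along[OF cl]) (use elim t off in auto)
    moreover have "windno (curve D i) (curve D j t1) = windno (curve D i) (curve D j (t - h))"
      by (rule windno_constant_along[OF cl]) (use elim t off in auto)
    ultimately show ?case by simp
  qed
qed

text \<open>
  The points next to the crossing may be replaced by any points \<open>t1\<close> and
  \<open>t2\<close> up to which the lower strand does not meet the upper component again.
\<close>

lemma weight_between:
  assumes D: "is_diagram D" and cr: "crossing D i s j t" and up: "upper D i s"
    and t: "t1 < t" "t < t2" and off: "\<And>r. t1 \<le> r \<Longrightarrow> r \<le> t2 \<Longrightarrow> r \<noteq> t \<Longrightarrow> curve D j r \<notin> range (curve D i)"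
  shows "weight D (curve D i s) = (windno (curve D i) (curve D j t2))\<^sup>2 - (windno (curve D i) (curve D j t1))\<^sup>2"
  using weight_eqI[OF D cr up square_jumpI[OF D _ _ t off]] cr by (simp add: crossing_def)

lemma crossing_over_exists:
  assumes D: "is_diagram D" and z: "z \<in> mixed_crossings D"
  obtains i s j t where "crossing D i s j t" "curve D i s = z" "upper D i s"
proof -
  obtain i s j t where c: "crossing D i s j t" "curve D i s = z" using z by (auto simp: mixed_crossings_def)
  have "upper D i s \<noteq> upper D j t" using double_point_upper[OF D crossing_double_point[OF c(1)]] by simp
  then show ?thesis using that[OF c] that[OF crossing_sym[OF c(1)]] c by (auto simp: crossing_def)
qed

text \<open>
  The jump of \<open>winding_number_jump\<close> along a strand \<open>j\<close> of a diagram;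
  the sign records the side from which component \<open>i\<close> is crossed.
\<close>

lemma windno_jump:
  assumes D: "is_diagram D" and cr: "crossing D i s j t"
    and t: "t1 < t" "t < t2" and off: "\<And>r. t1 \<le> r \<Longrightarrow> r \<le> t2 \<Longrightarrow> r \<noteq> t \<Longrightarrow> curve D j r \<notin> range (curve D i)"
  shows "windno (curve D i) (curve D j t2) = windno (curve D i) (curve D j t1) + sgn (velocity_det D (i, s) (j, t))"
proof -
  let ?c = "curve D i" and ?z = "curve D i s" and ?u = "velocity D (i, s)" and ?v = "velocity D (j, t)"
  have cl: "closed_curve ?c" and cj: "continuous_on UNIV (curve D j)"
    using D cr is_diagram_closed_curve by (auto simp: crossing_def closed_curve_def)
  obtain \<delta> where d: "\<delta> > 0"
    "\<And>h. 0 < \<bar>h\<bar> \<Longrightarrow> \<bar>h\<bar> < \<delta> \<Longrightarrow> curve D j (t + h) = ?z + of_real h * ?v"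
    "\<And>h. 0 < \<bar>h\<bar> \<Longrightarrow> \<bar>h\<bar> < \<delta> \<Longrightarrow> curve D j (t + h) \<notin> range ?c"
    using crossing_isolated_param[OF D cr] by blast
  obtain \<epsilon> where e: "\<epsilon> > 0" "\<And>\<sigma>. \<bar>\<sigma>\<bar> \<le> \<epsilon> \<Longrightarrow> ?c (s + \<sigma>) = ?z + of_real \<sigma> * ?u"
    by (rule crossing_linear[OF D cr]) (rule that)
  have inj: "\<And>r. ?c r = ?z \<Longrightarrow> r - s \<in> \<int>"
    using crossing_params[OF D cr] cr by (auto simp: crossing_def)
  have off': "?z + of_real h * ?v \<notin> range ?c" if "0 < \<bar>h\<bar>" "\<bar>h\<bar> < \<delta>" for h
    using d(2,3)[OF that] by simp
  have det: "velocity_det D (i, s) (j, t) = det2 ?u ?v" by (simp add: velocity_det_def)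
  have "\<exists>\<kappa>>0. \<forall>h. 0 < h \<and> h < \<kappa> \<longrightarrow>
     windno ?c (?z + of_real h * ?v) = windno ?c (?z - of_real h * ?v) + sgn (det2 ?u ?v)"
  proof (cases "det2 ?u ?v > 0")
    case True
    obtain \<kappa> where k: "\<kappa> > 0" "\<And>h. 0 < h \<Longrightarrow> h < \<kappa> \<Longrightarrow>
       winding_number ?c (?z + of_real h * ?v) = winding_number ?c (?z - of_real h * ?v) + 1"
      using winding_number_jump[OF cl refl inj e True off' d(1)] by blast
    show ?thesis
    proof (intro exI[of _ \<kappa>] conjI allI impI k(1))
      fix h assume "0 < h \<and> h < \<kappa>"
      then show "windno ?c (?z + of_real h * ?v) = windno ?c (?z - of_real h * ?v) + sgn (det2 ?u ?v)"
        using k(2)[of h] True by (simp add: windno_def)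
    qed
  next
    case False
    then have "det2 ?u ?v < 0" using crossing_velocity_det[OF D cr] det by simp
    then have neg: "det2 ?u (- ?v) > 0" by simp
    have off'': "?z + of_real h * (- ?v) \<notin> range ?c" if "0 < \<bar>h\<bar>" "\<bar>h\<bar> < \<delta>" for h
      using off'[of "-h"] that by simp
    obtain \<kappa> where k: "\<kappa> > 0" "\<And>h. 0 < h \<Longrightarrow> h < \<kappa> \<Longrightarrow>
       winding_number ?c (?z + of_real h * (- ?v)) = winding_number ?c (?z - of_real h * (- ?v)) + 1"
      using winding_number_jump[OF cl refl inj e neg off'' d(1)] by blast
    show ?thesis
    proof (intro exI[of _ \<kappa>] conjI allI impI k(1))
      fix h assume "0 < h \<and> h < \<kappa>"
      then show "windno ?c (?z + of_real h * ?v) = windno ?c (?z - of_real h * ?v) + sgn (det2 ?u ?v)"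
        using k(2)[of h] \<open>det2 ?u ?v < 0\<close> by (simp add: windno_def)
    qed
  qed
  then obtain \<kappa> where k: "\<kappa> > 0" "\<And>h. 0 < h \<Longrightarrow> h < \<kappa> \<Longrightarrow>
     windno ?c (?z + of_real h * ?v) = windno ?c (?z - of_real h * ?v) + sgn (det2 ?u ?v)" by blast
  define h where "h = min (min \<kappa> \<delta>) (min (t2 - t) (t - t1)) / 2"
  have h: "0 < h" "h < \<kappa>" "h < \<delta>" "t + h \<le> t2" "t1 \<le> t - h"
    using k d t unfolding h_def by (auto simp: min_def field_simps)
  have "windno ?c (curve D j (t + h)) = windno ?c (curve D j t2)"
    by (rule windno_constant_along[OF cl cj]) (use h t off in auto)
  moreover have "windno ?c (curve D j t1) = windno ?c (curve D j (t - h))"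
    by (rule windno_constant_along[OF cl cj]) (use h t off in auto)
  moreover have "curve D j (t + h) = ?z + of_real h * ?v" "curve D j (t - h) = ?z - of_real h * ?v"
    using d(2)[of h] d(2)[of "-h"] h by auto
  ultimately show ?thesis using k(2)[OF h(1,2)] det by simp
qed

section \<open>Planar isotopies\<close>

lemma crossing_isolated_interval:
  assumes D: "is_diagram D" and cr: "crossing D i s j t" and \<eta>: "\<eta> > 0"
  obtains t1 t2 where "t1 < t" "t < t2" "t - \<eta> < t1" "t2 < t + \<eta>"
    "\<And>r. t1 \<le> r \<Longrightarrow> r \<le> t2 \<Longrightarrow> r \<noteq> t \<Longrightarrow> curve D j r \<notin> range (curve D i)"
proof -
  obtain \<delta> where d: "\<delta> > 0" "\<And>h. 0 < \<bar>h\<bar> \<Longrightarrow> \<bar>h\<bar> < \<delta> \<Longrightarrow> curve D j (t + h) = curve D i s + of_real h * velocity D (j, t)"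
    "\<And>h. 0 < \<bar>h\<bar> \<Longrightarrow> \<bar>h\<bar> < \<delta> \<Longrightarrow> curve D j (t + h) \<notin> range (curve D i)"
    by (rule crossing_isolated_param[OF D cr]) (rule that)
  define e where "e = min \<delta> \<eta> / 2"
  have e: "0 < e" "e < \<delta>" "e < \<eta>" using d(1) \<eta> by (auto simp: e_def)
  show ?thesis
  proof (rule that[of "t - e" "t + e"])
    fix r assume "t - e \<le> r" "r \<le> t + e" "r \<noteq> t"
    then show "curve D j r \<notin> range (curve D i)" using d(3)[of "r - t"] e by auto
  qed (use e in auto)
qed

lemma reparametrisation_surj:
  assumes f: "reparametrisation f" obtains s where "f s = x"
proof -
  have ft: "f (t + of_nat n) = f t + of_nat n" for t n
  proof (induction n)
    case (Suc n)
    have "f ((t + of_nat n) + 1) = f (t + of_nat n) + 1" using f unfolding reparametrisation_def by blast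
    then show ?case using Suc by (simp add: add.assoc add.commute[of 1])
  qed simp
  obtain n where n: "real n > \<bar>x - f 0\<bar>" using reals_Archimedean2 by blast
  have "f (real n) = f 0 + n" using ft[of 0 n] by simp
  moreover have "f (- real n) = f 0 - n" using ft[of "- real n" n] by simp
  ultimately have "f (- real n) \<le> x" "x \<le> f (real n)" using n by linarith+
  moreover have "continuous_on {- real n..real n} f"
    using f unfolding reparametrisation_def by (meson continuous_on_subset subset_UNIV)
  ultimately obtain s where "f s = x" using IVT'[of f "- real n" x "real n"] by auto
  then show ?thesis by (rule that)
qed

text \<open>
  Winding numbers are carried along by the isotopy and do not depend on the parametrisation, and
  reparametrisations preserve the order in which a strand passes the two sides of a crossing.
\<close>

theorem winding_sum_planar_isotopy:
  assumes D: "is_diagram D" and E: "is_diagram E" and iso: "planar_isotopic D E"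
  shows "winding_sum D = winding_sum E"
proof -
  obtain H \<pi> f where H: "ambient_isotopy H" and pi: "bij_betw \<pi> {..<components D} {..<components E}"
    and f: "\<And>i. i < components D \<Longrightarrow> reparametrisation (f i)"
    and Hf: "\<And>i t. i < components D \<Longrightarrow> H 1 (curve D i t) = curve E (\<pi> i) (f i t)"
    and up: "\<And>i t q. double_point D (i, t) q \<Longrightarrow> upper D i t = upper E (\<pi> i) (f i t)"
    using iso unfolding planar_isotopic_def by blast
  have inj: "H 1 x = H 1 y \<Longrightarrow> x = y" for x y
    using H unfolding ambient_isotopy_def homeomorphism_def by (metis UNIV_I atLeastAtMost_iff order_refl zero_le_one)
  have pi': "\<pi> i < components E" if "i < components D" for i using pi that by (auto simp: bij_betw_def)
  have pinj: "\<pi> i = \<pi> j \<Longrightarrow> i = j" if "i < components D" "j < components D" for i j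
    using pi that by (auto simp: bij_betw_def inj_on_def)
  have rng: "range (curve E (\<pi> i)) = H 1 ` range (curve D i)" if i: "i < components D" for i
  proof -
    have "curve E (\<pi> i) t \<in> H 1 ` range (curve D i)" for t
      using reparametrisation_surj[OF f[OF i], of t] Hf[OF i] by (metis rangeI image_eqI)
    then show ?thesis using Hf[OF i] by fastforce
  qed
  have wind: "windno (curve E (\<pi> i)) (H 1 z) = windno (curve D i) z"
    if i: "i < components D" and z: "z \<notin> range (curve D i)" for i z
  proof -
    have cE: "closed_curve (curve E (\<pi> i))" using is_diagram_closed_curve[OF E pi'[OF i]] .
    have z': "H 1 z \<notin> range (curve E (\<pi> i))" using rng[OF i] z inj by auto
    have fi: "continuous_on UNIV (f i)" "\<And>t. f i (t + 1) = f i t + 1"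
      using f[OF i] by (auto simp: reparametrisation_def)
    have "H 1 \<circ> curve D i = curve E (\<pi> i) \<circ> f i" using Hf[OF i] by auto
    then show ?thesis
      using winding_number_isotopy[OF is_diagram_closed_curve[OF D i] H z]
        winding_number_reparametrisation[OF cE fi z'] by (simp add: windno_def)
  qed
  have cr: "crossing E (\<pi> i) (f i s) (\<pi> j) (f j t) \<longleftrightarrow> crossing D i s j t"
    if "i < components D" "j < components D" for i s j t
    using that pi' pinj inj Hf[OF that(1), of s] Hf[OF that(2), of t] by (auto simp: crossing_def)
  have weight: "weight E (H 1 (curve D i s)) = weight D (curve D i s)"
    if c: "crossing D i s j t" and u: "upper D i s" for i s j t
  proof -
    have ij: "i < components D" "j < components D" using c by (auto simp: crossing_def)
    obtain t1 t2 where t: "t1 < t" "t < t2" "t - 1 < t1" "t2 < t + 1"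
      and off: "\<And>r. t1 \<le> r \<Longrightarrow> r \<le> t2 \<Longrightarrow> r \<noteq> t \<Longrightarrow> curve D j r \<notin> range (curve D i)"
      by (rule crossing_isolated_interval[OF D c zero_less_one]) (rule that)
    have mono: "strict_mono (f j)" using f[OF ij(2)] by (simp add: reparametrisation_def)
    have 1: "weight D (curve D i s) = (windno (curve D i) (curve D j t2))\<^sup>2 - (windno (curve D i) (curve D j t1))\<^sup>2"
      by (rule weight_between[OF D c u t(1,2) off])
    have cE: "crossing E (\<pi> i) (f i s) (\<pi> j) (f j t)" using cr[OF ij] c by simp
    have uE: "upper E (\<pi> i) (f i s)" using up[OF crossing_double_point[OF c]] u by simp
    have 2: "weight E (curve E (\<pi> i) (f i s)) = (windno (curve E (\<pi> i)) (curve E (\<pi> j) (f j t2)))\<^sup>2 -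
       (windno (curve E (\<pi> i)) (curve E (\<pi> j) (f j t1)))\<^sup>2"
    proof (rule weight_between[OF E cE uE])
      show "f j t1 < f j t" "f j t < f j t2" using mono t by (auto simp: strict_mono_less)
      fix r' assume r': "f j t1 \<le> r'" "r' \<le> f j t2" "r' \<noteq> f j t"
      obtain r where r: "f j r = r'" using reparametrisation_surj[OF f[OF ij(2)]] by blast
      then have "t1 \<le> r" "r \<le> t2" "r \<noteq> t" using r' mono by (auto simp: strict_mono_less_eq)
      then have "curve D j r \<notin> range (curve D i)" by (rule off)
      then show "curve E (\<pi> j) r' \<notin> range (curve E (\<pi> i))"
        using rng[OF ij(1)] Hf[OF ij(2), of r] r inj by (metis imageE)
    qed
    have "windno (curve E (\<pi> i)) (curve E (\<pi> j) (f j r)) = windno (curve D i) (curve D j r)"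
      if "r = t1 \<or> r = t2" for r
    proof -
      have "curve D j r \<notin> range (curve D i)" by (rule off) (use that t in auto)
      then show ?thesis using wind[OF ij(1)] Hf[OF ij(2)] by metis
    qed
    then show ?thesis using 1 2 Hf[OF ij(1), of s] by simp
  qed
  have img: "mixed_crossings E = H 1 ` mixed_crossings D"
  proof
    show "mixed_crossings E \<subseteq> H 1 ` mixed_crossings D"
    proof
      fix z assume "z \<in> mixed_crossings E"
      then obtain i' s' j' t' where c: "crossing E i' s' j' t'" "z = curve E i' s'"
        by (auto simp: mixed_crossings_def)
      then have "i' \<in> \<pi> ` {..<components D}" "j' \<in> \<pi> ` {..<components D}"
        using pi by (auto simp: bij_betw_def crossing_def)
      then obtain i j where ij: "i' = \<pi> i" "i < components D" "j' = \<pi> j" "j < components D" by auto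
      obtain s where s: "f i s = s'" using reparametrisation_surj[OF f[OF ij(2)]] by blast
      obtain t where t: "f j t = t'" using reparametrisation_surj[OF f[OF ij(4)]] by blast
      have "crossing D i s j t" using c cr[OF ij(2,4), of s t] ij s t by simp
      then have "curve D i s \<in> mixed_crossings D" by (auto simp: mixed_crossings_def)
      moreover have "z = H 1 (curve D i s)" using c ij s Hf[OF ij(2)] by simp
      ultimately show "z \<in> H 1 ` mixed_crossings D" by blast
    qed
    show "H 1 ` mixed_crossings D \<subseteq> mixed_crossings E"
    proof
      fix z assume "z \<in> H 1 ` mixed_crossings D"
      then obtain i s j t where c: "crossing D i s j t" "z = H 1 (curve D i s)"
        by (auto simp: mixed_crossings_def)
      then have ij: "i < components D" "j < components D" by (auto simp: crossing_def)
      then have "crossing E (\<pi> i) (f i s) (\<pi> j) (f j t)" using cr c by simp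
      then show "z \<in> mixed_crossings E" using c Hf[OF ij(1)] unfolding mixed_crossings_def by auto
    qed
  qed
  have "winding_sum E = (\<Sum>z\<in>mixed_crossings D. weight E (H 1 z))"
    unfolding winding_sum_def img by (subst sum.reindex) (auto simp: inj_on_def dest: inj)
  also have "\<dots> = winding_sum D"
    unfolding winding_sum_def
  proof (rule sum.cong[OF refl])
    fix z assume "z \<in> mixed_crossings D"
    then obtain i s j t where "crossing D i s j t" "curve D i s = z" "upper D i s"
      by (rule crossing_over_exists[OF D])
    then show "weight E (H 1 z) = weight D z" using weight by blast
  qed
  finally show ?thesis by simp
qed

section \<open>Diagrams that agree outside of a disc\<close>

text \<open>
  Besides the curves outside of \<open>B\<close> also the parameters of the parts outside of
  \<open>B\<close> agree, so that strands can be compared without reparametrisation.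
\<close>

definition agree_off :: "complex set \<Rightarrow> diagram \<Rightarrow> diagram \<Rightarrow> bool" where
  "agree_off B D E \<longleftrightarrow> components D = components E \<and>
     (\<forall>i<components D. \<forall>t. curve D i t \<notin> B \<or> curve E i t \<notin> B \<longrightarrow>
        curve D i t = curve E i t \<and> upper D i t = upper E i t)"

lemma agree_off_sym: "agree_off B D E \<Longrightarrow> agree_off B E D"
  unfolding agree_off_def by metis

locale two_diagrams =
  fixes D E :: diagram and B :: "complex set"
  assumes D: "is_diagram D" and E: "is_diagram E" and disc: "B homeomorphic cball (0::complex) 1"
    and agree: "agree_off B D E"
begin

lemma comps: "components E = components D" using agree by (simp add: agree_off_def)

lemma closed_B: "closed B"
  using disc by (meson compact_cball homeomorphic_compactness compact_imp_closed)

lemma curve_agree: "i < components D \<Longrightarrow> curve D i t \<notin> B \<or> curve E i t \<notin> B \<Longrightarrow> curve D i t = curve E i t"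
  using agree by (auto simp: agree_off_def)

lemma range_off: "i < components D \<Longrightarrow> z \<notin> B \<Longrightarrow> z \<in> range (curve D i) \<longleftrightarrow> z \<in> range (curve E i)"
proof
  assume i: "i < components D" and z: "z \<notin> B"
  show "z \<in> range (curve E i)" if a: "z \<in> range (curve D i)"
  proof -
    obtain t where "z = curve D i t" using a by blast
    then have "z = curve E i t" using curve_agree[OF i, of t] z by simp
    then show ?thesis by simp
  qed
  show "z \<in> range (curve D i)" if a: "z \<in> range (curve E i)"
  proof -
    obtain t where "z = curve E i t" using a by blast
    then have "z = curve D i t" using curve_agree[OF i, of t] z by simp
    then show ?thesis by simp
  qed
qed

lemma windno_off:
  assumes i: "i < components D" and z: "z \<notin> B" "z \<notin> range (curve D i)"
  shows "windno (curve D i) z = windno (curve E i) z"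
proof -
  have "winding_number (curve D i) z = winding_number (curve E i) z"
  proof (rule winding_number_eq_off_disc[OF _ _ disc _ z])
    show "closed_curve (curve D i)" "closed_curve (curve E i)"
      using is_diagram_closed_curve D E i comps by auto
    show "curve D i t = curve E i t \<or> curve D i t \<in> B \<and> curve E i t \<in> B" for t
      using curve_agree[OF i] by blast
  qed
  then show ?thesis by (simp add: windno_def)
qed

text \<open>Arbitrarily close to a frontier point there are points outside of the disc.\<close>

lemma windno_frontier:
  assumes i: "i < components D" and z: "z \<in> frontier B" "z \<notin> range (curve D i)" "z \<notin> range (curve E i)"
  shows "windno (curve D i) z = windno (curve E i) z"
proof -
  have cl: "closed_curve (curve D i)" "closed_curve (curve E i)"
    using is_diagram_closed_curve D E i comps by auto
  then have "open (- (range (curve D i) \<union> range (curve E i)))"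
    using closed_curve_closed_range(1) by (metis closed_Un open_Compl)
  moreover have "z \<in> - (range (curve D i) \<union> range (curve E i))" using z by simp
  ultimately obtain \<rho> where \<rho>: "\<rho> > 0" "ball z \<rho> \<subseteq> - (range (curve D i) \<union> range (curve E i))"
    by (meson open_contains_ball_eq)
  have "z \<in> closure (- B)" using z(1) by (simp add: frontier_closures)
  then obtain w where w: "w \<in> - B" "dist w z < \<rho>" using \<rho>(1) unfolding closure_approachable by blast
  have wb: "w \<in> ball z \<rho>" using w by (simp add: dist_commute)
  have zb: "z \<in> ball z \<rho>" using \<rho> by simp
  have "windno (curve D i) z = windno (curve D i) w"
    by (rule windno_constant[OF cl(1) connected_ball _ zb wb]) (use \<rho>(2) in blast)
  also have "\<dots> = windno (curve E i) w"
    by (rule windno_off[OF i]) (use w wb \<rho>(2) in blast)+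
  also have "\<dots> = windno (curve E i) z"
    by (rule windno_constant[OF cl(2) connected_ball _ wb zb]) (use \<rho>(2) in blast)
  finally show ?thesis .
qed

lemma crossing_off:
  assumes c: "crossing D i s j t" and z: "curve D i s \<notin> B"
  shows "crossing E i s j t" "curve E i s = curve D i s"
  using c z curve_agree[of i s] curve_agree[of j t] comps by (auto simp: crossing_def)

lemma weight_off:
  assumes z: "z \<in> mixed_crossings D" "z \<notin> B"
  shows "weight E z = weight D z"
proof -
  obtain i s j t where c: "crossing D i s j t" "curve D i s = z" "upper D i s"
    by (rule crossing_over_exists[OF D z(1)])
  have ij: "i < components D" "j < components D" "curve D j t = z" using c by (auto simp: crossing_def)
  have "continuous_on UNIV (curve D j)" using is_diagram_closed_curve[OF D ij(2)] by (simp add: closed_curve_def)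
  then have "isCont (curve D j) t" by (simp add: continuous_on_eq_continuous_at)
  moreover have "open (- B)" "curve D j t \<in> - B" using closed_B z ij by auto
  ultimately have "\<forall>\<^sub>F r in at t. curve D j r \<in> - B"
    using topological_tendstoD unfolding isCont_def by blast
  then obtain \<eta> where \<eta>: "\<eta> > 0" "\<And>r. r \<noteq> t \<Longrightarrow> dist r t < \<eta> \<Longrightarrow> curve D j r \<notin> B"
    unfolding eventually_at by auto
  obtain t1 t2 where t: "t1 < t" "t < t2" "t - \<eta> < t1" "t2 < t + \<eta>"
    and off: "\<And>r. t1 \<le> r \<Longrightarrow> r \<le> t2 \<Longrightarrow> r \<noteq> t \<Longrightarrow> curve D j r \<notin> range (curve D i)"
    by (rule crossing_isolated_interval[OF D c(1) \<eta>(1)]) (rule that)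
  have offB: "curve D j r \<notin> B" if "t1 \<le> r" "r \<le> t2" for r
    using \<eta>(2)[of r] that t z ij by (cases "r = t") (auto simp: dist_real_def)
  have same: "curve E j r = curve D j r" if "t1 \<le> r" "r \<le> t2" for r
    using offB[OF that] curve_agree[OF ij(2)] by metis
  have zB: "curve D i s \<notin> B" using c z by simp
  have cE: "crossing E i s j t" "curve E i s = z" using crossing_off[OF c(1) zB] c by auto
  have uE: "upper E i s" using agree ij(1) zB c(3) by (auto simp: agree_off_def)
  have "weight D (curve D i s) = (windno (curve D i) (curve D j t2))\<^sup>2 - (windno (curve D i) (curve D j t1))\<^sup>2"
    by (rule weight_between[OF D c(1,3) t(1,2) off])
  moreover have "weight E (curve E i s) = (windno (curve E i) (curve E j t2))\<^sup>2 - (windno (curve E i) (curve E j t1))\<^sup>2"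
  proof (rule weight_between[OF E cE(1) uE t(1,2)])
    fix r assume "t1 \<le> r" "r \<le> t2" "r \<noteq> t"
    then show "curve E j r \<notin> range (curve E i)"
      using off[of r] same[of r] offB[of r] range_off[OF ij(1)] by metis
  qed
  moreover have "windno (curve D i) (curve D j r) = windno (curve E i) (curve E j r)" if "r = t1 \<or> r = t2" for r
  proof -
    have r: "t1 \<le> r" "r \<le> t2" "r \<noteq> t" using that t by auto
    have "curve D j r \<notin> B" "curve D j r \<notin> range (curve D i)" "curve E j r = curve D j r"
      using offB[OF r(1,2)] off[OF r] same[OF r(1,2)] .
    then show ?thesis using windno_off[OF ij(1)] by simp
  qed
  ultimately show ?thesis using c cE by simp
qed

lemma mixed_crossings_off: "mixed_crossings D - B \<subseteq> mixed_crossings E - B"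
proof
  fix z assume z: "z \<in> mixed_crossings D - B"
  then obtain i s j t where c: "crossing D i s j t" "z = curve D i s" by (auto simp: mixed_crossings_def)
  then have "crossing E i s j t" "curve E i s = z" using crossing_off z by auto
  then show "z \<in> mixed_crossings E - B" using z by (auto simp: mixed_crossings_def)
qed

end

lemma two_diagrams_sym: "two_diagrams D E B \<Longrightarrow> two_diagrams E D B"
  unfolding two_diagrams_def by (auto dest: agree_off_sym)

text \<open>Crossings outside of the disc have the same weight in both diagrams.\<close>

lemma (in two_diagrams) winding_sum_diff:
  "winding_sum E - winding_sum D =
     (\<Sum>z\<in>mixed_crossings E \<inter> B. weight E z) - (\<Sum>z\<in>mixed_crossings D \<inter> B. weight D z)"
proof -
  interpret sym: two_diagrams E D B by (rule two_diagrams_sym) unfold_locales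
  have eq: "mixed_crossings E - B = mixed_crossings D - B"
    using mixed_crossings_off sym.mixed_crossings_off by blast
  have "winding_sum F = (\<Sum>z\<in>mixed_crossings F \<inter> B. weight F z) + (\<Sum>z\<in>mixed_crossings F - B. weight F z)"
    if "is_diagram F" for F
    unfolding winding_sum_def
    using sum.Int_Diff[OF finite_mixed_crossings[OF that], of "weight F" B] .
  moreover have "(\<Sum>z\<in>mixed_crossings E - B. weight E z) = (\<Sum>z\<in>mixed_crossings D - B. weight D z)"
    unfolding eq by (rule sum.cong) (auto simp: weight_off)
  ultimately show ?thesis using D E by simp
qed

text \<open>
  Weights telescope: between the two crossings the lower strand stays in one component of the
  complement of the upper curve.
\<close>

lemma weight_two_overcrossings:
  assumes F: "is_diagram F" and c1: "crossing F i s1 j t1" "upper F i s1"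
    and c2: "crossing F i s2 j t2" "upper F i s2"
    and t: "c < t1" "t1 < t2" "t2 < d"
    and off: "\<And>r. c \<le> r \<Longrightarrow> r \<le> d \<Longrightarrow> r \<noteq> t1 \<Longrightarrow> r \<noteq> t2 \<Longrightarrow> curve F j r \<notin> range (curve F i)"
  shows "weight F (curve F i s1) + weight F (curve F i s2) =
     (windno (curve F i) (curve F j d))\<^sup>2 - (windno (curve F i) (curve F j c))\<^sup>2"
proof -
  let ?m = "(t1 + t2) / 2"
  have "weight F (curve F i s1) = (windno (curve F i) (curve F j ?m))\<^sup>2 - (windno (curve F i) (curve F j c))\<^sup>2"
    by (rule weight_between[OF F c1]) (use t off in auto)
  moreover have "weight F (curve F i s2) = (windno (curve F i) (curve F j d))\<^sup>2 - (windno (curve F i) (curve F j ?m))\<^sup>2"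
    by (rule weight_between[OF F c2]) (use t off in auto)
  ultimately show ?thesis by simp
qed

section \<open>Curls and bigons\<close>

lemma tangle_strand:
  assumes "tangle D B S" "(i, a, b) \<in> S"
  shows "i < components D" "a < b" "b < a + 1" "curve D i a \<in> frontier B" "curve D i b \<in> frontier B"
    "\<And>t. a < t \<Longrightarrow> t < b \<Longrightarrow> curve D i t \<in> interior B"
  using assms unfolding tangle_def by (auto dest!: bspec[of S])

lemma tangle_cover:
  assumes "tangle D B S" "i < components D" "curve D i t \<in> B"
  obtains a b s where "(i, a, b) \<in> S" "a \<le> s" "s \<le> b" "s - t \<in> \<int>"
proof -
  have "\<exists>x\<in>S. \<exists>p\<in>strand_points x. same_point p (i, t)" using assms unfolding tangle_def by blast
  then obtain x p where x: "x \<in> S" "p \<in> strand_points x" "same_point p (i, t)" by blast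
  obtain k a b where "x = (k, a, b)" by (cases x) auto
  then show ?thesis using x that by (auto simp: same_point_def)
qed

lemma frontier_not_interior: "z \<in> frontier B \<Longrightarrow> z \<notin> interior B"
  by (simp add: frontier_def)

text \<open>The set \<open>B\<close> is the disc of a local change, fixed once and for all.\<close>

locale local_move =
  fixes D E :: diagram and S :: "strand set" and B :: "complex set"
  assumes dD: "is_diagram D" and dE: "is_diagram E" and comp: "components D = components E"
    and tD: "tangle D B S" and tE: "tangle E B S"
    and outside: "\<And>i t. i < components D \<Longrightarrow>
      \<not> (\<exists>(j, a, b)\<in>S. \<exists>s\<in>{a<..<b}. same_point (j, s) (i, t)) \<Longrightarrow>
      curve E i t = curve D i t \<and> upper E i t = upper D i t"

lemma local_change_local_move:
  assumes "local_change D E S" obtains B where "local_move D E S B"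
  using assms unfolding local_change_def local_move_def by blast

lemma local_move_sym: "local_move D E S B \<Longrightarrow> local_move E D S B"
  unfolding local_move_def by simp

context local_move
begin

lemma same_or_inside:
  assumes i: "i < components D"
  shows "curve E i t = curve D i t \<and> upper E i t = upper D i t \<or> curve D i t \<in> B \<and> curve E i t \<in> B"
proof (cases "\<exists>(j, a, b)\<in>S. \<exists>s\<in>{a<..<b}. same_point (j, s) (i, t)")
  case True
  then obtain a b s where x: "(i, a, b) \<in> S" "a < s" "s < b" "s - t \<in> \<int>" by (auto simp: same_point_def)
  have "curve D i s \<in> interior B" "curve E i s \<in> interior B"
    using tangle_strand(6)[OF tD x(1-3)] tangle_strand(6)[OF tE x(1-3)] by auto
  moreover have "closed_curve (curve D i)" "closed_curve (curve E i)"
    using dD dE i comp is_diagram_closed_curve by auto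
  then have "curve D i s = curve D i t" "curve E i s = curve E i t"
    using x(4) closed_curve_cong_Ints by blast+
  ultimately show ?thesis using interior_subset by auto
qed (use outside[OF i] in blast)

lemma agree_off: "agree_off B D E"
  unfolding agree_off_def using same_or_inside comp by metis

sublocale two_diagrams D E B
  using dD dE tD agree_off by unfold_locales (auto simp: tangle_def)

text \<open>
  The two diagrams differ at most along the open strands, and these do not contain ends of
  strands.
\<close>

lemma strand_end_same:
  assumes x: "(i, a, b) \<in> S" and e: "e = a \<or> e = b"
  shows "curve E i e = curve D i e"
proof -
  have fr: "curve D i e \<in> frontier B" and i: "i < components D"
    using tangle_strand[OF tD x] e by auto
  show ?thesis
  proof (rule conjunct1[OF outside[OF i]], rule notI)
    assume "\<exists>(j, a, b)\<in>S. \<exists>s\<in>{a<..<b}. same_point (j, s) (i, e)"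
    then obtain a' b' s where y: "(i, a', b') \<in> S" "a' < s" "s < b'" "s - e \<in> \<int>" by (auto simp: same_point_def)
    have "curve D i s \<in> interior B" using tangle_strand(6)[OF tD y(1-3)] .
    moreover have "curve D i s = curve D i e"
      by (rule closed_curve_cong_Ints[OF is_diagram_closed_curve[OF dD i] y(4)])
    ultimately show False using frontier_not_interior[OF fr] by simp
  qed
qed

text \<open>
  Strands meet the frontier of the disc only in their ends, and these do not move. So an
  intersection on the frontier survives the change.
\<close>

lemma frontier_intersection:
  assumes x: "(i, a, b) \<in> S" and y: "(j, c, d) \<in> S" and e: "e = c \<or> e = d"
    and s: "a \<le> s" "s \<le> b" "curve D i s = curve D j e"
  shows "(s, e) \<in> intersections E (i, a, b) (j, c, d)"
proof -
  have fr: "curve D j e \<in> frontier B" using tangle_strand[OF tD y] e by auto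
  have "s = a \<or> s = b"
    using tangle_strand(6)[OF tD x, of s] s frontier_not_interior[OF fr] by force
  then have "curve E i s = curve E j e"
    using strand_end_same[OF x] strand_end_same[OF y] e s by metis
  then show ?thesis using s e tangle_strand(2)[OF tD y] by auto
qed

lemma crossing_in_strands:
  assumes c: "crossing D i s j t" and z: "curve D i s \<in> B"
  obtains a b s' c d t' where "(i, a, b) \<in> S" "(j, c, d) \<in> S" "s' - s \<in> \<int>" "t' - t \<in> \<int>"
    "(s', t') \<in> intersections D (i, a, b) (j, c, d)" "crossing D i s' j t'" "curve D i s' = curve D i s"
proof -
  have ij: "i < components D" "j < components D" "curve D i s = curve D j t" using c by (auto simp: crossing_def)
  obtain a b s' where x: "(i, a, b) \<in> S" "a \<le> s'" "s' \<le> b" "s' - s \<in> \<int>"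
    using tangle_cover[OF tD ij(1) z] by blast
  have z': "curve D j t \<in> B" using z ij by simp
  obtain c d t' where y: "(j, c, d) \<in> S" "c \<le> t'" "t' \<le> d" "t' - t \<in> \<int>"
    using tangle_cover[OF tD ij(2) z'] by blast
  have "curve D i s' = curve D i s"
    by (rule closed_curve_cong_Ints[OF is_diagram_closed_curve[OF dD ij(1)] x(4)])
  moreover have "curve D j t' = curve D j t"
    by (rule closed_curve_cong_Ints[OF is_diagram_closed_curve[OF dD ij(2)] y(4)])
  ultimately show ?thesis using that[OF x(1) y(1) x(4) y(4)] x y ij c by (auto simp: crossing_def)
qed

lemma one_component:
  assumes "\<And>x y. x \<in> S \<Longrightarrow> y \<in> S \<Longrightarrow> fst x = fst y"
  shows "mixed_crossings D \<inter> B = {}"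
proof (rule ccontr)
  assume "mixed_crossings D \<inter> B \<noteq> {}"
  then obtain i s j t where c: "crossing D i s j t" "curve D i s \<in> B" by (auto simp: mixed_crossings_def)
  obtain a b s' c' d t' where "(i, a, b) \<in> S" "(j, c', d) \<in> S" by (rule crossing_in_strands[OF c])
  then have "i = j" using assms by fastforce
  then show False using c by (simp add: crossing_def)
qed

end

text \<open>
  If all strands of the disc belong to one component, then no crossing in the disc counts.
\<close>

lemma (in local_move) one_component_winding_sum:
  assumes "\<And>x y. x \<in> S \<Longrightarrow> y \<in> S \<Longrightarrow> fst x = fst y"
  shows "winding_sum D = winding_sum E"
proof -
  interpret sym: local_move E D S B by (rule local_move_sym) unfold_locales
  show ?thesis using winding_sum_diff one_component[OF assms] sym.one_component[OF assms] by simp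
qed

theorem winding_sum_creates_curl:
  assumes "creates_curl pos over_first D E" shows "winding_sum D = winding_sum E"
proof -
  obtain i a b where "local_change D E {(i, a, b)}" using assms unfolding creates_curl_def by blast
  then obtain B where "local_move D E {(i, a, b)} B" by (rule local_change_local_move)
  then interpret local_move D E "{(i, a, b)}" B .
  show ?thesis by (rule one_component_winding_sum) simp
qed

text \<open>
  The two new crossings lie on the same lower strand, and the upper component is the same. So
  their weights telescope to a difference of squares of winding numbers at the two ends of the
  lower strand. These ends lie on the frontier, where the winding numbers are those before the
  move; and before the move the strand did not meet the upper component at all.
\<close>

theorem winding_sum_creates_bigon:
  assumes "creates_bigon par pos D E" shows "winding_sum D = winding_sum E"
proof -
  obtain i a b j c d s1 t1 s2 t2 where lc: "local_change D E {(i, a, b), (j, c, d)}"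
    and selfi: "self_intersections E (i, a, b) = {}" and selfj: "self_intersections E (j, c, d) = {}"
    and iD: "intersections D (i, a, b) (j, c, d) = {}"
    and iE: "intersections E (i, a, b) (j, c, d) = {(s1, t1), (s2, t2)}"
    and s: "s1 < s2" and up: "upper E i s1" "upper E i s2"
    using assms unfolding creates_bigon_def by blast
  let ?S = "{(i, a, b), (j, c, d)}"
  obtain B where "local_move D E ?S B" using lc by (rule local_change_local_move)
  then interpret local_move D E ?S B .
  interpret sym: local_move E D ?S B by (rule local_move_sym) unfold_locales
  show ?thesis
  proof (cases "i = j")
    case True
    show ?thesis by (rule one_component_winding_sum) (use True in auto)
  next
    case False
    have x: "(i, a, b) \<in> ?S" and y: "(j, c, d) \<in> ?S" by auto
    have ij: "i < components D" "j < components D" "i < components E" "j < components E"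
      using tangle_strand(1)[OF tD x] tangle_strand(1)[OF tD y] comp by auto
    have cd: "c < d" using tangle_strand(2)[OF tD y] .
    have st: "a \<le> s1" "s1 \<le> b" "a \<le> s2" "s2 \<le> b" "c \<le> t1" "t1 \<le> d" "c \<le> t2" "t2 \<le> d"
      "curve E i s1 = curve E j t1" "curve E i s2 = curve E j t2"
      using iE by (auto simp: set_eq_iff)
    have iD': "(q, r) \<notin> intersections D (i, a, b) (j, c, d)" for q r unfolding iD by simp
    have iE': "q = s1 \<and> r = t1 \<or> q = s2 \<and> r = t2" if "(q, r) \<in> intersections E (i, a, b) (j, c, d)" for q r
      using that unfolding iE by auto
    have z12: "curve E i s1 \<noteq> curve E i s2"
    proof
      assume "curve E i s1 = curve E i s2"
      then have "(s1, s2) \<in> self_intersections E (i, a, b)" using s st by simp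
      then show False unfolding selfi by simp
    qed
    then have t12: "t1 \<noteq> t2" using st by auto
    \<comment> \<open>The strand \<open>j\<close> meets the component \<open>i\<close> only in the new crossings.\<close>
    have D_off: "curve D j r \<notin> range (curve D i)" if r: "c \<le> r" "r \<le> d" for r
    proof
      assume "curve D j r \<in> range (curve D i)"
      then obtain q where q: "curve D i q = curve D j r" by (metis imageE)
      have "curve D j r \<in> B"
      proof -
        have "curve D j c \<in> B" "curve D j d \<in> B"
          using tangle_strand(4,5)[OF tD y] closed_B by (auto simp: frontier_def)
        moreover have "curve D j r \<in> B" if "c < r" "r < d"
          using tangle_strand(6)[OF tD y that] interior_subset by blast
        ultimately show ?thesis using r by (metis order_le_less)
      qed
      then have "curve D i q \<in> B" using q by simp
      then obtain a' b' q' where q': "(i, a', b') \<in> ?S" "a' \<le> q'" "q' \<le> b'" "q' - q \<in> \<int>"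
        using tangle_cover[OF tD ij(1)] by blast
      then have "a' = a" "b' = b" using False by auto
      moreover have "curve D i q' = curve D i q"
        by (rule closed_curve_cong_Ints[OF is_diagram_closed_curve[OF dD ij(1)] q'(4)])
      ultimately have "(q', r) \<in> intersections D (i, a, b) (j, c, d)" using q q' r by auto
      then show False using iD' by blast
    qed
    have E_on: "r = t1 \<or> r = t2" if r: "c \<le> r" "r \<le> d" "curve E j r \<in> range (curve E i)" for r
    proof -
      obtain q where q: "curve E i q = curve E j r" using r(3) by (metis imageE)
      have "curve E j r \<in> B"
      proof -
        have "curve E j c \<in> B" "curve E j d \<in> B"
          using tangle_strand(4,5)[OF tE y] closed_B by (auto simp: frontier_def)
        moreover have "curve E j r \<in> B" if "c < r" "r < d"
          using tangle_strand(6)[OF tE y that] interior_subset by blast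
        ultimately show ?thesis using r by (metis order_le_less)
      qed
      then have "curve E i q \<in> B" using q by simp
      then obtain a' b' q' where q': "(i, a', b') \<in> ?S" "a' \<le> q'" "q' \<le> b'" "q' - q \<in> \<int>"
        using tangle_cover[OF tE ij(3)] by blast
      then have "a' = a" "b' = b" using False by auto
      moreover have "curve E i q' = curve E i q"
        by (rule closed_curve_cong_Ints[OF is_diagram_closed_curve[OF dE ij(3)] q'(4)])
      ultimately have "(q', r) \<in> intersections E (i, a, b) (j, c, d)" using q q' r by auto
      then show ?thesis using iE' by blast
    qed
    have ends: "t \<noteq> c" "t \<noteq> d" if "t = t1 \<or> t = t2" for t
    proof -
      have "(s1, t1) \<in> intersections D (i, a, b) (j, c, d)" if "t1 = c \<or> t1 = d"
        using sym.frontier_intersection[OF x y that st(1,2)] st by simp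
      moreover have "(s2, t2) \<in> intersections D (i, a, b) (j, c, d)" if "t2 = c \<or> t2 = d"
        using sym.frontier_intersection[OF x y that st(3,4)] st by simp
      ultimately show "t \<noteq> c" "t \<noteq> d" using iD' that by blast+
    qed
    have inner: "c < t1" "t1 < d" "c < t2" "t2 < d" using ends[of t1] ends[of t2] st by auto
    have cr: "crossing E i s1 j t1" "crossing E i s2 j t2" using ij False st by (auto simp: crossing_def)
    have mD: "mixed_crossings D \<inter> B = {}"
    proof (rule ccontr)
      assume "mixed_crossings D \<inter> B \<noteq> {}"
      then obtain k q l r where c: "crossing D k q l r" "curve D k q \<in> B" by (auto simp: mixed_crossings_def)
      have "\<exists>q' r'. (q', r') \<in> intersections D (i, a, b) (j, c, d)"
      proof -
        obtain a' b' q' c' d' r' where u: "(k, a', b') \<in> ?S" "(l, c', d') \<in> ?S"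
          "(q', r') \<in> intersections D (k, a', b') (l, c', d')" "crossing D k q' l r'"
          by (rule crossing_in_strands[OF c])
        then have "k \<noteq> l" by (simp add: crossing_def)
        then consider "(k, a', b') = (i, a, b)" "(l, c', d') = (j, c, d)" | "(k, a', b') = (j, c, d)" "(l, c', d') = (i, a, b)"
          using u(1,2) by auto
        then show ?thesis
        proof cases
          case 1 then show ?thesis using u(3) by blast
        next
          case 2
          then have "(r', q') \<in> intersections D (i, a, b) (j, c, d)" using u(3) by auto
          then show ?thesis by blast
        qed
      qed
      then show False using iD' by blast
    qed
    have mE: "mixed_crossings E \<inter> B = {curve E i s1, curve E i s2}"
    proof
      show "mixed_crossings E \<inter> B \<subseteq> {curve E i s1, curve E i s2}"
      proof
        fix z assume "z \<in> mixed_crossings E \<inter> B"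
        then obtain k q l r where c: "crossing E k q l r" "curve E k q \<in> B" "z = curve E k q" by (auto simp: mixed_crossings_def)
        obtain a' b' q' c' d' r' where u: "(k, a', b') \<in> ?S" "(l, c', d') \<in> ?S"
          "(q', r') \<in> intersections E (k, a', b') (l, c', d')" "crossing E k q' l r'" "curve E k q' = curve E k q"
          by (rule sym.crossing_in_strands[OF c(1,2)])
        then have "k \<noteq> l" by (simp add: crossing_def)
        then consider "(k, a', b') = (i, a, b)" "(l, c', d') = (j, c, d)" | "(k, a', b') = (j, c, d)" "(l, c', d') = (i, a, b)"
          using u(1,2) by auto
        then show "z \<in> {curve E i s1, curve E i s2}"
        proof cases
          case 1
          then have "q' = s1 \<or> q' = s2" using u(3) iE'[of q' r'] by blast
          then show ?thesis using 1 u(5) c(3) by auto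
        next
          case 2
          then have "(r', q') \<in> intersections E (i, a, b) (j, c, d)" using u(3) by auto
          then have "r' = s1 \<or> r' = s2" using iE' by blast
          moreover have "curve E k q' = curve E l r'" using u(4) by (simp add: crossing_def)
          ultimately show ?thesis using 2 u(5) c(3) by auto
        qed
      qed
      have "curve E j t1 \<in> B" "curve E j t2 \<in> B"
        using tangle_strand(6)[OF tE y] inner interior_subset by blast+
      moreover have "curve E i s1 \<in> mixed_crossings E" "curve E i s2 \<in> mixed_crossings E"
        unfolding mixed_crossings_def using cr by blast+
      ultimately show "{curve E i s1, curve E i s2} \<subseteq> mixed_crossings E \<inter> B"
        using st(9,10) by simp
    qed
    have cE: "curve E j c \<notin> range (curve E i)" "curve E j d \<notin> range (curve E i)"
      using E_on[of c] E_on[of d] ends[of t1] ends[of t2] cd by auto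
    have cDE: "curve E j c = curve D j c" "curve E j d = curve D j d" using strand_end_same[OF y] by auto
    have fr: "curve D j c \<in> frontier B" "curve D j d \<in> frontier B" using tangle_strand[OF tD y] by auto
    have Wc: "windno (curve D i) (curve D j c) = windno (curve E i) (curve E j c)"
      using windno_frontier[OF ij(1) fr(1)] D_off[of c] cE cDE cd by simp
    have Wd: "windno (curve D i) (curve D j d) = windno (curve E i) (curve E j d)"
      using windno_frontier[OF ij(1) fr(2)] D_off[of d] cE cDE cd by simp
    have "closed_curve (curve D i)" "continuous_on UNIV (curve D j)"
      using is_diagram_closed_curve[OF dD] ij by (auto simp: closed_curve_def)
    then have Wcd: "windno (curve D i) (curve D j c) = windno (curve D i) (curve D j d)"
      by (rule windno_constant_along) (use D_off cd in auto)
    have "weight E (curve E i s1) + weight E (curve E i s2) =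
      (windno (curve E i) (curve E j d))\<^sup>2 - (windno (curve E i) (curve E j c))\<^sup>2"
    proof (cases "t1 < t2")
      case True
      show ?thesis
        by (rule weight_two_overcrossings[OF dE cr(1) up(1) cr(2) up(2) inner(1) True inner(4)]) (use E_on in blast)
    next
      case False
      then have "t2 < t1" using t12 by simp
      then have "weight E (curve E i s2) + weight E (curve E i s1) =
        (windno (curve E i) (curve E j d))\<^sup>2 - (windno (curve E i) (curve E j c))\<^sup>2"
        by (rule weight_two_overcrossings[OF dE cr(2) up(2) cr(1) up(1) inner(3) _ inner(2)]) (use E_on in blast)
      then show ?thesis by simp
    qed
    then have "weight E (curve E i s1) + weight E (curve E i s2) = 0" using Wc Wd Wcd by simp
    then show ?thesis using winding_sum_diff mD mE z12 by simp
  qed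
qed

section \<open>Triangle moves\<close>

text \<open>One side of a triangle move: three strands in a disc that pairwise cross once.\<close>

locale disc_triangle =
  fixes F :: diagram and B :: "complex set" and hi mid lo :: strand
  assumes dF: "is_diagram F" and tF: "tangle F B {hi, mid, lo}" and tri: "triangle F hi mid lo"
begin

abbreviation S where "S \<equiv> {hi, mid, lo}"

abbreviation par where "par \<equiv> param_at F"

abbreviation pt where "pt x y \<equiv> curve F (fst x) (par x y)"

abbreviation left_end :: "strand \<Rightarrow> real" where "left_end x \<equiv> fst (snd x)"

abbreviation right_end :: "strand \<Rightarrow> real" where "right_end x \<equiv> snd (snd x)"

lemma strand:
  assumes "x \<in> S"
  shows "fst x < components F" "left_end x < right_end x"
    "curve F (fst x) (left_end x) \<in> frontier B" "curve F (fst x) (right_end x) \<in> frontier B"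
    "\<And>t. left_end x < t \<Longrightarrow> t < right_end x \<Longrightarrow> curve F (fst x) t \<in> interior B"
  using tangle_strand[OF tF, of "fst x" "left_end x" "right_end x"] assms by (simp_all only: prod.collapse)

lemma closed_disc: "closed B"
  using tF unfolding tangle_def by (meson compact_cball homeomorphic_compactness compact_imp_closed)

lemma strand_in_disc:
  assumes "x \<in> S" "left_end x \<le> t" "t \<le> right_end x" shows "curve F (fst x) t \<in> B"
proof -
  have "curve F (fst x) (left_end x) \<in> B" "curve F (fst x) (right_end x) \<in> B"
    using strand(3,4)[OF assms(1)] closed_disc by (auto simp: frontier_def)
  moreover have "curve F (fst x) t \<in> B" if "left_end x < t" "t < right_end x"
    using strand(5)[OF assms(1) that] interior_subset by blast
  ultimately show ?thesis using assms by (metis order_le_less)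
qed

lemma mem_intersections:
  "(s, t) \<in> intersections F x y \<longleftrightarrow> left_end x \<le> s \<and> s \<le> right_end x \<and> left_end y \<le> t \<and> t \<le> right_end y \<and>
     curve F (fst x) s = curve F (fst y) t"
  by (cases x; cases y) auto

lemma intersections_swap: "(s, t) \<in> intersections F x y \<longleftrightarrow> (t, s) \<in> intersections F y x"
  by (auto simp: mem_intersections)

lemma param_at_eq:
  assumes "intersections F x y = {(s, t)}" shows "par x y = s" "par y x = t"
proof -
  show "par x y = s" unfolding param_at_def using assms by (auto intro!: the_equality)
  have "(s', t') \<in> intersections F y x \<longleftrightarrow> s' = t \<and> t' = s" for s' t'
    using intersections_swap[of t' s' x y] assms by auto
  then show "par y x = t" unfolding param_at_def by (auto intro!: the_equality)
qed

lemma passes_over: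
  assumes "(x, y) \<in> {(hi, mid), (hi, lo), (mid, lo)}"
  shows "intersections F x y = {(par x y, par y x)}" "upper F (fst x) (par x y)"
proof -
  have "passes_over_once F x y" using tri assms by (auto simp: triangle_def)
  then obtain s t where "intersections F x y = {(s, t)}" "upper F (fst x) s" by (auto simp: passes_over_once_def)
  then show "intersections F x y = {(par x y, par y x)}" "upper F (fst x) (par x y)"
    using param_at_eq by auto
qed

lemma intersection_iff:
  assumes "x \<in> S" "y \<in> S" "x \<noteq> y"
  shows "(s, t) \<in> intersections F x y \<longleftrightarrow> s = par x y \<and> t = par y x"
proof -
  have "(x, y) \<in> {(hi, mid), (hi, lo), (mid, lo)} \<or> (y, x) \<in> {(hi, mid), (hi, lo), (mid, lo)}"
    using assms by auto
  then show ?thesis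
  proof
    assume "(x, y) \<in> {(hi, mid), (hi, lo), (mid, lo)}"
    from passes_over(1)[OF this] show ?thesis by simp
  next
    assume "(y, x) \<in> {(hi, mid), (hi, lo), (mid, lo)}"
    from passes_over(1)[OF this] show ?thesis using intersections_swap[of s t x y] by auto
  qed
qed

lemma distinct_strands: "hi \<noteq> mid" "hi \<noteq> lo" "mid \<noteq> lo"
proof -
  have ne: "x \<noteq> y" if p: "(x, y) \<in> {(hi, mid), (hi, lo), (mid, lo)}" for x y
  proof
    assume e: "x = y"
    have x: "x \<in> S" using p by auto
    have "(left_end x, left_end x) \<in> intersections F x y" "(right_end x, right_end x) \<in> intersections F x y"
      using strand(2)[OF x] e by (auto simp: mem_intersections)
    then have "left_end x = right_end x" using passes_over(1)[OF p] by auto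
    then show False using strand(2)[OF x] by simp
  qed
  show "hi \<noteq> mid" "hi \<noteq> lo" "mid \<noteq> lo" by (rule ne; simp)+
qed

lemma pt:
  assumes "x \<in> S" "y \<in> S" "x \<noteq> y"
  shows "pt x y = pt y x" "left_end x \<le> par x y" "par x y \<le> right_end x"
  using intersection_iff[OF assms, of "par x y" "par y x"] by (auto simp: mem_intersections)

lemma strands_disjoint:
  assumes "x \<in> S" "y \<in> S" "x \<noteq> y" "left_end x \<le> s" "s \<le> right_end x" "left_end y \<le> t" "t \<le> right_end y"
  shows "\<not> same_point (fst x, s) (fst y, t)"
proof -
  have "(fst x, s) \<in> strand_points x" "(fst y, t) \<in> strand_points y"
    using assms by (cases x; cases y; auto)+
  then show ?thesis using tF assms(1-3) unfolding tangle_def by blast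
qed

text \<open>Otherwise three strands would meet in one point.\<close>

lemma params_distinct:
  assumes "x \<in> S" "y \<in> S" "w \<in> S" "x \<noteq> y" "x \<noteq> w" "y \<noteq> w"
  shows "par y x \<noteq> par y w"
proof
  assume e: "par y x = par y w"
  have "double_point F (fst y, par y x) (fst x, par x y)"
    using pt[OF assms(1,2,4)] pt[OF assms(2,1)] strands_disjoint[OF assms(2,1)] assms strand
    unfolding double_point_def by auto
  moreover have "double_point F (fst y, par y x) (fst w, par w y)"
    using pt[OF assms(2,3,6)] pt[OF assms(3,2)] strands_disjoint[OF assms(2,3)] assms strand e
    unfolding double_point_def by auto
  ultimately have "same_point (fst x, par x y) (fst w, par w y)" using dF unfolding is_diagram_def by blast
  then show False
    using strands_disjoint[OF assms(1,3,5)] pt[OF assms(1,2,4)] pt[OF assms(3,2)] assms by auto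
qed

lemma pt_crossing:
  assumes "x \<in> S" "y \<in> S" "fst x \<noteq> fst y"
  shows "crossing F (fst x) (par x y) (fst y) (par y x)"
  using pt[of x y] assms strand by (auto simp: crossing_def)

text \<open>Inside the disc there is nothing but the strands.\<close>

lemma param_cases:
  assumes y: "y \<in> S" and i: "i < components F" "i \<noteq> fst y"
    and r: "left_end y \<le> r" "r \<le> right_end y" "curve F (fst y) r \<in> range (curve F i)"
  obtains x where "x \<in> S" "fst x = i" "x \<noteq> y" "r = par y x"
proof -
  obtain q where q: "curve F i q = curve F (fst y) r" using r(3) by (metis imageE)
  then have "curve F i q \<in> B" using strand_in_disc[OF y r(1,2)] by simp
  then obtain a b q' where x: "(i, a, b) \<in> S" "a \<le> q'" "q' \<le> b" "q' - q \<in> \<int>"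
    using tangle_cover[OF tF i(1)] by blast
  have "curve F i q' = curve F i q"
    by (rule closed_curve_cong_Ints[OF is_diagram_closed_curve[OF dF i(1)] x(4)])
  then have "(q', r) \<in> intersections F (i, a, b) y" using x q r by (simp add: mem_intersections)
  moreover have ne: "(i, a, b) \<noteq> y" using i by auto
  ultimately have "r = par y (i, a, b)" using intersection_iff[OF x(1) y ne] by simp
  then show ?thesis using that[OF x(1)] ne by simp
qed

lemma mem_self_intersections:
  "(s, t) \<in> self_intersections F x \<longleftrightarrow> left_end x \<le> s \<and> s < t \<and> t \<le> right_end x \<and>
     curve F (fst x) s = curve F (fst x) t"
  by (cases x) auto

lemma self_free:
  assumes "x \<in> S" "left_end x \<le> s" "s \<le> right_end x" "left_end x \<le> t" "t \<le> right_end x"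
    "curve F (fst x) s = curve F (fst x) t"
  shows "s = t"
proof -
  have "self_intersections F x = {}" using tri assms(1) by (auto simp: triangle_def)
  then have none: "(s', t') \<notin> self_intersections F x" for s' t' by simp
  have "(s, t) \<in> self_intersections F x" if "s < t" unfolding mem_self_intersections using assms that by simp
  moreover have "(t, s) \<in> self_intersections F x" if "t < s" unfolding mem_self_intersections using assms that by simp
  ultimately show ?thesis using none by (metis linorder_neqE)
qed

lemma mixed_crossings_disc:
  "mixed_crossings F \<inter> B = (\<lambda>(x, y). pt x y) ` {p \<in> {(hi, mid), (hi, lo), (mid, lo)}. fst (fst p) \<noteq> fst (snd p)}"
  (is "?L = ?R")
proof
  show "?L \<subseteq> ?R"
  proof
    fix z assume "z \<in> ?L"
    then obtain i s j t where c: "crossing F i s j t" "z = curve F i s" "z \<in> B" by (auto simp: mixed_crossings_def)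
    have ij: "i < components F" "j < components F" "i \<noteq> j" "curve F j t = z" using c by (auto simp: crossing_def)
    obtain a b s' where x: "(i, a, b) \<in> S" "a \<le> s'" "s' \<le> b" "s' - s \<in> \<int>"
      using tangle_cover[OF tF ij(1)] c by blast
    obtain a' b' t' where y: "(j, a', b') \<in> S" "a' \<le> t'" "t' \<le> b'" "t' - t \<in> \<int>"
      using tangle_cover[OF tF ij(2)] c(3) ij(4) by metis
    have sz: "curve F i s' = z"
      using closed_curve_cong_Ints[OF is_diagram_closed_curve[OF dF ij(1)] x(4)] c by simp
    have tz: "curve F j t' = z"
      using closed_curve_cong_Ints[OF is_diagram_closed_curve[OF dF ij(2)] y(4)] ij by simp
    have ne: "(i, a, b) \<noteq> (j, a', b')" using ij by auto
    have "(s', t') \<in> intersections F (i, a, b) (j, a', b')" using sz tz x y by (simp add: mem_intersections)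
    then have "s' = par (i, a, b) (j, a', b')" "t' = par (j, a', b') (i, a, b)"
      using intersection_iff[OF x(1) y(1) ne] by auto
    then have z: "z = pt (i, a, b) (j, a', b')" "z = pt (j, a', b') (i, a, b)" using sz tz by auto
    have "((i, a, b), (j, a', b')) \<in> {(hi, mid), (hi, lo), (mid, lo)} \<or> ((j, a', b'), (i, a, b)) \<in> {(hi, mid), (hi, lo), (mid, lo)}"
      using x(1) y(1) ne by auto
    then show "z \<in> ?R"
    proof
      assume "((i, a, b), (j, a', b')) \<in> {(hi, mid), (hi, lo), (mid, lo)}"
      then show ?thesis using z(1) ij by (intro image_eqI[of _ _ "((i, a, b), (j, a', b'))"]) auto
    next
      assume "((j, a', b'), (i, a, b)) \<in> {(hi, mid), (hi, lo), (mid, lo)}"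
      then show ?thesis using z(2) ij by (intro image_eqI[of _ _ "((j, a', b'), (i, a, b))"]) auto
    qed
  qed
  show "?R \<subseteq> ?L"
  proof
    fix z assume "z \<in> ?R"
    then obtain p where p: "z = (\<lambda>(x, y). pt x y) p"
      "p \<in> {p \<in> {(hi, mid), (hi, lo), (mid, lo)}. fst (fst p) \<noteq> fst (snd p)}" by (rule imageE)
    define x y where "x = fst p" and "y = snd p"
    then have pe: "p = (x, y)" by simp
    have xy: "(x, y) \<in> {(hi, mid), (hi, lo), (mid, lo)}" "fst x \<noteq> fst y" "z = pt x y"
      using p unfolding pe by simp_all
    then have S: "x \<in> S" "y \<in> S" "x \<noteq> y" by auto
    have "z \<in> B" using strand_in_disc[OF S(1) pt(2,3)[OF S]] xy by simp
    moreover have "z \<in> mixed_crossings F" using pt_crossing[OF S(1,2) xy(2)] xy(3) unfolding mixed_crossings_def by blast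
    ultimately show "z \<in> ?L" by blast
  qed
qed

lemma pts_distinct: "pt hi mid \<noteq> pt hi lo" "pt hi mid \<noteq> pt mid lo" "pt hi lo \<noteq> pt mid lo"
proof -
  have gen: "pt y x \<noteq> pt y w" if "x \<in> S" "y \<in> S" "w \<in> S" "x \<noteq> y" "x \<noteq> w" "y \<noteq> w" for x y w
    using self_free[OF that(2) pt(2,3)[OF that(2,1)] pt(2,3)[OF that(2,3)]] params_distinct[OF that] that by auto
  note d = distinct_strands
  show "pt hi mid \<noteq> pt hi lo" using gen[of mid hi lo] d by auto
  show "pt hi mid \<noteq> pt mid lo" using gen[of hi mid lo] d pt(1)[of hi mid] by auto
  show "pt hi lo \<noteq> pt mid lo" using gen[of hi lo mid] d pt(1)[of hi lo] pt(1)[of mid lo] by auto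
qed

lemma weight_sum_disc:
  "(\<Sum>z\<in>mixed_crossings F \<inter> B. weight F z) =
     (if fst hi \<noteq> fst mid then weight F (pt hi mid) else 0) +
     (if fst hi \<noteq> fst lo then weight F (pt hi lo) else 0) +
     (if fst mid \<noteq> fst lo then weight F (pt mid lo) else 0)"
proof -
  let ?A = "{(hi, mid), (hi, lo), (mid, lo)}"
  have inj: "inj_on (\<lambda>(x, y). pt x y) ?A" using pts_distinct by (auto simp: inj_on_def)
  have "(\<Sum>z\<in>mixed_crossings F \<inter> B. weight F z) =
    (\<Sum>p\<in>{p \<in> ?A. fst (fst p) \<noteq> fst (snd p)}. weight F ((\<lambda>(x, y). pt x y) p))"
    unfolding mixed_crossings_disc
    by (subst sum.reindex) (auto intro: inj_on_subset[OF inj])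
  also have "\<dots> = (\<Sum>p\<in>?A. if fst (fst p) \<noteq> fst (snd p) then weight F ((\<lambda>(x, y). pt x y) p) else 0)"
    by (rule sum.inter_filter) simp
  also have "\<dots> = (if fst hi \<noteq> fst mid then weight F (pt hi mid) else 0) +
     (if fst hi \<noteq> fst lo then weight F (pt hi lo) else 0) +
     (if fst mid \<noteq> fst lo then weight F (pt mid lo) else 0)"
    using distinct_strands by simp
  finally show ?thesis .
qed

end

text \<open>
  In a triangle move no crossing lies on the frontier of the disc; this follows from comparing
  both sides of the move.
\<close>

locale inner_triangle = disc_triangle +
  assumes inner: "\<And>x y. x \<in> {hi, mid, lo} \<Longrightarrow> y \<in> {hi, mid, lo} \<Longrightarrow> x \<noteq> y \<Longrightarrow>
    fst (snd x) < param_at F x y \<and> param_at F x y < snd (snd x)"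
begin

abbreviation wind_along :: "nat \<Rightarrow> strand \<Rightarrow> real \<Rightarrow> real" where
  "wind_along i y t \<equiv> windno (curve F i) (curve F (fst y) t)"

lemma end_off:
  assumes y: "y \<in> S" and i: "i < components F" "i \<noteq> fst y" and e: "e = left_end y \<or> e = right_end y"
  shows "curve F (fst y) e \<notin> range (curve F i)"
proof
  assume "curve F (fst y) e \<in> range (curve F i)"
  moreover have "left_end y \<le> e" "e \<le> right_end y" using strand(2)[OF y] e by auto
  ultimately obtain x where "x \<in> S" "x \<noteq> y" "e = par y x" using param_cases[OF y i] by metis
  then show False using inner[of y x] y e by auto
qed

text \<open>
  With only one strand of the upper component in the disc, the lower strand meets that component
  only once.
\<close>

lemma weight_single:
  assumes xy: "(x, y) \<in> {(hi, mid), (hi, lo), (mid, lo)}" "fst x \<noteq> fst y"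
    and single: "\<And>w. w \<in> S \<Longrightarrow> fst w = fst x \<Longrightarrow> w = x"
  shows "weight F (pt x y) = (wind_along (fst x) y (right_end y))\<^sup>2 - (wind_along (fst x) y (left_end y))\<^sup>2"
proof -
  have S: "x \<in> S" "y \<in> S" "x \<noteq> y" using xy by auto
  have i: "fst x < components F" using strand S by auto
  show ?thesis
  proof (rule weight_between[OF dF pt_crossing[OF S(1,2) xy(2)] passes_over(2)[OF xy(1)]])
    show "left_end y < par y x" "par y x < right_end y" using inner[of y x] S by auto
    fix r assume r: "left_end y \<le> r" "r \<le> right_end y" "r \<noteq> par y x"
    show "curve F (fst y) r \<notin> range (curve F (fst x))"
    proof
      assume "curve F (fst y) r \<in> range (curve F (fst x))"
      then obtain w where "w \<in> S" "fst w = fst x" "r = par y w"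
        using param_cases[OF S(2) i xy(2) r(1,2)] by metis
      then show False using single r(3) by blast
    qed
  qed
qed

lemma two_crossings_off:
  assumes S: "x \<in> S" "y \<in> S" "w \<in> S" "x \<noteq> y" "x \<noteq> w" "y \<noteq> w" and c: "fst x = fst w" "fst x \<noteq> fst y"
    and r: "left_end y \<le> r" "r \<le> right_end y" "r \<noteq> par y x" "r \<noteq> par y w"
  shows "curve F (fst y) r \<notin> range (curve F (fst x))"
proof
  have i: "fst x < components F" using strand S by auto
  assume "curve F (fst y) r \<in> range (curve F (fst x))"
  then obtain v where "v \<in> S" "fst v = fst x" "v \<noteq> y" "r = par y v"
    using param_cases[OF S(2) i c(2) r(1,2)] by metis
  moreover have "v = x \<or> v = w" using calculation S by auto
  ultimately show False using r by auto
qed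

lemma one_crossing_off:
  assumes S: "x \<in> S" "y \<in> S" "x \<noteq> y" and c: "fst x \<noteq> fst y"
    and single: "\<And>w. w \<in> S \<Longrightarrow> fst w = fst x \<Longrightarrow> w = x"
    and r: "left_end y \<le> r" "r \<le> right_end y" "r \<noteq> par y x"
  shows "curve F (fst y) r \<notin> range (curve F (fst x))"
proof
  have i: "fst x < components F" using strand S by auto
  assume "curve F (fst y) r \<in> range (curve F (fst x))"
  then obtain w where "w \<in> S" "fst w = fst x" "r = par y w"
    using param_cases[OF S(2) i c r(1,2)] by metis
  then show False using single r(3) by blast
qed

text \<open>
  Top and middle strand on one component: the bottom strand meets it twice, both times from
  below, and the weights telescope.
\<close>

lemma weight_pair:
  assumes c: "fst hi = fst mid" "fst mid \<noteq> fst lo"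
  shows "weight F (pt hi lo) + weight F (pt mid lo) =
    (wind_along (fst hi) lo (right_end lo))\<^sup>2 - (wind_along (fst hi) lo (left_end lo))\<^sup>2"
proof -
  note d = distinct_strands
  have S: "hi \<in> S" "mid \<in> S" "lo \<in> S" by auto
  have off: "curve F (fst lo) r \<notin> range (curve F (fst hi))"
    if "left_end lo \<le> r" "r \<le> right_end lo" "r \<noteq> par lo hi" "r \<noteq> par lo mid" for r
    using two_crossings_off[of hi lo mid r] d c that by auto
  have in1: "left_end lo < par lo hi" "par lo hi < right_end lo" "left_end lo < par lo mid" "par lo mid < right_end lo"
    using inner[of lo hi] inner[of lo mid] d by auto
  have cr: "crossing F (fst hi) (par hi lo) (fst lo) (par lo hi)" "crossing F (fst hi) (par mid lo) (fst lo) (par lo mid)"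
    using pt_crossing[of hi lo] pt_crossing[of mid lo] c by auto
  have up: "upper F (fst hi) (par hi lo)" "upper F (fst hi) (par mid lo)"
    using passes_over(2)[of hi lo] passes_over(2)[of mid lo] c by auto
  have ne: "par lo hi \<noteq> par lo mid" using params_distinct[of hi lo mid] d by auto
  show ?thesis
  proof (cases "par lo hi < par lo mid")
    case True
    show ?thesis
      using weight_two_overcrossings[OF dF cr(1) up(1) cr(2) up(2) in1(1) True in1(4) off] c by simp
  next
    case False
    then have "par lo mid < par lo hi" using ne by simp
    from weight_two_overcrossings[OF dF cr(2) up(2) cr(1) up(1) in1(3) this in1(2) off]
    show ?thesis using c by simp
  qed
qed

lemma sgn_velocity_det:
  assumes xy: "(x, y) \<in> {(hi, mid), (hi, lo), (mid, lo)}" "fst x \<noteq> fst y"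
  shows "sgn (velocity_det F (fst x, par x y) (fst y, par y x)) = (if positive_at F x y then 1 else -1)"
proof -
  have S: "x \<in> S" "y \<in> S" using xy by auto
  have "velocity_det F (fst x, par x y) (fst y, par y x) \<noteq> 0"
    using crossing_velocity_det[OF dF pt_crossing[OF S xy(2)]] .
  then show ?thesis using passes_over(2)[OF xy(1)]
    by (auto simp: positive_at_def positive_crossing_def sgn_if)
qed

text \<open>
  Top and bottom strand on one component: the middle strand meets it once below the top strand
  and once above the bottom strand. Only the former crossing has a weight, but the latter shifts
  the winding numbers seen there by \<open>el\<close> if it comes first.
\<close>

lemma middle_weight:
  assumes c: "fst hi = fst lo" "fst mid \<noteq> fst lo"
  defines "eh \<equiv> if positive_at F hi mid then 1 else -1" and "el \<equiv> if positive_at F mid lo then -1 else 1"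
  shows "weight F (pt hi mid) =
     (if meets_before F mid lo hi
      then (wind_along (fst hi) mid (left_end mid) + el + eh)\<^sup>2 - (wind_along (fst hi) mid (left_end mid) + el)\<^sup>2
      else (wind_along (fst hi) mid (left_end mid) + eh)\<^sup>2 - (wind_along (fst hi) mid (left_end mid))\<^sup>2)"
proof -
  note d = distinct_strands
  have S: "hi \<in> S" "mid \<in> S" "lo \<in> S" by auto
  let ?W = "wind_along (fst hi) mid" and ?m = "(par mid hi + par mid lo) / 2"
  have off: "curve F (fst mid) r \<notin> range (curve F (fst hi))"
    if "left_end mid \<le> r" "r \<le> right_end mid" "r \<noteq> par mid hi" "r \<noteq> par mid lo" for r
    using two_crossings_off[of hi mid lo r] d c that by auto
  have in1: "left_end mid < par mid hi" "par mid hi < right_end mid" "left_end mid < par mid lo" "par mid lo < right_end mid"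
    using inner[of mid hi] inner[of mid lo] d by auto
  have cr: "crossing F (fst hi) (par hi mid) (fst mid) (par mid hi)" "crossing F (fst hi) (par lo mid) (fst mid) (par mid lo)"
    using pt_crossing[of hi mid] pt_crossing[of lo mid] c by auto
  have up: "upper F (fst hi) (par hi mid)" using passes_over(2)[of hi mid] by auto
  have eh: "sgn (velocity_det F (fst hi, par hi mid) (fst mid, par mid hi)) = eh"
    using sgn_velocity_det[of hi mid] c by (simp add: eh_def)
  have el: "sgn (velocity_det F (fst hi, par lo mid) (fst mid, par mid lo)) = el"
    using sgn_velocity_det[of mid lo] c
    by (simp add: velocity_det_swap[of F "(fst lo, par lo mid)" "(fst mid, par mid lo)"] el_def sgn_minus)
  have ne: "par mid hi \<noteq> par mid lo" using params_distinct[of hi mid lo] d by auto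
  show ?thesis
  proof (cases "par mid lo < par mid hi")
    case True
    have "?W ?m = ?W (left_end mid) + sgn (velocity_det F (fst hi, par lo mid) (fst mid, par mid lo))"
      by (rule windno_jump[OF dF cr(2)]) (use in1 True off in auto)
    moreover have "?W (right_end mid) = ?W ?m + sgn (velocity_det F (fst hi, par hi mid) (fst mid, par mid hi))"
      by (rule windno_jump[OF dF cr(1)]) (use in1 True off in auto)
    moreover have "weight F (pt hi mid) = (?W (right_end mid))\<^sup>2 - (?W ?m)\<^sup>2"
      by (rule weight_between[OF dF cr(1) up]) (use in1 True off in auto)
    ultimately show ?thesis using True eh el by (simp add: meets_before_def)
  next
    case False
    then have lt: "par mid hi < par mid lo" using ne by simp
    have "?W ?m = ?W (left_end mid) + sgn (velocity_det F (fst hi, par hi mid) (fst mid, par mid hi))"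
      by (rule windno_jump[OF dF cr(1)]) (use in1 lt off in auto)
    moreover have "weight F (pt hi mid) = (?W ?m)\<^sup>2 - (?W (left_end mid))\<^sup>2"
      by (rule weight_between[OF dF cr(1) up]) (use in1 lt off in auto)
    ultimately show ?thesis using False eh by (simp add: meets_before_def)
  qed
qed

text \<open>
  The crossing of the top with the bottom strand can be reached along either of them. The two
  results must agree, which ties the orders of the crossings on these strands to the signs of
  the crossings.
\<close>

lemma wind_at_outer_crossing:
  assumes c: "fst hi = fst lo" "fst mid \<noteq> fst lo"
  defines "eh \<equiv> if positive_at F hi mid then 1 else -1" and "el \<equiv> if positive_at F mid lo then -1 else 1"
  shows "windno (curve F (fst mid)) (pt hi lo) =
      wind_along (fst mid) hi (left_end hi) - of_bool (meets_before F hi mid lo) * eh"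
    "windno (curve F (fst mid)) (pt hi lo) =
      wind_along (fst mid) lo (left_end lo) - of_bool (\<not> meets_before F lo hi mid) * el"
proof -
  note d = distinct_strands
  have gen: "windno (curve F (fst mid)) (pt y w) = wind_along (fst mid) y (left_end y) +
      of_bool (meets_before F y mid w) * sgn (velocity_det F (fst mid, par mid y) (fst y, par y mid))"
    if yw: "(y, w) = (hi, lo) \<or> (y, w) = (lo, hi)" for y w
  proof -
    have S: "y \<in> S" "w \<in> S" "mid \<in> S" "mid \<noteq> y" "mid \<noteq> w" "y \<noteq> w" using yw d by auto
    have fy: "fst mid \<noteq> fst y" using c yw by auto
    have off: "curve F (fst y) r \<notin> range (curve F (fst mid))"
      if "left_end y \<le> r" "r \<le> right_end y" "r \<noteq> par y mid" for r
    proof (rule one_crossing_off[OF S(3,1,4) fy _ that])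
      fix v assume "v \<in> S" "fst v = fst mid"
      then show "v = mid" using c by auto
    qed
    have in1: "left_end y < par y mid" "par y mid < right_end y" "left_end y < par y w" "par y w < right_end y"
      using inner[of y mid] inner[of y w] S by auto
    have ne: "par y mid \<noteq> par y w" using params_distinct[of mid y w] S by auto
    show ?thesis
    proof (cases "par y mid < par y w")
      case True
      have "wind_along (fst mid) y (par y w) = wind_along (fst mid) y (left_end y) +
          sgn (velocity_det F (fst mid, par mid y) (fst y, par y mid))"
        by (rule windno_jump[OF dF pt_crossing[OF S(3,1) fy]]) (use in1 True off in auto)
      then show ?thesis using True by (simp add: meets_before_def)
    next
      case False
      have "closed_curve (curve F (fst mid))" "continuous_on UNIV (curve F (fst y))"
        using is_diagram_closed_curve[OF dF] strand S by (auto simp: closed_curve_def)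
      then have "wind_along (fst mid) y (left_end y) = wind_along (fst mid) y (par y w)"
        by (rule windno_constant_along) (use in1 False ne off in auto)
      then show ?thesis using False by (simp add: meets_before_def)
    qed
  qed
  have "sgn (velocity_det F (fst mid, par mid hi) (fst hi, par hi mid)) = - eh"
    using sgn_velocity_det[of hi mid] c velocity_det_swap[of F "(fst mid, par mid hi)" "(fst hi, par hi mid)"]
    by (simp add: eh_def sgn_minus)
  then show "windno (curve F (fst mid)) (pt hi lo) =
      wind_along (fst mid) hi (left_end hi) - of_bool (meets_before F hi mid lo) * eh"
    using gen[of hi lo] by simp
  have "sgn (velocity_det F (fst mid, par mid lo) (fst lo, par lo mid)) = - el"
    using sgn_velocity_det[of mid lo] c by (simp add: el_def)
  moreover have "meets_before F lo mid hi \<longleftrightarrow> \<not> meets_before F lo hi mid"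
    using params_distinct[of mid lo hi] d by (auto simp: meets_before_def)
  moreover have "pt lo hi = pt hi lo" using pt(1)[of lo hi] d by auto
  ultimately show "windno (curve F (fst mid)) (pt hi lo) =
      wind_along (fst mid) lo (left_end lo) - of_bool (\<not> meets_before F lo hi mid) * el"
    using gen[of lo hi] by simp
qed

end

text \<open>
  When top and bottom strand belong to one component and the middle strand to another one, the
  weight of the top-middle crossing changes by \<open>2 * el * eh\<close> or its negative,
  depending on which of its two crossings the middle strand meets first. Comparing
  \<open>wind_at_outer_crossing\<close> before and after the move gives \<open>el * eh\<close>
  in terms of the orders on the top and the bottom strand. Together, the change is
  \<open>2\<close> times a sign that is the product of the three orders; it depends only on the
  parity of the number of agreeing sides.
\<close>

theorem winding_sum_triangle_move:
  assumes mv: "triangle_move tm tb mb hi mid lo D E"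
    and sD: "triangle_sign D hi mid lo = -1"
  shows "winding_sum D \<le> winding_sum E"
proof -
  have lc: "local_change D E {hi, mid, lo}" and tri: "triangle D hi mid lo" "triangle E hi mid lo"
    and flip: "meets_before D hi mid lo \<noteq> meets_before E hi mid lo"
      "meets_before D mid lo hi \<noteq> meets_before E mid lo hi"
      "meets_before D lo hi mid \<noteq> meets_before E lo hi mid"
    and pos: "positive_at D hi mid = tm" "positive_at E hi mid = tm" "positive_at D mid lo = mb" "positive_at E mid lo = mb"
    using mv unfolding triangle_move_def by auto
  obtain B where "local_move D E {hi, mid, lo} B" using lc by (rule local_change_local_move)
  then interpret local_move D E "{hi, mid, lo}" B .
  interpret sym: local_move E D "{hi, mid, lo}" B by (rule local_move_sym) unfold_locales
  interpret TD: disc_triangle D B hi mid lo using dD tD tri by unfold_locales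
  interpret TE: disc_triangle E B hi mid lo using dE tE tri by unfold_locales
  let ?S = "{hi, mid, lo}"
  note d = TD.distinct_strands
  \<comment> \<open>On each strand the move exchanges its two crossings.\<close>
  have flips: "(param_at D y x < param_at D y w) \<noteq> (param_at E y x < param_at E y w)"
    if S: "x \<in> ?S" "y \<in> ?S" "w \<in> ?S" "x \<noteq> y" "x \<noteq> w" "y \<noteq> w" for x y w
  proof -
    have ne: "param_at D y x \<noteq> param_at D y w" "param_at E y x \<noteq> param_at E y w"
      using TD.params_distinct[OF S] TE.params_distinct[OF S] by auto
    consider "(y, x, w) = (hi, mid, lo)" | "(y, x, w) = (hi, lo, mid)" | "(y, x, w) = (mid, hi, lo)"
      | "(y, x, w) = (mid, lo, hi)" | "(y, x, w) = (lo, hi, mid)" | "(y, x, w) = (lo, mid, hi)"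
      using S by auto
    then show ?thesis using ne flip unfolding meets_before_def by cases auto
  qed
  \<comment> \<open>A crossing at an end of a strand would be the same before and after the move, so
    it could not change places with the other crossing.\<close>
  have inner: "fst (snd y) < param_at D y x \<and> param_at D y x < snd (snd y) \<and>
      fst (snd y) < param_at E y x \<and> param_at E y x < snd (snd y)"
    if S: "x \<in> ?S" "y \<in> ?S" "x \<noteq> y" for x y
  proof -
    have "\<exists>w\<in>?S. x \<noteq> w \<and> y \<noteq> w" using S d by auto
    then obtain w where w: "w \<in> ?S" "x \<noteq> w" "y \<noteq> w" by blast
    have b: "fst (snd y) \<le> param_at D y x" "param_at D y x \<le> snd (snd y)"
       "fst (snd y) \<le> param_at D y w" "param_at D y w \<le> snd (snd y)"
       "fst (snd y) \<le> param_at E y x" "param_at E y x \<le> snd (snd y)"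
       "fst (snd y) \<le> param_at E y w" "param_at E y w \<le> snd (snd y)"
      using TD.pt(2,3)[of y x] TD.pt(2,3)[of y w] TE.pt(2,3)[of y x] TE.pt(2,3)[of y w] S w by auto
    have ne: "param_at D y x \<noteq> param_at D y w" "param_at E y x \<noteq> param_at E y w"
      using TD.params_distinct[OF S(1,2) w(1) S(3) w(2,3)] TE.params_distinct[OF S(1,2) w(1) S(3) w(2,3)] by auto
    have xs: "(fst x, fst (snd x), snd (snd x)) \<in> ?S" "(fst y, fst (snd y), snd (snd y)) \<in> ?S"
      using S by (simp_all only: prod.collapse)
    have "param_at E y x = param_at D y x"
      if e: "param_at D y x = fst (snd y) \<or> param_at D y x = snd (snd y)"
    proof -
      have "(param_at D x y, param_at D y x) \<in> intersections E (fst x, fst (snd x), snd (snd x)) (fst y, fst (snd y), snd (snd y))"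
        using frontier_intersection[OF xs e] TD.pt[of x y] S by auto
      then show ?thesis using TE.intersection_iff[of x y] S by simp
    qed
    moreover have "param_at E y x = param_at D y x"
      if e: "param_at E y x = fst (snd y) \<or> param_at E y x = snd (snd y)"
    proof -
      have "(param_at E x y, param_at E y x) \<in> intersections D (fst x, fst (snd x), snd (snd x)) (fst y, fst (snd y), snd (snd y))"
        using sym.frontier_intersection[OF xs e] TE.pt[of x y] S by auto
      then show ?thesis using TD.intersection_iff[of x y] S by simp
    qed
    moreover have "(param_at D y x < param_at D y w) \<noteq> (param_at E y x < param_at E y w)"
      using flips[OF S(1,2) w(1) S(3) w(2,3)] .
    ultimately show ?thesis using b ne by (smt (verit))
  qed
  interpret ID: inner_triangle D B hi mid lo by unfold_locales (use inner in blast)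
  interpret IE: inner_triangle E B hi mid lo by unfold_locales (use inner in blast)
  have ends: "windno (curve E i) (curve E (fst y) e) = windno (curve D i) (curve D (fst y) e)"
    if y: "y \<in> ?S" and i: "i < components D" "i \<noteq> fst y" and e: "e = fst (snd y) \<or> e = snd (snd y)" for i y e
  proof -
    have y': "(fst y, fst (snd y), snd (snd y)) \<in> ?S" using y by (simp only: prod.collapse)
    have same: "curve E (fst y) e = curve D (fst y) e" using strand_end_same[OF y' e] .
    have "curve D (fst y) e \<in> frontier B" using TD.strand[OF y] e by auto
    from windno_frontier[OF i(1) this] show ?thesis
      using ID.end_off[OF y i e] IE.end_off[OF y _ i(2) e] i(1) same comp by simp
  qed
  have c: "fst hi < components D" "fst mid < components D" "fst lo < components D"
    using TD.strand(1) by auto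
  note diff = winding_sum_diff[unfolded TD.weight_sum_disc TE.weight_sum_disc]
  consider (one) "fst hi = fst mid" "fst mid = fst lo"
    | (hm) "fst hi = fst mid" "fst mid \<noteq> fst lo"
    | (ml) "fst hi \<noteq> fst mid" "fst mid = fst lo"
    | (hl) "fst hi = fst lo" "fst mid \<noteq> fst lo"
    | (dist) "fst hi \<noteq> fst mid" "fst mid \<noteq> fst lo" "fst hi \<noteq> fst lo" by metis
  then show ?thesis
  proof cases
    case one
    then show ?thesis using diff by simp
  next
    case hm
    then show ?thesis
      using diff ID.weight_pair[OF hm] IE.weight_pair[OF hm] ends[of lo "fst hi"] c by simp
  next
    case ml
    have single: "\<And>v. v \<in> ?S \<Longrightarrow> fst v = fst hi \<Longrightarrow> v = hi" using ml by force
    have "weight F (curve F (fst hi) (param_at F hi y)) =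
        (windno (curve F (fst hi)) (curve F (fst y) (snd (snd y))))\<^sup>2 - (windno (curve F (fst hi)) (curve F (fst y) (fst (snd y))))\<^sup>2"
      if "F = D \<or> F = E" "y = mid \<or> y = lo" for F y
    proof -
      have "(hi, y) \<in> {(hi, mid), (hi, lo), (mid, lo)}" "fst hi \<noteq> fst y" using that ml by auto
      from ID.weight_single[OF this single] IE.weight_single[OF this single] show ?thesis using that(1) by blast
    qed
    then show ?thesis
      using diff ml ends[of lo "fst hi"] ends[of mid "fst hi"] c by simp
  next
    case dist
    have "weight F (curve F (fst x) (param_at F x y)) =
        (windno (curve F (fst x)) (curve F (fst y) (snd (snd y))))\<^sup>2 - (windno (curve F (fst x)) (curve F (fst y) (fst (snd y))))\<^sup>2"
      if "F = D \<or> F = E" "(x, y) \<in> {(hi, mid), (hi, lo), (mid, lo)}" for F x y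
    proof -
      have "fst x \<noteq> fst y" and single: "\<And>v. v \<in> ?S \<Longrightarrow> fst v = fst x \<Longrightarrow> v = x" using that dist by force+
      from ID.weight_single[OF that(2) this] IE.weight_single[OF that(2) this] show ?thesis using that(1) by blast
    qed
    then show ?thesis
      using diff dist ends[of lo "fst hi"] ends[of mid "fst hi"] ends[of lo "fst mid"] c by simp
  next
    case hl
    have ml: "weight F (curve F (fst mid) (param_at F mid lo)) =
        (windno (curve F (fst mid)) (curve F (fst lo) (snd (snd lo))))\<^sup>2 - (windno (curve F (fst mid)) (curve F (fst lo) (fst (snd lo))))\<^sup>2"
      if "F = D \<or> F = E" for F
    proof -
      have p: "(mid, lo) \<in> {(hi, mid), (hi, lo), (mid, lo)}" by simp
      have single: "\<And>v. v \<in> ?S \<Longrightarrow> fst v = fst mid \<Longrightarrow> v = mid" using hl by force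
      from ID.weight_single[OF p hl(2) single] IE.weight_single[OF p hl(2) single] show ?thesis using that by blast
    qed
    \<comment> \<open>These signs describe how the middle strand crosses the component of the top
      and bottom strands; they are the same before and after the move.\<close>
    define eh el :: real where "eh = (if tm then 1 else -1)" and "el = (if mb then -1 else 1)"
    define w x y where "w = windno (curve D (fst hi)) (curve D (fst mid) (fst (snd mid)))"
      and "x = windno (curve D (fst mid)) (curve D (fst hi) (fst (snd hi)))"
      and "y = windno (curve D (fst mid)) (curve D (fst lo) (fst (snd lo)))"
    have ends': "windno (curve E (fst hi)) (curve E (fst mid) (fst (snd mid))) = w"
      "windno (curve E (fst mid)) (curve E (fst hi) (fst (snd hi))) = x"
      "windno (curve E (fst mid)) (curve E (fst lo) (fst (snd lo))) = y"
      using ends[of mid "fst hi"] ends[of hi "fst mid"] ends[of lo "fst mid"] c hl by (simp_all add: w_def x_def y_def)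
    have hmD: "weight D (curve D (fst hi) (param_at D hi mid)) =
        (if meets_before D mid lo hi then (w + el + eh)\<^sup>2 - (w + el)\<^sup>2 else (w + eh)\<^sup>2 - w\<^sup>2)"
      using ID.middle_weight[OF hl] pos by (simp add: w_def eh_def el_def)
    have hmE: "weight E (curve E (fst hi) (param_at E hi mid)) =
        (if meets_before E mid lo hi then (w + el + eh)\<^sup>2 - (w + el)\<^sup>2 else (w + eh)\<^sup>2 - w\<^sup>2)"
      using IE.middle_weight[OF hl] pos ends' by (simp add: eh_def el_def)
    have oD: "x - of_bool (meets_before D hi mid lo) * eh = y - of_bool (\<not> meets_before D lo hi mid) * el"
      using ID.wind_at_outer_crossing[OF hl] pos by (simp add: x_def y_def eh_def el_def)
    have oE: "x - of_bool (meets_before E hi mid lo) * eh = y - of_bool (\<not> meets_before E lo hi mid) * el"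
      using IE.wind_at_outer_crossing[OF hl] pos ends' by (simp add: eh_def el_def)
    have "winding_sum E - winding_sum D =
       weight E (curve E (fst hi) (param_at E hi mid)) - weight D (curve D (fst hi) (param_at D hi mid))"
      using diff ml[of D] ml[of E] hl ends[of lo "fst mid"] c by simp
    also have "\<dots> = 2"
      using sD flip oD oE unfolding hmD hmE triangle_sign_def agreeing_sides_def eh_def el_def
      by (auto simp: power2_eq_square algebra_simps split: if_splits)
    finally show ?thesis by simp
  qed
qed

theorem winding_sum_forward:
  assumes "forward_move m D E"
  shows "winding_sum D \<le> winding_sum E" "\<not> is_Omega3 m \<Longrightarrow> winding_sum D = winding_sum E"
  using assms winding_sum_creates_curl winding_sum_creates_bigon winding_sum_triangle_move
  by (cases m; force)+

text \<open>
  Only \<open>\<Omega>3\<close> moves change the sum, a forward one does not decrease it, and a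
  backward one does not increase it.
\<close>

theorem winding_sum_step:
  assumes "step A D E"
  shows "(\<nexists>m. is_Omega3 m \<and> (m, Forward) \<in> A) \<Longrightarrow> winding_sum E \<le> winding_sum D"
    and "(\<nexists>m. is_Omega3 m \<and> (m, Backward) \<in> A) \<Longrightarrow> winding_sum D \<le> winding_sum E"
proof -
  have D: "is_diagram D" and E: "is_diagram E" and or: "planar_isotopic D E \<or> (\<exists>m\<in>A. performs m D E)"
    using assms by (auto simp: step_def)
  consider (iso) "winding_sum D = winding_sum E" | (fw) m where "(m, Forward) \<in> A" "forward_move m D E"
    | (bw) m where "(m, Backward) \<in> A" "forward_move m E D"
  proof (cases "planar_isotopic D E")
    case True
    then show ?thesis using iso winding_sum_planar_isotopy[OF D E] by blast
  next
    case False
    then obtain m d where m: "(m, d) \<in> A" "performs (m, d) D E" using or by auto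
    then show ?thesis using fw bw by (cases d) auto
  qed
  note cases = this
  show "winding_sum E \<le> winding_sum D" if "\<nexists>m. is_Omega3 m \<and> (m, Forward) \<in> A"
    using cases
  proof cases
    case (fw m) then show ?thesis using winding_sum_forward(2)[of m] that by force
  next
    case (bw m) then show ?thesis using winding_sum_forward(1) by simp
  qed simp
  show "winding_sum D \<le> winding_sum E" if "\<nexists>m. is_Omega3 m \<and> (m, Backward) \<in> A"
    using cases
  proof cases
    case (bw m) then show ?thesis using winding_sum_forward(2)[of m] that by force
  next
    case (fw m) then show ?thesis using winding_sum_forward(1) by simp
  qed simp
qed

section \<open>Ambient isotopies of links\<close>

definition image_link :: "(complex \<times> real \<Rightarrow> complex \<times> real) \<Rightarrow> link \<Rightarrow> link" where
  "image_link h K = Link (link_components K) (\<lambda>i t. h (link_curve K i t))"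

lemma image_link_simps [simp]:
  "link_components (image_link h K) = link_components K"
  "link_curve (image_link h K) i t = h (link_curve K i t)"
  by (simp_all add: image_link_def)

lemma ambient_isotopy_homeomorphism:
  assumes "ambient_isotopy H" "\<tau> \<in> {0..1}" obtains g where "homeomorphism UNIV UNIV (H \<tau>) g"
  using assms unfolding ambient_isotopy_def by blast

lemma ambient_isotopy_inj:
  assumes "ambient_isotopy H" "\<tau> \<in> {0..1}" "H \<tau> x = H \<tau> y" shows "x = y"
proof -
  obtain g where "homeomorphism UNIV UNIV (H \<tau>) g" using ambient_isotopy_homeomorphism assms(1,2) by blast
  then show ?thesis using assms(3) unfolding homeomorphism_def by (metis UNIV_I)
qed

lemma ambient_isotopy_compose:
  assumes H: "ambient_isotopy H" and G: "ambient_isotopy G"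
  shows "ambient_isotopy (\<lambda>\<tau>. G \<tau> \<circ> H \<tau>)"
  unfolding ambient_isotopy_def
proof (intro conjI ballI)
  have cH: "continuous_on ({0..1} \<times> UNIV) (\<lambda>(\<tau>, x). H \<tau> x)" and cG: "continuous_on ({0..1} \<times> UNIV) (\<lambda>(\<tau>, x). G \<tau> x)"
    using H G by (auto simp: ambient_isotopy_def)
  have "continuous_on ({0..1} \<times> UNIV) (\<lambda>p. (\<lambda>(\<tau>, x). G \<tau> x) (fst p, (\<lambda>(\<tau>, x). H \<tau> x) p))"
    by (intro continuous_on_compose2[OF cG] continuous_intros cH) auto
  then show "continuous_on ({0..1} \<times> UNIV) (\<lambda>(\<tau>, x). (G \<tau> \<circ> H \<tau>) x)"
    by (simp add: case_prod_beta)
  show "G 0 \<circ> H 0 = id" using H G by (simp add: ambient_isotopy_def)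
  fix \<tau> :: real assume "\<tau> \<in> {0..1}"
  then obtain h g where "homeomorphism UNIV UNIV (H \<tau>) h" "homeomorphism UNIV UNIV (G \<tau>) g"
    using H G ambient_isotopy_homeomorphism by metis
  then show "\<exists>g. homeomorphism UNIV UNIV (G \<tau> \<circ> H \<tau>) g"
    using homeomorphism_compose by blast
qed

lemma ambient_isotopy_reverse:
  assumes H: "ambient_isotopy H" and g: "homeomorphism UNIV UNIV (H 1) g"
  shows "ambient_isotopy (\<lambda>\<tau>. H (1 - \<tau>) \<circ> g)"
  unfolding ambient_isotopy_def
proof (intro conjI ballI)
  have cH: "continuous_on ({0..1} \<times> UNIV) (\<lambda>(\<tau>, x). H \<tau> x)" using H by (simp add: ambient_isotopy_def)
  have gc: "continuous_on UNIV g" "homeomorphism UNIV UNIV g (H 1)"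
    using g homeomorphism_symD by (auto simp: homeomorphism_def)
  have "continuous_on ({0..1} \<times> UNIV) (\<lambda>p. (\<lambda>(\<tau>, x). H \<tau> x) (1 - fst p, g (snd p)))"
    by (intro continuous_on_compose2[OF cH] continuous_intros continuous_on_compose2[OF gc(1)]) auto
  then show "continuous_on ({0..1} \<times> UNIV) (\<lambda>(\<tau>, x). (H (1 - \<tau>) \<circ> g) x)"
    by (simp add: case_prod_beta)
  show "H (1 - 0) \<circ> g = id" using g by (auto simp: homeomorphism_def)
  fix \<tau> :: real assume "\<tau> \<in> {0..1}"
  then have "1 - \<tau> \<in> {0..1}" by auto
  then obtain h where "homeomorphism UNIV UNIV (H (1 - \<tau>)) h"
    using H ambient_isotopy_homeomorphism by metis
  then show "\<exists>g'. homeomorphism UNIV UNIV (H (1 - \<tau>) \<circ> g) g'"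
    using homeomorphism_compose[OF gc(2)] by blast
qed

lemma reparametrisation_id: "reparametrisation (\<lambda>t. t)"
  by (simp add: reparametrisation_def strict_mono_def)

lemma reparametrisation_compose:
  assumes "reparametrisation f" "reparametrisation g" shows "reparametrisation (\<lambda>t. g (f t))"
  using assms continuous_on_compose2[of UNIV g UNIV f] unfolding reparametrisation_def strict_mono_def by auto

lemma link_isotopic_trans:
  assumes KL: "link_isotopic K L" and LM: "link_isotopic L M" shows "link_isotopic K M"
proof -
  obtain H \<pi> f where H: "ambient_isotopy H" "bij_betw \<pi> {..<link_components K} {..<link_components L}"
    "\<And>i. i < link_components K \<Longrightarrow> reparametrisation (f i)"
    "\<And>i t. i < link_components K \<Longrightarrow> H 1 (link_curve K i t) = link_curve L (\<pi> i) (f i t)"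
    using KL unfolding link_isotopic_def by blast
  obtain G \<rho> g where G: "ambient_isotopy G" "bij_betw \<rho> {..<link_components L} {..<link_components M}"
    "\<And>i. i < link_components L \<Longrightarrow> reparametrisation (g i)"
    "\<And>i t. i < link_components L \<Longrightarrow> G 1 (link_curve L i t) = link_curve M (\<rho> i) (g i t)"
    using LM unfolding link_isotopic_def by blast
  have \<pi>: "\<pi> i < link_components L" if "i < link_components K" for i
    using H(2) that by (auto simp: bij_betw_def)
  show ?thesis unfolding link_isotopic_def
  proof (intro exI conjI allI impI)
    show "ambient_isotopy (\<lambda>\<tau>. G \<tau> \<circ> H \<tau>)" by (rule ambient_isotopy_compose[OF H(1) G(1)])
    show "bij_betw (\<rho> \<circ> \<pi>) {..<link_components K} {..<link_components M}"
      by (rule bij_betw_trans[OF H(2) G(2)])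
    fix i assume i: "i < link_components K"
    show "reparametrisation (\<lambda>t. g (\<pi> i) (f i t))"
      by (rule reparametrisation_compose[OF H(3)[OF i] G(3)[OF \<pi>[OF i]]])
    show "(G 1 \<circ> H 1) (link_curve K i t) = link_curve M ((\<rho> \<circ> \<pi>) i) (g (\<pi> i) (f i t))" for t
      using H(4)[OF i] G(4)[OF \<pi>[OF i]] by simp
  qed
qed

text \<open>Run the isotopy backwards.\<close>

lemma link_isotopic_image_link:
  assumes H: "ambient_isotopy H" shows "link_isotopic (image_link (H 1) K) K"
proof -
  obtain g where g: "homeomorphism UNIV UNIV (H 1) g" using ambient_isotopy_homeomorphism[OF H, of 1] by auto
  have H0: "H 0 = id" using H by (simp add: ambient_isotopy_def)
  show ?thesis unfolding link_isotopic_def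
  proof (intro exI conjI allI impI)
    show "ambient_isotopy (\<lambda>\<tau>. H (1 - \<tau>) \<circ> g)" by (rule ambient_isotopy_reverse[OF H g])
    show "bij_betw (\<lambda>i. i) {..<link_components (image_link (H 1) K)} {..<link_components K}"
      by (simp add: bij_betw_def)
    fix i t
    show "reparametrisation (\<lambda>t. t)" by (rule reparametrisation_id)
    have "g (H 1 x) = x" for x using g unfolding homeomorphism_def by blast
    then show "(H (1 - 1) \<circ> g) (link_curve (image_link (H 1) K) i t) = link_curve K i t"
      by (simp add: H0)
  qed
qed

lemma embedded_image_link:
  assumes H: "ambient_isotopy H" and K: "embedded_link K" shows "embedded_link (image_link (H 1) K)"
proof -
  have "continuous_on UNIV (H 1)"
    using ambient_isotopy_homeomorphism[OF H, of 1] by (auto simp: homeomorphism_def)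
  then have "continuous_on UNIV (\<lambda>t. H 1 (link_curve K i t))" if "i < link_components K" for i
    using K that unfolding embedded_link_def by (auto intro: continuous_on_compose2)
  moreover have "H 1 x = H 1 y \<Longrightarrow> x = y" for x y using ambient_isotopy_inj[OF H, of 1] by auto
  ultimately show ?thesis using K unfolding embedded_link_def by simp
qed

text \<open>
  Pushing every point \<open>x\<close> by \<open>\<phi> x\<close> in a fixed direction
  \<open>v\<close> is injective on every line parallel to \<open>v\<close> if
  \<open>\<phi>\<close> falls with slope less than one in this direction, no matter how steeply
  it rises. The intermediate value theorem on these lines gives surjectivity, and invariance of
  domain the continuity of the inverse.
\<close>

lemma ambient_isotopy_push:
  fixes v :: "'a::euclidean_space"
  assumes \<phi>: "continuous_on UNIV \<phi>" and lam: "l < 1" "0 \<le> l"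
    and slope: "\<And>x \<theta>. \<theta> \<ge> 0 \<Longrightarrow> \<phi> x \<le> \<phi> (x + \<theta> *\<^sub>R v) + l * \<theta>"
  shows "ambient_isotopy (\<lambda>\<tau> x. x + (\<tau> * \<phi> x) *\<^sub>R v)"
  unfolding ambient_isotopy_def
proof (intro conjI ballI)
  show "continuous_on ({0..1} \<times> UNIV) (\<lambda>(\<tau>, x). x + (\<tau> * \<phi> x) *\<^sub>R v)"
    unfolding case_prod_beta by (intro continuous_intros continuous_on_compose2[OF \<phi>]) auto
  show "(\<lambda>x. x + (0 * \<phi> x) *\<^sub>R v) = id" by auto
  fix \<tau> :: real assume \<tau>: "\<tau> \<in> {0..1}"
  let ?h = "\<lambda>x. x + (\<tau> * \<phi> x) *\<^sub>R v"
  have "\<tau> * l \<le> 1 * l" using \<tau> lam by (intro mult_right_mono) auto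
  then have tl: "\<tau> * l < 1" using lam by simp
  have cont: "continuous_on UNIV ?h" by (intro continuous_intros \<phi>)
  \<comment> \<open>The point that was pushed further was behind by \<open>\<theta>\<close>, so
    \<open>\<phi>\<close> fell by at least \<open>\<theta>\<close> over the distance
    \<open>\<theta>\<close>.\<close>
  have aux: "x = y" if e: "?h x = ?h y" and le: "\<phi> y \<le> \<phi> x" for x y
  proof -
    define \<theta> where "\<theta> = \<tau> * (\<phi> x - \<phi> y)"
    have th: "\<theta> \<ge> 0" using le \<tau> by (simp add: \<theta>_def)
    have y: "y = x + \<theta> *\<^sub>R v" using e by (simp add: \<theta>_def algebra_simps)
    have "\<phi> x - \<phi> y \<le> l * \<theta>" using slope[OF th, of x] y by simp
    then have "\<tau> * (\<phi> x - \<phi> y) \<le> \<tau> * (l * \<theta>)" using \<tau> by (intro mult_left_mono) auto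
    then have "\<theta> \<le> \<tau> * (l * \<theta>)" by (simp only: \<theta>_def[symmetric])
    then have "\<theta> * (1 - \<tau> * l) \<le> 0" by (simp add: algebra_simps)
    then have "\<theta> \<le> 0" using tl by (simp add: mult_le_0_iff)
    then show "x = y" using y th by simp
  qed
  have inj: "inj_on ?h UNIV"
  proof (rule inj_onI)
    fix x y assume "?h x = ?h y"
    then show "x = y" using aux[of x y] aux[of y x] by (cases "\<phi> y \<le> \<phi> x") auto
  qed
  have surj: "range ?h = UNIV"
  proof -
    have "z \<in> range ?h" for z
    proof -
      \<comment> \<open>A preimage of \<open>z\<close> is found on the line through
        \<open>z\<close>; the bound on the slope makes \<open>?g\<close> change sign within
        \<open>M\<close>.\<close>
      let ?g = "\<lambda>\<theta>. \<theta> - \<tau> * \<phi> (z - \<theta> *\<^sub>R v)"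
      define M where "M = \<bar>\<phi> z\<bar> / (1 - \<tau> * l)"
      have M: "M \<ge> 0" using tl by (simp add: M_def)
      have MM: "M * (1 - \<tau> * l) = \<bar>\<phi> z\<bar>" using tl by (simp add: M_def)
      have "\<phi> (z - M *\<^sub>R v) \<le> \<phi> z + l * M" using slope[OF M, of "z - M *\<^sub>R v"] by simp
      then have "\<tau> * \<phi> (z - M *\<^sub>R v) \<le> \<tau> * (\<phi> z + l * M)" using \<tau> by (intro mult_left_mono) auto
      moreover have "\<tau> * \<phi> z \<le> \<bar>\<phi> z\<bar>"
        using \<tau> by (metis abs_ge_self abs_ge_zero abs_mult abs_of_nonneg atLeastAtMost_iff mult_left_le_one_le order_trans)
      ultimately have hi: "?g M \<ge> 0" using MM by (simp add: algebra_simps)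
      have "\<phi> z \<le> \<phi> (z + M *\<^sub>R v) + l * M" using slope[OF M, of z] by simp
      then have "\<tau> * \<phi> z \<le> \<tau> * (\<phi> (z + M *\<^sub>R v) + l * M)" using \<tau> by (intro mult_left_mono) auto
      moreover have "- \<bar>\<phi> z\<bar> \<le> \<tau> * \<phi> z"
        using \<tau> by (smt (verit) atLeastAtMost_iff mult_left_le_one_le mult_nonneg_nonneg mult_minus_right)
      ultimately have lo: "?g (-M) \<le> 0" using MM by (simp add: algebra_simps)
      have "continuous_on {-M..M} ?g" by (intro continuous_intros continuous_on_compose2[OF \<phi>]) auto
      then obtain \<theta> where "?g \<theta> = 0" using IVT'[of ?g "-M" 0 M] lo hi M by auto
      then have "z = ?h (z - \<theta> *\<^sub>R v)" by simp
      then show ?thesis by (rule range_eqI)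
    qed
    then show ?thesis by blast
  qed
  obtain g where "homeomorphism UNIV (?h ` UNIV) ?h g"
    using invariance_of_domain_homeomorphism[OF open_UNIV cont _ inj] by auto
  then show "\<exists>g. homeomorphism UNIV UNIV ?h g" using surj by auto
qed

section \<open>Projections\<close>

text \<open>
  The value of \<open>upper\<close> away from the double points is arbitrary; this choice treats
  points without any partner below them as lower points.
\<close>

definition projection :: "link \<Rightarrow> diagram" where
  "projection K = Diagram (link_components K) (\<lambda>i t. fst (link_curve K i t))
     (\<lambda>i t. \<exists>j s. j < link_components K \<and> fst (link_curve K j s) = fst (link_curve K i t) \<and>
        snd (link_curve K j s) < snd (link_curve K i t))"

lemma projection_simps [simp]:
  "components (projection K) = link_components K"
  "curve (projection K) i t = fst (link_curve K i t)"
  "curve (projection K) i = (\<lambda>t. fst (link_curve K i t))"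
  by (simp_all add: projection_def)

lemma embedded_link_cong:
  assumes "embedded_link K" "i < link_components K" "s - t \<in> \<int>"
  shows "link_curve K i s = link_curve K i t"
  using assms closed_curve_cong_Ints[of "link_curve K i" s t] by (auto simp: embedded_link_def closed_curve_def)

text \<open>Without triple points, the only point below a given one is its partner.\<close>

lemma projection_upper:
  assumes K: "embedded_link K"
    and tr: "\<And>p q r. double_point (projection K) p q \<Longrightarrow> double_point (projection K) p r \<Longrightarrow> same_point q r"
    and dp: "double_point (projection K) (i, s) (j, t)"
  shows "upper (projection K) i s \<longleftrightarrow> snd (link_curve K j t) < snd (link_curve K i s)"
proof
  have ij: "i < link_components K" "j < link_components K" "fst (link_curve K i s) = fst (link_curve K j t)"
    using dp by (auto simp: double_point_def)
  show "upper (projection K) i s" if "snd (link_curve K j t) < snd (link_curve K i s)"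
    unfolding projection_def diagram.sel using ij that by metis
  assume "upper (projection K) i s"
  then obtain k r where k: "k < link_components K" "fst (link_curve K k r) = fst (link_curve K i s)"
    "snd (link_curve K k r) < snd (link_curve K i s)" by (auto simp: projection_def)
  have "\<not> same_point (i, s) (k, r)"
    using k embedded_link_cong[OF K, of k s r] by (auto simp: same_point_def)
  then have "double_point (projection K) (i, s) (k, r)" using k ij by (simp add: double_point_def)
  then have "same_point (j, t) (k, r)" using tr dp by blast
  then show "snd (link_curve K j t) < snd (link_curve K i s)"
    using k embedded_link_cong[OF K, of k t r] by (auto simp: same_point_def)
qed

lemma projection_diagram:
  assumes K: "embedded_link K"
    and poly: "\<And>i. i < link_components K \<Longrightarrow> polygonal_loop (\<lambda>t. fst (link_curve K i t))"
    and dp: "\<And>p q. double_point (projection K) p q \<Longrightarrow>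
        curve (projection K) (fst p) differentiable at (snd p) \<and> velocity_det (projection K) p q \<noteq> 0"
    and tr: "\<And>p q r. double_point (projection K) p q \<Longrightarrow> double_point (projection K) p r \<Longrightarrow> same_point q r"
  shows "is_diagram (projection K)" "projects_to K (projection K)"
proof -
  have dps: "double_point D p q \<Longrightarrow> double_point D q p" for D p q
    unfolding double_point_def using same_point_sym by metis
  have up: "upper (projection K) i s \<longleftrightarrow> snd (link_curve K j t) < snd (link_curve K i s)"
    if "double_point (projection K) (i, s) (j, t)" for i s j t
    by (rule projection_upper[OF K tr that])
  show "projects_to K (projection K)" using up by (simp add: projects_to_def)
  have "upper (projection K) (fst p) (snd p) \<noteq> upper (projection K) (fst q) (snd q)"
    if d: "double_point (projection K) p q" for p q
  proof -
    have 1: "double_point (projection K) (fst p, snd p) (fst q, snd q)" "double_point (projection K) (fst q, snd q) (fst p, snd p)"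
      using d dps by auto
    have "link_curve K (fst p) (snd p) \<noteq> link_curve K (fst q) (snd q)"
      using d K unfolding embedded_link_def double_point_def by (metis prod.collapse projection_simps(1))
    moreover have "fst (link_curve K (fst p) (snd p)) = fst (link_curve K (fst q) (snd q))"
      using d by (simp add: double_point_def)
    ultimately have "snd (link_curve K (fst p) (snd p)) \<noteq> snd (link_curve K (fst q) (snd q))"
      by (simp add: prod_eq_iff)
    then show ?thesis using up[OF 1(1)] up[OF 1(2)] by auto
  qed
  note alt = this
  show "is_diagram (projection K)" unfolding is_diagram_def
  proof (intro conjI allI impI)
    show "polygonal_loop (curve (projection K) i)" if "i < components (projection K)" for i
      using poly[of i] that by simp
    fix p q assume d: "double_point (projection K) p q"
    show "curve (projection K) (fst p) differentiable at (snd p)" "velocity_det (projection K) p q \<noteq> 0"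
      using dp[OF d] by blast+
    show "curve (projection K) (fst q) differentiable at (snd q)" using dp[OF dps[OF d]] by blast
    show "upper (projection K) (fst p) (snd p) \<noteq> upper (projection K) (fst q) (snd q)" by (rule alt[OF d])
  qed (use tr in blast)
qed

section \<open>Generic projections of polygonal links\<close>

text \<open>
  A shear that keeps heights. Projecting the sheared link vertically amounts to projecting the
  link along the direction \<open>(- w, 1)\<close>.
\<close>

definition tilt :: "complex \<Rightarrow> complex \<times> real \<Rightarrow> complex \<times> real" where
  "tilt w p = (fst p + of_real (snd p) * w, snd p)"

lemma ambient_isotopy_tilt: "ambient_isotopy (\<lambda>\<tau> p. p + (\<tau> * snd p) *\<^sub>R (w :: complex, 0::real))" (is "ambient_isotopy ?H")
proof (rule ambient_isotopy_push[where l = 0])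
  show "continuous_on UNIV (\<lambda>p :: complex \<times> real. snd p)" by (intro continuous_intros)
qed auto

lemma tilt_eq: "tilt w = (\<lambda>p. p + (1 * snd p) *\<^sub>R (w, 0::real))"
  by (auto simp: tilt_def prod_eq_iff scaleR_conv_of_real)

lemma polygonal_loop_direction:
  assumes "polygonal_loop c"
  obtains h v w where "h > 0" "v \<noteq> 0" "w \<noteq> 0"
    "\<And>r. t \<le> r \<Longrightarrow> r < t + h \<Longrightarrow> c r = c t + (r - t) *\<^sub>R v"
    "\<And>r. t - h < r \<Longrightarrow> r \<le> t \<Longrightarrow> c r = c t + (r - t) *\<^sub>R w"
proof -
  obtain v where v: "v \<noteq> 0" "\<forall>\<^sub>F h in at_right 0. c (t + h) = c t + h *\<^sub>R v"
    using assms unfolding polygonal_loop_def by blast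
  obtain w where w: "w \<noteq> 0" "\<forall>\<^sub>F h in at_left 0. c (t + h) = c t + h *\<^sub>R w"
    using assms unfolding polygonal_loop_def by blast
  obtain a where a: "a > 0" "\<And>h. 0 < h \<Longrightarrow> h < a \<Longrightarrow> c (t + h) = c t + h *\<^sub>R v"
    using v(2) unfolding eventually_at_right_field by blast
  obtain b where b: "b < 0" "\<And>h. b < h \<Longrightarrow> h < 0 \<Longrightarrow> c (t + h) = c t + h *\<^sub>R w"
    using w(2) unfolding eventually_at_left_field by blast
  show ?thesis
  proof (rule that[of "min a (-b)" v w])
    fix r assume r: "t \<le> r" "r < t + min a (-b)"
    then show "c r = c t + (r - t) *\<^sub>R v" using a(2)[of "r - t"] by (cases "r = t") auto
  next
    fix r assume r: "t - min a (-b) < r" "r \<le> t"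
    then show "c r = c t + (r - t) *\<^sub>R w" using b(2)[of "r - t"] by (cases "r = t") auto
  qed (use a b v w in auto)
qed

text \<open>
  Linearity on an open interval, with the line given by its point at some parameter
  \<open>\<tau>\<close>. This is how countably many pairs of a point and a direction describe
  all edges.
\<close>

definition runs_along :: "link \<Rightarrow> nat \<Rightarrow> real \<Rightarrow> real \<Rightarrow> complex \<times> real \<Rightarrow> bool" where
  "runs_along K i t \<tau> d \<longleftrightarrow>
     (\<exists>\<epsilon>>0. \<forall>r. \<bar>r - t\<bar> < \<epsilon> \<longrightarrow> link_curve K i r = link_curve K i \<tau> + (r - \<tau>) *\<^sub>R d)"

text \<open>
  By compactness a polygonal loop has finitely many edges, but countability suffices for
  genericity and follows directly from Lindelof coverings of the line: around each parameter
  there is an interval on both halves of which the loop is straight. The set \<open>T\<close>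
  contains the centres of a countable subcover and in particular all vertices.
\<close>

lemma countably_many_edges:
  assumes K: "polygonal_link K"
  obtains T Ed where "countable (T :: real set)" "countable (Ed :: (nat \<times> real \<times> complex \<times> real) set)"
    "\<And>i \<tau> d. (i, \<tau>, d) \<in> Ed \<Longrightarrow> i < link_components K \<and> d \<noteq> 0"
    "\<And>i t. i < link_components K \<Longrightarrow> t \<in> T \<or> (\<exists>\<tau> d. (i, \<tau>, d) \<in> Ed \<and> runs_along K i t \<tau> d)"
    "\<And>i t. i < link_components K \<Longrightarrow> \<exists>\<epsilon> v w. \<epsilon> > 0 \<and> (\<exists>\<tau>. (i, \<tau>, v) \<in> Ed) \<and> (\<exists>\<tau>. (i, \<tau>, w) \<in> Ed) \<and>
       (\<forall>r. t \<le> r \<longrightarrow> r < t + \<epsilon> \<longrightarrow> link_curve K i r = link_curve K i t + (r - t) *\<^sub>R v) \<and>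
       (\<forall>r. t - \<epsilon> < r \<longrightarrow> r \<le> t \<longrightarrow> link_curve K i r = link_curve K i t + (r - t) *\<^sub>R w)"
proof -
  let ?n = "link_components K"
  have poly: "polygonal_loop (link_curve K i)" if "i < ?n" for i using K that by (simp add: polygonal_link_def)
  define P where "P i t x \<longleftrightarrow> fst x > 0 \<and> fst (snd x) \<noteq> 0 \<and> snd (snd x) \<noteq> 0 \<and>
    (\<forall>r. t \<le> r \<longrightarrow> r < t + fst x \<longrightarrow> link_curve K i r = link_curve K i t + (r - t) *\<^sub>R fst (snd x)) \<and>
    (\<forall>r. t - fst x < r \<longrightarrow> r \<le> t \<longrightarrow> link_curve K i r = link_curve K i t + (r - t) *\<^sub>R snd (snd x))"
    for i t and x :: "real \<times> (complex \<times> real) \<times> (complex \<times> real)"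
  have ex: "\<exists>x. P i t x" if "i < ?n" for i t
  proof (rule polygonal_loop_direction[OF poly[OF that], of t])
    fix h :: real and v w :: "complex \<times> real"
    assume "h > 0" "v \<noteq> 0" "w \<noteq> 0" "\<And>r. t \<le> r \<Longrightarrow> r < t + h \<Longrightarrow> link_curve K i r = link_curve K i t + (r - t) *\<^sub>R v"
      "\<And>r. t - h < r \<Longrightarrow> r \<le> t \<Longrightarrow> link_curve K i r = link_curve K i t + (r - t) *\<^sub>R w"
    then have "P i t (h, v, w)" unfolding P_def fst_conv snd_conv by blast
    then show ?thesis by blast
  qed
  define F where "F i t = (SOME x. P i t x)" for i t
  have F: "P i t (F i t)" if "i < ?n" for i t unfolding F_def by (rule someI_ex[OF ex[OF that]])
  define h v w where "h i t = fst (F i t)" and "v i t = fst (snd (F i t))" and "w i t = snd (snd (F i t))" for i t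
  have hvw: "\<And>i t. i < ?n \<Longrightarrow> h i t > 0" "\<And>i t. i < ?n \<Longrightarrow> v i t \<noteq> 0" "\<And>i t. i < ?n \<Longrightarrow> w i t \<noteq> 0"
    "\<And>i t r. i < ?n \<Longrightarrow> t \<le> r \<Longrightarrow> r < t + h i t \<Longrightarrow> link_curve K i r = link_curve K i t + (r - t) *\<^sub>R v i t"
    "\<And>i t r. i < ?n \<Longrightarrow> t - h i t < r \<Longrightarrow> r \<le> t \<Longrightarrow> link_curve K i r = link_curve K i t + (r - t) *\<^sub>R w i t"
    using F unfolding P_def h_def v_def w_def by blast+
  have "\<exists>T. countable T \<and> (\<forall>t. \<exists>\<tau>\<in>T. t \<in> ball \<tau> (h i \<tau>))" if i: "i < ?n" for i
  proof -
    let ?F = "range (\<lambda>\<tau>. ball \<tau> (h i \<tau>))"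
    obtain F' where F': "F' \<subseteq> ?F" "countable F'" "\<Union>F' = \<Union>?F"
      using Lindelof[of ?F] by auto
    have "\<Union>?F = UNIV" using hvw(1)[OF i] by (auto intro: centre_in_ball[THEN iffD2])
    have "\<exists>T. countable T \<and> F' = (\<lambda>\<tau>. ball \<tau> (h i \<tau>)) ` T"
      using F'(1,2) by (metis countable_subset_image)
    then obtain T where T: "countable T" "F' = (\<lambda>\<tau>. ball \<tau> (h i \<tau>)) ` T" by blast
    have "\<forall>t. \<exists>\<tau>\<in>T. t \<in> ball \<tau> (h i \<tau>)"
    proof
      fix t have "t \<in> \<Union>F'" using F'(3) \<open>\<Union>?F = UNIV\<close> by simp
      then show "\<exists>\<tau>\<in>T. t \<in> ball \<tau> (h i \<tau>)" unfolding T(2) by blast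
    qed
    then show ?thesis using T(1) by blast
  qed
  then obtain T where T: "\<And>i. i < ?n \<Longrightarrow> countable (T i)" "\<And>i t. i < ?n \<Longrightarrow> \<exists>\<tau>\<in>T i. t \<in> ball \<tau> (h i \<tau>)"
    by metis
  define T' where "T' = (\<Union>i<?n. T i)"
  define Ed where "Ed = (\<Union>i<?n. (\<lambda>\<tau>. (i, \<tau>, v i \<tau>)) ` T i \<union> (\<lambda>\<tau>. (i, \<tau>, w i \<tau>)) ` T i)"
  have count: "countable T'" "countable Ed"
    using T(1) unfolding T'_def Ed_def by (auto intro!: countable_UN)
  have ed: "i < ?n \<and> d \<noteq> 0" if "(i, \<tau>, d) \<in> Ed" for i \<tau> d using that hvw(2,3) by (auto simp: Ed_def)
  have alt: "t \<in> T' \<or> (\<exists>\<tau> d. (i, \<tau>, d) \<in> Ed \<and> runs_along K i t \<tau> d)" if i: "i < ?n" for i t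
  proof -
    obtain \<tau> where \<tau>: "\<tau> \<in> T i" "\<bar>\<tau> - t\<bar> < h i \<tau>" using T(2)[OF i, of t] by (auto simp: dist_real_def)
    show ?thesis
    proof (cases t \<tau> rule: linorder_cases)
      case less
      have "link_curve K i r = link_curve K i \<tau> + (r - \<tau>) *\<^sub>R w i \<tau>"
        if "\<bar>r - t\<bar> < min (\<tau> - t) (h i \<tau> - (\<tau> - t))" for r
        by (rule hvw(5)[OF i]) (use that less in auto)
      moreover have "min (\<tau> - t) (h i \<tau> - (\<tau> - t)) > 0" using less \<tau> by auto
      ultimately have "runs_along K i t \<tau> (w i \<tau>)" unfolding runs_along_def by blast
      moreover have "(i, \<tau>, w i \<tau>) \<in> Ed" using \<tau> i by (auto simp: Ed_def)
      ultimately show ?thesis by blast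
    next
      case equal then show ?thesis using \<tau> i by (auto simp: T'_def)
    next
      case greater
      have "link_curve K i r = link_curve K i \<tau> + (r - \<tau>) *\<^sub>R v i \<tau>"
        if "\<bar>r - t\<bar> < min (t - \<tau>) (h i \<tau> - (t - \<tau>))" for r
        by (rule hvw(4)[OF i]) (use that greater in auto)
      moreover have "min (t - \<tau>) (h i \<tau> - (t - \<tau>)) > 0" using greater \<tau> by auto
      ultimately have "runs_along K i t \<tau> (v i \<tau>)" unfolding runs_along_def by blast
      moreover have "(i, \<tau>, v i \<tau>) \<in> Ed" using \<tau> i by (auto simp: Ed_def)
      ultimately show ?thesis by blast
    qed
  qed
  have dirs: "\<exists>\<epsilon> v w. \<epsilon> > 0 \<and> (\<exists>\<tau>. (i, \<tau>, v) \<in> Ed) \<and> (\<exists>\<tau>. (i, \<tau>, w) \<in> Ed) \<and>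
       (\<forall>r. t \<le> r \<longrightarrow> r < t + \<epsilon> \<longrightarrow> link_curve K i r = link_curve K i t + (r - t) *\<^sub>R v) \<and>
       (\<forall>r. t - \<epsilon> < r \<longrightarrow> r \<le> t \<longrightarrow> link_curve K i r = link_curve K i t + (r - t) *\<^sub>R w)"
    if i: "i < ?n" for i t
  proof -
    obtain \<tau> where \<tau>: "\<tau> \<in> T i" "\<bar>\<tau> - t\<bar> < h i \<tau>" using T(2)[OF i, of t] by (auto simp: dist_real_def)
    have in_Ed: "(i, \<tau>, v i \<tau>) \<in> Ed" "(i, \<tau>, w i \<tau>) \<in> Ed" using \<tau> i by (auto simp: Ed_def)
    show ?thesis
    proof (cases "t = \<tau>")
      case True
      then show ?thesis using hvw(1)[OF i, of \<tau>] hvw(4,5)[OF i, of \<tau>] in_Ed by blast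
    next
      case False
      have shift: ?thesis if along: "\<And>r. \<bar>r - t\<bar> < \<epsilon> \<Longrightarrow> link_curve K i r = link_curve K i \<tau> + (r - \<tau>) *\<^sub>R d"
        and "\<epsilon> > 0" and d: "(i, \<tau>, d) \<in> Ed" for \<epsilon> d
      proof -
        have near: "link_curve K i r = link_curve K i t + (r - t) *\<^sub>R d" if r: "\<bar>r - t\<bar> < \<epsilon>" for r
        proof -
          have "link_curve K i t = link_curve K i \<tau> + (t - \<tau>) *\<^sub>R d" using along[of t] \<open>\<epsilon> > 0\<close> by simp
          then show ?thesis by (simp only: along[OF r]) (simp add: algebra_simps)
        qed
        have "(\<forall>r. t \<le> r \<longrightarrow> r < t + \<epsilon> \<longrightarrow> link_curve K i r = link_curve K i t + (r - t) *\<^sub>R d) \<and>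
          (\<forall>r. t - \<epsilon> < r \<longrightarrow> r \<le> t \<longrightarrow> link_curve K i r = link_curve K i t + (r - t) *\<^sub>R d)"
          by (intro conjI allI impI near) linarith+
        then show ?thesis using \<open>\<epsilon> > 0\<close> d by blast
      qed
      show ?thesis
      proof (cases "t < \<tau>")
        case True
        show ?thesis
        proof (rule shift[of "min (\<tau> - t) (h i \<tau> - (\<tau> - t))" "w i \<tau>"])
          fix r assume "\<bar>r - t\<bar> < min (\<tau> - t) (h i \<tau> - (\<tau> - t))"
          then show "link_curve K i r = link_curve K i \<tau> + (r - \<tau>) *\<^sub>R w i \<tau>"
            by (intro hvw(5)[OF i]) (use True in auto)
        qed (use True \<tau> in_Ed in auto)
      next
        case False
        then have gt: "\<tau> < t" using \<open>t \<noteq> \<tau>\<close> by simp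
        show ?thesis
        proof (rule shift[of "min (t - \<tau>) (h i \<tau> - (t - \<tau>))" "v i \<tau>"])
          fix r assume "\<bar>r - t\<bar> < min (t - \<tau>) (h i \<tau> - (t - \<tau>))"
          then show "link_curve K i r = link_curve K i \<tau> + (r - \<tau>) *\<^sub>R v i \<tau>"
            by (intro hvw(4)[OF i]) (use gt in auto)
        qed (use gt \<tau> in_Ed in auto)
      qed
    qed
  qed
  show ?thesis by (rule that[OF count ed alt dirs])
qed

text \<open>The vertical projection of the tilted point.\<close>

definition shadow :: "complex \<Rightarrow> complex \<times> real \<Rightarrow> complex" where
  "shadow w p = fst p + of_real (snd p) * w"

lemma fst_tilt: "fst (tilt w p) = shadow w p"
  by (simp add: tilt_def shadow_def)

lemma shadow_linear:
  "shadow w (p + q) = shadow w p + shadow w q" "shadow w (p - q) = shadow w p - shadow w q"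
  "shadow w (c *\<^sub>R p) = of_real c * shadow w p" "shadow w 0 = 0"
  by (simp_all add: shadow_def scaleR_conv_of_real algebra_simps)

text \<open>
  The plane spanned by \<open>X\<close> and \<open>Y\<close> contains the direction \<open>(- w,
  1)\<close> of projection only for \<open>w\<close> on a line.
\<close>

lemma negligible_shadow_span:
  obtains N where "negligible N"
    "\<And>w \<alpha> \<beta>. \<alpha> *\<^sub>R X + \<beta> *\<^sub>R Y \<noteq> 0 \<Longrightarrow> shadow w (\<alpha> *\<^sub>R X + \<beta> *\<^sub>R Y) = 0 \<Longrightarrow> w \<in> N"
proof -
  have "dim {X, Y} \<le> card {X, Y}" by (rule dim_le_card') simp
  also have "\<dots> \<le> 2" by (simp add: card_insert_if)
  finally have "dim {X, Y} < DIM(complex \<times> real)" by simp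
  then obtain n where n: "n \<noteq> 0" "\<And>y. y \<in> span {X, Y} \<Longrightarrow> orthogonal n y"
    by (rule orthogonal_to_subspace_exists) (rule that)
  let ?N = "{w. inner (fst n) w = snd n}"
  show ?thesis
  proof (rule that[of ?N])
    show "negligible ?N" using n(1) by (intro negligible_hyperplane) (auto simp: prod_eq_iff)
    fix w \<alpha> \<beta> let ?Z = "\<alpha> *\<^sub>R X + \<beta> *\<^sub>R Y"
    assume Z: "?Z \<noteq> 0" "shadow w ?Z = 0"
    have "orthogonal n ?Z" by (intro n(2) span_add span_scale span_base) auto
    then have o: "inner (fst n) (fst ?Z) + snd n * snd ?Z = 0" by (simp add: orthogonal_def inner_prod_def)
    have f: "fst ?Z = - (snd ?Z *\<^sub>R w)"
      using Z(2) by (simp add: shadow_def scaleR_conv_of_real eq_neg_iff_add_eq_0)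
    have s: "snd ?Z \<noteq> 0" using Z(1) f by (auto simp: prod_eq_iff)
    have "snd ?Z * (snd n - inner (fst n) w) = 0" using o unfolding f by (simp add: algebra_simps)
    then show "w \<in> ?N" using s by simp
  qed
qed

text \<open>
  The tilts for which a line \<open>P + s d\<close> meets the lines \<open>Q + \<sigma>
  d'\<close> and \<open>R + \<rho> d''\<close> in one point of the projection form a curve: for
  each \<open>s\<close> the direction of projection lies in the plane through \<open>P + s
  d\<close> and the second line and in the plane through \<open>P + s d\<close> and the third
  line, so it is determined by \<open>s\<close> and depends on it rationally. A differentiable
  curve in the plane is negligible.
\<close>

lemma negligible_triple_shadows:
  "negligible {w. \<exists>s \<sigma> \<rho>. shadow w (P + s *\<^sub>R d - (Q + \<sigma> *\<^sub>R d')) = 0 \<and>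
      shadow w (P + s *\<^sub>R d - (R + \<rho> *\<^sub>R d'')) = 0 \<and> det2 (shadow w d') (shadow w d'') \<noteq> 0 \<and>
      snd (P + s *\<^sub>R d) \<noteq> snd (Q + \<sigma> *\<^sub>R d') \<and> snd (P + s *\<^sub>R d) \<noteq> snd (R + \<rho> *\<^sub>R d'')}"
    (is "negligible ?M")
proof -
  define Br Bi A where
    "Br = (\<lambda>(Q :: complex \<times> real) (e :: complex \<times> real) s.
        (snd P + s * snd d - snd Q) * Re (fst e) - snd e * (Re (fst P) + s * Re (fst d) - Re (fst Q)))"
    and "Bi = (\<lambda>(Q :: complex \<times> real) (e :: complex \<times> real) s.
        (snd P + s * snd d - snd Q) * Im (fst e) - snd e * (Im (fst P) + s * Im (fst d) - Im (fst Q)))"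
    and "A = (\<lambda>(Q :: complex \<times> real) (e :: complex \<times> real) s.
        Re (fst e) * (Im (fst P) + s * Im (fst d) - Im (fst Q)) - Im (fst e) * (Re (fst P) + s * Re (fst d) - Re (fst Q)))"
  define \<Delta> where "\<Delta> s = Br Q d' s * Bi R d'' s - Bi Q d' s * Br R d'' s" for s
  define Fr where "Fr s = (A R d'' s * Br Q d' s - A Q d' s * Br R d'' s) / \<Delta> s" for s
  define Fi where "Fi s = (A R d'' s * Bi Q d' s - A Q d' s * Bi R d'' s) / \<Delta> s" for s
  define F where "F s = of_real (Fr s) + \<i> * of_real (Fi s)" for s
  have "?M \<subseteq> F ` {s. \<Delta> s \<noteq> 0}"
  proof
    fix w assume "w \<in> ?M"
    then obtain s \<sigma> \<rho> where e: "shadow w (P + s *\<^sub>R d - (Q + \<sigma> *\<^sub>R d')) = 0"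
      "shadow w (P + s *\<^sub>R d - (R + \<rho> *\<^sub>R d'')) = 0" "det2 (shadow w d') (shadow w d'') \<noteq> 0"
      "snd (P + s *\<^sub>R d) \<noteq> snd (Q + \<sigma> *\<^sub>R d')" "snd (P + s *\<^sub>R d) \<noteq> snd (R + \<rho> *\<^sub>R d'')" by blast
    \<comment> \<open>The three quantities express that \<open>w\<close> solves a linear equation
      with coefficients depending on \<open>s\<close>; the lines \<open>Q + \<sigma> e\<close> for
      \<open>e = d'\<close> and \<open>R + \<rho> d''\<close> give two such equations with
      determinant \<open>\<Delta> s\<close>.\<close>
    have key: "Br Q e s = (snd P + s * snd d - snd Q - \<sigma> * snd e) * Re (shadow w e) \<and>
        Bi Q e s = (snd P + s * snd d - snd Q - \<sigma> * snd e) * Im (shadow w e) \<and>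
        Br Q e s * Im w - Bi Q e s * Re w = - A Q e s"
      if z: "shadow w (P + s *\<^sub>R d - (Q + \<sigma> *\<^sub>R e)) = 0" for Q e \<sigma>
    proof -
      have r: "Re (fst P) + s * Re (fst d) - Re (fst Q) =
          \<sigma> * Re (shadow w e) - (snd P + s * snd d - snd Q) * Re w"
        and i: "Im (fst P) + s * Im (fst d) - Im (fst Q) =
          \<sigma> * Im (shadow w e) - (snd P + s * snd d - snd Q) * Im w"
        using z by (auto simp: shadow_def complex_eq_iff algebra_simps)
      have er: "Re (fst e) = Re (shadow w e) - snd e * Re w" and ei: "Im (fst e) = Im (shadow w e) - snd e * Im w"
        by (simp_all add: shadow_def)
      show ?thesis unfolding Br_def Bi_def A_def r i er ei by (simp add: algebra_simps)
    qed
    note k1 = key[OF e(1)] and k2 = key[OF e(2)]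
    have h: "snd P + s * snd d - snd Q - \<sigma> * snd d' \<noteq> 0" "snd P + s * snd d - snd R - \<rho> * snd d'' \<noteq> 0"
      using e(4,5) by auto
    have "\<Delta> s = (snd P + s * snd d - snd Q - \<sigma> * snd d') * (snd P + s * snd d - snd R - \<rho> * snd d'') *
        det2 (shadow w d') (shadow w d'')"
      unfolding \<Delta>_def k1[THEN conjunct1] k1[THEN conjunct2, THEN conjunct1]
        k2[THEN conjunct1] k2[THEN conjunct2, THEN conjunct1] by algebra
    then have \<Delta>: "\<Delta> s \<noteq> 0" using h e(3) by simp
    have "\<Delta> s * Re w = A R d'' s * Br Q d' s - A Q d' s * Br R d'' s"
      "\<Delta> s * Im w = A R d'' s * Bi Q d' s - A Q d' s * Bi R d'' s"
      using k1 k2 unfolding \<Delta>_def by algebra+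
    then have "Re w = Fr s" "Im w = Fi s" using \<Delta> by (auto simp: Fr_def Fi_def field_simps)
    then have "w = F s" by (simp add: F_def complex_eq_iff)
    then show "w \<in> F ` {s. \<Delta> s \<noteq> 0}" using \<Delta> by blast
  qed
  moreover have "negligible (F ` {s. \<Delta> s \<noteq> 0})"
  proof (rule negligible_differentiable_image_lowdim)
    have dA: "A Q e differentiable at s" "Br Q e differentiable at s" "Bi Q e differentiable at s" for Q e s
      unfolding A_def Br_def Bi_def by (auto intro!: derivative_intros)
    then have d\<Delta>: "\<Delta> differentiable at s" for s
      unfolding \<Delta>_def by (auto intro!: derivative_intros)
    have "F differentiable at s" if "\<Delta> s \<noteq> 0" for s
    proof -
      have "Fr differentiable at s" "Fi differentiable at s"
        unfolding Fr_def Fi_def using that by (auto intro!: derivative_intros differentiable_divide dA d\<Delta>)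
      then obtain a b where "(Fr has_field_derivative a) (at s)" "(Fi has_field_derivative b) (at s)"
        using real_differentiable_def by blast
      then have "(F has_vector_derivative (of_real a + \<i> * of_real b)) (at s)"
        unfolding F_def by (intro derivative_intros)
      then show ?thesis by (rule differentiableI_vector)
    qed
    then show "F differentiable_on {s. \<Delta> s \<noteq> 0}"
      unfolding differentiable_on_def using differentiable_at_withinI by blast
  qed simp
  ultimately show ?thesis using negligible_subset by blast
qed

lemma countable_UN_negligible:
  assumes "countable I" "\<And>i. i \<in> I \<Longrightarrow> negligible (S i)" shows "negligible (\<Union>i\<in>I. S i)"
  using negligible_countable_Union[of "S ` I"] assms by auto

lemma shadow_height: "shadow w p = shadow w q \<Longrightarrow> p \<noteq> q \<Longrightarrow> snd p \<noteq> snd q"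
  by (auto simp: shadow_def prod_eq_iff)

text \<open>
  The bad tilts are covered by countably many negligible sets. They contract an edge
  (\<open>S1\<close>), project a vertex to another vertex or to an edge (\<open>S2\<close>,
  \<open>S3\<close>), make the projections of two edges parallel or equal (\<open>S4\<close>),
  or project three edges to a common point (\<open>S5\<close>).
\<close>

theorem generic_tilt:
  assumes K: "polygonal_link K"
  obtains N where "negligible N"
    "\<And>w. w \<notin> N \<Longrightarrow> is_diagram (projection (image_link (tilt w) K))"
    "\<And>w. w \<notin> N \<Longrightarrow> projects_to (image_link (tilt w) K) (projection (image_link (tilt w) K))"
    "\<And>w i s q. w \<notin> N \<Longrightarrow> double_point (projection (image_link (tilt w) K)) (i, s) q \<Longrightarrow>
       \<exists>\<tau> d. runs_along K i s \<tau> d"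
proof -
  let ?n = "link_components K" and ?c = "link_curve K"
  obtain T Ed where ct: "countable (T :: real set)" "countable (Ed :: (nat \<times> real \<times> complex \<times> real) set)"
    and ed: "\<And>i \<tau> d. (i, \<tau>, d) \<in> Ed \<Longrightarrow> i < ?n \<and> d \<noteq> 0"
    and alt: "\<And>i t. i < ?n \<Longrightarrow> t \<in> T \<or> (\<exists>\<tau> d. (i, \<tau>, d) \<in> Ed \<and> runs_along K i t \<tau> d)"
    and dirs: "\<And>i t. i < ?n \<Longrightarrow> \<exists>\<epsilon> v w. \<epsilon> > 0 \<and> (\<exists>\<tau>. (i, \<tau>, v) \<in> Ed) \<and> (\<exists>\<tau>. (i, \<tau>, w) \<in> Ed) \<and>
       (\<forall>r. t \<le> r \<longrightarrow> r < t + \<epsilon> \<longrightarrow> ?c i r = ?c i t + (r - t) *\<^sub>R v) \<and>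
       (\<forall>r. t - \<epsilon> < r \<longrightarrow> r \<le> t \<longrightarrow> ?c i r = ?c i t + (r - t) *\<^sub>R w)"
    by (rule countably_many_edges[OF K]) (rule that)
  have "\<exists>N. negligible N \<and> (\<forall>w \<alpha> \<beta>. \<alpha> *\<^sub>R X + \<beta> *\<^sub>R Y \<noteq> 0 \<longrightarrow> shadow w (\<alpha> *\<^sub>R X + \<beta> *\<^sub>R Y) = 0 \<longrightarrow> w \<in> N)" for X Y
    by (rule negligible_shadow_span[of X Y]) blast
  then obtain N where N: "\<And>X Y. negligible (N X Y)"
    "\<And>X Y w \<alpha> \<beta>. \<alpha> *\<^sub>R X + \<beta> *\<^sub>R Y \<noteq> 0 \<Longrightarrow> shadow w (\<alpha> *\<^sub>R X + \<beta> *\<^sub>R Y) = 0 \<Longrightarrow> w \<in> N X Y"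
    by metis
  define M where "M P d Q d' R d'' = {w. \<exists>s \<sigma> \<rho>. shadow w (P + s *\<^sub>R d - (Q + \<sigma> *\<^sub>R d')) = 0 \<and>
      shadow w (P + s *\<^sub>R d - (R + \<rho> *\<^sub>R d'')) = 0 \<and> det2 (shadow w d') (shadow w d'') \<noteq> 0 \<and>
      snd (P + s *\<^sub>R d) \<noteq> snd (Q + \<sigma> *\<^sub>R d') \<and> snd (P + s *\<^sub>R d) \<noteq> snd (R + \<rho> *\<^sub>R d'')}" for P d Q d' R d''
  have M: "negligible (M P d Q d' R d'')" for P d Q d' R d''
    unfolding M_def by (rule negligible_triple_shadows)
  define V where "V = ({..<?n} \<times> T)"
  have cV: "countable V" unfolding V_def using ct by auto
  define S1 where "S1 = (\<Union>e\<in>Ed. N (snd (snd e)) 0)"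
  define S2 where "S2 = (\<Union>e\<in>V. \<Union>f\<in>V. N (?c (fst e) (snd e) - ?c (fst f) (snd f)) 0)"
  define S3 where "S3 = (\<Union>e\<in>V. \<Union>f\<in>Ed. N (?c (fst e) (snd e) - ?c (fst f) (fst (snd f))) (snd (snd f)))"
  define S4 where "S4 = (\<Union>e\<in>Ed. \<Union>f\<in>Ed. N (snd (snd e)) (snd (snd f)) \<union>
      N (?c (fst e) (fst (snd e)) - ?c (fst f) (fst (snd f))) (snd (snd e)))"
  define S5 where "S5 = (\<Union>e\<in>Ed. \<Union>f\<in>Ed. \<Union>g\<in>Ed. M (?c (fst e) (fst (snd e))) (snd (snd e))
      (?c (fst f) (fst (snd f))) (snd (snd f)) (?c (fst g) (fst (snd g))) (snd (snd g)))"
  define Bad where "Bad = S1 \<union> S2 \<union> S3 \<union> S4 \<union> S5"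
  have Bad1: "w \<in> Bad" if "(i, \<tau>, d) \<in> Ed" "w \<in> N d 0" for i \<tau> d w
  proof -
    have "w \<in> S1" unfolding S1_def by (rule UN_I[OF that(1)]) (use that(2) in simp)
    then show ?thesis by (simp add: Bad_def)
  qed
  have Bad2: "w \<in> Bad" if "(i, t) \<in> V" "(j, u) \<in> V" "w \<in> N (?c i t - ?c j u) 0" for i t j u w
  proof -
    have "w \<in> S2" unfolding S2_def by (rule UN_I[OF that(1)], rule UN_I[OF that(2)]) (use that(3) in simp)
    then show ?thesis by (simp add: Bad_def)
  qed
  have Bad3: "w \<in> Bad" if "(i, t) \<in> V" "(j, \<tau>, d) \<in> Ed" "w \<in> N (?c i t - ?c j \<tau>) d" for i t j \<tau> d w
  proof -
    have "w \<in> S3" unfolding S3_def by (rule UN_I[OF that(1)], rule UN_I[OF that(2)]) (use that(3) in simp)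
    then show ?thesis by (simp add: Bad_def)
  qed
  have Bad4: "w \<in> Bad" if "(i, \<tau>, d) \<in> Ed" "(j, \<tau>', d') \<in> Ed" "w \<in> N d d' \<union> N (?c i \<tau> - ?c j \<tau>') d"
    for i \<tau> d j \<tau>' d' w
  proof -
    have "w \<in> S4" unfolding S4_def by (rule UN_I[OF that(1)], rule UN_I[OF that(2)]) (use that(3) in simp)
    then show ?thesis by (simp add: Bad_def)
  qed
  have Bad5: "w \<in> Bad" if "(i, \<tau>, d) \<in> Ed" "(j, \<tau>', d') \<in> Ed" "(k, \<tau>'', d'') \<in> Ed"
    "w \<in> M (?c i \<tau>) d (?c j \<tau>') d' (?c k \<tau>'') d''" for i \<tau> d j \<tau>' d' k \<tau>'' d'' w
  proof -
    have "w \<in> S5" unfolding S5_def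
      by (rule UN_I[OF that(1)], rule UN_I[OF that(2)], rule UN_I[OF that(3)]) (use that(4) in simp)
    then show ?thesis by (simp add: Bad_def)
  qed
  have negl: "negligible Bad" unfolding Bad_def S1_def S2_def S3_def S4_def S5_def
    by (intro negligible_Un countable_UN_negligible ct(2) cV N(1) M)
  have emb: "embedded_link K" using K by (simp add: polygonal_link_def)
  have main: "is_diagram (projection (image_link (tilt w) K)) \<and>
      projects_to (image_link (tilt w) K) (projection (image_link (tilt w) K)) \<and>
      (\<forall>i s q. double_point (projection (image_link (tilt w) K)) (i, s) q \<longrightarrow> (\<exists>\<tau> d. runs_along K i s \<tau> d))"
    if w: "w \<notin> Bad" for w
  proof -
    let ?K = "image_link (tilt w) K" and ?D = "projection (image_link (tilt w) K)"
    have curve: "curve ?D i = (\<lambda>t. shadow w (?c i t))" for i by (simp add: fst_tilt)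
    have embK: "embedded_link ?K"
      using embedded_image_link[OF ambient_isotopy_tilt[of w] emb] by (simp only: tilt_eq[symmetric])
    have b0: "shadow w d \<noteq> 0" if "(i, \<tau>, d) \<in> Ed" for i \<tau> d
    proof
      assume "shadow w d = 0"
      then have "w \<in> N d 0" using N(2)[of 1 d 0 0 w] ed[OF that] by simp
      then show False using w Bad1[OF that] by blast
    qed
    have poly: "polygonal_loop (\<lambda>t. fst (link_curve ?K i t))" if i: "i < link_components ?K" for i
      unfolding polygonal_loop_def
    proof (intro conjI allI)
      have i: "i < ?n" using i by simp
      fix t
      have "polygonal_loop (?c i)" using K i by (simp add: polygonal_link_def)
      then show "fst (link_curve ?K i (t + 1)) = fst (link_curve ?K i t)" by (simp add: polygonal_loop_def)
      obtain \<epsilon> v u \<tau> \<tau>' where e: "\<epsilon> > 0" "(i, \<tau>, v) \<in> Ed" "(i, \<tau>', u) \<in> Ed"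
        "\<And>r. t \<le> r \<Longrightarrow> r < t + \<epsilon> \<Longrightarrow> ?c i r = ?c i t + (r - t) *\<^sub>R v"
        "\<And>r. t - \<epsilon> < r \<Longrightarrow> r \<le> t \<Longrightarrow> ?c i r = ?c i t + (r - t) *\<^sub>R u"
        using dirs[OF i, of t] by metis
      show "\<exists>v. v \<noteq> 0 \<and> (\<forall>\<^sub>F h in at_right 0. fst (link_curve ?K i (t + h)) = fst (link_curve ?K i t) + h *\<^sub>R v)"
      proof (intro exI[of _ "shadow w v"] conjI b0[OF e(2)])
        show "\<forall>\<^sub>F h in at_right 0. fst (link_curve ?K i (t + h)) = fst (link_curve ?K i t) + h *\<^sub>R shadow w v"
          unfolding eventually_at_right_field
        proof (intro exI[of _ \<epsilon>] conjI allI impI e(1))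
          fix h :: real assume "0 < h" "h < \<epsilon>"
          then have "?c i (t + h) = ?c i t + h *\<^sub>R v" using e(4)[of "t + h"] by simp
          then show "fst (link_curve ?K i (t + h)) = fst (link_curve ?K i t) + h *\<^sub>R shadow w v"
            by (simp add: fst_tilt shadow_linear scaleR_conv_of_real)
        qed
      qed
      show "\<exists>v. v \<noteq> 0 \<and> (\<forall>\<^sub>F h in at_left 0. fst (link_curve ?K i (t + h)) = fst (link_curve ?K i t) + h *\<^sub>R v)"
      proof (intro exI[of _ "shadow w u"] conjI b0[OF e(3)])
        show "\<forall>\<^sub>F h in at_left 0. fst (link_curve ?K i (t + h)) = fst (link_curve ?K i t) + h *\<^sub>R shadow w u"
          unfolding eventually_at_left_field
        proof (intro exI[of _ "-\<epsilon>"] conjI allI impI)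
          show "- \<epsilon> < 0" using e(1) by simp
          fix h :: real assume "- \<epsilon> < h" "h < 0"
          then have "?c i (t + h) = ?c i t + h *\<^sub>R u" using e(5)[of "t + h"] by simp
          then show "fst (link_curve ?K i (t + h)) = fst (link_curve ?K i t) + h *\<^sub>R shadow w u"
            by (simp add: fst_tilt shadow_linear scaleR_conv_of_real)
        qed
      qed
    qed
    have distinct: "?c i s \<noteq> ?c j t" if "double_point ?D (i, s) (j, t)" for i s j t
      using that emb unfolding double_point_def embedded_link_def by auto
    have no_vertex: "s \<notin> T" if dp: "double_point ?D (i, s) (j, t)" for i s j t
    proof
      assume s: "s \<in> T"
      have ij: "i < ?n" "j < ?n" "shadow w (?c i s) = shadow w (?c j t)"
        using dp by (auto simp: double_point_def fst_tilt)
      have sV: "(i, s) \<in> V" using s ij by (simp add: V_def)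
      show False
      proof (cases "t \<in> T")
        case True
        then have tV: "(j, t) \<in> V" using ij by (simp add: V_def)
        have "w \<in> N (?c i s - ?c j t) 0"
          using N(2)[of 1 "?c i s - ?c j t" 0 0 w] distinct[OF dp] ij by (simp add: shadow_linear)
        then show False using w Bad2[OF sV tV] by blast
      next
        case False
        then obtain \<tau> d where e: "(j, \<tau>, d) \<in> Ed" "runs_along K j t \<tau> d" using alt[OF ij(2)] by blast
        have "?c j t = ?c j \<tau> + (t - \<tau>) *\<^sub>R d" using e(2) unfolding runs_along_def by force
        then have Z: "?c i s - ?c j t = 1 *\<^sub>R (?c i s - ?c j \<tau>) + (\<tau> - t) *\<^sub>R d" by (simp add: algebra_simps)
        have "w \<in> N (?c i s - ?c j \<tau>) d"
          by (rule N(2)[of 1 _ "\<tau> - t"]; unfold Z[symmetric]) (use distinct[OF dp] ij in \<open>simp_all add: shadow_linear\<close>)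
        then show False using w Bad3[OF sV e(1)] by blast
      qed
    qed
    have sym: "double_point ?D (i, s) (j, t) \<Longrightarrow> double_point ?D (j, t) (i, s)" for i s j t
      unfolding double_point_def using same_point_sym by auto
    have edge: "\<exists>\<tau> d. (i, \<tau>, d) \<in> Ed \<and> ?c i s = ?c i \<tau> + (s - \<tau>) *\<^sub>R d \<and>
        curve ?D i differentiable at s \<and> velocity ?D (i, s) = shadow w d"
      if dp: "double_point ?D (i, s) (j, t)" for i s j t
    proof -
      have i: "i < ?n" using dp by (simp add: double_point_def)
      obtain \<tau> d where e: "(i, \<tau>, d) \<in> Ed" "runs_along K i s \<tau> d" using alt[OF i] no_vertex[OF dp] by blast
      obtain \<epsilon> where \<epsilon>: "\<epsilon> > 0" "\<And>r. \<bar>r - s\<bar> < \<epsilon> \<Longrightarrow> ?c i r = ?c i \<tau> + (r - \<tau>) *\<^sub>R d"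
        using e(2) unfolding runs_along_def by blast
      have "((\<lambda>r. shadow w (?c i \<tau>) + (r - \<tau>) *\<^sub>R shadow w d) has_vector_derivative shadow w d) (at s)"
        by (auto intro!: derivative_eq_intros)
      moreover have "shadow w (?c i \<tau>) + (r - \<tau>) *\<^sub>R shadow w d = curve ?D i r" if "r \<in> ball s \<epsilon>" for r
      proof -
        have "\<bar>r - s\<bar> < \<epsilon>" using that by (simp add: dist_real_def abs_minus_commute)
        then show ?thesis unfolding curve \<epsilon>(2)[OF \<open>\<bar>r - s\<bar> < \<epsilon>\<close>] by (simp add: shadow_linear scaleR_conv_of_real)
      qed
      ultimately have d: "(curve ?D i has_vector_derivative shadow w d) (at s)"
        using has_vector_derivative_transform_within_open[of _ "shadow w d" s "ball s \<epsilon>" "curve ?D i"] \<epsilon>(1) by auto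
      then have "velocity ?D (i, s) = shadow w d" by (simp add: velocity_def vector_derivative_at del: projection_simps)
      moreover have "?c i s = ?c i \<tau> + (s - \<tau>) *\<^sub>R d" using \<epsilon> by simp
      ultimately show ?thesis using e(1) d by (blast intro: differentiableI_vector)
    qed
    have trans: "velocity_det ?D (i, s) (j, t) \<noteq> 0" if dp: "double_point ?D (i, s) (j, t)" for i s j t
    proof
      obtain \<tau> d where e: "(i, \<tau>, d) \<in> Ed" "?c i s = ?c i \<tau> + (s - \<tau>) *\<^sub>R d" "velocity ?D (i, s) = shadow w d"
        using edge[OF dp] by blast
      obtain \<tau>' d' where f: "(j, \<tau>', d') \<in> Ed" "?c j t = ?c j \<tau>' + (t - \<tau>') *\<^sub>R d'" "velocity ?D (j, t) = shadow w d'"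
        using edge[OF sym[OF dp]] by blast
      assume "velocity_det ?D (i, s) (j, t) = 0"
      then have det: "det2 (shadow w d) (shadow w d') = 0" using e(3) f(3) by (simp add: velocity_det_def)
      have V: "shadow w d \<noteq> 0" using b0[OF e(1)] .
      obtain c where c: "shadow w d' = of_real c * shadow w d"
      proof (cases "Re (shadow w d) = 0")
        case True
        then show ?thesis using that[of "Im (shadow w d') / Im (shadow w d)"] V det
          by (auto simp: complex_eq_iff field_simps)
      next
        case False
        then show ?thesis using that[of "Re (shadow w d') / Re (shadow w d)"] V det
          by (auto simp: complex_eq_iff field_simps)
      qed
      show False
      proof (cases "d' = c *\<^sub>R d")
        case False
        have "w \<in> N d d'"
          using N(2)[of "-c" d 1 d' w] False c by (simp add: shadow_linear)
        then show False using w Bad4[OF e(1) f(1)] by blast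
      next
        case True
        have Z: "?c i s - ?c j t = 1 *\<^sub>R (?c i \<tau> - ?c j \<tau>') + ((s - \<tau>) - (t - \<tau>') * c) *\<^sub>R d"
          unfolding e(2) f(2) True by (simp add: algebra_simps)
        have sh: "shadow w (?c i s) = shadow w (?c j t)" using dp by (auto simp: double_point_def fst_tilt)
        have "w \<in> N (?c i \<tau> - ?c j \<tau>') d"
          by (rule N(2)[of 1 _ "(s - \<tau>) - (t - \<tau>') * c"]; unfold Z[symmetric])
             (use distinct[OF dp] sh in \<open>simp_all add: shadow_linear\<close>)
        then show False using w Bad4[OF e(1) f(1)] by blast
      qed
    qed
    have triple: "same_point (j, t) (k, r)"
      if pq: "double_point ?D (i, s) (j, t)" and pr: "double_point ?D (i, s) (k, r)" for i s j t k r
    proof (rule ccontr)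
      assume ns: "\<not> same_point (j, t) (k, r)"
      then have qr: "double_point ?D (j, t) (k, r)" using pq pr by (simp add: double_point_def)
      obtain \<tau> d where e: "(i, \<tau>, d) \<in> Ed" "?c i s = ?c i \<tau> + (s - \<tau>) *\<^sub>R d"
        using edge[OF pq] by blast
      obtain \<tau>' d' where f: "(j, \<tau>', d') \<in> Ed" "?c j t = ?c j \<tau>' + (t - \<tau>') *\<^sub>R d'" "velocity ?D (j, t) = shadow w d'"
        using edge[OF qr] by blast
      obtain \<tau>'' d'' where g: "(k, \<tau>'', d'') \<in> Ed" "?c k r = ?c k \<tau>'' + (r - \<tau>'') *\<^sub>R d''" "velocity ?D (k, r) = shadow w d''"
        using edge[OF sym[OF qr]] by blast
      have det: "det2 (shadow w d') (shadow w d'') \<noteq> 0" using trans[OF qr] f(3) g(3) by (simp add: velocity_det_def)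
      have sh: "shadow w (?c i s) = shadow w (?c j t)" "shadow w (?c i s) = shadow w (?c k r)"
        using pq pr by (auto simp: double_point_def fst_tilt)
      have hts: "snd (?c i s) \<noteq> snd (?c j t)" "snd (?c i s) \<noteq> snd (?c k r)"
        using sh distinct[OF pq] distinct[OF pr] shadow_height by blast+
      have "w \<in> M (?c i \<tau>) d (?c j \<tau>') d' (?c k \<tau>'') d''"
        unfolding M_def
        by (intro CollectI exI[of _ "s - \<tau>"] exI[of _ "t - \<tau>'"] exI[of _ "r - \<tau>''"])
           (use sh hts det in \<open>simp add: shadow_linear flip: e(2) f(2) g(2)\<close>)
      then show False using w Bad5[OF e(1) f(1) g(1)] by blast
    qed
    show ?thesis
    proof (intro conjI allI impI)
      fix i s q assume dp: "double_point ?D (i, s) q"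
      have i: "i < ?n" using dp by (simp add: double_point_def)
      have "double_point ?D (i, s) (fst q, snd q)" using dp by simp
      then show "\<exists>\<tau> d. runs_along K i s \<tau> d" using alt[OF i] no_vertex by blast
    next
      have dp: "curve ?D (fst p) differentiable at (snd p) \<and> velocity_det ?D p q \<noteq> 0" if d: "double_point ?D p q" for p q
        using edge[of "fst p" "snd p" "fst q" "snd q"] trans[of "fst p" "snd p" "fst q" "snd q"] d
        by (simp only: prod.collapse) blast
      have tr: "same_point q r" if "double_point ?D p q" "double_point ?D p r" for p q r
        using triple[of "fst p" "snd p" "fst q" "snd q" "fst r" "snd r"] that by (simp only: prod.collapse)
      show "is_diagram ?D" by (rule projection_diagram(1)[OF embK poly dp tr])
      show "projects_to ?K ?D" by (rule projection_diagram(2)[OF embK poly dp tr])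
    qed
  qed
  show ?thesis by (rule that[OF negl]) (use main in blast)+
qed

section \<open>Projections in which two components cross\<close>

definition independent3 :: "'a::real_vector \<Rightarrow> 'a \<Rightarrow> 'a \<Rightarrow> bool" where
  "independent3 a b c \<longleftrightarrow> (\<forall>\<alpha> \<beta> \<gamma>. \<alpha> *\<^sub>R a + \<beta> *\<^sub>R b + \<gamma> *\<^sub>R c = 0 \<longrightarrow> \<alpha> = 0 \<and> \<beta> = 0 \<and> \<gamma> = 0)"

lemma det2_relation: "of_real (det2 b c) * a + of_real (det2 c a) * b + of_real (det2 a b) * c = 0"
  by (simp add: complex_eq_iff algebra_simps)

lemma independent3_height:
  fixes a b c :: "complex \<times> real"
  assumes "independent3 a b c" shows "snd a \<noteq> 0 \<or> snd b \<noteq> 0 \<or> snd c \<noteq> 0"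
proof (rule ccontr)
  assume "\<not> ?thesis"
  then have h: "snd a = 0" "snd b = 0" "snd c = 0" by auto
  have comb: "\<alpha> = 0 \<and> \<beta> = 0 \<and> \<gamma> = 0" if "of_real \<alpha> * fst a + of_real \<beta> * fst b + of_real \<gamma> * fst c = 0" for \<alpha> \<beta> \<gamma>
  proof -
    have "\<alpha> *\<^sub>R a + \<beta> *\<^sub>R b + \<gamma> *\<^sub>R c = 0" using that h by (simp add: prod_eq_iff scaleR_conv_of_real)
    then show ?thesis using assms unfolding independent3_def by blast
  qed
  have "det2 (fst a) (fst b) = 0" using comb[OF det2_relation] by simp
  then have "Re (fst b) = 0" "Im (fst b) = 0"
    using comb[of "Re (fst b)" "- Re (fst a)" 0] comb[of "Im (fst b)" "- Im (fst a)" 0]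
    by (simp_all add: complex_eq_iff algebra_simps)
  then show False using comb[of 0 1 0] by (simp add: complex_eq_iff)
qed

text \<open>
  The sign \<open>\<sigma>\<close> of the parameter allows an edge to be run through backwards.
\<close>

definition edge_from :: "(real \<Rightarrow> complex \<times> real) \<Rightarrow> real \<Rightarrow> real \<Rightarrow> complex \<times> real \<Rightarrow> real \<Rightarrow> bool" where
  "edge_from c t \<sigma> a \<epsilon> \<longleftrightarrow> (\<forall>x. 0 \<le> x \<longrightarrow> x < \<epsilon> \<longrightarrow> c (t + \<sigma> * x) = c t + x *\<^sub>R a)"

lemma edge_from_mono: "edge_from c t \<sigma> a \<epsilon> \<Longrightarrow> \<delta> \<le> \<epsilon> \<Longrightarrow> edge_from c t \<sigma> a \<delta>"
  by (simp add: edge_from_def)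

text \<open>
  Take any edge of the second component, with direction \<open>b\<close>, and a point of the
  first component that is extremal in this direction. If both edges at this point were parallel
  to \<open>b\<close>, they would lead back into the same half-line and overlap.
\<close>

lemma nonparallel_edges:
  assumes K: "polygonal_link K" and n: "2 \<le> link_components K"
  obtains t0 \<sigma> a t1 b \<epsilon> where "\<epsilon> > 0" "edge_from (link_curve K 0) t0 \<sigma> a \<epsilon>" "edge_from (link_curve K 1) t1 1 b \<epsilon>"
    "\<And>\<alpha> \<beta>. \<alpha> *\<^sub>R a + \<beta> *\<^sub>R b = 0 \<Longrightarrow> \<alpha> = 0 \<and> \<beta> = 0"
proof -
  let ?c = "link_curve K 0"
  have poly: "polygonal_loop ?c" "polygonal_loop (link_curve K 1)" using K n by (auto simp: polygonal_link_def)
  obtain e b where e: "e > 0" "b \<noteq> 0" "\<And>r. 0 \<le> r \<Longrightarrow> r < 0 + e \<Longrightarrow> link_curve K 1 r = link_curve K 1 0 + (r - 0) *\<^sub>R b"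
    by (rule polygonal_loop_direction[OF poly(2), of 0]) (rule that)
  have eb: "edge_from (link_curve K 1) 0 1 b e" unfolding edge_from_def
  proof (intro allI impI)
    fix x assume "0 \<le> x" "x < e"
    then show "link_curve K 1 (0 + 1 * x) = link_curve K 1 0 + x *\<^sub>R b" using e(3)[of x] by simp
  qed
  have cl: "closed_curve ?c" by (rule polygonal_loop_closed_curve[OF poly(1)])
  then have "continuous_on {0..1} (\<lambda>t. inner b (?c t))"
    unfolding closed_curve_def by (intro continuous_intros) (auto intro: continuous_on_subset)
  then obtain t0 where t0: "t0 \<in> {0..1}" "\<And>t. t \<in> {0..1} \<Longrightarrow> inner b (?c t) \<le> inner b (?c t0)"
    using continuous_attains_sup[of "{0..1::real}" "\<lambda>t. inner b (?c t)"] by auto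
  have max: "inner b (?c t) \<le> inner b (?c t0)" for t
  proof -
    have "?c (frac t) = ?c t" by (rule closed_curve_cong_Ints[OF cl]) (simp add: frac_def)
    moreover have "frac t \<in> {0..1}" using frac_lt_1[of t] by (simp add: less_imp_le)
    ultimately show ?thesis using t0(2)[of "frac t"] by simp
  qed
  obtain h v w where h: "h > 0" "v \<noteq> 0" "w \<noteq> 0"
    "\<And>r. t0 \<le> r \<Longrightarrow> r < t0 + h \<Longrightarrow> ?c r = ?c t0 + (r - t0) *\<^sub>R v"
    "\<And>r. t0 - h < r \<Longrightarrow> r \<le> t0 \<Longrightarrow> ?c r = ?c t0 + (r - t0) *\<^sub>R w"
    by (rule polygonal_loop_direction[OF poly(1), of t0]) (rule that)
  have ev1: "edge_from ?c t0 1 v h" unfolding edge_from_def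
  proof (intro allI impI)
    fix x assume "0 \<le> x" "x < h"
    then show "?c (t0 + 1 * x) = ?c t0 + x *\<^sub>R v" using h(4)[of "t0 + x"] by simp
  qed
  have ev2: "edge_from ?c t0 (-1) (- w) h" unfolding edge_from_def
  proof (intro allI impI)
    fix x assume "0 \<le> x" "x < h"
    then show "?c (t0 + (-1) * x) = ?c t0 + x *\<^sub>R (- w)" using h(5)[of "t0 - x"] by simp
  qed
  note ev = ev1 ev2
  have le: "k \<le> 0" if "edge_from ?c t0 \<sigma> (k *\<^sub>R b) h" for \<sigma> k
  proof -
    have "?c (t0 + \<sigma> * (h/2)) = ?c t0 + (h/2) *\<^sub>R (k *\<^sub>R b)"
      using that[unfolded edge_from_def, rule_format, of "h/2"] h(1) by simp
    then have "inner b ((h/2) *\<^sub>R (k *\<^sub>R b)) \<le> 0" using max[of "t0 + \<sigma> * (h/2)"] by (simp add: inner_add_right)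
    then have "(h/2) * (k * inner b b) \<le> 0" by simp
    moreover have "inner b b > 0" using e(2) by simp
    ultimately show ?thesis using h(1) by (simp add: mult_le_0_iff zero_less_mult_iff not_less)
  qed
  have par: "\<exists>k. u = k *\<^sub>R b" if dep: "\<alpha> *\<^sub>R u + \<beta> *\<^sub>R b = 0" "\<not> (\<alpha> = 0 \<and> \<beta> = 0)" for \<alpha> \<beta> and u :: "complex \<times> real"
  proof -
    have "\<alpha> \<noteq> 0" using dep e(2) by auto
    have "\<alpha> *\<^sub>R u = - \<beta> *\<^sub>R b" using dep(1) by (simp add: add_eq_0_iff)
    then have "u = (- \<beta> / \<alpha>) *\<^sub>R b" using \<open>\<alpha> \<noteq> 0\<close> by (metis divide_inverse_commute scaleR_left_imp_eq scaleR_scaleR right_inverse mult.assoc mult_1 vector_fraction_eq_iff)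
    then show ?thesis by blast
  qed
  show ?thesis
  proof (cases "(\<forall>\<alpha> \<beta>. \<alpha> *\<^sub>R v + \<beta> *\<^sub>R b = 0 \<longrightarrow> \<alpha> = 0 \<and> \<beta> = 0) \<or> (\<forall>\<alpha> \<beta>. \<alpha> *\<^sub>R (- w) + \<beta> *\<^sub>R b = 0 \<longrightarrow> \<alpha> = 0 \<and> \<beta> = 0)")
    case True
    have he: "min h e > 0" using h(1) e(1) by simp
    show ?thesis using True
    proof
      assume i: "\<forall>\<alpha> \<beta>. \<alpha> *\<^sub>R v + \<beta> *\<^sub>R b = 0 \<longrightarrow> \<alpha> = 0 \<and> \<beta> = 0"
      show ?thesis by (rule that[OF he edge_from_mono[OF ev(1)] edge_from_mono[OF eb]], simp, simp, erule i[rule_format])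
    next
      assume i: "\<forall>\<alpha> \<beta>. \<alpha> *\<^sub>R (- w) + \<beta> *\<^sub>R b = 0 \<longrightarrow> \<alpha> = 0 \<and> \<beta> = 0"
      show ?thesis by (rule that[OF he edge_from_mono[OF ev(2)] edge_from_mono[OF eb]], simp, simp, erule i[rule_format])
    qed
  next
    case False
    then obtain k l where kl: "v = k *\<^sub>R b" "- w = l *\<^sub>R b" using par by metis
    have "k \<le> 0" by (rule le[of 1]) (use ev(1) kl(1) in simp)
    moreover have "l \<le> 0" by (rule le[of "-1"]) (use ev(2) kl(2) in simp)
    moreover have "k \<noteq> 0" "l \<noteq> 0" using kl h(2,3) by auto
    ultimately have "k < 0" "l < 0" by simp_all
    define m where "m = min h 1 / (2 * (\<bar>k\<bar> + \<bar>l\<bar>))"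
    have m: "m > 0" unfolding m_def using h(1) \<open>k < 0\<close> by (intro divide_pos_pos) auto
    have "m * (\<bar>k\<bar> + \<bar>l\<bar>) = min h 1 / 2" using \<open>k < 0\<close> by (simp add: m_def field_simps)
    then have sum: "m * \<bar>k\<bar> + m * \<bar>l\<bar> = min h 1 / 2" by (simp add: algebra_simps)
    have x: "0 < m * \<bar>l\<bar>" "0 < m * \<bar>k\<bar>" using \<open>k < 0\<close> \<open>l < 0\<close> by (intro mult_pos_pos m; simp)+
    then have x': "m * \<bar>l\<bar> < h" "m * \<bar>k\<bar> < h" "m * \<bar>k\<bar> + m * \<bar>l\<bar> < 1" using sum h(1) by auto
    have "?c (t0 + 1 * (m * \<bar>l\<bar>)) = ?c t0 + (m * \<bar>l\<bar>) *\<^sub>R v" "?c (t0 + (-1) * (m * \<bar>k\<bar>)) = ?c t0 + (m * \<bar>k\<bar>) *\<^sub>R (- w)"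
      using ev[unfolded edge_from_def] x x' by (meson less_imp_le)+
    then have "?c (t0 + m * \<bar>l\<bar>) = ?c (t0 - m * \<bar>k\<bar>)"
      using \<open>k < 0\<close> \<open>l < 0\<close> by (simp add: kl mult.commute)
    then have "(t0 + m * \<bar>l\<bar>) - (t0 - m * \<bar>k\<bar>) \<in> \<int>"
    proof -
      have "0 < link_components K" using n by simp
      then have "same_point (0, t0 + m * \<bar>l\<bar>) (0, t0 - m * \<bar>k\<bar>)"
        using K \<open>?c (t0 + m * \<bar>l\<bar>) = ?c (t0 - m * \<bar>k\<bar>)\<close> unfolding polygonal_link_def embedded_link_def by blast
      then show ?thesis by (simp only: same_point_def snd_conv)
    qed
    then have "m * \<bar>k\<bar> + m * \<bar>l\<bar> \<in> \<int>" by (simp add: algebra_simps)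
    then obtain z where "m * \<bar>k\<bar> + m * \<bar>l\<bar> = of_int z" by (rule Ints_cases)
    then have "of_int z > (0::real)" "of_int z < (1::real)" using x x' by linarith+
    then show ?thesis by simp
  qed
qed

text \<open>
  For skew edges, some tilt makes two interior points of them coincide in the projection. There
  the projected edges are not parallel, so the coincidence persists in a neighbourhood, which is
  not contained in \<open>N\<close>.
\<close>

lemma tilt_with_crossing:
  assumes n: "2 \<le> link_components K" and eps: "\<epsilon> > 0"
    and ea: "edge_from (link_curve K 0) t0 \<sigma> a \<epsilon>" and eb: "edge_from (link_curve K 1) t1 1 b \<epsilon>"
    and ind: "independent3 a b (link_curve K 0 t0 - link_curve K 1 t1)" and N: "negligible N"
  obtains w s t where "w \<notin> N" "crossing (projection (image_link (tilt w) K)) 0 s 1 t"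
proof -
  let ?p = "link_curve K 0 t0" and ?q = "link_curve K 1 t1"
  have "\<exists>x y. 0 < x \<and> x < \<epsilon> \<and> 0 < y \<and> y < \<epsilon> \<and> snd (?p - ?q) + x * snd a - y * snd b \<noteq> 0"
  proof (rule ccontr)
    assume "\<not> ?thesis"
    then have z: "snd (?p - ?q) + x * snd a - y * snd b = 0" if "0 < x" "x < \<epsilon>" "0 < y" "y < \<epsilon>" for x y
      using that by blast
    have "snd (?p - ?q) + \<epsilon>/2 * snd a - \<epsilon>/2 * snd b = 0" "snd (?p - ?q) + \<epsilon>/4 * snd a - \<epsilon>/2 * snd b = 0"
      "snd (?p - ?q) + \<epsilon>/2 * snd a - \<epsilon>/4 * snd b = 0" using eps by (intro z; simp)+
    then have "\<epsilon>/4 * snd a = 0" "\<epsilon>/4 * snd b = 0" "snd (?p - ?q) + \<epsilon>/2 * snd a - \<epsilon>/2 * snd b = 0"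
      by linarith+
    then have "snd a = 0" "snd b = 0" "snd (?p - ?q) = 0" using eps by auto
    then show False using independent3_height[OF ind] by blast
  qed
  then obtain x0 y0 where xy: "0 < x0" "x0 < \<epsilon>" "0 < y0" "y0 < \<epsilon>" "snd (?p - ?q) + x0 * snd a - y0 * snd b \<noteq> 0"
    by blast
  \<comment> \<open>The tilt \<open>w0\<close> projects along the line that joins the two interior
    points of the edges with parameters \<open>x0\<close> and \<open>y0\<close>.\<close>
  define c where "c = (?p - ?q) + x0 *\<^sub>R a - y0 *\<^sub>R b"
  have hc: "snd c \<noteq> 0" using xy(5) by (simp add: c_def)
  define w0 where "w0 = - (fst c / of_real (snd c))"
  have c0: "shadow w0 c = 0" using hc by (simp add: shadow_def w0_def)
  let ?\<delta> = "\<lambda>w. det2 (shadow w a) (shadow w b)"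
  let ?x = "\<lambda>w. - det2 (shadow w c) (shadow w b) / ?\<delta> w" and ?y = "\<lambda>w. det2 (shadow w a) (shadow w c) / ?\<delta> w"
  \<comment> \<open>Otherwise the direction \<open>c\<close> of projection would lie in the plane
    spanned by \<open>a\<close> and \<open>b\<close>.\<close>
  have \<delta>0: "?\<delta> w0 \<noteq> 0"
  proof
    assume d: "?\<delta> w0 = 0"
    have ker: "\<alpha> = 0 \<and> \<beta> = 0" if "shadow w0 (\<alpha> *\<^sub>R a + \<beta> *\<^sub>R b) = 0" for \<alpha> \<beta>
    proof -
      let ?Z = "\<alpha> *\<^sub>R a + \<beta> *\<^sub>R b"
      define k where "k = snd ?Z / snd c"
      have "snd ?Z = k * snd c" using hc by (simp add: k_def)
      moreover have "fst ?Z = of_real k * fst c"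
        using that hc by (simp add: shadow_def w0_def k_def field_simps eq_neg_iff_add_eq_0)
      ultimately have "?Z = k *\<^sub>R c" by (simp add: prod_eq_iff scaleR_conv_of_real)
      then have "(\<alpha> - k * x0) *\<^sub>R a + (\<beta> + k * y0) *\<^sub>R b + (- k) *\<^sub>R (?p - ?q) = 0"
        by (simp add: c_def algebra_simps)
      then have "\<alpha> - k * x0 = 0 \<and> \<beta> + k * y0 = 0 \<and> - k = 0" using ind unfolding independent3_def by blast
      then show ?thesis by auto
    qed
    have k: "\<alpha> = 0 \<and> \<beta> = 0" if "of_real \<alpha> * shadow w0 a + of_real \<beta> * shadow w0 b = 0" for \<alpha> \<beta>
      using ker[of \<alpha> \<beta>] that by (simp add: shadow_linear)
    have "Re (shadow w0 b) = 0 \<and> - Re (shadow w0 a) = 0" "Im (shadow w0 b) = 0 \<and> - Im (shadow w0 a) = 0"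
      using d by (intro k; simp add: complex_eq_iff algebra_simps)+
    then show False using k[of 1 0] by (simp add: complex_eq_iff)
  qed
  define \<eta> where "\<eta> = min (min x0 (\<epsilon> - x0)) (min y0 (\<epsilon> - y0))"
  have \<eta>: "\<eta> > 0" using xy by (simp add: \<eta>_def)
  have cont: "isCont (\<lambda>w. shadow w p) w0" for p unfolding shadow_def by (intro continuous_intros)
  have contR: "isCont (\<lambda>w. Re (shadow w p)) w0" "isCont (\<lambda>w. Im (shadow w p)) w0" for p
    by (rule continuous_Re[OF cont], rule continuous_Im[OF cont])
  have "isCont ?\<delta> w0" by (intro continuous_intros contR)
  moreover have "isCont ?x w0" using \<delta>0 by (intro continuous_intros contR)
  moreover have "isCont ?y w0" using \<delta>0 by (intro continuous_intros contR)
  ultimately have lim: "(?\<delta> \<longlongrightarrow> ?\<delta> w0) (nhds w0)" "(?x \<longlongrightarrow> ?x w0) (nhds w0)" "(?y \<longlongrightarrow> ?y w0) (nhds w0)"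
    using isCont_def tendsto_at_iff_tendsto_nhds by blast+
  have x0y0: "?x w0 = 0" "?y w0 = 0" using c0 by simp_all
  have "\<forall>\<^sub>F w in nhds w0. ?\<delta> w \<noteq> 0" using tendsto_imp_eventually_ne[OF lim(1) \<delta>0] .
  moreover have "\<forall>\<^sub>F w in nhds w0. dist (?x w) 0 < \<eta>" using tendstoD[OF lim(2) \<eta>] unfolding x0y0 .
  moreover have "\<forall>\<^sub>F w in nhds w0. dist (?y w) 0 < \<eta>" using tendstoD[OF lim(3) \<eta>] unfolding x0y0 .
  ultimately have "\<forall>\<^sub>F w in nhds w0. ?\<delta> w \<noteq> 0 \<and> \<bar>?x w\<bar> < \<eta> \<and> \<bar>?y w\<bar> < \<eta>"
    by eventually_elim (simp add: dist_real_def)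
  then obtain S where S: "open S" "w0 \<in> S" "\<And>w. w \<in> S \<Longrightarrow> ?\<delta> w \<noteq> 0 \<and> \<bar>?x w\<bar> < \<eta> \<and> \<bar>?y w\<bar> < \<eta>"
    unfolding eventually_nhds by blast
  have "\<not> negligible S" using open_not_negligible[OF S(1)] S(2) by blast
  then obtain w where w: "w \<in> S" "w \<notin> N" using negligible_subset[OF N, of S] by blast
  define x y where "x = x0 + ?x w" and "y = y0 + ?y w"
  have bounds: "0 \<le> x" "x < \<epsilon>" "0 \<le> y" "y < \<epsilon>"
  proof -
    have xy': "\<bar>?x w\<bar> < \<eta>" "\<bar>?y w\<bar> < \<eta>" using S(3)[OF w(1)] by blast+
    have "\<eta> \<le> x0" "\<eta> \<le> \<epsilon> - x0" "\<eta> \<le> y0" "\<eta> \<le> \<epsilon> - y0" by (simp_all add: \<eta>_def)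
    then show "0 \<le> x" "x < \<epsilon>" "0 \<le> y" "y < \<epsilon>" using xy' unfolding x_def y_def by linarith+
  qed
  have \<delta>w: "?\<delta> w \<noteq> 0" using S(3)[OF w(1)] by blast
  have "of_real (?\<delta> w) * (shadow w c + of_real (?x w) * shadow w a - of_real (?y w) * shadow w b) = 0"
    using det2_relation[of "shadow w b" "shadow w c" "shadow w a"] \<delta>w by (simp add: complex_eq_iff field_simps)
  then have "shadow w c + of_real (?x w) * shadow w a - of_real (?y w) * shadow w b = 0"
    using \<delta>w by (metis mult_eq_0_iff of_real_eq_0_iff)
  then have "shadow w (?p + x *\<^sub>R a) = shadow w (?q + y *\<^sub>R b)"
    unfolding x_def y_def c_def by (simp add: shadow_linear algebra_simps)
  moreover have "link_curve K 0 (t0 + \<sigma> * x) = ?p + x *\<^sub>R a" "link_curve K 1 (t1 + 1 * y) = ?q + y *\<^sub>R b"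
    using ea eb bounds unfolding edge_from_def by blast+
  ultimately have "crossing (projection (image_link (tilt w) K)) 0 (t0 + \<sigma> * x) 1 (t1 + 1 * y)"
    using n by (simp add: crossing_def fst_tilt)
  then show ?thesis using that w(2) by blast
qed

text \<open>
  The map \<open>F\<close> is a shear along \<open>n\<close> on each side of the plane
  \<open>inner m X = k\<close>, and it is continuous across this plane.
\<close>

lemma fold_link:
  fixes m n :: "complex \<times> real" and k :: real
  assumes K: "polygonal_link K" and \<mu>n: "inner m n = 0"
  defines "F \<equiv> \<lambda>X. X + (1 * \<bar>inner m X - k\<bar>) *\<^sub>R n"
  shows "polygonal_link (image_link F K)" "link_isotopic (image_link F K) K"
proof -
  let ?H = "\<lambda>\<tau> X. X + (\<tau> * \<bar>inner m X - k\<bar>) *\<^sub>R n"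
  have H: "ambient_isotopy ?H"
  proof (rule ambient_isotopy_push[where l = 0])
    show "continuous_on UNIV (\<lambda>X. \<bar>inner m X - k\<bar>)" by (intro continuous_intros)
  qed (simp_all add: inner_add_right \<mu>n)
  show iso: "link_isotopic (image_link F K) K" using link_isotopic_image_link[OF H] by (simp add: F_def)
  have emb: "embedded_link (image_link F K)"
    using embedded_image_link[OF H] K by (simp add: F_def polygonal_link_def)
  have inj: "X = Y" if "F X = F Y" for X Y
  proof -
    have "?H 1 X = ?H 1 Y" using that by (simp only: F_def)
    from ambient_isotopy_inj[OF H _ this] show ?thesis by simp
  qed
  \<comment> \<open>On a short segment from \<open>X\<close> the fold is linear.\<close>
  have lin: "\<exists>v'. v' \<noteq> 0 \<and> (\<exists>\<delta>>0. \<forall>h. 0 < h \<longrightarrow> h < \<delta> \<longrightarrow> F (X + h *\<^sub>R v) = F X + h *\<^sub>R v')" if v: "v \<noteq> 0" for X v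
  proof -
    let ?A = "inner m X - k" and ?B = "inner m v"
    define s where "s = (if ?A \<noteq> 0 then sgn ?A else sgn ?B)"
    define \<delta> where "\<delta> = (if ?A \<noteq> 0 then \<bar>?A\<bar> / (\<bar>?B\<bar> + 1) else 1)"
    have \<delta>: "\<delta> > 0" by (simp add: \<delta>_def add_nonneg_pos)
    have abs: "\<bar>?A + h * ?B\<bar> = \<bar>?A\<bar> + h * (s * ?B)" if h: "0 < h" "h < \<delta>" for h
    proof (cases "?A = 0")
      case True
      then have s: "s * ?B = \<bar>?B\<bar>" by (simp add: s_def sgn_if abs_if)
      show ?thesis unfolding s using True h(1) by (simp add: abs_mult)
    next
      case False
      then have "h * (\<bar>?B\<bar> + 1) < \<bar>?A\<bar>" using h(2) by (simp add: \<delta>_def pos_less_divide_eq add_nonneg_pos)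
      then have "\<bar>h * ?B\<bar> < \<bar>?A\<bar>" using h(1) by (simp add: abs_mult algebra_simps)
      then show ?thesis using False by (auto simp: s_def sgn_if abs_if split: if_splits)
    qed
    let ?v = "v + (s * ?B) *\<^sub>R n"
    have eq: "F (X + h *\<^sub>R v) = F X + h *\<^sub>R ?v" if h: "0 < h" "h < \<delta>" for h
    proof -
      have "\<bar>inner m (X + h *\<^sub>R v) - k\<bar> = \<bar>?A\<bar> + h * (s * ?B)"
        using abs[OF h] by (simp add: inner_add_right algebra_simps)
      then show ?thesis unfolding F_def by (simp add: algebra_simps)
    qed
    have "?v \<noteq> 0"
    proof
      assume "?v = 0"
      then have "F (X + (\<delta>/2) *\<^sub>R v) = F X" using eq[of "\<delta>/2"] \<delta> by (simp del: scaleR_half_double)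
      then show False using inj[of "X + (\<delta>/2) *\<^sub>R v" X] v \<delta> by simp
    qed
    then show ?thesis using eq \<delta> by blast
  qed
  have "polygonal_loop (\<lambda>t. F (c t))" if c: "polygonal_loop c" for c
    unfolding polygonal_loop_def
  proof (intro conjI allI)
    fix t
    show "F (c (t + 1)) = F (c t)" using c by (simp add: polygonal_loop_def)
    obtain h v w where h: "h > 0" "v \<noteq> 0" "w \<noteq> 0"
      "\<And>r. t \<le> r \<Longrightarrow> r < t + h \<Longrightarrow> c r = c t + (r - t) *\<^sub>R v"
      "\<And>r. t - h < r \<Longrightarrow> r \<le> t \<Longrightarrow> c r = c t + (r - t) *\<^sub>R w"
      by (rule polygonal_loop_direction[OF c, of t]) (rule that)
    obtain v' \<delta> where v': "v' \<noteq> 0" "\<delta> > 0" "\<And>x. 0 < x \<Longrightarrow> x < \<delta> \<Longrightarrow> F (c t + x *\<^sub>R v) = F (c t) + x *\<^sub>R v'"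
      using lin[OF h(2), of "c t"] by blast
    show "\<exists>v. v \<noteq> 0 \<and> (\<forall>\<^sub>F h in at_right 0. F (c (t + h)) = F (c t) + h *\<^sub>R v)"
      unfolding eventually_at_right_field
    proof (intro exI[of _ v'] conjI v'(1) exI[of _ "min h \<delta>"] allI impI)
      fix x assume "0 < x" "x < min h \<delta>"
      then show "F (c (t + x)) = F (c t) + x *\<^sub>R v'" using h(4)[of "t + x"] v'(3)[of x] by simp
    qed (use h(1) v'(2) in auto)
    have "- w \<noteq> 0" using h(3) by simp
    then obtain w' \<delta>' where w': "w' \<noteq> 0" "\<delta>' > 0" "\<And>x. 0 < x \<Longrightarrow> x < \<delta>' \<Longrightarrow> F (c t + x *\<^sub>R (- w)) = F (c t) + x *\<^sub>R w'"
      using lin[of "- w" "c t"] by blast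
    show "\<exists>v. v \<noteq> 0 \<and> (\<forall>\<^sub>F h in at_left 0. F (c (t + h)) = F (c t) + h *\<^sub>R v)"
      unfolding eventually_at_left_field
    proof (intro exI[of _ "- w'"] conjI exI[of _ "- min h \<delta>'"] allI impI)
      fix x assume x: "- min h \<delta>' < x" "x < 0"
      then have "c (t + x) = c t + (- x) *\<^sub>R (- w)" using h(5)[of "t + x"] by simp
      then show "F (c (t + x)) = F (c t) + x *\<^sub>R (- w')" using w'(3)[of "-x"] x by simp
    qed (use h(1) w'(1,2) in auto)
  qed
  then show "polygonal_link (image_link F K)" using K emb unfolding polygonal_link_def
    by (simp add: image_link_def)
qed

text \<open>
  If the two edges lie in a plane, fold space along another plane that separates their initial
  points. The fold moves points in the direction of the normal vector \<open>n\<close> by their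
  distance from the fold, up to a factor, so it tilts the two edges in different senses. The
  position \<open>k\<close> of the fold is free, and all but one value move the edges out of a
  common plane.
\<close>

lemma noncoplanar_edges:
  assumes K: "polygonal_link K" and n: "2 \<le> link_components K"
  obtains K' t0 \<sigma> a t1 b \<epsilon> where "polygonal_link K'" "link_isotopic K' K" "link_components K' = link_components K"
    "\<epsilon> > 0" "edge_from (link_curve K' 0) t0 \<sigma> a \<epsilon>" "edge_from (link_curve K' 1) t1 1 b \<epsilon>"
    "independent3 a b (link_curve K' 0 t0 - link_curve K' 1 t1)"
proof -
  obtain t0 \<sigma> a t1 b \<epsilon> where e: "\<epsilon> > 0" "edge_from (link_curve K 0) t0 \<sigma> a \<epsilon>" "edge_from (link_curve K 1) t1 1 b \<epsilon>"
    and ind: "\<And>\<alpha> \<beta>. \<alpha> *\<^sub>R a + \<beta> *\<^sub>R b = 0 \<Longrightarrow> \<alpha> = 0 \<and> \<beta> = 0"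
    by (rule nonparallel_edges[OF K n]) (rule that)
  let ?p = "link_curve K 0 t0" and ?q = "link_curve K 1 t1"
  show ?thesis
  proof (cases "independent3 a b (?p - ?q)")
    case True
    have "link_isotopic K K" using fold_link(2)[OF K, of 0 0 0] by (simp add: image_link_def)
    then show ?thesis using that[OF K _ refl e True] by simp
  next
    case False
    then obtain x y z where xyz: "x *\<^sub>R a + y *\<^sub>R b + z *\<^sub>R (?p - ?q) = 0" "\<not> (x = 0 \<and> y = 0 \<and> z = 0)"
      unfolding independent3_def by blast
    have z: "z \<noteq> 0" using xyz ind[of x y] by auto
    define \<alpha> \<beta> where "\<alpha> = - x / z" and "\<beta> = - y / z"
    have "(1/z) *\<^sub>R (x *\<^sub>R a + y *\<^sub>R b + z *\<^sub>R (?p - ?q)) = 0" using xyz by simp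
    then have pq: "?p - ?q = \<alpha> *\<^sub>R a + \<beta> *\<^sub>R b" using z
      by (simp add: \<alpha>_def \<beta>_def scaleR_add_right algebra_simps add_eq_0_iff)
    have "dim {a, b} \<le> card {a, b}" by (rule dim_le_card') simp
    also have "\<dots> \<le> 2" by (simp add: card_insert_if)
    finally have "dim {a, b} < DIM(complex \<times> real)" by simp
    then obtain n where n0: "n \<noteq> 0" and orth: "\<And>y. y \<in> span {a, b} \<Longrightarrow> orthogonal n y"
      by (rule orthogonal_to_subspace_exists) (rule that)
    have na: "inner n a = 0" "inner n b = 0" using orth[of a] orth[of b] by (auto simp: orthogonal_def span_base)
    define m where "m = ?p - ?q"
    have na': "inner a n = 0" "inner b n = 0" using na inner_commute[of a n] inner_commute[of b n] by simp_all
    have mn: "inner m n = 0" unfolding m_def pq using na' by (simp add: inner_add_left)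
    have "?p \<noteq> ?q"
    proof
      assume e: "?p = ?q"
      have "0 < link_components K" "1 < link_components K" using n by simp_all
      then have "same_point (0, t0) (1, t1)"
        using K e unfolding polygonal_link_def embedded_link_def by blast
      then show False by (simp add: same_point_def)
    qed
    then have "inner m m > 0" by (simp add: m_def)
    then have mpq: "inner m ?q < inner m ?p" by (simp add: m_def inner_diff_right)
    \<comment> \<open>The folded edges are coplanar exactly if \<open>M k\<close> vanishes.\<close>
    define M where "M k = inner m ?p + inner m ?q - 2 * k - \<alpha> * inner m a + \<beta> * inner m b" for k
    have "\<exists>k. inner m ?q < k \<and> k < inner m ?p \<and> M k \<noteq> 0"
    proof (cases "M ((inner m ?p + inner m ?q) / 2) = 0")
      case True
      then show ?thesis using mpq by (intro exI[of _ "(inner m ?p + 2 * inner m ?q) / 3"]) (auto simp: M_def field_simps)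
    next
      case False
      then show ?thesis using mpq by (intro exI[of _ "(inner m ?p + inner m ?q) / 2"]) auto
    qed
    then obtain k where k: "inner m ?q < k" "k < inner m ?p" "M k \<noteq> 0" by blast
    let ?F = "\<lambda>X. X + (1 * \<bar>inner m X - k\<bar>) *\<^sub>R n"
    let ?K = "image_link ?F K"
    define \<delta> where "\<delta> = min \<epsilon> (min ((inner m ?p - k) / (\<bar>inner m a\<bar> + 1)) ((k - inner m ?q) / (\<bar>inner m b\<bar> + 1)))"
    have \<delta>: "\<delta> > 0" using e k by (simp add: \<delta>_def add_nonneg_pos)
    let ?a = "a + inner m a *\<^sub>R n" and ?b = "b - inner m b *\<^sub>R n"
    have ea: "edge_from (link_curve ?K 0) t0 \<sigma> ?a \<delta>"
      unfolding edge_from_def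
    proof (intro allI impI)
      fix x assume x: "0 \<le> x" "x < \<delta>"
      then have c: "link_curve K 0 (t0 + \<sigma> * x) = ?p + x *\<^sub>R a" using e(2) by (simp add: edge_from_def \<delta>_def)
      have "x * (\<bar>inner m a\<bar> + 1) < inner m ?p - k" using x by (simp add: \<delta>_def pos_less_divide_eq add_nonneg_pos)
      moreover have "x * (- inner m a) \<le> x * (\<bar>inner m a\<bar> + 1)" using x by (intro mult_left_mono) auto
      ultimately have "inner m (?p + x *\<^sub>R a) > k" by (simp add: inner_add_right)
      then show "link_curve ?K 0 (t0 + \<sigma> * x) = link_curve ?K 0 t0 + x *\<^sub>R ?a"
        using k by (simp add: c inner_add_right algebra_simps)
    qed
    have eb: "edge_from (link_curve ?K 1) t1 1 ?b \<delta>"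
      unfolding edge_from_def
    proof (intro allI impI)
      fix x assume x: "0 \<le> x" "x < \<delta>"
      then have c: "link_curve K 1 (t1 + 1 * x) = ?q + x *\<^sub>R b" using e(3) by (simp add: edge_from_def \<delta>_def)
      have "x * (\<bar>inner m b\<bar> + 1) < k - inner m ?q" using x by (simp add: \<delta>_def pos_less_divide_eq add_nonneg_pos)
      moreover have "x * inner m b \<le> x * (\<bar>inner m b\<bar> + 1)" using x by (intro mult_left_mono) auto
      ultimately have "inner m (?q + x *\<^sub>R b) < k" by (simp add: inner_add_right)
      then show "link_curve ?K 1 (t1 + 1 * x) = link_curve ?K 1 t1 + x *\<^sub>R ?b"
        using k by (simp only: c image_link_simps) (simp add: inner_add_right algebra_simps)
    qed
    have diff: "link_curve ?K 0 t0 - link_curve ?K 1 t1 =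
        \<alpha> *\<^sub>R a + \<beta> *\<^sub>R b + (inner m ?p + inner m ?q - 2 * k) *\<^sub>R n"
    proof -
      have A: "link_curve ?K 0 t0 = ?p + (inner m ?p - k) *\<^sub>R n" using k by simp
      have B: "link_curve ?K 1 t1 = ?q + (k - inner m ?q) *\<^sub>R n" using k by simp
      have e: "inner m ?p + inner m ?q - 2 * k = (inner m ?p - k) - (k - inner m ?q)" by simp
      show ?thesis unfolding A B e pq[symmetric] by (simp only: scaleR_diff_left) simp
    qed
    have "independent3 ?a ?b (link_curve ?K 0 t0 - link_curve ?K 1 t1)"
      unfolding independent3_def diff
    proof (intro allI impI)
      fix x y z assume "x *\<^sub>R ?a + y *\<^sub>R ?b + z *\<^sub>R (\<alpha> *\<^sub>R a + \<beta> *\<^sub>R b + (inner m ?p + inner m ?q - 2 * k) *\<^sub>R n) = 0"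
      then have comb: "(x + z * \<alpha>) *\<^sub>R a + (y + z * \<beta>) *\<^sub>R b +
          (x * inner m a - y * inner m b + z * (inner m ?p + inner m ?q - 2 * k)) *\<^sub>R n = 0" (is "?A + ?B + ?C *\<^sub>R n = 0")
        by (simp add: algebra_simps)
      have "inner n (?A + ?B + ?C *\<^sub>R n) = ?C * inner n n" by (simp add: inner_add_right na)
      then have C: "?C = 0" using comb n0 by simp
      then have "x + z * \<alpha> = 0 \<and> y + z * \<beta> = 0" using ind comb by simp
      then have xy: "x = - z * \<alpha>" "y = - z * \<beta>" by auto
      have "z * M k = 0" using C unfolding xy M_def by (simp add: algebra_simps)
      then have "z = 0" using k(3) by simp
      then show "x = 0 \<and> y = 0 \<and> z = 0" using xy by simp
    qed
    then show ?thesis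
      using that[OF fold_link[OF K mn, of k] _ \<delta> ea eb] by simp
  qed
qed

section \<open>A finger under a crossing\<close>

text \<open>
  In the direction \<open>u\<close> this bump rises with slope \<open>25\<close> and falls with
  slope \<open>4/5\<close>. Only the fall is constrained by \<open>ambient_isotopy_push\<close>,
  and the steep factors keep the support small.
\<close>

definition tent :: "real \<Rightarrow> real \<Rightarrow> real \<Rightarrow> real" where
  "tent s u r = max 0 (min (1 - \<bar>s\<bar> - 4/5 * u) (1 - \<bar>s\<bar> + 25 * u) - 25 * \<bar>r\<bar>)"

lemma tent_slope: "0 \<le> \<theta> \<Longrightarrow> tent s u r \<le> tent s (u + \<theta>) r + 4/5 * \<theta>"
proof -
  assume \<theta>: "0 \<le> \<theta>"
  let ?m = "min (1 - \<bar>s\<bar> - 4/5 * u) (1 - \<bar>s\<bar> + 25 * u)"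
  let ?m' = "min (1 - \<bar>s\<bar> - 4/5 * (u + \<theta>)) (1 - \<bar>s\<bar> + 25 * (u + \<theta>))"
  have "?m \<le> 1 - \<bar>s\<bar> - 4/5 * u" by (rule min.cobounded1)
  then have 1: "?m - 4/5 * \<theta> \<le> 1 - \<bar>s\<bar> - 4/5 * (u + \<theta>)" by (simp add: distrib_left)
  have "?m \<le> 1 - \<bar>s\<bar> + 25 * u" by (rule min.cobounded2)
  then have 2: "?m - 4/5 * \<theta> \<le> 1 - \<bar>s\<bar> + 25 * (u + \<theta>)" using \<theta> by (simp add: distrib_left)
  have le: "?m - 4/5 * \<theta> \<le> ?m'" by (rule min.boundedI[OF 1 2])
  have "0 \<le> max 0 (?m' - 25 * \<bar>r\<bar>)" "?m' - 25 * \<bar>r\<bar> \<le> max 0 (?m' - 25 * \<bar>r\<bar>)" by simp_all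
  then show "tent s u r \<le> tent s (u + \<theta>) r + 4/5 * \<theta>"
    unfolding tent_def using \<theta> le by (intro max.boundedI) linarith+
qed

lemma tent_pos:
  assumes "tent s u r \<noteq> 0"
  shows "25 * \<bar>r\<bar> < 1 - \<bar>s\<bar> - 4/5 * u" "25 * \<bar>r\<bar> < 1 - \<bar>s\<bar> + 25 * u"
  using assms by (auto simp: tent_def max_def min_def split: if_splits)

text \<open>
  The amounts of two successive pushes, in coordinates in which the upper strand of the crossing
  is the \<open>x\<close>-axis at height \<open>1\<close> and the lower strand the
  \<open>y\<close>-axis at height \<open>0\<close>. The first push has the direction \<open>(-
  19/20, - 1/5, - 10)\<close> and the second one \<open>(- 11/20, 3/10, 0)\<close>. In both
  cases the second argument of \<open>tent\<close> grows with unit speed in the direction of the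
  push, and the other arguments are constant along it.
\<close>

definition push1 :: "real \<Rightarrow> real \<Rightarrow> real \<Rightarrow> real" where
  "push1 x y h = tent ((x - 9/20 - 19/4 * y) / (3/20)) (- 5 * y) (h - 1 - 50 * y)"

definition push2 :: "real \<Rightarrow> real \<Rightarrow> real \<Rightarrow> real" where
  "push2 x y h = tent ((h + 4) / 5) (10/3 * (y + 1/10) - (h + 4) / 15)
     (3/10 * (x - 1/20) + 11/20 * (y + 1/10) - 11/250 * (h + 4))"

lemma push1_slope:
  assumes "0 \<le> \<theta>"
  shows "push1 x y h \<le> push1 (x + \<theta> * (- 19/20)) (y + \<theta> * (- 1/5)) (h + \<theta> * (- 10)) + 4/5 * \<theta>"
proof -
  have e: "x + \<theta> * (- 19/20) - 9/20 - 19/4 * (y + \<theta> * (- 1/5)) = x - 9/20 - 19/4 * y"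
    "- 5 * (y + \<theta> * (- 1/5)) = - 5 * y + \<theta>"
    "h + \<theta> * (- 10) - 1 - 50 * (y + \<theta> * (- 1/5)) = h - 1 - 50 * y" by (simp_all add: field_simps)
  show ?thesis unfolding push1_def e by (rule tent_slope[OF assms])
qed

lemma push2_slope:
  assumes "0 \<le> \<theta>"
  shows "push2 x y h \<le> push2 (x + \<theta> * (- 11/20)) (y + \<theta> * (3/10)) (h + \<theta> * 0) + 4/5 * \<theta>"
proof -
  have e: "10/3 * (y + \<theta> * (3/10) + 1/10) - (h + \<theta> * 0 + 4) / 15 = 10/3 * (y + 1/10) - (h + 4) / 15 + \<theta>"
    "3/10 * (x + \<theta> * (- 11/20) - 1/20) + 11/20 * (y + \<theta> * (3/10) + 1/10) - 11/250 * (h + \<theta> * 0 + 4) =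
     3/10 * (x - 1/20) + 11/20 * (y + 1/10) - 11/250 * (h + 4)"
    "h + \<theta> * 0 + 4 = h + 4" by (simp_all add: field_simps)
  show ?thesis unfolding push2_def e(1,2) unfolding e(3) by (rule tent_slope[OF assms])
qed

lemma push1_support:
  assumes "push1 x y h \<noteq> 0" shows "\<bar>x\<bar> < 1 \<and> \<bar>y\<bar> < 1"
proof -
  define s r where "s = (x - 9/20 - 19/4 * y) / (3/20)" and "r = h - 1 - 50 * y"
  have x: "x = 9/20 + 19/4 * y + 3/20 * s" by (simp add: s_def field_simps)
  have "tent s (- 5 * y) r \<noteq> 0" using assms by (simp only: push1_def s_def r_def not_False_eq_True)
  note p = tent_pos[OF this]
  have "\<bar>s\<bar> < 1 + 4 * y" "\<bar>s\<bar> < 1 - 125 * y" using p by linarith+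
  then show ?thesis unfolding x by linarith
qed

lemma push2_support:
  assumes "push2 x y h \<noteq> 0" shows "\<bar>x\<bar> < 1 \<and> \<bar>y\<bar> < 1"
proof -
  define s where "s = (h + 4) / 5"
  have h: "h = 5 * s - 4" by (simp add: s_def field_simps)
  define u r where "u = 10/3 * (y + 1/10) - s / 3" and "r = 3/10 * (x - 1/20) + 11/20 * (y + 1/10) - 11/50 * s"
  have y: "y = 3/10 * u + 1/10 * s - 1/10" by (simp add: u_def field_simps)
  have x: "x = 1/20 + 10/3 * r - 11/20 * u + 11/20 * s" by (simp add: u_def r_def field_simps)
  have "tent s u r \<noteq> 0" using assms unfolding push2_def h u_def r_def by (simp add: field_simps)
  note p = tent_pos[OF this]
  have ab: "s \<le> \<bar>s\<bar>" "- s \<le> \<bar>s\<bar>" "r \<le> \<bar>r\<bar>" "- r \<le> \<bar>r\<bar>" "0 \<le> \<bar>r\<bar>" by simp_all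
  have "x < 1" "- x < 1" "y < 1" "- y < 1" unfolding x y using p ab by argo+
  then show ?thesis by (simp add: abs_less_iff)
qed

text \<open>Restrictions of the two amounts to the upper strand.\<close>

definition profile1 :: "real \<Rightarrow> real" where "profile1 x = max 0 (1 - \<bar>x - 9/20\<bar> / (3/20))"

definition profile2 :: "real \<Rightarrow> real" where "profile2 x = max 0 (1 - \<bar>x - 21/40\<bar> / (3/40))"

lemma push_under: "push1 0 y 0 = 0" "push2 0 y 0 = 0"
proof -
  show "push1 0 y 0 = 0" unfolding push1_def
    by (rule ccontr, drule tent_pos) (auto simp: abs_if field_simps split: if_splits)
  show "push2 0 y 0 = 0" unfolding push2_def
    by (rule ccontr, drule tent_pos) (auto simp: abs_if field_simps split: if_splits)
qed

lemma push1_over: "push1 x 0 1 = profile1 x"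
  unfolding push1_def tent_def profile1_def by (auto simp: abs_if max_def min_def field_simps)

lemma profile1_cases: "x \<le> 3/10 \<Longrightarrow> profile1 x = 0" "3/10 \<le> x \<Longrightarrow> x \<le> 9/20 \<Longrightarrow> profile1 x = 20/3 * x - 2"
  "9/20 \<le> x \<Longrightarrow> x \<le> 3/5 \<Longrightarrow> profile1 x = 4 - 20/3 * x" "3/5 \<le> x \<Longrightarrow> profile1 x = 0"
  by (auto simp: profile1_def abs_if max_def field_simps)

lemma profile2_cases: "x \<le> 9/20 \<Longrightarrow> profile2 x = 0" "9/20 \<le> x \<Longrightarrow> x \<le> 21/40 \<Longrightarrow> profile2 x = 40/3 * x - 6"
  "21/40 \<le> x \<Longrightarrow> x \<le> 3/5 \<Longrightarrow> profile2 x = 8 - 40/3 * x" "3/5 \<le> x \<Longrightarrow> profile2 x = 0"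
  by (auto simp: profile2_def abs_if max_def field_simps)

text \<open>
  The image of the upper strand under the first push is straight on the part that the second
  push moves.
\<close>

lemma push2_over: "push2 (x - 19/20 * profile1 x) (- 1/5 * profile1 x) (1 - 10 * profile1 x) = profile2 x"
proof -
  consider "x \<le> 3/10" | "3/10 \<le> x" "x \<le> 9/20" | "9/20 \<le> x" "x \<le> 3/5" | "3/5 \<le> x" by linarith
  then show ?thesis
  proof cases
    case 1
    then show ?thesis by (auto simp: profile1_cases profile2_cases push2_def tent_def max_def min_def)
  next
    case 2
    then show ?thesis by (simp add: profile1_cases profile2_cases push2_def tent_def) (auto simp: max_def min_def abs_if field_simps)
  next
    case 3
    have arg: "(1 - 10 * (4 - 20/3 * x) + 4) / 5 = 40/3 * x - 7"
      "10/3 * (- 1/5 * (4 - 20/3 * x) + 1/10) - (1 - 10 * (4 - 20/3 * x) + 4) / 15 = 0"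
      "3/10 * (x - 19/20 * (4 - 20/3 * x) - 1/20) + 11/20 * (- 1/5 * (4 - 20/3 * x) + 1/10)
        - 11/250 * (1 - 10 * (4 - 20/3 * x) + 4) = 0" by (simp_all add: field_simps)
    have "push2 (x - 19/20 * profile1 x) (- 1/5 * profile1 x) (1 - 10 * profile1 x) = tent (40/3 * x - 7) 0 0"
      unfolding push2_def profile1_cases(3)[OF 3] arg ..
    also have "\<dots> = profile2 x" unfolding tent_def profile2_def by (auto simp: abs_if max_def field_simps)
    finally show ?thesis .
  next
    case 4
    then show ?thesis by (auto simp: profile1_cases profile2_cases push2_def tent_def max_def min_def)
  qed
qed

text \<open>
  The image of the upper strand under both pushes: a finger that leaves the
  \<open>x\<close>-axis at \<open>3/10\<close>, runs to \<open>(- 1/2, - 1/5)\<close>, then to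
  \<open>(- 1/2, 1/5)\<close>, and back to the axis at \<open>3/5\<close>. It encloses the
  crossing at the origin.
\<close>

definition finger_x :: "real \<Rightarrow> real" where "finger_x x = x - 19/20 * profile1 x - 11/20 * profile2 x"

definition finger_y :: "real \<Rightarrow> real" where "finger_y x = 3/10 * profile2 x - 1/5 * profile1 x"

lemma finger_cases:
  "x \<le> 3/10 \<Longrightarrow> finger_x x = x \<and> finger_y x = 0"
  "3/10 \<le> x \<Longrightarrow> x \<le> 9/20 \<Longrightarrow> finger_x x = 19/10 - 16/3 * x \<and> finger_y x = 2/5 - 4/3 * x"
  "9/20 \<le> x \<Longrightarrow> x \<le> 21/40 \<Longrightarrow> finger_x x = - 1/2 \<and> finger_y x = 16/3 * x - 13/5"
  "21/40 \<le> x \<Longrightarrow> x \<le> 3/5 \<Longrightarrow> finger_x x = 44/3 * x - 41/5 \<and> finger_y x = 8/5 - 8/3 * x"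
  "3/5 \<le> x \<Longrightarrow> finger_x x = x \<and> finger_y x = 0"
  by (auto simp: finger_x_def finger_y_def profile1_cases profile2_cases field_simps)

lemma finger_split:
  obtains "x \<le> 3/10" "finger_x x = x" "finger_y x = 0"
  | "3/10 \<le> x" "x \<le> 9/20" "finger_x x = 19/10 - 16/3 * x" "finger_y x = 2/5 - 4/3 * x"
  | "9/20 \<le> x" "x \<le> 21/40" "finger_x x = - 1/2" "finger_y x = 16/3 * x - 13/5"
  | "21/40 \<le> x" "x \<le> 3/5" "finger_x x = 44/3 * x - 41/5" "finger_y x = 8/5 - 8/3 * x"
  | "3/5 \<le> x" "finger_x x = x" "finger_y x = 0"
proof -
  consider "x \<le> 3/10" | "3/10 \<le> x" "x \<le> 9/20" | "9/20 \<le> x" "x \<le> 21/40" | "21/40 \<le> x" "x \<le> 3/5" | "3/5 \<le> x" by linarith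
  then show ?thesis
  proof cases
    case 1 then show ?thesis using that(1) finger_cases(1)[of x] by blast
  next
    case 2 then show ?thesis using that(2) finger_cases(2)[of x] by blast
  next
    case 3 then show ?thesis using that(3) finger_cases(3)[of x] by blast
  next
    case 4 then show ?thesis using that(4) finger_cases(4)[of x] by blast
  next
    case 5 then show ?thesis using that(5) finger_cases(5)[of x] by blast
  qed
qed

text \<open>The finger crosses its own strand in \<open>(- 1/2, 0)\<close>.\<close>

lemma finger_double:
  assumes "finger_x x = finger_x x'" "finger_y x = finger_y x'" "x \<noteq> x'"
  shows "x = - 1/2 \<and> x' = 39/80 \<or> x = 39/80 \<and> x' = - 1/2"
  by (cases x rule: finger_split; cases x' rule: finger_split; use assms in linarith)

text \<open>Besides the origin, the finger meets the lower strand on both sides of the crossing.\<close>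

lemma finger_on_axis:
  assumes "finger_x x = 0"
  shows "x = 0 \<and> finger_y x = 0 \<or> x = 57/160 \<and> finger_y x = - 3/40 \<or> x = 123/220 \<and> finger_y x = 6/55"
  by (cases x rule: finger_split; use assms in linarith)

lemma finger_bounds: "\<bar>x\<bar> \<le> 1 \<Longrightarrow> \<bar>finger_x x\<bar> \<le> 1 \<and> \<bar>finger_y x\<bar> \<le> 1"
  "3/10 \<le> x \<Longrightarrow> x \<le> 3/5 \<Longrightarrow> \<bar>finger_x x\<bar> < 1 \<and> \<bar>finger_y x\<bar> < 1"
  by (cases x rule: finger_split; auto)+

lemma finger_values: "finger_x 0 = 0" "finger_y 0 = 0" "finger_x (-1/2) = -1/2" "finger_y (-1/2) = 0" "finger_x (39/80) = -1/2" "finger_y (39/80) = 0"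
  "finger_x (57/160) = 0" "finger_y (57/160) = - 3/40" "finger_x (123/220) = 0" "finger_y (123/220) = 6/55"
  using finger_cases[of 0] finger_cases[of "-1/2"] finger_cases[of "39/80"] finger_cases[of "57/160"] finger_cases[of "123/220"] by simp_all

lemma finger_right:
  obtains \<delta> p q where "\<delta> > 0" "p \<noteq> 0 \<or> q \<noteq> 0"
    "\<And>h. 0 \<le> h \<Longrightarrow> h < \<delta> \<Longrightarrow> finger_x (x + h) = finger_x x + h * p \<and> finger_y (x + h) = finger_y x + h * q"
proof -
  consider "x < 3/10" | "3/10 \<le> x" "x < 9/20" | "9/20 \<le> x" "x < 21/40" | "21/40 \<le> x" "x < 3/5" | "3/5 \<le> x" by linarith
  then show ?thesis
  proof cases
    case 1 then show ?thesis by (intro that[of "3/10 - x" 1 0]) (simp_all add: finger_cases(1) algebra_simps)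
  next
    case 2 then show ?thesis by (intro that[of "9/20 - x" "-16/3" "-4/3"]) (simp_all add: finger_cases(2) algebra_simps)
  next
    case 3 then show ?thesis by (intro that[of "21/40 - x" 0 "16/3"]) (simp_all add: finger_cases(3) algebra_simps)
  next
    case 4 then show ?thesis by (intro that[of "3/5 - x" "44/3" "-8/3"]) (simp_all add: finger_cases(4) algebra_simps)
  next
    case 5 then show ?thesis by (intro that[of 1 1 0]) (simp_all add: finger_cases(5) algebra_simps)
  qed
qed

lemma finger_left:
  obtains \<delta> p q where "\<delta> > 0" "p \<noteq> 0 \<or> q \<noteq> 0"
    "\<And>h. h \<le> 0 \<Longrightarrow> - \<delta> < h \<Longrightarrow> finger_x (x + h) = finger_x x + h * p \<and> finger_y (x + h) = finger_y x + h * q"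
proof -
  consider "x \<le> 3/10" | "3/10 < x" "x \<le> 9/20" | "9/20 < x" "x \<le> 21/40" | "21/40 < x" "x \<le> 3/5" | "3/5 < x" by linarith
  then show ?thesis
  proof cases
    case 1 then show ?thesis by (intro that[of 1 1 0]) (simp_all add: finger_cases(1) algebra_simps)
  next
    case 2 then show ?thesis by (intro that[of "x - 3/10" "-16/3" "-4/3"]) (simp_all add: finger_cases(2) algebra_simps)
  next
    case 3 then show ?thesis by (intro that[of "x - 9/20" 0 "16/3"]) (simp_all add: finger_cases(3) algebra_simps)
  next
    case 4 then show ?thesis by (intro that[of "x - 21/40" "44/3" "-8/3"]) (simp_all add: finger_cases(4) algebra_simps)
  next
    case 5 then show ?thesis by (intro that[of "x - 3/5" 1 0]) (simp_all add: finger_cases(5) algebra_simps)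
  qed
qed

lemma finger_direction:
  assumes "x \<in> {-1/2, 0, 57/160, 39/80, 123/220}"
  obtains \<delta> p q where "\<delta> > 0"
    "\<And>h. \<bar>h\<bar> < \<delta> \<Longrightarrow> finger_x (x + h) = finger_x x + h * p \<and> finger_y (x + h) = finger_y x + h * q"
    "x = -1/2 \<Longrightarrow> p = 1 \<and> q = 0" "x = 0 \<Longrightarrow> p = 1 \<and> q = 0" "x = 57/160 \<Longrightarrow> p = -16/3"
    "x = 39/80 \<Longrightarrow> p = 0 \<and> q = 16/3" "x = 123/220 \<Longrightarrow> p = 44/3"
proof -
  consider "x = -1/2 \<or> x = 0" | "x = 57/160" | "x = 39/80" | "x = 123/220" using assms by auto
  then show ?thesis
  proof cases
    case 1 then show ?thesis
    proof (intro that[of "1/10" 1 0])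
      fix h :: real assume "\<bar>h\<bar> < 1/10"
      then have "x + h \<le> 3/10" "x \<le> 3/10" using 1 by auto
      then show "finger_x (x + h) = finger_x x + h * 1 \<and> finger_y (x + h) = finger_y x + h * 0" by (simp add: finger_cases(1))
    qed auto
  next
    case 2 then show ?thesis
    proof (intro that[of "1/100" "-16/3" "-4/3"])
      fix h :: real assume "\<bar>h\<bar> < 1/100"
      then have "3/10 \<le> x + h" "x + h \<le> 9/20" using 2 by auto
      then show "finger_x (x + h) = finger_x x + h * (-16/3) \<and> finger_y (x + h) = finger_y x + h * (-4/3)"
        unfolding 2 using finger_cases(2)[of "57/160 + h"] by (simp add: finger_values field_simps)
    qed auto
  next
    case 3 then show ?thesis
    proof (intro that[of "1/100" 0 "16/3"])
      fix h :: real assume "\<bar>h\<bar> < 1/100"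
      then have "9/20 \<le> x + h" "x + h \<le> 21/40" using 3 by auto
      then show "finger_x (x + h) = finger_x x + h * 0 \<and> finger_y (x + h) = finger_y x + h * (16/3)" using 3 by (simp add: finger_cases(3) finger_values)
    qed auto
  next
    case 4 then show ?thesis
    proof (intro that[of "1/100" "44/3" "-8/3"])
      fix h :: real assume "\<bar>h\<bar> < 1/100"
      then have "21/40 \<le> x + h" "x + h \<le> 3/5" using 4 by auto
      then show "finger_x (x + h) = finger_x x + h * (44/3) \<and> finger_y (x + h) = finger_y x + h * (-8/3)"
        unfolding 4 using finger_cases(4)[of "123/220 + h"] by (simp add: finger_values field_simps)
    qed auto
  qed
qed

section \<open>The isotopy near a crossing\<close>

text \<open>
  A crossing with upper strand \<open>i\<close> and lower strand \<open>j\<close>, both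
  straight, and a parallelogram around it that no other part of the projection enters.
  Coordinates are chosen so that the parallelogram is given by \<open>\<bar>x\<bar> \<le>
  1\<close> and \<open>\<bar>y\<bar> \<le> 1\<close>.
\<close>

locale crossing_box =
  fixes K :: link and i j :: nat and s t \<epsilon> :: real and a b :: "complex \<times> real"
  assumes emb: "embedded_link K" and dia: "is_diagram (projection K)"
    and i: "i < link_components K" and j: "j < link_components K" and ij: "i \<noteq> j"
    and eps: "0 < \<epsilon>" and small: "\<epsilon> \<le> 1/8"
    and la: "\<And>x. \<bar>x\<bar> \<le> 2 \<Longrightarrow> link_curve K i (s + \<epsilon> * x) = link_curve K i s + x *\<^sub>R a"
    and lb: "\<And>y. \<bar>y\<bar> \<le> 2 \<Longrightarrow> link_curve K j (t + \<epsilon> * y) = link_curve K j t + y *\<^sub>R b"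
    and meet: "fst (link_curve K i s) = fst (link_curve K j t)"
    and above: "snd (link_curve K j t) < snd (link_curve K i s)"
    and det: "det2 (fst a) (fst b) \<noteq> 0"
    and box: "\<And>k r x y. k < link_components K \<Longrightarrow> \<bar>x\<bar> \<le> 1 \<Longrightarrow> \<bar>y\<bar> \<le> 1 \<Longrightarrow>
      fst (link_curve K k r) = fst (link_curve K i s) + of_real x * fst a + of_real y * fst b \<Longrightarrow>
      k = i \<and> y = 0 \<and> (\<exists>m::int. r = s + \<epsilon> * x + of_int m) \<or>
      k = j \<and> x = 0 \<and> (\<exists>m::int. r = t + \<epsilon> * y + of_int m)"
begin

abbreviation "n \<equiv> link_components K"
abbreviation "D \<equiv> projection K"

definition q :: "real \<Rightarrow> real \<Rightarrow> complex" where
  "q x y = fst (link_curve K i s) + of_real x * fst a + of_real y * fst b"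

definition gap :: real where "gap = snd (link_curve K i s) - snd (link_curve K j t)"

text \<open>
  Coordinates of space in which the strands are the axes of \<open>push1\<close>: height
  \<open>0\<close> is on the plane through the lower strand, height \<open>1\<close> on the
  parallel plane through the upper strand.
\<close>

definition pt :: "real \<Rightarrow> real \<Rightarrow> real \<Rightarrow> complex \<times> real" where
  "pt x y h = (q x y, snd (link_curve K j t) + x * snd a + y * snd b + h * gap)"

text \<open>
  Inverse to \<open>q\<close> by the rule of Cramer; \<open>cy\<close> and \<open>ch\<close>
  recover the other two coordinates.
\<close>

definition cx :: "complex \<Rightarrow> real" where
  "cx w = det2 (w - fst (link_curve K i s)) (fst b) / det2 (fst a) (fst b)"

definition cy :: "complex \<Rightarrow> real" where
  "cy w = det2 (fst a) (w - fst (link_curve K i s)) / det2 (fst a) (fst b)"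

definition ch :: "complex \<times> real \<Rightarrow> real" where
  "ch X = (snd X - snd (link_curve K j t) - cx (fst X) * snd a - cy (fst X) * snd b) / gap"

lemma gap: "gap > 0" using above by (simp add: gap_def)

lemma cx_q [simp]: "cx (q x y) = x"
proof -
  have "det2 (q x y - fst (link_curve K i s)) (fst b) = x * det2 (fst a) (fst b)"
    by (simp add: q_def algebra_simps)
  then show ?thesis using det by (simp add: cx_def)
qed

lemma cy_q [simp]: "cy (q x y) = y"
proof -
  have "det2 (fst a) (q x y - fst (link_curve K i s)) = y * det2 (fst a) (fst b)"
    by (simp add: q_def algebra_simps)
  then show ?thesis using det by (simp add: cy_def)
qed

lemma q_coords: "q (cx w) (cy w) = w"
proof -
  let ?d = "det2 (fst a) (fst b)" and ?w = "w - fst (link_curve K i s)"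
  have "of_real ?d * (of_real (cx w) * fst a + of_real (cy w) * fst b) =
      of_real (det2 ?w (fst b)) * fst a + of_real (det2 (fst a) ?w) * fst b"
    using det by (simp add: cx_def cy_def distrib_left flip: of_real_mult mult.assoc)
  also have "\<dots> = of_real ?d * ?w" by (simp add: complex_eq_iff algebra_simps)
  finally have "of_real (cx w) * fst a + of_real (cy w) * fst b = ?w"
    using det by (metis mult_cancel_left of_real_eq_0_iff)
  then show ?thesis by (simp add: q_def algebra_simps)
qed

lemma q_eq_iff [simp]: "q x y = q x' y' \<longleftrightarrow> x = x' \<and> y = y'"
  by (metis cx_q cy_q)

lemma fst_pt [simp]: "fst (pt x y h) = q x y" by (simp add: pt_def)

lemma ch_pt [simp]: "ch (pt x y h) = h"
  using gap by (simp add: ch_def pt_def)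

lemma pt_coords: "pt (cx (fst X)) (cy (fst X)) (ch X) = X"
proof -
  have "ch X * gap = snd X - snd (link_curve K j t) - cx (fst X) * snd a - cy (fst X) * snd b"
    using gap by (simp add: ch_def)
  then show ?thesis by (simp add: pt_def prod_eq_iff q_coords)
qed

definition dir :: "real \<Rightarrow> real \<Rightarrow> real \<Rightarrow> complex \<times> real" where
  "dir x y h = (of_real x * fst a + of_real y * fst b, x * snd a + y * snd b + h * gap)"

lemma pt_dir: "pt x y h + \<theta> *\<^sub>R dir x' y' h' = pt (x + \<theta> * x') (y + \<theta> * y') (h + \<theta> * h')"
  by (simp add: pt_def dir_def q_def prod_eq_iff scaleR_conv_of_real algebra_simps)

lemma coords_continuous: "continuous_on UNIV (\<lambda>X :: complex \<times> real. cx (fst X))" "continuous_on UNIV (\<lambda>X :: complex \<times> real. cy (fst X))"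
  "continuous_on UNIV ch"
proof -
  show c: "continuous_on UNIV (\<lambda>X :: complex \<times> real. cx (fst X))" "continuous_on UNIV (\<lambda>X :: complex \<times> real. cy (fst X))"
    unfolding cx_def cy_def using det by (intro continuous_intros; simp)+
  show "continuous_on UNIV ch" unfolding ch_def using gap by (intro continuous_intros c; simp)
qed

definition G1 :: "real \<Rightarrow> complex \<times> real \<Rightarrow> complex \<times> real" where
  "G1 \<tau> X = X + (\<tau> * push1 (cx (fst X)) (cy (fst X)) (ch X)) *\<^sub>R dir (- 19/20) (- 1/5) (- 10)"

definition G2 :: "real \<Rightarrow> complex \<times> real \<Rightarrow> complex \<times> real" where
  "G2 \<tau> X = X + (\<tau> * push2 (cx (fst X)) (cy (fst X)) (ch X)) *\<^sub>R dir (- 11/20) (3/10) 0"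

lemma G1_pt: "G1 1 (pt x y h) = pt (x + push1 x y h * (- 19/20)) (y + push1 x y h * (- 1/5)) (h + push1 x y h * (- 10))"
  unfolding G1_def fst_pt cx_q cy_q ch_pt pt_dir by simp

lemma G2_pt: "G2 1 (pt x y h) = pt (x + push2 x y h * (- 11/20)) (y + push2 x y h * (3/10)) h"
  unfolding G2_def fst_pt cx_q cy_q ch_pt pt_dir by simp

lemma ambient_G1: "ambient_isotopy G1"
proof -
  have "ambient_isotopy (\<lambda>\<tau> X. X + (\<tau> * push1 (cx (fst X)) (cy (fst X)) (ch X)) *\<^sub>R dir (- 19/20) (- 1/5) (- 10))"
  proof (rule ambient_isotopy_push[where l = "4/5"])
    show "continuous_on UNIV (\<lambda>X. push1 (cx (fst X)) (cy (fst X)) (ch X))"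
      unfolding push1_def tent_def by (intro continuous_intros coords_continuous) auto
    fix X and \<theta> :: real assume \<theta>: "0 \<le> \<theta>"
    obtain x y h where X: "X = pt x y h" using pt_coords by metis
    show "push1 (cx (fst X)) (cy (fst X)) (ch X) \<le>
      push1 (cx (fst (X + \<theta> *\<^sub>R dir (- 19/20) (- 1/5) (- 10)))) (cy (fst (X + \<theta> *\<^sub>R dir (- 19/20) (- 1/5) (- 10))))
        (ch (X + \<theta> *\<^sub>R dir (- 19/20) (- 1/5) (- 10))) + 4/5 * \<theta>"
      unfolding X pt_dir fst_pt cx_q cy_q ch_pt by (rule push1_slope[OF \<theta>])
  qed simp_all
  then show ?thesis by (simp add: G1_def[abs_def])
qed

lemma ambient_G2: "ambient_isotopy G2"
proof -
  have "ambient_isotopy (\<lambda>\<tau> X. X + (\<tau> * push2 (cx (fst X)) (cy (fst X)) (ch X)) *\<^sub>R dir (- 11/20) (3/10) 0)"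
  proof (rule ambient_isotopy_push[where l = "4/5"])
    show "continuous_on UNIV (\<lambda>X. push2 (cx (fst X)) (cy (fst X)) (ch X))"
      unfolding push2_def tent_def by (intro continuous_intros coords_continuous) auto
    fix X and \<theta> :: real assume \<theta>: "0 \<le> \<theta>"
    obtain x y h where X: "X = pt x y h" using pt_coords by metis
    show "push2 (cx (fst X)) (cy (fst X)) (ch X) \<le>
      push2 (cx (fst (X + \<theta> *\<^sub>R dir (- 11/20) (3/10) 0))) (cy (fst (X + \<theta> *\<^sub>R dir (- 11/20) (3/10) 0)))
        (ch (X + \<theta> *\<^sub>R dir (- 11/20) (3/10) 0)) + 4/5 * \<theta>"
      unfolding X pt_dir fst_pt cx_q cy_q ch_pt by (rule push2_slope[OF \<theta>])
  qed simp_all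
  then show ?thesis by (simp add: G2_def[abs_def])
qed

definition fingered :: link where "fingered = image_link (G2 1) (image_link (G1 1) K)"

abbreviation "E \<equiv> projection fingered"

lemma fingered_components [simp]: "link_components fingered = n" by (simp add: fingered_def)

lemma fingered_curve: "link_curve fingered k r = G2 1 (G1 1 (link_curve K k r))" by (simp add: fingered_def)

lemma fingered_isotopic: "link_isotopic fingered K"
  unfolding fingered_def
  by (rule link_isotopic_trans[OF link_isotopic_image_link[OF ambient_G2] link_isotopic_image_link[OF ambient_G1]])

lemma fingered_embedded: "embedded_link fingered"
  unfolding fingered_def by (intro embedded_image_link ambient_G1 ambient_G2 emb)

lemma over_strand: "\<bar>x\<bar> \<le> 2 \<Longrightarrow> link_curve K i (s + \<epsilon> * x) = pt x 0 1"
  by (simp add: la pt_def q_def gap_def prod_eq_iff scaleR_conv_of_real)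

lemma under_strand: "\<bar>y\<bar> \<le> 2 \<Longrightarrow> link_curve K j (t + \<epsilon> * y) = pt 0 y 0"
  using meet by (simp add: lb pt_def q_def gap_def prod_eq_iff scaleR_conv_of_real)

lemma over_strand2: "\<bar>x\<bar> \<le> 2 \<Longrightarrow> link_curve fingered i (s + \<epsilon> * x) = pt (finger_x x) (finger_y x) (1 - 10 * profile1 x)"
proof -
  assume x: "\<bar>x\<bar> \<le> 2"
  have p2: "push2 (x + profile1 x * (- 19/20)) (0 + profile1 x * (- 1/5)) (1 + profile1 x * (- 10)) = profile2 x"
    using push2_over[of x] by (simp add: mult.commute)
  show ?thesis unfolding fingered_curve over_strand[OF x] G1_pt push1_over G2_pt p2
    by (simp add: finger_x_def finger_y_def algebra_simps)
qed

lemma under_strand2: "\<bar>y\<bar> \<le> 2 \<Longrightarrow> link_curve fingered j (t + \<epsilon> * y) = pt 0 y 0"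
  unfolding fingered_curve by (simp add: under_strand G1_pt G2_pt push_under)

lemma outside_box:
  assumes "\<not> (\<bar>cx (fst X)\<bar> < 1 \<and> \<bar>cy (fst X)\<bar> < 1)" shows "G2 1 (G1 1 X) = X"
proof -
  obtain x y h where X: "X = pt x y h" using pt_coords by metis
  have "push1 x y h = 0" "push2 x y h = 0" using push1_support[of x y h] push2_support[of x y h] assms X by auto
  then show ?thesis unfolding X by (simp add: G1_pt G2_pt)
qed

lemma add_int [simp]:
  assumes "k < n"
  shows "link_curve K k (r + of_int m) = link_curve K k r" "link_curve fingered k (r + of_int m) = link_curve fingered k r"
  using embedded_link_cong[OF emb assms, of "r + of_int m" r] embedded_link_cong[OF fingered_embedded, of k "r + of_int m" r] assms
  by auto

text \<open>The parameters that belong to the finger.\<close>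

definition modified :: "nat \<Rightarrow> real \<Rightarrow> bool" where
  "modified k r \<longleftrightarrow> k = i \<and> (\<exists>x (m::int). 3/10 \<le> x \<and> x \<le> 3/5 \<and> r = s + \<epsilon> * x + of_int m)"

text \<open>
  A point of the link over the parallelogram lies on one of the two strands, and there only the
  finger moves.
\<close>

lemma unmodified:
  assumes k: "k < n" and nm: "\<not> modified k r" shows "link_curve fingered k r = link_curve K k r"
proof (cases "\<bar>cx (fst (link_curve K k r))\<bar> < 1 \<and> \<bar>cy (fst (link_curve K k r))\<bar> < 1")
  case False
  then show ?thesis unfolding fingered_curve by (rule outside_box)
next
  case True
  let ?w = "fst (link_curve K k r)"
  have "k = i \<and> cy ?w = 0 \<and> (\<exists>m::int. r = s + \<epsilon> * cx ?w + of_int m) \<or>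
      k = j \<and> cx ?w = 0 \<and> (\<exists>m::int. r = t + \<epsilon> * cy ?w + of_int m)"
    by (rule box[OF k]) (use True q_coords[of ?w] in \<open>simp_all add: q_def\<close>)
  then show ?thesis
  proof
    assume "k = i \<and> cy ?w = 0 \<and> (\<exists>m::int. r = s + \<epsilon> * cx ?w + of_int m)"
    then obtain x and m :: int where x: "k = i" "r = s + \<epsilon> * x + of_int m" "\<bar>x\<bar> < 1" using True by auto
    then have "\<not> (3/10 \<le> x \<and> x \<le> 3/5)" using nm unfolding modified_def by blast
    then have "finger_x x = x" "finger_y x = 0" "profile1 x = 0" using finger_cases[of x] profile1_cases[of x] by auto
    then show ?thesis using x i by (simp add: over_strand over_strand2)
  next
    assume "k = j \<and> cx ?w = 0 \<and> (\<exists>m::int. r = t + \<epsilon> * cy ?w + of_int m)"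
    then obtain y and m :: int where y: "k = j" "r = t + \<epsilon> * y + of_int m" "\<bar>y\<bar> < 1" using True by auto
    then show ?thesis using j by (simp add: under_strand under_strand2)
  qed
qed

lemma unmodified_near:
  assumes "\<not> modified k r" obtains \<eta> where "\<eta> > 0" "\<And>r'. \<bar>r' - r\<bar> < \<eta> \<Longrightarrow> \<not> modified k r'"
proof (cases "k = i")
  case False
  then show ?thesis using that[of 1] by (simp add: modified_def)
next
  case True
  define c f where "c = s + \<epsilon> * (3/10)" and "f = frac (r - c)"
  define M where "M = \<lfloor>r - c\<rfloor>"
  have r: "r = c + f + of_int M" by (simp add: f_def M_def frac_def)
  have f: "f < 1" by (simp add: f_def frac_lt_1)
  have f0: "f > \<epsilon> * (3/10)"
  proof (rule ccontr)
    assume "\<not> ?thesis"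
    then have le: "f / \<epsilon> \<le> 3/10" using eps by (simp add: field_simps)
    have "0 \<le> f" by (simp add: f_def)
    then have "0 \<le> f / \<epsilon>" using eps by simp
    moreover have "r = s + \<epsilon> * (3/10 + f / \<epsilon>) + of_int M" using r eps by (simp add: c_def distrib_left)
    moreover have "3/10 + f / \<epsilon> \<le> 3/5" using le by linarith
    ultimately have "modified k r" unfolding modified_def using True
      by (intro conjI exI[of _ "3/10 + f / \<epsilon>"] exI[of _ M]) linarith+
    then show False using assms by simp
  qed
  show ?thesis
  proof (rule that[of "min (f - \<epsilon> * (3/10)) (1 - f)"])
    fix r' assume r': "\<bar>r' - r\<bar> < min (f - \<epsilon> * (3/10)) (1 - f)"
    show "\<not> modified k r'"
    proof
      assume "modified k r'"
      then obtain x and m :: int where x: "3/10 \<le> x" "x \<le> 3/5" "r' = s + \<epsilon> * x + of_int m" unfolding modified_def by blast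
      have "\<epsilon> * (3/10) \<le> \<epsilon> * x" "\<epsilon> * x \<le> \<epsilon> * (3/5)" using x eps by (intro mult_left_mono; simp)+
      moreover have "\<epsilon> * x + of_int m - \<epsilon> * (3/10) - of_int M = r' - r + f" using x(3) r by (simp add: c_def)
      ultimately have "of_int (m - M) < (1::real)" "of_int (m - M) > (0::real)" using r' by auto
      then show False by simp
    qed
  qed (use f f0 in auto)
qed

lemma curve_E_over: "\<bar>x\<bar> \<le> 2 \<Longrightarrow> curve E i (s + \<epsilon> * x + of_int m) = q (finger_x x) (finger_y x)"
  using i by (simp add: over_strand2)

lemma curve_E_under: "\<bar>y\<bar> \<le> 2 \<Longrightarrow> curve E j (t + \<epsilon> * y + of_int m) = q 0 y"
  using j by (simp add: under_strand2)

lemma curve_D_over: "\<bar>x\<bar> \<le> 2 \<Longrightarrow> curve D i (s + \<epsilon> * x + of_int m) = q x 0"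
  using i by (simp add: over_strand)

lemma curve_D_under: "\<bar>y\<bar> \<le> 2 \<Longrightarrow> curve D j (t + \<epsilon> * y + of_int m) = q 0 y"
  using j by (simp add: under_strand)

lemma in_box:
  assumes k: "k < n" and w: "curve E k r = q x y" "\<bar>x\<bar> \<le> 1" "\<bar>y\<bar> \<le> 1"
  shows "k = i \<and> (\<exists>x' (m::int). \<bar>x'\<bar> \<le> 1 \<and> r = s + \<epsilon> * x' + of_int m \<and> finger_x x' = x \<and> finger_y x' = y) \<or>
    k = j \<and> x = 0 \<and> (\<exists>m::int. r = t + \<epsilon> * y + of_int m)"
proof (cases "modified k r")
  case True
  then obtain x' and m :: int where x': "k = i" "3/10 \<le> x'" "x' \<le> 3/5" "r = s + \<epsilon> * x' + of_int m"
    unfolding modified_def by blast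
  then have "q (finger_x x') (finger_y x') = q x y" using curve_E_over[of x' m] w(1) by simp
  then have "finger_x x' = x" "finger_y x' = y" by simp_all
  moreover have "\<bar>x'\<bar> \<le> 1" using x' by simp
  ultimately show ?thesis using x' by blast
next
  case False
  then have "fst (link_curve K k r) = q x y" using w(1) unmodified[OF k] by simp
  from box[OF k w(2,3) this[unfolded q_def]] show ?thesis
  proof
    assume "k = i \<and> y = 0 \<and> (\<exists>m::int. r = s + \<epsilon> * x + of_int m)"
    then obtain m :: int where m: "k = i" "y = 0" "r = s + \<epsilon> * x + of_int m" by blast
    then have "q (finger_x x) (finger_y x) = q x y" using curve_E_over[of x m] w by simp
    then show ?thesis using m w(2) by auto
  qed simp
qed

lemma out_box:
  assumes "curve E k r = w" "\<not> (\<bar>cx w\<bar> \<le> 1 \<and> \<bar>cy w\<bar> \<le> 1)" shows "\<not> modified k r"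
proof
  assume "modified k r"
  then obtain x and m :: int where x: "k = i" "3/10 \<le> x" "x \<le> 3/5" "r = s + \<epsilon> * x + of_int m"
    unfolding modified_def by blast
  then have "w = q (finger_x x) (finger_y x)" using curve_E_over[of x m] assms(1) by simp
  then show False using finger_bounds(2)[OF x(2,3)] assms(2) by simp
qed

lemma polygonal_E:
  assumes k: "k < link_components fingered" shows "polygonal_loop (\<lambda>t. fst (link_curve fingered k t))"
  unfolding polygonal_loop_def
proof (intro conjI allI)
  have k: "k < n" using k by simp
  have polyD: "polygonal_loop (\<lambda>t. fst (link_curve K k t))" using dia k by (simp add: is_diagram_def)
  fix r
  show "fst (link_curve fingered k (r + 1)) = fst (link_curve fingered k r)" using add_int(2)[OF k, of r 1] by simp
  have nz: "of_real (p / \<epsilon>) * fst a + of_real (p' / \<epsilon>) * fst b \<noteq> 0" if "p \<noteq> 0 \<or> p' \<noteq> 0" for p p'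
  proof
    assume "of_real (p / \<epsilon>) * fst a + of_real (p' / \<epsilon>) * fst b = 0"
    then have "of_real (p / \<epsilon>) * fst a = of_real (- p' / \<epsilon>) * fst b" by (simp add: add_eq_0_iff)
    from det2_independent[OF det this] show False using that eps by auto
  qed
  have move: "fst (link_curve fingered i (s + \<epsilon> * x + of_int m + h)) =
      fst (link_curve fingered i (s + \<epsilon> * x + of_int m)) + h *\<^sub>R (of_real (p / \<epsilon>) * fst a + of_real (p' / \<epsilon>) * fst b)"
    if "3/10 \<le> x" "x \<le> 3/5" "\<bar>h / \<epsilon>\<bar> \<le> 1" "finger_x (x + h / \<epsilon>) = finger_x x + h / \<epsilon> * p" "finger_y (x + h / \<epsilon>) = finger_y x + h / \<epsilon> * p'" for x h p p' and m :: int
  proof -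
    have "s + \<epsilon> * x + of_int m + h = s + \<epsilon> * (x + h / \<epsilon>) + of_int m" using eps by (simp add: distrib_left)
    then have "curve E i (s + \<epsilon> * x + of_int m + h) = q (finger_x (x + h / \<epsilon>)) (finger_y (x + h / \<epsilon>))"
      using curve_E_over[of "x + h / \<epsilon>" m] that by (simp only: ; simp)
    moreover have "curve E i (s + \<epsilon> * x + of_int m) = q (finger_x x) (finger_y x)" using curve_E_over[of x m] that by simp
    ultimately show ?thesis using that(4,5) by (simp add: q_def scaleR_conv_of_real algebra_simps)
  qed
  show "\<exists>v. v \<noteq> 0 \<and> (\<forall>\<^sub>F h in at_right 0. fst (link_curve fingered k (r + h)) = fst (link_curve fingered k r) + h *\<^sub>R v)"
  proof (cases "modified k r")
    case True
    then obtain x and m :: int where x: "k = i" "3/10 \<le> x" "x \<le> 3/5" "r = s + \<epsilon> * x + of_int m"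
      unfolding modified_def by blast
    obtain \<delta> p p' where d: "\<delta> > 0" "p \<noteq> 0 \<or> p' \<noteq> 0"
      "\<And>h. 0 \<le> h \<Longrightarrow> h < \<delta> \<Longrightarrow> finger_x (x + h) = finger_x x + h * p \<and> finger_y (x + h) = finger_y x + h * p'"
      by (rule finger_right[of x]) (rule that)
    show ?thesis unfolding eventually_at_right_field
    proof (intro exI conjI allI impI)
      show "of_real (p / \<epsilon>) * fst a + of_real (p' / \<epsilon>) * fst b \<noteq> 0" by (rule nz[OF d(2)])
      show "0 < \<epsilon> * min 1 \<delta>" using eps d(1) by simp
      fix h assume h: "0 < h" "h < \<epsilon> * min 1 \<delta>"
      have "h / \<epsilon> < min 1 \<delta>" using h(2) by (simp only: pos_divide_less_eq[OF eps] mult.commute)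
      moreover have "0 \<le> h / \<epsilon>" using h(1) eps by simp
      ultimately have h': "0 \<le> h / \<epsilon>" "h / \<epsilon> < min 1 \<delta>" by blast+
      show "fst (link_curve fingered k (r + h)) = fst (link_curve fingered k r) + h *\<^sub>R (of_real (p / \<epsilon>) * fst a + of_real (p' / \<epsilon>) * fst b)"
        unfolding x(1,4) by (rule move[OF x(2,3)]) (use h' d(3)[of "h / \<epsilon>"] in auto)
    qed
  next
    case False
    obtain \<eta> where e: "\<eta> > 0" "\<And>r'. \<bar>r' - r\<bar> < \<eta> \<Longrightarrow> \<not> modified k r'" by (rule unmodified_near[OF False]) (rule that)
    obtain v where v: "v \<noteq> 0" "\<forall>\<^sub>F h in at_right 0. fst (link_curve K k (r + h)) = fst (link_curve K k r) + h *\<^sub>R v"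
      using polyD unfolding polygonal_loop_def by blast
    have "\<forall>\<^sub>F h in at_right 0. link_curve fingered k (r + h) = link_curve K k (r + h)"
      unfolding eventually_at_right_field using e unmodified[OF k] by (intro exI[of _ \<eta>]) simp
    with v(2) have "\<forall>\<^sub>F h in at_right 0. fst (link_curve fingered k (r + h)) = fst (link_curve fingered k r) + h *\<^sub>R v"
      by eventually_elim (simp add: unmodified[OF k False])
    then show ?thesis using v(1) by blast
  qed
  show "\<exists>v. v \<noteq> 0 \<and> (\<forall>\<^sub>F h in at_left 0. fst (link_curve fingered k (r + h)) = fst (link_curve fingered k r) + h *\<^sub>R v)"
  proof (cases "modified k r")
    case True
    then obtain x and m :: int where x: "k = i" "3/10 \<le> x" "x \<le> 3/5" "r = s + \<epsilon> * x + of_int m"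
      unfolding modified_def by blast
    obtain \<delta> p p' where d: "\<delta> > 0" "p \<noteq> 0 \<or> p' \<noteq> 0"
      "\<And>h. h \<le> 0 \<Longrightarrow> - \<delta> < h \<Longrightarrow> finger_x (x + h) = finger_x x + h * p \<and> finger_y (x + h) = finger_y x + h * p'"
      by (rule finger_left[of x]) (rule that)
    show ?thesis unfolding eventually_at_left_field
    proof (intro exI conjI allI impI)
      show "of_real (p / \<epsilon>) * fst a + of_real (p' / \<epsilon>) * fst b \<noteq> 0" by (rule nz[OF d(2)])
      show "- (\<epsilon> * min 1 \<delta>) < 0" using eps d(1) by simp
      fix h assume h: "- (\<epsilon> * min 1 \<delta>) < h" "h < 0"
      then have "- h < \<epsilon> * min 1 \<delta>" by simp
      then have "- h / \<epsilon> < min 1 \<delta>" by (simp only: pos_divide_less_eq[OF eps] mult.commute)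
      then have lo: "- min 1 \<delta> < h / \<epsilon>" by linarith
      have "h / \<epsilon> \<le> 0" using eps h by (simp add: divide_le_0_iff)
      note h' = this lo
      show "fst (link_curve fingered k (r + h)) = fst (link_curve fingered k r) + h *\<^sub>R (of_real (p / \<epsilon>) * fst a + of_real (p' / \<epsilon>) * fst b)"
        unfolding x(1,4) by (rule move[OF x(2,3)]) (use h' d(3)[of "h / \<epsilon>"] in auto)
    qed
  next
    case False
    obtain \<eta> where e: "\<eta> > 0" "\<And>r'. \<bar>r' - r\<bar> < \<eta> \<Longrightarrow> \<not> modified k r'" by (rule unmodified_near[OF False]) (rule that)
    obtain v where v: "v \<noteq> 0" "\<forall>\<^sub>F h in at_left 0. fst (link_curve K k (r + h)) = fst (link_curve K k r) + h *\<^sub>R v"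
      using polyD unfolding polygonal_loop_def by blast
    have "\<forall>\<^sub>F h in at_left 0. link_curve fingered k (r + h) = link_curve K k (r + h)"
      unfolding eventually_at_left_field using e unmodified[OF k] by (intro exI[of _ "-\<eta>"]) simp
    with v(2) have "\<forall>\<^sub>F h in at_left 0. fst (link_curve fingered k (r + h)) = fst (link_curve fingered k r) + h *\<^sub>R v"
      by eventually_elim (simp add: unmodified[OF k False])
    then show ?thesis using v(1) by blast
  qed
qed

lemma over_derivative:
  assumes x: "\<bar>x\<bar> \<le> 1" and d: "\<delta> > 0" "\<And>h. \<bar>h\<bar> < \<delta> \<Longrightarrow> finger_x (x + h) = finger_x x + h * p \<and> finger_y (x + h) = finger_y x + h * p'"
  shows "(curve E i has_vector_derivative (of_real (p / \<epsilon>) * fst a + of_real (p' / \<epsilon>) * fst b)) (at (s + \<epsilon> * x + of_int m))"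
proof -
  let ?r = "s + \<epsilon> * x + of_int m" and ?v = "of_real (p / \<epsilon>) * fst a + of_real (p' / \<epsilon>) * fst b"
  have "((\<lambda>r. q (finger_x x) (finger_y x) + (r - ?r) *\<^sub>R ?v) has_vector_derivative ?v) (at ?r)"
    by (auto intro!: derivative_eq_intros)
  moreover have "q (finger_x x) (finger_y x) + (r - ?r) *\<^sub>R ?v = curve E i r" if r: "r \<in> ball ?r (\<epsilon> * min 1 \<delta>)" for r
  proof -
    define h where "h = (r - ?r) / \<epsilon>"
    have "\<bar>r - ?r\<bar> < \<epsilon> * min 1 \<delta>" using r by (simp add: dist_real_def abs_minus_commute)
    moreover have "\<bar>h\<bar> = \<bar>r - ?r\<bar> / \<epsilon>" using eps by (simp add: h_def abs_divide)
    ultimately have "\<bar>h\<bar> < min 1 \<delta>" by (simp only: pos_divide_less_eq[OF eps] mult.commute)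
    then have h: "\<bar>h\<bar> < 1" "\<bar>h\<bar> < \<delta>" by auto
    have r: "r = s + \<epsilon> * (x + h) + of_int m" "r - ?r = \<epsilon> * h" using eps by (simp_all add: h_def distrib_left)
    have "curve E i r = q (finger_x (x + h)) (finger_y (x + h))" unfolding r(1) by (rule curve_E_over) (use x h in auto)
    also have "\<dots> = q (finger_x x) (finger_y x) + (r - ?r) *\<^sub>R ?v"
      unfolding r(2) using d(2)[OF h(2)] eps by (simp add: q_def scaleR_conv_of_real algebra_simps)
    finally show ?thesis ..
  qed
  ultimately show ?thesis
    using has_vector_derivative_transform_within_open[of _ ?v ?r "ball ?r (\<epsilon> * min 1 \<delta>)" "curve E i"] eps d(1) by auto
qed

lemma under_derivative:
  assumes y: "\<bar>y\<bar> \<le> 1"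
  shows "(curve E j has_vector_derivative (of_real (1 / \<epsilon>) * fst b)) (at (t + \<epsilon> * y + of_int m))"
proof -
  let ?r = "t + \<epsilon> * y + of_int m" and ?v = "of_real (1 / \<epsilon>) * fst b"
  have "((\<lambda>r. q 0 y + (r - ?r) *\<^sub>R ?v) has_vector_derivative ?v) (at ?r)"
    by (auto intro!: derivative_eq_intros)
  moreover have "q 0 y + (r - ?r) *\<^sub>R ?v = curve E j r" if r: "r \<in> ball ?r \<epsilon>" for r
  proof -
    define h where "h = (r - ?r) / \<epsilon>"
    have "\<bar>r - ?r\<bar> < \<epsilon>" using r by (simp add: dist_real_def abs_minus_commute)
    then have h: "\<bar>h\<bar> < 1" using eps by (simp add: h_def abs_divide)
    have r: "r = t + \<epsilon> * (y + h) + of_int m" "r - ?r = \<epsilon> * h" using eps by (simp_all add: h_def distrib_left)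
    have "curve E j r = q 0 (y + h)" unfolding r(1) by (rule curve_E_under) (use y h in auto)
    also have "\<dots> = q 0 y + (r - ?r) *\<^sub>R ?v"
      unfolding r(2) using eps by (simp add: q_def scaleR_conv_of_real algebra_simps)
    finally show ?thesis ..
  qed
  ultimately show ?thesis
    using has_vector_derivative_transform_within_open[of _ ?v ?r "ball ?r \<epsilon>" "curve E j"] eps by auto
qed

lemma velocity_eqI: "(curve F k has_vector_derivative v) (at r) \<Longrightarrow> velocity F (k, r) = v"
  by (simp add: velocity_def vector_derivative_at)

lemma unmodified_derivative:
  assumes k: "k < n" and nm: "\<not> modified k r" and d: "curve D k differentiable at r"
  shows "curve E k differentiable at r" "velocity E (k, r) = velocity D (k, r)"
proof -
  obtain \<eta> where e: "\<eta> > 0" "\<And>r'. \<bar>r' - r\<bar> < \<eta> \<Longrightarrow> \<not> modified k r'" by (rule unmodified_near[OF nm]) (rule that)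
  have v: "velocity D (k, r) = vector_derivative (curve D k) (at r)" by (simp add: velocity_def)
  have "(curve D k has_vector_derivative velocity D (k, r)) (at r)"
    unfolding v by (rule d[unfolded vector_derivative_works])
  moreover have "curve D k r' = curve E k r'" if "r' \<in> ball r \<eta>" for r'
    using unmodified[OF k e(2)[of r']] that by (simp add: dist_real_def abs_minus_commute)
  ultimately have h: "(curve E k has_vector_derivative velocity D (k, r)) (at r)"
    using has_vector_derivative_transform_within_open[of "curve D k" _ r "ball r \<eta>" "curve E k"] e(1)
    by (simp del: projection_simps)
  show "curve E k differentiable at r" by (rule differentiableI_vector[OF h])
  show "velocity E (k, r) = velocity D (k, r)" by (rule velocity_eqI[OF h])
qed

section \<open>The new diagram\<close>

text \<open>
  The double points of the new diagram: those of the old diagram outside of the parallelogram,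
  the one of the finger with its own strand, and the three crossings of the two strands.
\<close>

definition outer_pair :: "nat \<Rightarrow> real \<Rightarrow> nat \<Rightarrow> real \<Rightarrow> bool" where
  "outer_pair k r l r' \<longleftrightarrow> double_point D (k, r) (l, r') \<and> \<not> modified k r \<and> \<not> modified l r' \<and>
     \<not> (\<bar>cx (curve E k r)\<bar> \<le> 1 \<and> \<bar>cy (curve E k r)\<bar> \<le> 1)"

definition loop_pair :: "nat \<Rightarrow> real \<Rightarrow> nat \<Rightarrow> real \<Rightarrow> bool" where
  "loop_pair k r l r' \<longleftrightarrow> k = i \<and> l = i \<and> (\<exists>m m'::int.
     r = s + \<epsilon> * (-1/2) + of_int m \<and> r' = s + \<epsilon> * (39/80) + of_int m' \<or>
     r = s + \<epsilon> * (39/80) + of_int m \<and> r' = s + \<epsilon> * (-1/2) + of_int m')"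

definition over_under :: "nat \<Rightarrow> real \<Rightarrow> nat \<Rightarrow> real \<Rightarrow> real \<Rightarrow> bool" where
  "over_under k r l r' x \<longleftrightarrow> k = i \<and> l = j \<and> x \<in> {0, 57/160, 123/220} \<and>
     (\<exists>m m'::int. r = s + \<epsilon> * x + of_int m \<and> r' = t + \<epsilon> * finger_y x + of_int m')"

lemma double_point_types:
  assumes dp: "double_point E (k, r) (l, r')"
  shows "outer_pair k r l r' \<or> loop_pair k r l r' \<or> (\<exists>x. over_under k r l r' x) \<or> (\<exists>x. over_under l r' k r x)"
proof -
  define w where "w = curve E k r"
  have dp': "k < n \<and> l < n \<and> curve E k r = curve E l r' \<and> \<not> same_point (k, r) (l, r')"
    using dp unfolding double_point_def fst_conv snd_conv projection_simps(1) fingered_components .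
  have wk: "curve E k r = w" by (simp only: w_def)
  have kl: "k < n" "l < n" "curve E l r' = w" "\<not> same_point (k, r) (l, r')"
    subgoal using dp' by blast
    subgoal using dp' by blast
    subgoal unfolding w_def using dp' by (elim conjE) (erule sym)
    subgoal using dp' by blast
    done
  show ?thesis
  proof (cases "\<bar>cx w\<bar> \<le> 1 \<and> \<bar>cy w\<bar> \<le> 1")
    case False
    have nm: "\<not> modified k r" "\<not> modified l r'" by (rule out_box[OF wk False], rule out_box[OF kl(3) False])
    have "curve D k r = w" "curve D l r' = w" using wk kl(3) unmodified[OF kl(1) nm(1)] unmodified[OF kl(2) nm(2)] by simp_all
    then have "double_point D (k, r) (l, r')" using kl(1,2,4) by (simp only: double_point_def fst_conv snd_conv projection_simps(1) simp_thms)
    then have "outer_pair k r l r'" using nm False wk unfolding outer_pair_def by (simp only: simp_thms)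
    then show ?thesis by blast
  next
    case True
    have w: "w = q (cx w) (cy w)" by (rule q_coords[symmetric])
    have inb: "k = i \<and> (\<exists>x' (m::int). \<bar>x'\<bar> \<le> 1 \<and> r = s + \<epsilon> * x' + of_int m \<and> finger_x x' = cx w \<and> finger_y x' = cy w) \<or>
       k = j \<and> cx w = 0 \<and> (\<exists>m::int. r = t + \<epsilon> * cy w + of_int m)" if "k < n" "curve E k r = w" for k r
      by (rule in_box[OF that(1)]) (use that(2) w True in \<open>simp_all only: simp_thms\<close>)
    have vert: "x \<in> {0, 57/160, 123/220}" if "finger_x x = 0" for x using finger_on_axis[OF that] by auto
    consider (o) x m where "k = i" "r = s + \<epsilon> * x + of_int m" "finger_x x = cx w" "finger_y x = cy w"
      | (u) m where "k = j" "cx w = 0" "r = t + \<epsilon> * cy w + of_int m"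
      using inb[OF kl(1) wk] by blast
    note c1 = this
    consider (o) x m where "l = i" "r' = s + \<epsilon> * x + of_int m" "finger_x x = cx w" "finger_y x = cy w"
      | (u) m where "l = j" "cx w = 0" "r' = t + \<epsilon> * cy w + of_int m"
      using inb[OF kl(2,3)] by blast
    note c2 = this
    show ?thesis using c1
    proof cases
      case (o x m)
      note k = o
      show ?thesis using c2
      proof cases
        case (o x' m')
        have "x \<noteq> x'"
        proof
          assume "x = x'"
          then have "r - r' \<in> \<int>" using k(2) o(2) by simp
          then show False using kl(4) k(1) o(1) by (simp add: same_point_def)
        qed
        then have "x = -1/2 \<and> x' = 39/80 \<or> x = 39/80 \<and> x' = -1/2" using finger_double[of x x'] k o by simp
        then have "loop_pair k r l r'" unfolding loop_pair_def using k(1,2) o(1,2) by blast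
        then show ?thesis by blast
      next
        case (u m')
        have "over_under k r l r' x" unfolding over_under_def using k u(1,3) vert[of x] u(2) by auto
        then show ?thesis by blast
      qed
    next
      case (u m)
      note k = u
      show ?thesis using c2
      proof cases
        case (o x' m')
        have "over_under l r' k r x'" unfolding over_under_def using o k(1,3) vert[of x'] k(2) by auto
        then show ?thesis by blast
      next
        case (u m')
        then have "same_point (k, r) (l, r')" using k by (simp add: same_point_def)
        then show ?thesis using kl(4) by simp
      qed
    qed
  qed
qed

lemma over_values:
  assumes "x \<in> {0, 57/160, 123/220}" shows "finger_x x = 0" "\<bar>finger_y x\<bar> \<le> 1/5" "0 \<le> x" "x < 3/5"
proof -
  have "x = 0 \<or> x = 57/160 \<or> x = 123/220" using assms by blast
  then have "finger_x x = 0 \<and> \<bar>finger_y x\<bar> \<le> 1/5 \<and> 0 \<le> x \<and> x < 3/5"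
    by (elim disjE; simp only: finger_values; simp)
  then show "finger_x x = 0" "\<bar>finger_y x\<bar> \<le> 1/5" "0 \<le> x" "x < 3/5" by blast+
qed

lemma over_under_det:
  assumes x: "x \<in> {0, 57/160, 123/220}"
  shows "curve E i differentiable at (s + \<epsilon> * x + of_int m)" "curve E j differentiable at (t + \<epsilon> * finger_y x + of_int m')"
    "velocity_det E (i, s + \<epsilon> * x + of_int m) (j, t + \<epsilon> * finger_y x + of_int m') =
      (if x = 0 then 1 else if x = 57/160 then -16/3 else 44/3) * det2 (fst a) (fst b) / \<epsilon>\<^sup>2"
proof -
  obtain \<delta> p p' where d: "\<delta> > 0" "\<And>h. \<bar>h\<bar> < \<delta> \<Longrightarrow> finger_x (x + h) = finger_x x + h * p \<and> finger_y (x + h) = finger_y x + h * p'"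
    and p: "x = 0 \<Longrightarrow> p = 1 \<and> p' = 0" "x = 57/160 \<Longrightarrow> p = -16/3" "x = 123/220 \<Longrightarrow> p = 44/3"
    by (rule finger_direction[of x]) (use x in auto)
  have bx: "\<bar>x\<bar> \<le> 1" "\<bar>finger_y x\<bar> \<le> 1" using over_values(2-4)[OF x] by simp_all
  note vo = over_derivative[OF bx(1) d, of m] and vu = under_derivative[OF bx(2), of m']
  have velo: "velocity E (i, s + \<epsilon> * x + of_int m) = of_real (p / \<epsilon>) * fst a + of_real (p' / \<epsilon>) * fst b"
    by (rule velocity_eqI[OF vo])
  have velu: "velocity E (j, t + \<epsilon> * finger_y x + of_int m') = of_real (1 / \<epsilon>) * fst b"
    by (rule velocity_eqI[OF vu])
  show "curve E i differentiable at (s + \<epsilon> * x + of_int m)" by (rule differentiableI_vector[OF vo])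
  show "curve E j differentiable at (t + \<epsilon> * finger_y x + of_int m')" by (rule differentiableI_vector[OF vu])
  have "velocity_det E (i, s + \<epsilon> * x + of_int m) (j, t + \<epsilon> * finger_y x + of_int m') = p * det2 (fst a) (fst b) / \<epsilon>\<^sup>2"
    unfolding velocity_det_def velo velu using eps
    by (simp add: field_simps power2_eq_square)
  moreover have "p = (if x = 0 then 1 else if x = 57/160 then -16/3 else 44/3)" using x p by auto
  ultimately show "velocity_det E (i, s + \<epsilon> * x + of_int m) (j, t + \<epsilon> * finger_y x + of_int m') =
      (if x = 0 then 1 else if x = 57/160 then -16/3 else 44/3) * det2 (fst a) (fst b) / \<epsilon>\<^sup>2" by simp
qed

lemma over_over_det:
  assumes xx: "x = -1/2 \<and> x' = 39/80 \<or> x = 39/80 \<and> x' = -1/2"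
  shows "curve E i differentiable at (s + \<epsilon> * x + of_int m)"
    "velocity_det E (i, s + \<epsilon> * x + of_int m) (i, s + \<epsilon> * x' + of_int m') \<noteq> 0"
proof -
  have d1: "finger_x (-1/2 + h) = finger_x (-1/2) + h * 1 \<and> finger_y (-1/2 + h) = finger_y (-1/2) + h * 0" if "\<bar>h\<bar> < 1/2" for h
    unfolding finger_values using finger_cases(1)[of "-1/2 + h"] that by auto
  have d2: "finger_x (39/80 + h) = finger_x (39/80) + h * 0 \<and> finger_y (39/80 + h) = finger_y (39/80) + h * (16/3)" if "\<bar>h\<bar> < 1/80" for h
    unfolding finger_values using finger_cases(3)[of "39/80 + h"] that by (auto simp: field_simps abs_less_iff)
  have v1: "(curve E i has_vector_derivative (of_real (1 / \<epsilon>) * fst a + of_real (0 / \<epsilon>) * fst b)) (at (s + \<epsilon> * (-1/2) + of_int m))" for m :: int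
    by (rule over_derivative[of _ "1/2"]) (use d1 in auto)
  have v2: "(curve E i has_vector_derivative (of_real (0 / \<epsilon>) * fst a + of_real ((16/3) / \<epsilon>) * fst b)) (at (s + \<epsilon> * (39/80) + of_int m))" for m :: int
    by (rule over_derivative[of _ "1/80"]) (use d2 in auto)
  have det12: "velocity_det E (i, s + \<epsilon> * (-1/2) + of_int m) (i, s + \<epsilon> * (39/80) + of_int m') = 16/3 * det2 (fst a) (fst b) / \<epsilon>\<^sup>2" for m m' :: int
  proof -
    have e1: "velocity E (i, s + \<epsilon> * (-1/2) + of_int m) = of_real (1 / \<epsilon>) * fst a + of_real (0 / \<epsilon>) * fst b"
      by (rule velocity_eqI[OF v1])
    have e2: "velocity E (i, s + \<epsilon> * (39/80) + of_int m') = of_real (0 / \<epsilon>) * fst a + of_real ((16/3) / \<epsilon>) * fst b"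
      by (rule velocity_eqI[OF v2])
    show ?thesis unfolding velocity_det_def e1 e2 using eps by (simp add: field_simps power2_eq_square)
  qed
  show "curve E i differentiable at (s + \<epsilon> * x + of_int m)"
    using xx
  proof (elim disjE conjE)
    assume x: "x = -1/2" show ?thesis unfolding x by (rule differentiableI_vector[OF v1])
  next
    assume x: "x = 39/80" show ?thesis unfolding x by (rule differentiableI_vector[OF v2])
  qed
  have nz: "16/3 * det2 (fst a) (fst b) / \<epsilon>\<^sup>2 \<noteq> 0" using det eps by simp
  show "velocity_det E (i, s + \<epsilon> * x + of_int m) (i, s + \<epsilon> * x' + of_int m') \<noteq> 0"
    using xx
  proof (elim disjE conjE)
    assume x: "x = -1/2" "x' = 39/80"
    show ?thesis unfolding x det12 by (rule nz)
  next
    assume x: "x = 39/80" "x' = -1/2"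
    show ?thesis unfolding x velocity_det_swap[of E "(i, s + \<epsilon> * (39/80) + of_int m)"] det12
      using nz by (simp only: neg_equal_0_iff_equal not_False_eq_True)
  qed
qed

lemma double_point_transverse:
  assumes dp: "double_point E p p'"
  shows "curve E (fst p) differentiable at (snd p) \<and> velocity_det E p p' \<noteq> 0"
proof -
  obtain k r l r' where p: "p = (k, r)" "p' = (l, r')" by (metis prod.collapse)
  have "curve E k differentiable at r \<and> velocity_det E (k, r) (l, r') \<noteq> 0"
    using double_point_types[OF dp[unfolded p]]
  proof (elim disjE exE)
    assume "outer_pair k r l r'"
    then have d: "double_point D (k, r) (l, r')" and nm: "\<not> modified k r" "\<not> modified l r'"
      unfolding outer_pair_def by blast+
    then have kl: "k < n" "l < n" by (auto simp: double_point_def)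
    have dd: "curve D k differentiable at r" "curve D l differentiable at r'" "velocity_det D (k, r) (l, r') \<noteq> 0"
      using dia d unfolding is_diagram_def by (metis fst_conv snd_conv)+
    note u = unmodified_derivative[OF kl(1) nm(1) dd(1)] and u' = unmodified_derivative[OF kl(2) nm(2) dd(2)]
    have "velocity_det E (k, r) (l, r') = velocity_det D (k, r) (l, r')" by (simp only: velocity_det_def u(2) u'(2))
    then show ?thesis using u(1) dd(3) by (simp only: simp_thms)
  next
    assume "loop_pair k r l r'"
    then show ?thesis unfolding loop_pair_def using over_over_det[of "-1/2" "39/80"] over_over_det[of "39/80" "-1/2"] by blast
  next
    fix x assume "over_under k r l r' x"
    then obtain m m' :: int where e: "k = i" "l = j" "r = s + \<epsilon> * x + of_int m" "r' = t + \<epsilon> * finger_y x + of_int m'"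
      "x \<in> {0, 57/160, 123/220}" unfolding over_under_def by blast
    have "velocity_det E (k, r) (l, r') \<noteq> 0" unfolding e(1-4) over_under_det(3)[OF e(5)] using det eps by simp
    then show ?thesis using over_under_det(1)[OF e(5)] unfolding e(1,3) by blast
  next
    fix x assume "over_under l r' k r x"
    then obtain m m' :: int where e: "l = i" "k = j" "r' = s + \<epsilon> * x + of_int m" "r = t + \<epsilon> * finger_y x + of_int m'"
      "x \<in> {0, 57/160, 123/220}" unfolding over_under_def by blast
    have "velocity_det E (l, r') (k, r) \<noteq> 0" unfolding e(1-4) over_under_det(3)[OF e(5)] using det eps by simp
    then have "velocity_det E (k, r) (l, r') \<noteq> 0" using velocity_det_swap[of E "(l, r')" "(k, r)"] by simp
    then show ?thesis using over_under_det(2)[OF e(5)] unfolding e(2,4) by blast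
  qed
  then show ?thesis unfolding p fst_conv snd_conv .
qed

lemma inner_position:
  assumes "loop_pair k r l r'" shows "curve E k r = q (-1/2) 0"
proof -
  obtain x and m :: int where x: "k = i" "r = s + \<epsilon> * x + of_int m" "x = -1/2 \<or> x = 39/80"
    using assms unfolding loop_pair_def by blast
  have v: "finger_x x = -1/2" "finger_y x = 0" "\<bar>x\<bar> \<le> 2"
    using x(3) by (elim disjE; simp only: finger_values; simp)+
  show ?thesis using curve_E_over[OF v(3), of m] unfolding v(1,2) x(1,2) .
qed

lemma over_position:
  assumes "over_under k r l r' x" shows "curve E k r = q 0 (finger_y x)" "curve E l r' = q 0 (finger_y x)"
proof -
  obtain m m' :: int where e: "k = i" "l = j" "r = s + \<epsilon> * x + of_int m" "r' = t + \<epsilon> * finger_y x + of_int m'"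
    "x \<in> {0, 57/160, 123/220}" using assms unfolding over_under_def by blast
  have b: "\<bar>x\<bar> \<le> 2" "\<bar>finger_y x\<bar> \<le> 2" "finger_x x = 0" using over_values[OF e(5)] by simp_all
  show "curve E k r = q 0 (finger_y x)" using curve_E_over[OF b(1), of m] unfolding e(1,3) b(3) .
  show "curve E l r' = q 0 (finger_y x)" using curve_E_under[OF b(2), of m'] unfolding e(2,4) .
qed

lemma outer_position: "outer_pair k r l r' \<Longrightarrow> \<bar>y\<bar> \<le> 1 \<Longrightarrow> \<bar>x\<bar> \<le> 1 \<Longrightarrow> curve E k r \<noteq> q x y"
  unfolding outer_pair_def by auto

lemma finger_y_bound: "x \<in> {0, 57/160, 123/220} \<Longrightarrow> \<bar>finger_y x\<bar> \<le> 1" using over_values(2)[of x] by linarith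

lemma finger_y_inj: "x \<in> {0, 57/160, 123/220} \<Longrightarrow> x' \<in> {0, 57/160, 123/220} \<Longrightarrow> finger_y x = finger_y x' \<Longrightarrow> x = x'"
  unfolding insert_iff empty_iff by (elim disjE FalseE; simp only: finger_values; simp)

lemma small_shift:
  assumes "s + \<epsilon> * x + of_int m = s + \<epsilon> * x' + of_int m'" "\<bar>x - x'\<bar> \<le> 1" shows "x = x'"
proof -
  have e: "\<epsilon> * (x - x') = of_int (m' - m)" using assms(1) by (simp add: algebra_simps)
  have "\<bar>\<epsilon> * (x - x')\<bar> \<le> 1/8 * 1" unfolding abs_mult using assms(2) eps small by (intro mult_mono) auto
  then have "\<bar>of_int (m' - m) :: real\<bar> < 1" unfolding e by simp
  then have "m' - m = 0" by linarith
  then show ?thesis using e eps by simp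
qed

lemma loop_pair_unique:
  assumes "loop_pair k r l r'" "loop_pair k r l2 r2" shows "same_point (l, r') (l2, r2)"
proof -
  obtain x x' and m m' :: int where a: "l = i" "r = s + \<epsilon> * x + of_int m" "r' = s + \<epsilon> * x' + of_int m'"
    "x = -1/2 \<and> x' = 39/80 \<or> x = 39/80 \<and> x' = -1/2" using assms(1) unfolding loop_pair_def by blast
  obtain y y' and p p' :: int where b: "l2 = i" "r = s + \<epsilon> * y + of_int p" "r2 = s + \<epsilon> * y' + of_int p'"
    "y = -1/2 \<and> y' = 39/80 \<or> y = 39/80 \<and> y' = -1/2" using assms(2) unfolding loop_pair_def by blast
  have "x = y" by (rule small_shift[of x m y p]) (use a b in auto)
  then have "x' = y'" using a b by auto
  then show ?thesis using a b by (simp add: same_point_def)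
qed

lemma double_point_unique:
  assumes 1: "double_point E p p'" and 2: "double_point E p p''" shows "same_point p' p''"
proof -
  obtain k r l r' l2 r2 where p: "p = (k, r)" "p' = (l, r')" "p'' = (l2, r2)" by (metis prod.collapse)
  note t1 = double_point_types[OF 1[unfolded p]] and t2 = double_point_types[OF 2[unfolded p]]
  have pos0: "curve E k r \<noteq> q (-1/2) 0" if "outer_pair k r l r'" for l r' using outer_position[OF that] by simp
  have posx: "curve E k r \<noteq> q 0 (finger_y x)" if "outer_pair k r l r'" "x \<in> {0, 57/160, 123/220}" for l r' x
    by (rule outer_position[OF that(1) finger_y_bound[OF that(2)]]) simp
  have mem: "x \<in> {0, 57/160, 123/220}" if "over_under k r l r' x" for k r l r' x
    using that unfolding over_under_def by blast
  have "same_point (l, r') (l2, r2)" using t1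
  proof (elim disjE exE)
    assume a: "outer_pair k r l r'"
    show ?thesis using t2
    proof (elim disjE exE)
      assume b: "outer_pair k r l2 r2"
      then show ?thesis using a dia unfolding outer_pair_def is_diagram_def by blast
    next
      assume "loop_pair k r l2 r2" then show ?thesis using pos0[OF a] inner_position by blast
    next
      fix x assume "over_under k r l2 r2 x" then show ?thesis using posx[OF a mem] over_position(1) by blast
    next
      fix x assume "over_under l2 r2 k r x" then show ?thesis using posx[OF a mem] over_position(2) by blast
    qed
  next
    assume a: "loop_pair k r l r'"
    note w = inner_position[OF a]
    show ?thesis using t2
    proof (elim disjE exE)
      assume b: "outer_pair k r l2 r2" then show ?thesis using pos0 w by blast
    next
      assume "loop_pair k r l2 r2" then show ?thesis using loop_pair_unique[OF a] by blast
    next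
      fix x assume "over_under k r l2 r2 x"
      from over_position(1)[OF this] w have "q (-1/2) 0 = q 0 (finger_y x)" by simp
      then show ?thesis by simp
    next
      fix x assume "over_under l2 r2 k r x"
      from over_position(2)[OF this] w have "q (-1/2) 0 = q 0 (finger_y x)" by simp
      then show ?thesis by simp
    qed
  next
    fix x assume a: "over_under k r l r' x"
    note w = over_position(1)[OF a]
    show ?thesis using t2
    proof (elim disjE exE)
      assume b: "outer_pair k r l2 r2" then show ?thesis using posx[OF b mem[OF a]] w by blast
    next
      assume b: "loop_pair k r l2 r2"
      from inner_position[OF b] w have "q (-1/2) 0 = q 0 (finger_y x)" by simp
      then show ?thesis by simp
    next
      fix y assume b: "over_under k r l2 r2 y"
      have "q 0 (finger_y x) = q 0 (finger_y y)" using over_position(1)[OF b] w by simp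
      then have "finger_y x = finger_y y" by simp
      then show ?thesis using a b unfolding over_under_def by (auto simp: same_point_def)
    next
      fix y assume b: "over_under l2 r2 k r y"
      then show ?thesis using a ij unfolding over_under_def by blast
    qed
  next
    fix x assume a: "over_under l r' k r x"
    note w = over_position(2)[OF a]
    show ?thesis using t2
    proof (elim disjE exE)
      assume b: "outer_pair k r l2 r2" then show ?thesis using posx[OF b mem[OF a]] w by blast
    next
      assume b: "loop_pair k r l2 r2"
      from inner_position[OF b] w have "q (-1/2) 0 = q 0 (finger_y x)" by simp
      then show ?thesis by simp
    next
      fix y assume b: "over_under k r l2 r2 y"
      then show ?thesis using a ij unfolding over_under_def by blast
    next
      fix y assume b: "over_under l2 r2 k r y"
      have "q 0 (finger_y x) = q 0 (finger_y y)" using over_position(2)[OF b] w by simp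
      then have "finger_y x = finger_y y" by simp
      then have "x = y" by (rule finger_y_inj[OF mem[OF a] mem[OF b]])
      then show ?thesis using a b unfolding over_under_def by (auto simp: same_point_def)
    qed
  qed
  then show ?thesis unfolding p .
qed

lemma diagram_E: "is_diagram E" "projects_to fingered E"
proof -
  note pd = projection_diagram[of fingered, OF fingered_embedded polygonal_E]
  show "is_diagram E" by (rule pd(1)[OF _ double_point_transverse double_point_unique])
  show "projects_to fingered E" by (rule pd(2)[OF _ double_point_transverse double_point_unique])
qed

section \<open>The effect of the finger on the winding sum\<close>

definition window :: "complex set" where "window = {w. \<bar>cx w\<bar> \<le> 1 \<and> \<bar>cy w\<bar> \<le> 1}"

lemma window_image: "window = (\<lambda>p. q (fst p) (snd p)) ` ({-1..1} \<times> {-1..1})"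
proof
  show "window \<subseteq> (\<lambda>p. q (fst p) (snd p)) ` ({-1..1} \<times> {-1..1})"
  proof
    fix w assume "w \<in> window"
    then show "w \<in> (\<lambda>p. q (fst p) (snd p)) ` ({-1..1} \<times> {-1..1})"
      by (intro image_eqI[of _ _ "(cx w, cy w)"]) (auto simp: window_def q_coords abs_le_iff)
  qed
  show "(\<lambda>p. q (fst p) (snd p)) ` ({-1..1} \<times> {-1..1}) \<subseteq> window"
    by (auto simp: window_def abs_le_iff)
qed

lemma cxy_continuous: "continuous_on UNIV cx" "continuous_on UNIV cy"
  unfolding cx_def[abs_def] cy_def[abs_def] using det by (intro continuous_intros; simp)+

lemma disc_window: "window homeomorphic cball (0::complex) 1"
proof (rule homeomorphic_convex_compact_cball)
  show "convex window"
  proof (rule convexI)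
    fix w w' and u v :: real assume w: "w \<in> window" "w' \<in> window" and uv: "0 \<le> u" "0 \<le> v" "u + v = 1"
    have "u *\<^sub>R q (cx w) (cy w) + v *\<^sub>R q (cx w') (cy w') = q (u * cx w + v * cx w') (u * cy w + v * cy w')"
    proof -
      have u: "u = 1 - v" using uv by simp
      show ?thesis unfolding u by (simp add: q_def scaleR_conv_of_real algebra_simps)
    qed
    then have e: "u *\<^sub>R w + v *\<^sub>R w' = q (u * cx w + v * cx w') (u * cy w + v * cy w')" by (simp add: q_coords)
    have "\<bar>u * c + v * c'\<bar> \<le> 1" if "\<bar>c\<bar> \<le> 1" "\<bar>c'\<bar> \<le> 1" for c c' :: real
      using convexD[OF convex_cball, of c 0 1 c' u v] that uv by simp
    then show "u *\<^sub>R w + v *\<^sub>R w' \<in> window" unfolding e using w by (simp add: window_def)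
  qed
  show "compact window" unfolding window_image
    by (intro compact_continuous_image compact_Times compact_Icc) (auto simp: q_def intro!: continuous_intros)
  have "open {w. \<bar>cx w\<bar> < 1 \<and> \<bar>cy w\<bar> < 1}"
    by (intro open_Collect_conj open_Collect_less continuous_intros cxy_continuous)
  moreover have "{w. \<bar>cx w\<bar> < 1 \<and> \<bar>cy w\<bar> < 1} \<subseteq> window" by (auto simp: window_def)
  moreover have "q 0 0 \<in> {w. \<bar>cx w\<bar> < 1 \<and> \<bar>cy w\<bar> < 1}" by simp
  ultimately show "interior window \<noteq> {}" using interiorI by blast
qed simp

lemma outside_same:
  assumes k: "k < n" and "curve D k r \<notin> window \<or> curve E k r \<notin> window"
  shows "link_curve fingered k r = link_curve K k r" "curve D k r = curve E k r" "curve D k r \<notin> window"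
proof -
  have "\<not> modified k r"
  proof
    assume md: "modified k r"
    then obtain x and m :: int where x: "k = i" "3/10 \<le> x" "x \<le> 3/5" "r = s + \<epsilon> * x + of_int m"
      unfolding modified_def by blast
    have "curve D k r = q x 0" "curve E k r = q (finger_x x) (finger_y x)"
      using curve_D_over[of x m] curve_E_over[of x m] x by simp_all
    then have "curve D k r \<in> window" "curve E k r \<in> window" using finger_bounds(2)[OF x(2,3)] x by (simp_all add: window_def)
    then show False using assms(2) by blast
  qed
  then show "link_curve fingered k r = link_curve K k r" by (rule unmodified[OF k])
  then show "curve D k r = curve E k r" by simp
  then show "curve D k r \<notin> window" using assms(2) by simp
qed

text \<open>
  The old and the new link agree over all points outside of the parallelogram, and so do heights
  and double points there.
\<close>

lemma two_diagrams: "two_diagrams D E window"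
proof
  show "is_diagram D" by (rule dia)
  show "is_diagram E" by (rule diagram_E)
  show "window homeomorphic cball (0::complex) 1" by (rule disc_window)
  show "agree_off window D E" unfolding agree_off_def
  proof (intro conjI allI impI)
    show "components D = components E" by simp
    fix k r assume k: "k < components D" and out: "curve D k r \<notin> window \<or> curve E k r \<notin> window"
    have k: "k < n" using k by simp
    note same = outside_same[OF k out]
    show "curve D k r = curve E k r" by (rule same(2))
    have "fst (link_curve K l r') = fst (link_curve K k r) \<and> snd (link_curve K l r') < snd (link_curve K k r) \<longleftrightarrow>
        fst (link_curve fingered l r') = fst (link_curve fingered k r) \<and> snd (link_curve fingered l r') < snd (link_curve fingered k r)"
      if l: "l < n" for l r'
    proof (cases "curve D l r' \<notin> window \<or> curve E l r' \<notin> window")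
      case True
      then show ?thesis using outside_same(1)[OF l True] same(1) by simp
    next
      case False
      then have "curve D l r' \<noteq> curve D k r" "curve E l r' \<noteq> curve E k r" using same(2,3) by metis+
      then show ?thesis by simp
    qed
    then show "upper D k r = upper E k r" unfolding projection_def by auto
  qed
qed

abbreviation "\<sigma> \<equiv> sgn (det2 (fst a) (fst b))"

lemma sgn_det_E:
  "sgn (velocity_det E (i, s + \<epsilon> * 0 + of_int 0) (j, t + \<epsilon> * finger_y 0 + of_int 0)) = \<sigma>"
  "sgn (velocity_det E (i, s + \<epsilon> * (57/160) + of_int 0) (j, t + \<epsilon> * finger_y (57/160) + of_int 0)) = - \<sigma>"
proof -
  show "sgn (velocity_det E (i, s + \<epsilon> * 0 + of_int 0) (j, t + \<epsilon> * finger_y 0 + of_int 0)) = \<sigma>"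
    using over_under_det(3)[of 0 0 0] eps by (simp add: sgn_mult sgn_divide)
  have "velocity_det E (i, s + \<epsilon> * (57/160) + of_int 0) (j, t + \<epsilon> * finger_y (57/160) + of_int 0) = -16/3 * det2 (fst a) (fst b) / \<epsilon>\<^sup>2"
    using over_under_det(3)[of "57/160" 0 0] by simp
  then show "sgn (velocity_det E (i, s + \<epsilon> * (57/160) + of_int 0) (j, t + \<epsilon> * finger_y (57/160) + of_int 0)) = - \<sigma>"
    using eps by (simp only: sgn_mult sgn_divide) simp
qed

lemma not_modified_s: "\<not> modified i s"
proof
  assume "modified i s"
  then obtain x and m :: int where x: "3/10 \<le> x" "x \<le> 3/5" "s = s + \<epsilon> * x + of_int m" unfolding modified_def by blast
  have "0 = x" by (rule small_shift[of 0 0 x m]) (use x in auto)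
  then show False using x by simp
qed

lemma crossing_E:
  assumes x: "x \<in> {0, 57/160, 123/220}"
  shows "crossing E i (s + \<epsilon> * x) j (t + \<epsilon> * finger_y x)" "curve E i (s + \<epsilon> * x) = q 0 (finger_y x)"
proof -
  have b: "\<bar>x\<bar> \<le> 2" "\<bar>finger_y x\<bar> \<le> 2" "finger_x x = 0" using over_values[OF x] by simp_all
  then have "curve E i (s + \<epsilon> * x) = q 0 (finger_y x)" "curve E j (t + \<epsilon> * finger_y x) = q 0 (finger_y x)"
    using curve_E_over[of x 0] curve_E_under[of "finger_y x" 0] by simp_all
  then show "crossing E i (s + \<epsilon> * x) j (t + \<epsilon> * finger_y x)" "curve E i (s + \<epsilon> * x) = q 0 (finger_y x)"
    using i j ij by (simp_all add: crossing_def)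
qed

lemma crossing_D: "crossing D i s j t" "curve D i s = q 0 0"
  using i j ij meet by (simp_all add: crossing_def q_def)

lemma sgn_det_D: "sgn (velocity_det D (i, s) (j, t)) = \<sigma>"
proof -
  have "double_point D (i, s) (j, t)" by (rule crossing_double_point[OF crossing_D(1)])
  then have "curve D i differentiable at s" "curve D j differentiable at t"
    using dia unfolding is_diagram_def by (metis fst_conv snd_conv)+
  moreover have "\<not> modified j t" using ij by (simp add: modified_def)
  ultimately have "velocity E (i, s) = velocity D (i, s)" "velocity E (j, t) = velocity D (j, t)"
    using unmodified_derivative(2)[OF i not_modified_s] unmodified_derivative(2)[OF j] by blast+
  then have "velocity_det D (i, s) (j, t) = velocity_det E (i, s) (j, t)" by (simp only: velocity_det_def)
  then show ?thesis using sgn_det_E(1) by (simp add: finger_values)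
qed

lemma upper_D: "upper D i s"
  unfolding projection_def diagram.sel using i j meet above by metis

lemma upper_projectionI:
  "l < link_components L \<Longrightarrow> fst (link_curve L l r') = fst (link_curve L k r) \<Longrightarrow>
     snd (link_curve L l r') < snd (link_curve L k r) \<Longrightarrow> upper (projection L) k r"
  unfolding projection_def diagram.sel by blast

lemma upper_E: "upper E i (s + \<epsilon> * 0)" "x \<in> {57/160, 123/220} \<Longrightarrow> upper E j (t + \<epsilon> * finger_y x)"
proof -
  show "upper E i (s + \<epsilon> * 0)"
  proof (rule upper_projectionI[of j _ "t + \<epsilon> * 0"])
    show "snd (link_curve fingered j (t + \<epsilon> * 0)) < snd (link_curve fingered i (s + \<epsilon> * 0))"
      using gap by (subst over_strand2, simp, subst under_strand2, simp) (simp add: pt_def finger_values profile1_cases)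
    show "fst (link_curve fingered j (t + \<epsilon> * 0)) = fst (link_curve fingered i (s + \<epsilon> * 0))"
      by (subst over_strand2, simp, subst under_strand2, simp) (simp add: finger_values)
  qed (use j in simp)
  assume x: "x \<in> {57/160, 123/220}"
  then have b: "\<bar>x\<bar> \<le> 2" "\<bar>finger_y x\<bar> \<le> 2" "finger_x x = 0" "1 - 10 * profile1 x < 0"
    subgoal using over_values[of x] x by auto
    subgoal using over_values[of x] x by auto
    subgoal using over_values(1)[of x] x by blast
    subgoal using x profile1_cases(2)[of "57/160"] profile1_cases(3)[of "123/220"] unfolding insert_iff empty_iff
      by (elim disjE FalseE) (simp_all only:, simp_all)
    done
  show "upper E j (t + \<epsilon> * finger_y x)"
  proof (rule upper_projectionI[of i _ "s + \<epsilon> * x"])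
    have "(1 - 10 * profile1 x) * gap < 0" using b(4) gap by (simp add: mult_neg_pos)
    then show "snd (link_curve fingered i (s + \<epsilon> * x)) < snd (link_curve fingered j (t + \<epsilon> * finger_y x))"
      unfolding over_strand2[OF b(1)] under_strand2[OF b(2)] by (simp add: pt_def b(3))
    show "fst (link_curve fingered i (s + \<epsilon> * x)) = fst (link_curve fingered j (t + \<epsilon> * finger_y x))"
      unfolding over_strand2[OF b(1)] under_strand2[OF b(2)] by (simp add: b(3))
  qed (use i in simp)
qed

lemma mixed_D: "mixed_crossings D \<inter> window = {q 0 0}"
proof
  show "mixed_crossings D \<inter> window \<subseteq> {q 0 0}"
  proof
    fix w assume "w \<in> mixed_crossings D \<inter> window"
    then obtain k r l r' where c: "crossing D k r l r'" "w = curve D k r" "w \<in> window" by (auto simp: mixed_crossings_def)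
    have kl: "k < n" "l < n" "k \<noteq> l" "curve D l r' = w" using c by (auto simp: crossing_def)
    have b: "\<bar>cx w\<bar> \<le> 1" "\<bar>cy w\<bar> \<le> 1" using c(3) by (auto simp: window_def)
    have bx: "k = i \<and> cy w = 0 \<or> k = j \<and> cx w = 0" if "k < n" "curve D k r = w" for k r
    proof -
      have "fst (link_curve K k r) = fst (link_curve K i s) + of_real (cx w) * fst a + of_real (cy w) * fst b"
        using that(2) q_coords[of w] by (simp add: q_def)
      from box[OF that(1) b this] show ?thesis by blast
    qed
    have "cx w = 0 \<and> cy w = 0" using bx[OF kl(1)] bx[OF kl(2,4)] kl(3) c(2) by auto
    then show "w \<in> {q 0 0}" using q_coords[of w] by simp
  qed
  have "q 0 0 \<in> mixed_crossings D" unfolding mixed_crossings_def using crossing_D by force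
  then show "{q 0 0} \<subseteq> mixed_crossings D \<inter> window" by (simp add: window_def)
qed

lemma mixed_E: "mixed_crossings E \<inter> window = {q 0 0, q 0 (- 3/40), q 0 (6/55)}"
proof
  show "mixed_crossings E \<inter> window \<subseteq> {q 0 0, q 0 (- 3/40), q 0 (6/55)}"
  proof
    fix w assume "w \<in> mixed_crossings E \<inter> window"
    then obtain k r l r' where c: "crossing E k r l r'" "w = curve E k r" "w \<in> window" by (auto simp: mixed_crossings_def)
    have kl: "k \<noteq> l" using c(1) by (simp add: crossing_def)
    have no: "\<not> outer_pair k r l r'" using c(2,3) unfolding outer_pair_def window_def by blast
    have nl: "\<not> loop_pair k r l r'" using kl unfolding loop_pair_def by blast
    obtain x where w: "x \<in> {0, 57/160, 123/220}" "w = q 0 (finger_y x)"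
    proof -
      have "(\<exists>x. over_under k r l r' x) \<or> (\<exists>x. over_under l r' k r x)"
        using double_point_types[OF crossing_double_point[OF c(1)]] no nl by blast
      then show ?thesis
      proof (elim disjE exE)
        fix x assume o: "over_under k r l r' x"
        then show ?thesis using that[of x] over_position(1)[OF o] c(2) unfolding over_under_def by simp
      next
        fix x assume o: "over_under l r' k r x"
        then show ?thesis using that[of x] over_position(2)[OF o] c(2) unfolding over_under_def by simp
      qed
    qed
    have "finger_y x = 0 \<or> finger_y x = - 3/40 \<or> finger_y x = 6/55"
      using w(1) unfolding insert_iff empty_iff by (elim disjE FalseE; simp only: finger_values; simp)
    then show "w \<in> {q 0 0, q 0 (- 3/40), q 0 (6/55)}" unfolding w(2) by (elim disjE) simp_all
  qed
  have "q 0 (finger_y x) \<in> mixed_crossings E \<inter> window" if x: "x \<in> {0, 57/160, 123/220}" for x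
  proof -
    have "curve E i (s + \<epsilon> * x) \<in> mixed_crossings E" unfolding mixed_crossings_def using crossing_E(1)[OF x] by blast
    then show ?thesis using crossing_E(2)[OF x] finger_y_bound[OF x] by (simp add: window_def)
  qed
  from this[of 0] this[of "57/160"] this[of "123/220"]
  show "{q 0 0, q 0 (- 3/40), q 0 (6/55)} \<subseteq> mixed_crossings E \<inter> window" by (simp add: finger_values)
qed

lemma D_off: "\<bar>y\<bar> \<le> 1 \<Longrightarrow> y \<noteq> 0 \<Longrightarrow> q 0 y \<notin> range (curve D i)"
proof
  assume y: "\<bar>y\<bar> \<le> 1" "y \<noteq> 0" and "q 0 y \<in> range (curve D i)"
  then obtain r where "q 0 y = curve D i r" by blast
  then have "fst (link_curve K i r) = fst (link_curve K i s) + of_real 0 * fst a + of_real y * fst b" by (simp add: q_def)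
  from box[OF i _ y(1) this] show False using y(2) ij by auto
qed

lemma E_off: "\<bar>y\<bar> \<le> 1 \<Longrightarrow> y \<notin> {0, - 3/40, 6/55} \<Longrightarrow> q 0 y \<notin> range (curve E i)"
proof
  assume y: "\<bar>y\<bar> \<le> 1" "y \<notin> {0, - 3/40, 6/55}" and "q 0 y \<in> range (curve E i)"
  then obtain r where "curve E i r = q 0 y" by (metis imageE)
  from in_box[OF i this _ y(1)] obtain x where "finger_x x = 0" "finger_y x = y" using ij by auto
  then show False using finger_on_axis[of x] y(2) by auto
qed

lemma D_param: "t - \<epsilon> \<le> r \<Longrightarrow> r \<le> t + \<epsilon> \<Longrightarrow> curve D j r = q 0 ((r - t) / \<epsilon>) \<and> curve E j r = q 0 ((r - t) / \<epsilon>) \<and> \<bar>(r - t) / \<epsilon>\<bar> \<le> 1"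
proof -
  assume r: "t - \<epsilon> \<le> r" "r \<le> t + \<epsilon>"
  have e: "r = t + \<epsilon> * ((r - t) / \<epsilon>) + of_int 0" using eps by simp
  have "\<bar>r - t\<bar> \<le> \<epsilon>" using r by (simp add: abs_le_iff)
  then have b: "\<bar>(r - t) / \<epsilon>\<bar> \<le> 1" using eps by (simp add: abs_divide)
  then have b2: "\<bar>(r - t) / \<epsilon>\<bar> \<le> 2" by linarith
  show ?thesis using curve_D_under[OF b2, of 0] curve_E_under[OF b2, of 0] b unfolding e[symmetric] by blast
qed

lemma jump_D:
  "windno (curve D i) (q 0 1) = windno (curve D i) (q 0 (-1)) + \<sigma>"
  "weight D (q 0 0) = (windno (curve D i) (q 0 1))\<^sup>2 - (windno (curve D i) (q 0 (-1)))\<^sup>2"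
proof -
  have off: "curve D j r \<notin> range (curve D i)" if "t - \<epsilon> \<le> r" "r \<le> t + \<epsilon>" "r \<noteq> t" for r
    using D_param[OF that(1,2)] D_off[of "(r - t) / \<epsilon>"] that(3) eps by simp
  have lt: "t - \<epsilon> < t" "t < t + \<epsilon>" using eps by simp_all
  have ends: "curve D j (t - \<epsilon>) = q 0 (-1)" "curve D j (t + \<epsilon>) = q 0 1"
    using D_param[of "t - \<epsilon>"] D_param[of "t + \<epsilon>"] eps by simp_all
  show "windno (curve D i) (q 0 1) = windno (curve D i) (q 0 (-1)) + \<sigma>"
    using windno_jump[OF dia crossing_D(1) lt off] unfolding ends sgn_det_D .
  show "weight D (q 0 0) = (windno (curve D i) (q 0 1))\<^sup>2 - (windno (curve D i) (q 0 (-1)))\<^sup>2"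
    using weight_between[OF dia crossing_D(1) upper_D lt off] unfolding ends crossing_D(2) .
qed

lemma E_between:
  assumes x: "x \<in> {0, 57/160, 123/220}" and y: "-1 \<le> y" "y < finger_y x" "finger_y x < y'" "y' \<le> 1"
    and only: "\<And>v. y \<le> v \<Longrightarrow> v \<le> y' \<Longrightarrow> v \<noteq> finger_y x \<Longrightarrow> v \<notin> {0, - 3/40, 6/55}"
  shows "windno (curve E i) (q 0 y') = windno (curve E i) (q 0 y) +
      sgn (velocity_det E (i, s + \<epsilon> * x) (j, t + \<epsilon> * finger_y x))"
    "upper E i (s + \<epsilon> * x) \<Longrightarrow> weight E (q 0 (finger_y x)) = (windno (curve E i) (q 0 y'))\<^sup>2 - (windno (curve E i) (q 0 y))\<^sup>2"
proof -
  have lt: "t + \<epsilon> * y < t + \<epsilon> * finger_y x" "t + \<epsilon> * finger_y x < t + \<epsilon> * y'" using y eps by simp_all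
  have off: "curve E j r \<notin> range (curve E i)" if r: "t + \<epsilon> * y \<le> r" "r \<le> t + \<epsilon> * y'" "r \<noteq> t + \<epsilon> * finger_y x" for r
  proof -
    define v where "v = (r - t) / \<epsilon>"
    have rv: "r = t + \<epsilon> * v" using eps by (simp add: v_def)
    have v: "y \<le> v" "v \<le> y'" "v \<noteq> finger_y x" using r eps unfolding rv by auto
    have "curve E j r = q 0 v" using curve_E_under[of v 0] v y unfolding rv by simp
    then show ?thesis using E_off[of v] only[OF v] v y by simp
  qed
  have ends: "curve E j (t + \<epsilon> * y) = q 0 y" "curve E j (t + \<epsilon> * y') = q 0 y'"
    using curve_E_under[of y 0] curve_E_under[of y' 0] y by simp_all
  show "windno (curve E i) (q 0 y') = windno (curve E i) (q 0 y) +
      sgn (velocity_det E (i, s + \<epsilon> * x) (j, t + \<epsilon> * finger_y x))"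
    using windno_jump[OF diagram_E(1) crossing_E(1)[OF x] lt off] unfolding ends .
  show "weight E (q 0 (finger_y x)) = (windno (curve E i) (q 0 y'))\<^sup>2 - (windno (curve E i) (q 0 y))\<^sup>2"
    if "upper E i (s + \<epsilon> * x)"
    using weight_between[OF diagram_E(1) crossing_E(1)[OF x] that lt off] unfolding ends crossing_E(2)[OF x] .
qed

text \<open>
  On the way to the old crossing the lower strand passes the finger, which shifts the winding
  numbers before and after the crossing by \<open>- \<sigma>\<close>.
\<close>

lemma weight_centre:
  "weight E (q 0 0) = (windno (curve E i) (q 0 (-1)))\<^sup>2 - (windno (curve E i) (q 0 (-1)) - \<sigma>)\<^sup>2"
proof -
  have "windno (curve E i) (q 0 (- 1/20)) = windno (curve E i) (q 0 (-1)) +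
      sgn (velocity_det E (i, s + \<epsilon> * (57/160)) (j, t + \<epsilon> * finger_y (57/160)))"
    by (rule E_between(1)) (auto simp: finger_values)
  then have 1: "windno (curve E i) (q 0 (- 1/20)) = windno (curve E i) (q 0 (-1)) - \<sigma>"
    using sgn_det_E(2) by simp
  have "windno (curve E i) (q 0 (1/20)) = windno (curve E i) (q 0 (- 1/20)) +
      sgn (velocity_det E (i, s + \<epsilon> * 0) (j, t + \<epsilon> * finger_y 0))"
    by (rule E_between(1)) (auto simp: finger_values)
  then have 2: "windno (curve E i) (q 0 (1/20)) = windno (curve E i) (q 0 (- 1/20)) + \<sigma>"
    using sgn_det_E(1) by simp
  have "weight E (q 0 (finger_y 0)) = (windno (curve E i) (q 0 (1/20)))\<^sup>2 - (windno (curve E i) (q 0 (- 1/20)))\<^sup>2"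
    by (rule E_between(2)) (use upper_E(1) in \<open>auto simp: finger_values\<close>)
  then show ?thesis using 1 2 by (simp add: finger_values)
qed

text \<open>
  The finger passes below the other strand, so in these crossings the winding numbers of
  component \<open>j\<close> count. They are equal at both ends of the finger, because the
  original segment between these ends does not meet component \<open>j\<close>.
\<close>

lemma weight_sides: "weight E (q 0 (- 3/40)) + weight E (q 0 (6/55)) = 0"
proof -
  let ?x1 = "57/160" and ?x2 = "123/220"
  have c: "crossing E j (t + \<epsilon> * finger_y ?x1) i (s + \<epsilon> * ?x1)" "crossing E j (t + \<epsilon> * finger_y ?x2) i (s + \<epsilon> * ?x2)"
    by (rule crossing_sym, rule crossing_E(1), simp)+
  have Eji: "curve E j (t + \<epsilon> * finger_y ?x1) = q 0 (- 3/40)" "curve E j (t + \<epsilon> * finger_y ?x2) = q 0 (6/55)"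
    using curve_E_under[of "- 3/40" 0] curve_E_under[of "6/55" 0] by (simp_all add: finger_values)
  have up: "upper E j (t + \<epsilon> * finger_y ?x1)" "upper E j (t + \<epsilon> * finger_y ?x2)" by (intro upper_E(2); simp)+
  have off: "curve E i r \<notin> range (curve E j)"
    if r: "s + \<epsilon> * (3/10) \<le> r" "r \<le> s + \<epsilon> * (3/5)" "r \<noteq> s + \<epsilon> * ?x1" "r \<noteq> s + \<epsilon> * ?x2" for r
  proof
    assume "curve E i r \<in> range (curve E j)"
    then obtain r' where r': "curve E j r' = curve E i r" by (metis imageE)
    define x where "x = (r - s) / \<epsilon>"
    have rx: "r = s + \<epsilon> * x" using eps by (simp add: x_def)
    have x: "3/10 \<le> x" "x \<le> 3/5" "x \<noteq> ?x1" "x \<noteq> ?x2" using r eps unfolding rx by auto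
    have "curve E j r' = q (finger_x x) (finger_y x)" using curve_E_over[of x 0] x r' unfolding rx by simp
    from in_box[OF j this] have "finger_x x = 0" using finger_bounds(2)[OF x(1,2)] ij by auto
    then show False using finger_on_axis[of x] x by auto
  qed
  have lt: "s + \<epsilon> * (3/10) < s + \<epsilon> * ?x1" "s + \<epsilon> * ?x1 < s + \<epsilon> * ?x2" "s + \<epsilon> * ?x2 < s + \<epsilon> * (3/5)"
    using eps by simp_all
  have "weight E (curve E j (t + \<epsilon> * finger_y ?x1)) + weight E (curve E j (t + \<epsilon> * finger_y ?x2)) =
      (windno (curve E j) (curve E i (s + \<epsilon> * (3/5))))\<^sup>2 - (windno (curve E j) (curve E i (s + \<epsilon> * (3/10))))\<^sup>2"
    by (rule weight_two_overcrossings[OF diagram_E(1) c(1) up(1) c(2) up(2) lt off])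
  moreover have "curve E i (s + \<epsilon> * (3/5)) = q (3/5) 0" "curve E i (s + \<epsilon> * (3/10)) = q (3/10) 0"
    using curve_E_over[of "3/5" 0] curve_E_over[of "3/10" 0] finger_cases(5)[of "3/5"] finger_cases(1)[of "3/10"] by simp_all
  moreover have "windno (curve E j) (q (3/5) 0) = windno (curve E j) (q (3/10) 0)"
  proof (rule windno_constant)
    show "closed_curve (curve E j)" using is_diagram_closed_curve[OF diagram_E(1), of j] j by simp
    let ?S = "(\<lambda>x. q x 0) ` {3/10..3/5}"
    show "connected ?S" unfolding q_def by (intro connected_continuous_image continuous_intros connected_Icc)
    show "?S \<inter> range (curve E j) = {}"
    proof (rule ccontr)
      assume "?S \<inter> range (curve E j) \<noteq> {}"
      then obtain w where w: "w \<in> ?S" "w \<in> range (curve E j)" by blast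
      from w(1) obtain x where "x \<in> {3/10..3/5}" "w = q x 0" by blast
      moreover from w(2) obtain r' where "w = curve E j r'" by blast
      ultimately have x: "3/10 \<le> x" "x \<le> 3/5" "curve E j r' = q x 0" by (simp_all only: atLeastAtMost_iff)
      from in_box[OF j x(3)] show False using x ij by auto
    qed
    show "q (3/5) 0 \<in> ?S" "q (3/10) 0 \<in> ?S" by (intro imageI; simp)+
  qed
  ultimately show ?thesis unfolding Eji by simp
qed

lemma q_frontier: "q 0 (-1) \<in> frontier window"
proof -
  interpret two_diagrams D E window by (rule two_diagrams)
  have "q 0 (-1) \<in> window" by (simp add: window_def)
  moreover have "q 0 (-1) \<notin> interior window"
  proof
    assume "q 0 (-1) \<in> interior window"
    then obtain \<rho> where \<rho>: "\<rho> > 0" "ball (q 0 (-1)) \<rho> \<subseteq> window" by (meson mem_interior)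
    define M where "M = norm (fst b) + 1"
    have M: "M > 0" "norm (fst b) < M" by (simp_all add: M_def add_nonneg_pos)
    define \<theta> where "\<theta> = \<rho> / M"
    have \<theta>: "\<theta> > 0" using \<rho>(1) M(1) by (simp add: \<theta>_def)
    have "\<theta> * norm (fst b) < \<theta> * M" using \<theta> M(2) by simp
    then have lt: "\<theta> * norm (fst b) < \<rho>" using M(1) by (simp add: \<theta>_def)
    have "dist (q 0 (-1)) (q 0 (-1 - \<theta>)) = \<theta> * norm (fst b)"
      using \<theta> by (simp add: q_def dist_norm norm_mult algebra_simps)
    then have "q 0 (-1 - \<theta>) \<in> window" using lt \<rho>(2) by auto
    then show False using \<theta> by (simp add: window_def)
  qed
  ultimately show ?thesis using closed_B by (simp add: frontier_def)
qed

text \<open>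
  With \<open>W\<close> the winding number of component \<open>i\<close> at the entry of the
  lower strand, the weight of the crossing changes from \<open>(W + \<sigma>)\<^sup>2 -
  W\<^sup>2\<close> to \<open>W\<^sup>2 - (W - \<sigma>)\<^sup>2\<close>.
\<close>

theorem winding_sum_changes: "winding_sum E = winding_sum D - 2"
proof -
  interpret two_diagrams D E window by (rule two_diagrams)
  have W: "windno (curve D i) (q 0 (-1)) = windno (curve E i) (q 0 (-1))"
    by (rule windno_frontier[OF _ q_frontier D_off E_off]) (use i in auto)
  have "(\<Sum>z\<in>mixed_crossings E \<inter> window. weight E z) = weight E (q 0 0)"
    unfolding mixed_E using weight_sides by simp
  moreover have "(\<Sum>z\<in>mixed_crossings D \<inter> window. weight D z) = weight D (q 0 0)" unfolding mixed_D by simp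
  ultimately have "winding_sum E - winding_sum D = weight E (q 0 0) - weight D (q 0 0)"
    using winding_sum_diff by simp
  moreover have "\<sigma>\<^sup>2 = 1" using det by (simp add: sgn_if)
  ultimately show ?thesis using weight_centre jump_D W by (simp add: power2_eq_square algebra_simps)
qed

end

section \<open>Two diagrams with different winding sums\<close>

text \<open>
  The other components keep a positive distance from the crossing, and near it components
  \<open>i\<close> and \<open>j\<close> consist of the two straight strands only.
\<close>

lemma crossing_box_at:
  assumes emb: "embedded_link K" and dia: "is_diagram (projection K)"
    and cr: "crossing (projection K) i s j t"
    and above: "snd (link_curve K j t) < snd (link_curve K i s)" and e: "e > 0"
    and la: "\<And>h. \<bar>h\<bar> < e \<Longrightarrow> link_curve K i (s + h) = link_curve K i s + h *\<^sub>R a"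
    and lb: "\<And>h. \<bar>h\<bar> < e \<Longrightarrow> link_curve K j (t + h) = link_curve K j t + h *\<^sub>R b"
  obtains \<epsilon> where "crossing_box K i j s t \<epsilon> (\<epsilon> *\<^sub>R a) (\<epsilon> *\<^sub>R b)"
proof -
  let ?D = "projection K" and ?n = "link_components K" and ?z = "fst (link_curve K i s)"
  have ij: "i < ?n" "j < ?n" "i \<noteq> j" and meet: "?z = fst (link_curve K j t)"
    using cr by (simp_all add: crossing_def)
  have vel: "velocity ?D (k, r) = fst c"
    if dp: "double_point ?D (k, r) p" and lin: "\<And>h. \<bar>h\<bar> < e \<Longrightarrow> link_curve K k (r + h) = link_curve K k r + h *\<^sub>R c" for k r p c
  proof -
    obtain \<eta> where \<eta>: "\<eta> > 0" "\<And>\<sigma>. \<bar>\<sigma>\<bar> \<le> \<eta> \<Longrightarrow> curve ?D k (r + \<sigma>) = curve ?D k r + of_real \<sigma> * velocity ?D (k, r)"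
      using double_point_linear[OF dia dp] unfolding fst_conv snd_conv by blast
    define h where "h = min \<eta> (e / 2)"
    have h: "h > 0" "\<bar>h\<bar> \<le> \<eta>" "\<bar>h\<bar> < e" using \<eta>(1) e by (auto simp: h_def)
    have "of_real h * velocity ?D (k, r) = of_real h * fst c"
      using \<eta>(2)[OF h(2)] arg_cong[OF lin[OF h(3)], of fst] by (auto simp: scaleR_conv_of_real)
    then show ?thesis using h(1) by simp
  qed
  have dps: "double_point ?D (i, s) (j, t)" "double_point ?D (j, t) (i, s)"
    by (rule crossing_double_point[OF cr], rule crossing_double_point[OF crossing_sym[OF cr]])
  have v: "velocity ?D (i, s) = fst a" "velocity ?D (j, t) = fst b"
    by (rule vel[OF dps(1) la], assumption, rule vel[OF dps(2) lb], assumption)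
  have det: "det2 (fst a) (fst b) \<noteq> 0"
    using crossing_velocity_det[OF dia cr] unfolding velocity_det_def v .
  obtain \<rho>1 where \<rho>1: "\<rho>1 > 0" "\<And>r. dist (curve ?D i r) (curve ?D i s) < \<rho>1 \<Longrightarrow> \<exists>k::int. \<bar>r + of_int k - s\<bar> < e"
    by (rule crossing_near_point[OF dia cr e]) (rule that)
  obtain \<rho>2 where \<rho>2: "\<rho>2 > 0" "\<And>r. dist (curve ?D j r) (curve ?D j t) < \<rho>2 \<Longrightarrow> \<exists>k::int. \<bar>r + of_int k - t\<bar> < e"
    by (rule crossing_near_point[OF dia crossing_sym[OF cr] e]) (rule that)
  define C where "C = (\<Union>k\<in>{..<?n} - {i, j}. range (curve ?D k))"
  have "closed (range (curve ?D k))" if "k < ?n" for k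
    by (rule closed_curve_closed_range(1)[OF is_diagram_closed_curve[OF dia]]) (use that in simp)
  then have "closed C" unfolding C_def by (intro closed_UN ballI) blast+
  moreover have "?z \<notin> C"
  proof
    assume "?z \<in> C"
    then obtain k r where k: "k < ?n" "k \<noteq> i" "k \<noteq> j" "curve ?D k r = ?z" unfolding C_def by force
    then have "double_point ?D (i, s) (k, r)" using ij by (simp add: double_point_def same_point_def)
    then have "same_point (j, t) (k, r)" using dia dps(1) unfolding is_diagram_def by blast
    then show False using k(3) by (simp add: same_point_def)
  qed
  ultimately obtain \<rho>3 where \<rho>3: "\<rho>3 > 0" "\<And>w. dist w ?z < \<rho>3 \<Longrightarrow> w \<notin> C"
    using open_dist[of "- C"] by (auto simp: open_Compl)
  define \<rho> M where "\<rho> = min \<rho>1 (min \<rho>2 \<rho>3)" and "M = norm (fst a) + norm (fst b) + 1"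
  have \<rho>: "\<rho> > 0" "\<rho> \<le> \<rho>1" "\<rho> \<le> \<rho>2" "\<rho> \<le> \<rho>3" using \<rho>1 \<rho>2 \<rho>3 by (auto simp: \<rho>_def)
  have M: "M > 0" "norm (fst a) + norm (fst b) < M" unfolding M_def by (simp_all add: add_nonneg_pos)
  \<comment> \<open>Both strands are straight for twice the size of the parallelogram, and the
    parallelogram lies in the disc of radius \<open>\<rho>\<close> around the crossing.\<close>
  define \<epsilon> where "\<epsilon> = min (1/8) (min (e / 4) (\<rho> / M))"
  have eps: "0 < \<epsilon>" "\<epsilon> \<le> 1/8" "\<epsilon> \<le> e / 4" "\<epsilon> \<le> \<rho> / M" using e \<rho>(1) M(1) unfolding \<epsilon>_def by (simp, linarith+)
  have small: "\<epsilon> * (norm (fst a) + norm (fst b)) < \<rho>"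
  proof -
    have "\<epsilon> * (norm (fst a) + norm (fst b)) < \<epsilon> * M" using eps(1) M(2) by simp
    also have "\<dots> \<le> \<rho>" using eps(4) M(1) by (simp add: field_simps)
    finally show ?thesis .
  qed
  have in_e: "\<bar>\<epsilon> * x\<bar> < e" if "\<bar>x\<bar> \<le> 2" for x
  proof -
    have "\<bar>\<epsilon> * x\<bar> \<le> e / 4 * 2" unfolding abs_mult using that eps(1,3) by (intro mult_mono) auto
    then show ?thesis using e by simp
  qed
  have dist_w: "dist (?z + of_real x * fst (\<epsilon> *\<^sub>R a) + of_real y * fst (\<epsilon> *\<^sub>R b)) ?z < \<rho>"
    if "\<bar>x\<bar> \<le> 1" "\<bar>y\<bar> \<le> 1" for x y
  proof -
    have "dist (?z + of_real x * fst (\<epsilon> *\<^sub>R a) + of_real y * fst (\<epsilon> *\<^sub>R b)) ?z =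
        norm (of_real x * fst (\<epsilon> *\<^sub>R a) + of_real y * fst (\<epsilon> *\<^sub>R b))"
      by (simp add: dist_norm)
    also have "\<dots> \<le> \<bar>x\<bar> * (\<epsilon> * norm (fst a)) + \<bar>y\<bar> * (\<epsilon> * norm (fst b))"
      by (rule order_trans[OF norm_triangle_ineq]) (use eps(1) in \<open>simp add: norm_mult\<close>)
    also have "\<dots> \<le> 1 * (\<epsilon> * norm (fst a)) + 1 * (\<epsilon> * norm (fst b))"
      using that eps(1) by (intro add_mono mult_right_mono) auto
    finally show ?thesis using small by (simp add: distrib_left)
  qed
  have "crossing_box K i j s t \<epsilon> (\<epsilon> *\<^sub>R a) (\<epsilon> *\<^sub>R b)"
  proof
    show "link_curve K i (s + \<epsilon> * x) = link_curve K i s + x *\<^sub>R \<epsilon> *\<^sub>R a" if "\<bar>x\<bar> \<le> 2" for x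
      using la[OF in_e[OF that]] by (simp add: mult.commute)
    show "link_curve K j (t + \<epsilon> * x) = link_curve K j t + x *\<^sub>R \<epsilon> *\<^sub>R b" if "\<bar>x\<bar> \<le> 2" for x
      using lb[OF in_e[OF that]] by (simp add: mult.commute)
    have "det2 (fst (\<epsilon> *\<^sub>R a)) (fst (\<epsilon> *\<^sub>R b)) = \<epsilon>\<^sup>2 * det2 (fst a) (fst b)"
      by (simp add: power2_eq_square algebra_simps)
    then show "det2 (fst (\<epsilon> *\<^sub>R a)) (fst (\<epsilon> *\<^sub>R b)) \<noteq> 0" using det eps(1) by simp
    fix k r x y
    assume k: "k < ?n" and xy: "\<bar>x\<bar> \<le> 1" "\<bar>y\<bar> \<le> 1"
      and w: "fst (link_curve K k r) = ?z + of_real x * fst (\<epsilon> *\<^sub>R a) + of_real y * fst (\<epsilon> *\<^sub>R b)"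
    have d: "dist (curve ?D k r) ?z < \<rho>" using dist_w[OF xy] w by simp
    then have "curve ?D k r \<notin> C" using \<rho>3(2) \<rho>(4) by simp
    then have "k = i \<or> k = j" using k unfolding C_def by blast
    then show "k = i \<and> y = 0 \<and> (\<exists>m::int. r = s + \<epsilon> * x + of_int m) \<or>
       k = j \<and> x = 0 \<and> (\<exists>m::int. r = t + \<epsilon> * y + of_int m)"
    proof
      assume ki: "k = i"
      obtain m :: int where m: "\<bar>r + of_int m - s\<bar> < e" using \<rho>1(2)[of r] d \<rho>(2) unfolding ki by auto
      have "link_curve K i r = link_curve K i (s + (r + of_int m - s))"
        by (rule embedded_link_cong[OF emb ij(1)]) simp
      then have "fst (link_curve K i r) = ?z + of_real (r + of_int m - s) * fst a"
        unfolding la[OF m] by (simp add: scaleR_conv_of_real)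
      then have "of_real (r + of_int m - s - \<epsilon> * x) * fst a = of_real (\<epsilon> * y) * fst b"
        using w unfolding ki by (simp add: scaleR_conv_of_real algebra_simps)
      from det2_independent[OF det this] have "r = s + \<epsilon> * x + of_int (- m)" "y = 0" using eps(1) by auto
      then show ?thesis using ki by blast
    next
      assume kj: "k = j"
      obtain m :: int where m: "\<bar>r + of_int m - t\<bar> < e" using \<rho>2(2)[of r] d \<rho>(3) meet unfolding kj by auto
      have "link_curve K j r = link_curve K j (t + (r + of_int m - t))"
        by (rule embedded_link_cong[OF emb ij(2)]) simp
      then have "fst (link_curve K j r) = ?z + of_real (r + of_int m - t) * fst b"
        unfolding lb[OF m] using meet by (simp add: scaleR_conv_of_real)
      then have "of_real (\<epsilon> * x) * fst a = of_real (r + of_int m - t - \<epsilon> * y) * fst b"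
        using w unfolding kj by (simp add: scaleR_conv_of_real algebra_simps)
      from det2_independent[OF det this] have "r = t + \<epsilon> * y + of_int (- m)" "x = 0" using eps(1) by auto
      then show ?thesis using kj by blast
    qed
  qed (use emb dia ij meet above eps in simp_all)
  then show ?thesis by (rule that)
qed

lemma crossing_lowers_winding_sum:
  assumes emb: "embedded_link K" and iso: "link_isotopic K L" and dia: "is_diagram (projection K)"
    and cr: "crossing (projection K) i s j t"
    and above: "snd (link_curve K j t) < snd (link_curve K i s)" and e: "e > 0"
    and la: "\<And>h. \<bar>h\<bar> < e \<Longrightarrow> link_curve K i (s + h) = link_curve K i s + h *\<^sub>R a"
    and lb: "\<And>h. \<bar>h\<bar> < e \<Longrightarrow> link_curve K j (t + h) = link_curve K j t + h *\<^sub>R b"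
  obtains E where "diagram_of L E" "winding_sum E = winding_sum (projection K) - 2"
proof -
  obtain \<epsilon> where "crossing_box K i j s t \<epsilon> (\<epsilon> *\<^sub>R a) (\<epsilon> *\<^sub>R b)"
    by (rule crossing_box_at[OF emb dia cr above e la lb])
  then interpret crossing_box K i j s t \<epsilon> "\<epsilon> *\<^sub>R a" "\<epsilon> *\<^sub>R b" .
  have "diagram_of L E" unfolding diagram_of_def
    using diagram_E fingered_embedded link_isotopic_trans[OF fingered_isotopic iso] by blast
  then show ?thesis using that winding_sum_changes by blast
qed

text \<open>
  A generic tilt in which the first two components cross; either of them may be the upper one.
\<close>

theorem diagrams_with_different_winding_sum:
  assumes L: "is_link L" and n: "2 \<le> link_components L"
  obtains D E where "diagram_of L D" "diagram_of L E" "winding_sum E = winding_sum D - 2"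
proof -
  obtain K0 where K0: "polygonal_link K0" "link_isotopic K0 L" using L by (auto simp: is_link_def)
  have "link_components K0 = link_components L"
    using K0(2) bij_betw_same_card[of _ "{..<link_components K0}" "{..<link_components L}"]
    unfolding link_isotopic_def by (metis card_lessThan)
  then have n0: "2 \<le> link_components K0" using n by simp
  obtain K' t0 \<sigma> a t1 b \<epsilon> where K': "polygonal_link K'" "link_isotopic K' K0" "link_components K' = link_components K0"
    and ed: "\<epsilon> > 0" "edge_from (link_curve K' 0) t0 \<sigma> a \<epsilon>" "edge_from (link_curve K' 1) t1 1 b \<epsilon>"
    and ind: "independent3 a b (link_curve K' 0 t0 - link_curve K' 1 t1)"
    by (rule noncoplanar_edges[OF K0(1) n0]) (rule that)
  obtain N where N: "negligible N"
    and dia: "\<And>w. w \<notin> N \<Longrightarrow> is_diagram (projection (image_link (tilt w) K'))"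
    and pro: "\<And>w. w \<notin> N \<Longrightarrow> projects_to (image_link (tilt w) K') (projection (image_link (tilt w) K'))"
    and run: "\<And>w i s q. w \<notin> N \<Longrightarrow> double_point (projection (image_link (tilt w) K')) (i, s) q \<Longrightarrow>
       \<exists>\<tau> d. runs_along K' i s \<tau> d"
    by (rule generic_tilt[OF K'(1)]) (rule that)
  have n': "2 \<le> link_components K'" using n0 K'(3) by simp
  obtain w s t where w: "w \<notin> N" and cr: "crossing (projection (image_link (tilt w) K')) 0 s 1 t"
    by (rule tilt_with_crossing[OF n' ed ind N]) (rule that)
  define K where "K = image_link (tilt w) K'"
  have emb': "embedded_link K'" using K'(1) by (simp add: polygonal_link_def)
  have emb: "embedded_link K" unfolding K_def tilt_eq by (rule embedded_image_link[OF ambient_isotopy_tilt emb'])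
  have "link_isotopic K K'" unfolding K_def tilt_eq by (rule link_isotopic_image_link[OF ambient_isotopy_tilt])
  then have iso: "link_isotopic K L" using K'(2) K0(2) link_isotopic_trans by blast
  note dia = dia[OF w, folded K_def] and pro = pro[OF w, folded K_def] and cr = cr[folded K_def]
  have D: "diagram_of L (projection K)" unfolding diagram_of_def using dia pro emb iso by blast
  have linear: "\<exists>e d. e > 0 \<and> (\<forall>h. \<bar>h\<bar> < e \<longrightarrow> link_curve K i (s + h) = link_curve K i s + h *\<^sub>R d)"
    if dp: "double_point (projection K) (i, s) q" for i s q
  proof -
    obtain \<tau> d where "runs_along K' i s \<tau> d" using run[OF w dp[unfolded K_def]] by blast
    then obtain e where e: "e > 0" "\<And>r. \<bar>r - s\<bar> < e \<Longrightarrow> link_curve K' i r = link_curve K' i \<tau> + (r - \<tau>) *\<^sub>R d"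
      unfolding runs_along_def by blast
    have "link_curve K i (s + h) = link_curve K i s + h *\<^sub>R tilt w d" if h: "\<bar>h\<bar> < e" for h
    proof -
      have "link_curve K' i (s + h) = link_curve K' i s + h *\<^sub>R d"
        using e(2)[of "s + h"] e(2)[of s] h e(1) by (simp flip: scaleR_add_left add: add.assoc)
      then show ?thesis unfolding K_def by (simp add: tilt_def prod_eq_iff scaleR_conv_of_real algebra_simps)
    qed
    then show ?thesis using e(1) by blast
  qed
  obtain e0 a0 where e0: "e0 > 0" "\<And>h. \<bar>h\<bar> < e0 \<Longrightarrow> link_curve K 0 (s + h) = link_curve K 0 s + h *\<^sub>R a0"
    using linear[OF crossing_double_point[OF cr]] by blast
  obtain e1 b0 where e1: "e1 > 0" "\<And>h. \<bar>h\<bar> < e1 \<Longrightarrow> link_curve K 1 (t + h) = link_curve K 1 t + h *\<^sub>R b0"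
    using linear[OF crossing_double_point[OF crossing_sym[OF cr]]] by blast
  define e where "e = min e0 e1"
  have e: "e > 0" "\<And>h. \<bar>h\<bar> < e \<Longrightarrow> link_curve K 0 (s + h) = link_curve K 0 s + h *\<^sub>R a0"
    "\<And>h. \<bar>h\<bar> < e \<Longrightarrow> link_curve K 1 (t + h) = link_curve K 1 t + h *\<^sub>R b0"
    using e0 e1 by (simp_all add: e_def)
  have "snd (link_curve K 0 s) \<noteq> snd (link_curve K 1 t)"
  proof
    assume "snd (link_curve K 0 s) = snd (link_curve K 1 t)"
    then have "link_curve K 0 s = link_curve K 1 t" using cr by (simp add: crossing_def prod_eq_iff)
    then have "same_point (0, s) (1, t)" using emb cr unfolding embedded_link_def crossing_def by simp
    then show False by (simp add: same_point_def)
  qed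
  then consider "snd (link_curve K 1 t) < snd (link_curve K 0 s)" | "snd (link_curve K 0 s) < snd (link_curve K 1 t)"
    by linarith
  then show ?thesis
  proof cases
    case 1
    obtain E where "diagram_of L E" "winding_sum E = winding_sum (projection K) - 2"
      by (rule crossing_lowers_winding_sum[OF emb iso dia cr 1 e])
    then show ?thesis by (rule that[OF D])
  next
    case 2
    obtain E where "diagram_of L E" "winding_sum E = winding_sum (projection K) - 2"
      by (rule crossing_lowers_winding_sum[OF emb iso dia crossing_sym[OF cr] 2 e(1,3,2)])
    then show ?thesis by (rule that[OF D])
  qed
qed

lemma winding_sum_steps:
  assumes "(step A)\<^sup>*\<^sup>* D E"
  shows "(\<nexists>m. is_Omega3 m \<and> (m, Forward) \<in> A) \<Longrightarrow> winding_sum E \<le> winding_sum D"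
    and "(\<nexists>m. is_Omega3 m \<and> (m, Backward) \<in> A) \<Longrightarrow> winding_sum D \<le> winding_sum E"
  using assms
proof (induction rule: rtranclp_induct)
  case (step F G)
  { case 1 then show ?case using step.IH(1)[OF 1] winding_sum_step(1)[OF step.hyps(2) 1] by linarith
  next case 2 then show ?case using step.IH(2)[OF 2] winding_sum_step(2)[OF step.hyps(2) 2] by linarith }
qed simp_all

theorem theorem7:
  fixes L :: link and A :: "directed_move set"
  assumes "is_link L"
    and "2 \<le> link_components L"
    and "generating L A"
  shows "(\<exists>m. is_Omega3 m \<and> (m, Forward) \<in> A) \<and> (\<exists>m. is_Omega3 m \<and> (m, Backward) \<in> A)"
proof -
  obtain D E where DE: "diagram_of L D" "diagram_of L E" and less: "winding_sum E = winding_sum D - 2"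
    by (rule diagrams_with_different_winding_sum[OF assms(1,2)])
  have "(step A)\<^sup>*\<^sup>* D E" "(step A)\<^sup>*\<^sup>* E D" using assms(3) DE by (auto simp: generating_def)
  then have "(\<nexists>m. is_Omega3 m \<and> (m, Backward) \<in> A) \<Longrightarrow> winding_sum D \<le> winding_sum E"
    and "(\<nexists>m. is_Omega3 m \<and> (m, Forward) \<in> A) \<Longrightarrow> winding_sum D \<le> winding_sum E"
    using winding_sum_steps by blast+
  then show ?thesis using less by fastforce
qed

end
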